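(* Let $d\ge2$, $k\ge1$, let $\mathcal T_h$ be a conforming triangulation of a polyhedral domain $\Omega\subset\mathbb R^d$ and $\mathcal T_h^{\rm R}$ its barycentric refinement. For each $T\in\mathcal T_h$ and each $f\in\Delta_\ell(\mathring T^{\rm R})$ fix a basis $\{\boldsymbol n^f_1,\dots,\boldsymbol n^f_{d-\ell}\}$ of $\mathscr N^f$. With local shape function space $\Sigma_{k,\phi}^{\operatorname{div}}(T^{\rm R};\mathbb S)$ (see context) on each $T\in\mathcal T_h$, the degrees of freedom (a) $\int_F\boldsymbol\tau\boldsymbol n_F\cdot\boldsymbol q\,\mathrm ds$, $F\in\Delta_{d-1}(\mathcal T_h)$, $\boldsymbol q\in\mathbb P_k(F;\mathbb R^d)$; (b) $\int_f\big((\boldsymbol n^f_i)^{\intercal}\boldsymbol\tau\boldsymbol n^f_j\big)q\,\mathrm ds$, $f\in\Delta_\ell(\mathring{\mathcal T}_h^{\rm R})$, $q\in\mathbb P_{k-(\ell+1)}(f)$, $1\le i\le j\le d-\ell$, $\ell=0,\dots,d-1$; (c) $\int_F(\Pi_F\boldsymbol\tau\boldsymbol n_F)\cdot\boldsymbol q\,\mathrm ds$, $F\in\Delta_{d-1}(\mathring{\mathcal T}_h^{\rm R})$, $\boldsymbol q\in\mathrm{ND}_{k-2}(F)$; (d) $\int_K\boldsymbol\tau:\boldsymbol q\,\mathrm dx$, $K\in\mathcal T_h^{\rm R}$, $\boldsymbol q\in\mathbb B_k(\operatorname{div},K;\mathbb S)$ determine a space $\Sigma_{k,\phi}^{\operatorname{div}}(\mathcal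 T_h^{\rm R};\mathbb S)\subset H(\operatorname{div},\Omega;\mathbb S)$. That is, on each $T$ the degrees of freedom associated with $T$ are unisolvent for $\Sigma_{k,\phi}^{\operatorname{div}}(T^{\rm R};\mathbb S)$, and the space of all $\boldsymbol\tau$ with $\boldsymbol\tau|_T\in\Sigma_{k,\phi}^{\operatorname{div}}(T^{\rm R};\mathbb S)$ for all $T\in\mathcal T_h$ and with (a) single-valued on every $F\in\Delta_{d-1}(\mathcal T_h)$ is contained in $H(\operatorname{div},\Omega;\mathbb S)$ and uniquely determined by (a)–(d).
   Context: $\mathbb S$: real symmetric $d\times d$ matrices; $\operatorname{sym}\boldsymbol\tau=(\boldsymbol\tau+\boldsymbol\tau^{\intercal})/2$; $\mathbb S(V)=\operatorname{sym}(V\otimes V)$. $H(\operatorname{div},D;\mathbb S)$ is the space of $L^2$ symmetric tensor fields with row-wise divergence in $L^2$; $H_0(\operatorname{div},D;\mathbb S)$ its subspace with $\boldsymbol\tau\boldsymbol n|_{\partial D}=0$. For a $(d-1)$-simplex $F$ with fixed unit normal $\boldsymbol n_F$, $\Pi_F\boldsymbol v=(\boldsymbol I-\boldsymbol n_F\boldsymbol n_F^{\intercal})\boldsymbol v$, and $\mathrm{ND}_{k-2}(F)$ is the set of tangential vector polynomials $\boldsymbol q$ of degree $\le k-1$ on $F$ such that $\boldsymbol q\cdot\boldsymbol x\in\mathbb P_{k-1}(F)$ ($\boldsymbol x$: position vector in $F$). Split. $T$ has vertices $\texttt v_0,\dots,\texttt v_d$ and barycenter $\texttt v_c$; $T_i$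 is obtained from $T$ by replacing $\texttt v_i$ by $\texttt v_c$; $T^{\rm R}=\{T_0,\dots,T_d\}$; $\mathcal T_h^{\rm R}=\bigcup_TT^{\rm R}$. $\Delta_\ell(\cdot)$ denotes $\ell$-dimensional subsimplices; $\Delta_\ell(\mathring T^{\rm R})=\Delta_\ell(T^{\rm R})\setminus\Delta_\ell(T)$, $\Delta_\ell(\mathring{\mathcal T}_h^{\rm R})=\Delta_\ell(\mathcal T_h^{\rm R})\setminus\Delta_\ell(\mathcal T_h)$. Subsimplices of $T^{\rm R}$ are identified with subsets of $\{0,\dots,d,c\}$. For $f\in\Delta_\ell(T)$, $f^*=\{0,\dots,d\}\setminus f$ and $f(0)$ is a fixed vertex of $f$. $\boldsymbol t_{i,j}=\texttt v_j-\texttt v_i$. $\mathscr T^f$ is the tangent space of $f$, $\mathscr N^f$ its orthogonal complement, $\mathscr N^f(\mathbb S)=\mathbb S(\mathscr N^f)\oplus\operatorname{sym}(\mathscr T^f\otimes\mathscr N^f)$. Interior $(d-1)$-faces of $T^{\rm R}$ are $T_i\cap T_j$, $i<j$. Bubbles. $\lambda_i^{\rm R}$ is the continuous piecewise linear function on $T^{\rm R}$ with $\lambda_i^{\rm R}(\texttt v_j)=\delta_{ij}$, $i,j\in\{0,\dots,d,c\}$; $b_f^{\rm R}=\prod_{i\in f}\lambda_i^{\rm R}$. $\mathbb P_r(f)$: polynomials of degree $\le r$ on $f$ ($\{0\}$ if $r<0$; $\mathbb R$ if $f$ is a vertex and $r\ge0$, with $\int_fu\,\mathrm ds=u(f)$),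 extended to $T$ as homogeneous polynomials of degree $r$ in $\lambda_i^{\rm R}$, $i\in f$. For $f\in\Delta_\ell(T^{\rm R})$, $\mathbb B_kV^f=b_f^{\rm R}\mathbb P_{k-\ell-1}(f)\otimes V^f$. Enrichment. For $f\in\Delta_\ell(T)$, $i,j\in f^*$: $\boldsymbol\phi^f_{ij}=\chi_{T_i}\operatorname{sym}(\boldsymbol t_{f(0),c}\otimes\boldsymbol t_{f(0),j})-\chi_{T_j}\operatorname{sym}(\boldsymbol t_{f(0),c}\otimes\boldsymbol t_{f(0),i})$, $\Phi^f(\mathbb S)=\operatorname{span}\{\boldsymbol\phi^f_{ij}:i,j\in f^*,i<j\}$. Interior tangential-normal functions. For $F=T_i\cap T_j$ and $f\in\Delta_\ell(F)$, $\mathbb B_k\operatorname{sym}(\mathscr T^f\otimes\mathscr N^F)$ is the span of the functions supported on $T_i\cup T_j$ equal on $T_m$, $m\in\{i,j\}$, to $b_f^{\rm R}\,p\operatorname{sym}(\boldsymbol t\otimes\hat{\boldsymbol n}^m)$, $p\in\mathbb P_{k-\ell-1}(f)$, $\boldsymbol t\in\mathscr T^f$, where $\hat{\boldsymbol n}^m\in\mathscr N^f$ satisfies $\hat{\boldsymbol n}^m\cdot\boldsymbol n_F=1$ and $\hat{\boldsymbol n}^m\cdot\boldsymbol n_{F'}=0$ for all other $(d-1)$-faces $F'\supseteq f$ of $T_m$. Element bubbles. $\mathbb B_k(\operatorname{div},K;\mathbb S)=H_0(\operatorname{div},K;\mathbb S)\cap\mathbb P_k(K;\mathbb S)$ for $K\in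 T^{\rm R}$, extended by zero. Space. $$\Sigma_{k,\phi}^{\operatorname{div}}(T^{\rm R};\mathbb S)=\sum_{\ell=0}^{d-1}\Big[\sum_{f\in\Delta_\ell(T)}\big(\mathbb B_k\mathscr N^f(\mathbb S)+\mathbb B_k\Phi^f(\mathbb S)\big)+\sum_{f\in\Delta_\ell(\mathring T^{\rm R})}\mathbb B_k\mathbb S(\mathscr N^f)\Big]+\sum_{F\in\Delta_{d-1}(\mathring T^{\rm R})}\sum_{\ell=0}^{d-1}\sum_{f\in\Delta_\ell(F)}\mathbb B_k\operatorname{sym}(\mathscr T^f\otimes\mathscr N^F)+\sum_{i=0}^d\mathbb B_k(\operatorname{div},T_i;\mathbb S).$$ For elements of this space the integrands in (b), (c) are single-valued. *)

theory Defs
  imports "HOL-Analysis.Analysis" "HOL-Library.Function_Algebras"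
begin

definition tensor :: "real^'n \<Rightarrow> real^'n \<Rightarrow> real^'n^'n" where
  "tensor u v = (\<chi> i j. u $ i * v $ j)"

definition sym_part :: "real^'n^'n \<Rightarrow> real^'n^'n" where
  "sym_part A = (1/2) *\<^sub>R (A + transpose A)"

text \<open>A simplex is given by its set of vertices; the point set it occupies is the convex hull.\<close>

definition tan_space :: "(real^'n) set \<Rightarrow> (real^'n) set" where
  "tan_space f = span {y - x | x y. x \<in> f \<and> y \<in> f}"

definition nor_space :: "(real^'n) set \<Rightarrow> (real^'n) set" where
  "nor_space f = orthogonal_comp (tan_space f)"

definition sym_tensors :: "(real^'n) set \<Rightarrow> (real^'n) set \<Rightarrow> (real^'n^'n) set" where
  "sym_tensors U V = span {sym_part (tensor u v) | u v. u \<in> U \<and> v \<in> V}"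

text \<open>\<open>SS V\<close> is $\mathbb S(V)$ and \<open>NS f\<close> is $\mathscr N^f(\mathbb S)$; the sum in \<open>NS\<close> is direct
  because the two summands are orthogonal.\<close>

definition SS :: "(real^'n) set \<Rightarrow> (real^'n^'n) set" where
  "SS V = sym_tensors V V"

definition NS :: "(real^'n) set \<Rightarrow> (real^'n^'n) set" where
  "NS f = {A + B | A B. A \<in> SS (nor_space f) \<and> B \<in> sym_tensors (tan_space f) (nor_space f)}"

definition faces :: "nat \<Rightarrow> (real^'n) set set \<Rightarrow> (real^'n) set set" where
  "faces l M = {f. \<exists>K\<in>M. f \<subseteq> K \<and> card f = l + 1}"

definition barycenter :: "(real^'n) set \<Rightarrow> real^'n" where
  "barycenter T = (1 / real (card T)) *\<^sub>R (\<Sum>v\<in>T. v)"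

text \<open>For a vertex \<open>v\<close> of \<open>T\<close>, \<open>subcell T v\<close> is $T_i$ with $\mathtt v_i$ = \<open>v\<close>, and \<open>split T\<close> is
  $T^{\rm R}$.\<close>

definition subcell :: "(real^'n) set \<Rightarrow> real^'n \<Rightarrow> (real^'n) set" where
  "subcell T v = insert (barycenter T) (T - {v})"

definition split :: "(real^'n) set \<Rightarrow> (real^'n) set set" where
  "split T = subcell T ` T"

definition refine :: "(real^'n) set set \<Rightarrow> (real^'n) set set" where
  "refine M = (\<Union>T\<in>M. split T)"

definition interior_faces :: "nat \<Rightarrow> (real^'n) set set \<Rightarrow> (real^'n) set set" where
  "interior_faces l M = faces l (refine M) - faces l M"

text \<open>The regularity condition excludes domains with slits, which are lost in the closure.\<close>

definition polyhedral_domain :: "(real^'n) set \<Rightarrow> bool" where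
  "polyhedral_domain \<Omega> \<longleftrightarrow>
     open \<Omega> \<and> connected \<Omega> \<and> \<Omega> \<noteq> {} \<and> interior (closure \<Omega>) = \<Omega> \<and>
     (\<exists>\<P>. finite \<P> \<and> (\<forall>P\<in>\<P>. polytope P) \<and> closure \<Omega> = \<Union>\<P>)"

definition conforming_triangulation :: "(real^'n) set \<Rightarrow> (real^'n) set set \<Rightarrow> bool" where
  "conforming_triangulation \<Omega> Th \<longleftrightarrow>
     (\<forall>T\<in>Th. card T = CARD('n) + 1 \<and> \<not> affine_dependent T) \<and>
     triangulation ((\<lambda>T. convex hull T) ` Th) \<and>
     closure \<Omega> = (\<Union>T\<in>Th. convex hull T)"

definition unit_normal :: "(real^'n) set \<Rightarrow> real^'n \<Rightarrow> bool" where
  "unit_normal F n \<longleftrightarrow> norm n = 1 \<and> n \<in> nor_space F"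

text \<open>The degree bound is an integer; for a negative bound the index set is empty and the
  space is \<open>{0}\<close>.\<close>

definition polys :: "int \<Rightarrow> (real^'n \<Rightarrow> real) set" where
  "polys r = {p. \<exists>c. p = (\<lambda>x. \<Sum>\<alpha> | int (sum \<alpha> (UNIV :: 'n set)) \<le> r. c \<alpha> * (\<Prod>i\<in>UNIV. (x $ i) ^ \<alpha> i))}"

definition vec_polys :: "int \<Rightarrow> (real^'n \<Rightarrow> real^'n) set" where
  "vec_polys r = {q. \<forall>i. (\<lambda>x. q x $ i) \<in> polys r}"

definition sym_polys :: "int \<Rightarrow> (real^'n \<Rightarrow> real^'n^'n) set" where
  "sym_polys r = {q. (\<forall>i j. (\<lambda>x. q x $ i $ j) \<in> polys r) \<and> (\<forall>x. transpose (q x) = q x)}"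

text \<open>A function on \<open>f\<close> is represented by its extension by zero to the whole space, so that
  polynomials that agree on \<open>f\<close> are identified.\<close>

definition on_simplex :: "(real^'n) set \<Rightarrow> (real^'n \<Rightarrow> 'b::zero) \<Rightarrow> real^'n \<Rightarrow> 'b" where
  "on_simplex f p = (\<lambda>x. if x \<in> convex hull f then p x else 0)"

definition polys_on :: "(real^'n) set \<Rightarrow> int \<Rightarrow> (real^'n \<Rightarrow> real) set" where
  "polys_on f r = on_simplex f ` polys r"

definition vec_polys_on :: "(real^'n) set \<Rightarrow> int \<Rightarrow> (real^'n \<Rightarrow> real^'n) set" where
  "vec_polys_on f r = on_simplex f ` vec_polys r"

text \<open>\<open>ND k F\<close> is $\mathrm{ND}_{k-2}(F)$. For tangential \<open>q\<close> of degree at most \<open>k - 1\<close> the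
  condition on \<open>q x \<bullet> x\<close> does not depend on the origin of the position vector.\<close>

definition ND :: "nat \<Rightarrow> (real^'n) set \<Rightarrow> (real^'n \<Rightarrow> real^'n) set" where
  "ND k F = {q \<in> vec_polys_on F (int k - 1).
      (\<forall>x\<in>convex hull F. q x \<in> tan_space F) \<and> (\<lambda>x. q x \<bullet> x) \<in> polys_on F (int k - 1)}"

text \<open>The surface measure on the affine hull of an \<open>l\<close>-simplex \<open>f\<close>: the image of the
  \<open>l\<close>-dimensional Lebesgue measure under an isometric parametrization. It does not depend on
  the chosen point and orthonormal basis; for a vertex it is the Dirac measure.\<close>

definition surface_measure :: "(real^'n) set \<Rightarrow> (real^'n) measure" where
  "surface_measure f =
     (let a = (SOME a. a \<in> f);
          B = (SOME B. pairwise orthogonal B \<and> (\<forall>b\<in>B. norm b = 1) \<and> span B = tan_space f)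
      in distr (\<Pi>\<^sub>M b\<in>B. lborel) borel (\<lambda>s. a + (\<Sum>b\<in>B. s b *\<^sub>R b)))"

definition surface_integral :: "(real^'n) set \<Rightarrow> (real^'n \<Rightarrow> real) \<Rightarrow> real" where
  "surface_integral f u = (LINT x:convex hull f|surface_measure f. u x)"

primrec cont_diff :: "nat \<Rightarrow> (real^'n \<Rightarrow> real) \<Rightarrow> bool" where
  "cont_diff 0 u \<longleftrightarrow> continuous_on UNIV u"
| "cont_diff (Suc m) u \<longleftrightarrow>
     (\<forall>x. u differentiable (at x)) \<and> (\<forall>v. cont_diff m (\<lambda>x. frechet_derivative u (at x) v))"

definition smooth :: "(real^'n \<Rightarrow> real) \<Rightarrow> bool" where
  "smooth u \<longleftrightarrow> (\<forall>m. cont_diff m u)"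

definition test_function :: "(real^'n) set \<Rightarrow> (real^'n \<Rightarrow> real) \<Rightarrow> bool" where
  "test_function D u \<longleftrightarrow>
     smooth u \<and> compact (closure {x. u x \<noteq> 0}) \<and> closure {x. u x \<noteq> 0} \<subseteq> D"

definition grad :: "(real^'n \<Rightarrow> real) \<Rightarrow> real^'n \<Rightarrow> real^'n" where
  "grad u x = (\<chi> j. frechet_derivative u (at x) (axis j 1))"

definition L2 :: "(real^'n) set \<Rightarrow> (real^'n \<Rightarrow> 'b::euclidean_space) \<Rightarrow> bool" where
  "L2 D u \<longleftrightarrow>
     u \<in> borel_measurable (lebesgue_on D) \<and> integrable (lebesgue_on D) (\<lambda>x. (norm (u x))\<^sup>2)"

text \<open>With \<open>g\<close> the row-wise divergence of \<open>\<tau>\<close>, this is the vector whose \<open>i\<close>-th entry is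
  $\langle (\tau n)_i, u\rangle_{\partial D}$, the normal trace being defined by Green's formula.\<close>

definition normal_trace ::
  "(real^'n) set \<Rightarrow> (real^'n \<Rightarrow> real^'n^'n) \<Rightarrow> (real^'n \<Rightarrow> real^'n) \<Rightarrow> (real^'n \<Rightarrow> real) \<Rightarrow> real^'n" where
  "normal_trace D \<tau> g u = (LINT x|lebesgue_on D. \<tau> x *v grad u x + u x *\<^sub>R g x)"

definition weak_div ::
  "(real^'n) set \<Rightarrow> (real^'n \<Rightarrow> real^'n^'n) \<Rightarrow> (real^'n \<Rightarrow> real^'n) \<Rightarrow> bool" where
  "weak_div D \<tau> g \<longleftrightarrow>
     (\<forall>u. test_function D u \<longrightarrow>
        (LINT x|lebesgue_on D. \<tau> x *v grad u x) = - (LINT x|lebesgue_on D. u x *\<^sub>R g x))"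

definition Hdiv :: "(real^'n) set \<Rightarrow> (real^'n \<Rightarrow> real^'n^'n) set" where
  "Hdiv D = {\<tau>. L2 D \<tau> \<and> (AE x in lebesgue_on D. transpose (\<tau> x) = \<tau> x) \<and>
                 (\<exists>g. L2 D g \<and> weak_div D \<tau> g)}"

definition H0div :: "(real^'n) set \<Rightarrow> (real^'n \<Rightarrow> real^'n^'n) set" where
  "H0div D = {\<tau> \<in> Hdiv D.
      \<forall>g. L2 D g \<and> weak_div D \<tau> g \<longrightarrow> (\<forall>u. smooth u \<longrightarrow> normal_trace D \<tau> g u = 0)}"

definition Bdiv :: "nat \<Rightarrow> (real^'n) set \<Rightarrow> (real^'n \<Rightarrow> real^'n^'n) set" where
  "Bdiv k K = H0div (interior (convex hull K)) \<inter> sym_polys (int k)"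

text \<open>A piecewise polynomial field \<open>\<tau>\<close> on a mesh is a family of polynomials indexed by the
  cells, with \<open>\<tau> K = 0\<close> if \<open>K\<close> is not a cell. The trace of \<open>\<tau>\<close> on a face of \<open>K\<close> taken from
  the side of \<open>K\<close> is the restriction of \<open>\<tau> K\<close>.\<close>

type_synonym 'n field = "(real^'n) set \<Rightarrow> real^'n \<Rightarrow> real^'n^'n"

definition scale_field :: "real \<Rightarrow> 'n::finite field \<Rightarrow> 'n field" where
  "scale_field a \<tau> = (\<lambda>K x. a *\<^sub>R \<tau> K x)"

global_interpretation field: vector_space scale_field
  by standard (simp_all add: scale_field_def fun_eq_iff scaleR_add_left scaleR_add_right)

definition restrict_field :: "(real^'n) set set \<Rightarrow> 'n::finite field \<Rightarrow> 'n field" where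
  "restrict_field M \<tau> = (\<lambda>K x. if K \<in> M then \<tau> K x else 0)"

text \<open>The function on the domain, defined up to a null set, that a family represents.\<close>

definition field_fun :: "(real^'n) set set \<Rightarrow> 'n::finite field \<Rightarrow> real^'n \<Rightarrow> real^'n^'n" where
  "field_fun M \<tau> x = (\<Sum>K\<in>M. indicator (interior (convex hull K)) x *\<^sub>R \<tau> K x)"

text \<open>\<open>lam v K\<close> is $\lambda_v^{\rm R}$ on the cell \<open>K\<close>; it vanishes if \<open>v\<close> is not a vertex of \<open>K\<close>.\<close>

definition lam :: "real^'n \<Rightarrow> (real^'n) set \<Rightarrow> real^'n \<Rightarrow> real" where
  "lam v K = (THE p. p \<in> polys 1 \<and> (\<forall>w\<in>K. p w = (if w = v then 1 else 0)))"

definition bub :: "(real^'n) set \<Rightarrow> (real^'n) set \<Rightarrow> real^'n \<Rightarrow> real" where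
  "bub f K x = (\<Prod>v\<in>f. lam v K x)"

text \<open>The extensions of the elements of $\mathbb P_r(f)$ as homogeneous polynomials of degree
  \<open>r\<close> in the barycentric coordinates of the vertices of \<open>f\<close>.\<close>

definition hom_polys :: "(real^'n) set \<Rightarrow> int \<Rightarrow> ((real^'n) set \<Rightarrow> real^'n \<Rightarrow> real) set" where
  "hom_polys f r = {p. \<exists>c. p = (\<lambda>K x.
      \<Sum>\<alpha> | (\<forall>v. v \<notin> f \<longrightarrow> \<alpha> v = (0::nat)) \<and> int (sum \<alpha> f) = r. c \<alpha> * (\<Prod>v\<in>f. lam v K x ^ \<alpha> v))}"

text \<open>\<open>bubbles k l T f V\<close> is $\mathbb B_kV^f$ for an \<open>l\<close>-dimensional \<open>f\<close>, where \<open>V\<close> consists of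
  tensor fields that are constant on each cell of the split of \<open>T\<close>.\<close>

definition bubbles ::
  "nat \<Rightarrow> nat \<Rightarrow> (real^'n) set \<Rightarrow> (real^'n) set \<Rightarrow> ((real^'n) set \<Rightarrow> real^'n^'n) set \<Rightarrow> 'n::finite field set" where
  "bubbles k l T f V = field.span
     {restrict_field (split T) (\<lambda>K x. (bub f K x * p K x) *\<^sub>R A K) | p A.
        p \<in> hom_polys f (int k - int l - 1) \<and> A \<in> V}"

definition constant_fields :: "(real^'n^'n) set \<Rightarrow> ((real^'n) set \<Rightarrow> real^'n^'n) set" where
  "constant_fields V = (\<lambda>A K. A) ` V"

definition phi ::
  "((real^'n) set \<Rightarrow> real^'n) \<Rightarrow> (real^'n) set \<Rightarrow> (real^'n) set \<Rightarrow> real^'n \<Rightarrow> real^'n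
     \<Rightarrow> (real^'n) set \<Rightarrow> real^'n^'n" where
  "phi v0 T f vi vj = (\<lambda>K.
      (if K = subcell T vi then sym_part (tensor (barycenter T - v0 f) (vj - v0 f)) else 0)
    - (if K = subcell T vj then sym_part (tensor (barycenter T - v0 f) (vi - v0 f)) else 0))"

text \<open>Since \<open>phi\<close> is antisymmetric in its last two arguments, no order of the vertices is
  needed, and since \<open>bubbles\<close> takes the span, the generators of $\Phi^f(\mathbb S)$ suffice.\<close>

definition phi_generators ::
  "((real^'n) set \<Rightarrow> real^'n) \<Rightarrow> (real^'n) set \<Rightarrow> (real^'n) set \<Rightarrow> ((real^'n) set \<Rightarrow> real^'n^'n) set" where
  "phi_generators v0 T f = {phi v0 T f vi vj | vi vj. vi \<in> T - f \<and> vj \<in> T - f \<and> vi \<noteq> vj}"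

text \<open>The set \<open>nhat nrm f F K\<close> contains exactly one vector, $\hat n^m$ for \<open>K\<close> = $T_m$.\<close>

definition nhat ::
  "((real^'n) set \<Rightarrow> real^'n) \<Rightarrow> (real^'n) set \<Rightarrow> (real^'n) set \<Rightarrow> (real^'n) set \<Rightarrow> (real^'n) set" where
  "nhat nrm f F K = {n \<in> nor_space f. n \<bullet> nrm F = 1 \<and>
      (\<forall>F'\<in>faces (CARD('n) - 1) {K}. f \<subseteq> F' \<and> F' \<noteq> F \<longrightarrow> n \<bullet> nrm F' = 0)}"

definition tn_bubbles ::
  "((real^'n) set \<Rightarrow> real^'n) \<Rightarrow> nat \<Rightarrow> nat \<Rightarrow> (real^'n) set \<Rightarrow> (real^'n) set \<Rightarrow> (real^'n) set
     \<Rightarrow> 'n::finite field set" where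
  "tn_bubbles nrm k l T F f = field.span
     {restrict_field {K \<in> split T. F \<subseteq> K} (\<lambda>K x. (bub f K x * p K x) *\<^sub>R sym_part (tensor t (n K))) | p t n.
        p \<in> hom_polys f (int k - int l - 1) \<and> t \<in> tan_space f \<and>
        (\<forall>K\<in>split T. F \<subseteq> K \<longrightarrow> n K \<in> nhat nrm f F K)}"

definition cell_bubbles :: "nat \<Rightarrow> (real^'n) set \<Rightarrow> 'n::finite field set" where
  "cell_bubbles k K = (\<lambda>q. restrict_field {K} (\<lambda>K'. q)) ` Bdiv k K"

text \<open>A sum of subspaces is the span of their union.\<close>

definition Sigma_loc ::
  "((real^'n) set \<Rightarrow> real^'n) \<Rightarrow> ((real^'n) set \<Rightarrow> real^'n) \<Rightarrow> nat \<Rightarrow> (real^'n) set \<Rightarrow> 'n::finite field set" where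
  "Sigma_loc nrm v0 k T = field.span
     ((\<Union>l<CARD('n).
         (\<Union>f\<in>faces l {T}. bubbles k l T f (constant_fields (NS f)) \<union> bubbles k l T f (phi_generators v0 T f))
         \<union> (\<Union>f\<in>interior_faces l {T}. bubbles k l T f (constant_fields (SS (nor_space f)))))
      \<union> (\<Union>F\<in>interior_faces (CARD('n) - 1) {T}. \<Union>l<CARD('n). \<Union>f\<in>faces l {F}. tn_bubbles nrm k l T F f)
      \<union> (\<Union>K\<in>split T. cell_bubbles k K))"

definition dof_a ::
  "((real^'n) set \<Rightarrow> real^'n) \<Rightarrow> (real^'n) set \<Rightarrow> (real^'n) set \<Rightarrow> 'n::finite field \<Rightarrow> (real^'n \<Rightarrow> real^'n) \<Rightarrow> real" where
  "dof_a nrm T F \<tau> q =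
     surface_integral F (\<lambda>x. (\<tau> (insert (barycenter T) F) x *v nrm F) \<bullet> q x)"

text \<open>In \<open>dof_b\<close> and \<open>dof_c\<close>, \<open>K\<close> is the cell from which the trace on the face is taken.\<close>

definition dof_b ::
  "(real^'n) set \<Rightarrow> (real^'n) set \<Rightarrow> real^'n \<Rightarrow> real^'n \<Rightarrow> 'n::finite field \<Rightarrow> (real^'n \<Rightarrow> real) \<Rightarrow> real" where
  "dof_b K f m n \<tau> q = surface_integral f (\<lambda>x. (m \<bullet> (\<tau> K x *v n)) * q x)"

definition tangential_part :: "real^'n \<Rightarrow> real^'n \<Rightarrow> real^'n" where
  "tangential_part n v = v - (n \<bullet> v) *\<^sub>R n"

definition dof_c ::
  "((real^'n) set \<Rightarrow> real^'n) \<Rightarrow> (real^'n) set \<Rightarrow> (real^'n) set \<Rightarrow> 'n::finite field \<Rightarrow> (real^'n \<Rightarrow> real^'n) \<Rightarrow> real" where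
  "dof_c nrm K F \<tau> q =
     surface_integral F (\<lambda>x. tangential_part (nrm F) (\<tau> K x *v nrm F) \<bullet> q x)"

definition dof_d :: "(real^'n) set \<Rightarrow> 'n::finite field \<Rightarrow> (real^'n \<Rightarrow> real^'n^'n) \<Rightarrow> real" where
  "dof_d K \<tau> q = (LINT x:convex hull K|lebesgue. \<tau> K x \<bullet> q x)"

definition linear_on :: "('a \<Rightarrow> 'b::real_vector) set \<Rightarrow> (('a \<Rightarrow> 'b) \<Rightarrow> real) \<Rightarrow> bool" where
  "linear_on Q L \<longleftrightarrow>
     (\<forall>q\<in>Q. \<forall>r\<in>Q. \<forall>a b. L (\<lambda>x. a *\<^sub>R q x + b *\<^sub>R r x) = a * L q + b * L r)"

text \<open>The degrees of freedom of a mesh \<open>M\<close> are unisolvent for \<open>V\<close>: arbitrary values of the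
  degrees of freedom are attained by exactly one element of \<open>V\<close>. As the degrees of freedom are
  linear in the test function \<open>q\<close>, their values form a linear functional on each test space,
  and prescribing them on a basis is the same as prescribing this functional.
  \<open>elt f\<close> is a cell containing \<open>f\<close>, from which the trace on \<open>f\<close> is taken, and
  \<open>nb f\<close> enumerates the basis of the normal space of \<open>f\<close>.\<close>

definition unisolvent ::
  "((real^'n) set \<Rightarrow> real^'n) \<Rightarrow> ((real^'n) set \<Rightarrow> nat \<Rightarrow> real^'n) \<Rightarrow> ((real^'n) set \<Rightarrow> (real^'n) set)
     \<Rightarrow> nat \<Rightarrow> (real^'n) set set \<Rightarrow> 'n::finite field set \<Rightarrow> bool" where
  "unisolvent nrm nb elt k M V \<longleftrightarrow>
     (\<forall>La Lb Lc Ld.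
        (\<forall>F\<in>faces (CARD('n) - 1) M. linear_on (vec_polys_on F (int k)) (La F)) \<and>
        (\<forall>l<CARD('n). \<forall>f\<in>interior_faces l M. \<forall>i j. 1 \<le> i \<and> i \<le> j \<and> j \<le> CARD('n) - l \<longrightarrow>
           linear_on (polys_on f (int k - (int l + 1))) (Lb f i j)) \<and>
        (\<forall>F\<in>interior_faces (CARD('n) - 1) M. linear_on (ND k F) (Lc F)) \<and>
        (\<forall>K\<in>refine M. linear_on (Bdiv k K) (Ld K))
        \<longrightarrow>
        (\<exists>!\<tau>. \<tau> \<in> V \<and>
           (\<forall>T\<in>M. \<forall>F\<in>faces (CARD('n) - 1) {T}. \<forall>q\<in>vec_polys_on F (int k).
              dof_a nrm T F \<tau> q = La F q) \<and>
           (\<forall>l<CARD('n). \<forall>f\<in>interior_faces l M. \<forall>i j. 1 \<le> i \<and> i \<le> j \<and> j \<le> CARD('n) - l \<longrightarrow>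
              (\<forall>q\<in>polys_on f (int k - (int l + 1)). dof_b (elt f) f (nb f i) (nb f j) \<tau> q = Lb f i j q)) \<and>
           (\<forall>F\<in>interior_faces (CARD('n) - 1) M. \<forall>q\<in>ND k F. dof_c nrm (elt F) F \<tau> q = Lc F q) \<and>
           (\<forall>K\<in>refine M. \<forall>q\<in>Bdiv k K. dof_d K \<tau> q = Ld K q)))"

definition Sigma_glob ::
  "((real^'n) set \<Rightarrow> real^'n) \<Rightarrow> ((real^'n) set \<Rightarrow> real^'n) \<Rightarrow> nat \<Rightarrow> (real^'n) set set \<Rightarrow> 'n::finite field set" where
  "Sigma_glob nrm v0 k Th = {\<tau>.
      restrict_field (refine Th) \<tau> = \<tau> \<and>
      (\<forall>T\<in>Th. restrict_field (split T) \<tau> \<in> Sigma_loc nrm v0 k T) \<and>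
      (\<forall>T\<in>Th. \<forall>T'\<in>Th. \<forall>F\<in>faces (CARD('n) - 1) {T} \<inter> faces (CARD('n) - 1) {T'}.
         \<forall>q\<in>vec_polys_on F (int k). dof_a nrm T F \<tau> q = dof_a nrm T' F \<tau> q)}"

end

theory Submission
  imports Defs
begin

text \<open>Uniqueness. If the degrees of freedom (a) vanish, the normal traces on the facets of \<open>T\<close> vanish,
  and on a face \<open>f\<close> of \<open>T\<close> the numbers \<open>g\<^sub>l \<bullet> \<tau>\<^sub>i g\<^sub>j\<close> (\<open>g\<close> the gradients of the barycentric coordinates
  of \<open>T\<close>) are symmetric in \<open>l, j\<close> and, by continuity of the normal trace across \<open>T\<^sub>i \<inter> T\<^sub>j\<close>, antisymmetric
  in \<open>i, j\<close>, hence zero. So the normal-normal part on an interior face is divisible by the face bubble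
  and (b), by induction on the dimension, makes it vanish. On an interior facet the coefficients of the
  remaining tangential trace \<open>w\<close> are multiples \<open>\<lambda>\<^sub>v p\<^sub>v\<close> of the barycentric coordinates, and the field
  \<open>q\<close> in ND with \<open>q \<bullet> (v - x) = p\<^sub>v\<close> has \<open>w \<bullet> q = \<Sum>\<^sub>v \<lambda>\<^sub>v p\<^sub>v\<^sup>2\<close>, so that (c) gives \<open>w = 0\<close>, and (d) the rest.

  Existence. Each kind of degrees of freedom is attained on fields for which the preceding ones vanish;
  the coefficient polynomials come from representing the prescribed functional by a weighted inner
  product on the test space.

  Conformity. On a simplex, Green's formula with a smooth cutoff in the barycentric coordinates
  replaces the boundary integral over each facet by the limit of volume integrals over layers at that
  facet. Neighbouring cells are compared by the affine map that fixes their common facet.\<close>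

section \<open>Polynomials\<close>

text \<open>No dimension is counted anywhere: uniqueness uses only what \<open>conforming\<close>
  records about a field, and existence therefore has to be constructed. All geometry is carried by
  the gradients of the barycentric coordinates. Up to nonzero factors they are the facet normals,
  those of the vertices outside a face span its normal space, and they are dual to the edges, so
  that traces become polynomials with computable coefficients. The obstacle in (a) is the relation
  behind uniqueness: a constant symmetric tensor A at a face f satisfies g_i . A g_j = g_j . A g_i,
  so constant tensors alone cannot give the facets at f independent traces. The functions
  \<open>phi\<close> jump between the cells and break this symmetry, yet keep the normal trace
  across every interior facet continuous. Elements of \<open>Bdiv\<close> are defined by weak
  divergences, whereas the degrees of freedom need their pointwise normal traces; Green's formula on
  one simplex serves this equivalence as well as conformity.\<close>

lemma finite_exponents: "finite {\<alpha>::'n::finite \<Rightarrow> nat. int (sum \<alpha> UNIV) \<le> r}"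
proof (rule finite_subset)
  show "{\<alpha>::'n \<Rightarrow> nat. int (sum \<alpha> UNIV) \<le> r}
    \<subseteq> {\<alpha>. \<forall>x. (x \<in> UNIV \<longrightarrow> \<alpha> x \<in> {..nat r}) \<and> (x \<notin> UNIV \<longrightarrow> \<alpha> x = 0)}"
  proof (clarsimp simp del: of_nat_sum)
    fix \<alpha> :: "'n \<Rightarrow> nat" and x assume "int (sum \<alpha> UNIV) \<le> r"
    moreover have "\<alpha> x \<le> sum \<alpha> UNIV" by (simp add: member_le_sum)
    ultimately show "\<alpha> x \<le> nat r" by linarith
  qed
qed (rule finite_set_of_finite_funs; simp)

lemma polys_monomial:
  assumes "int (sum \<alpha> UNIV) \<le> r"
  shows "(\<lambda>x::real^'n. \<Prod>i\<in>UNIV. (x $ i) ^ \<alpha> i) \<in> polys r"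
  unfolding polys_def
  apply (rule CollectI)
  apply (rule exI[of _ "\<lambda>\<beta>. if \<beta> = \<alpha> then 1 else 0"])
  using assms by (simp add: if_distrib[of "\<lambda>a. a * _"] sum.delta[OF finite_exponents] del: of_nat_sum cong: if_cong)

lemma polys_add: "p \<in> polys r ==> q \<in> polys r ==> (\<lambda>x. p x + q x) \<in> polys r"
  unfolding polys_def by (auto simp: sum.distrib[symmetric] distrib_right[symmetric])

lemma polys_scale: "p \<in> polys r ==> (\<lambda>x. a * p x) \<in> polys r"
  unfolding polys_def by (auto simp: sum_distrib_left mult.assoc[symmetric])

lemma polys_zero: "(\<lambda>x. 0) \<in> polys r"
  unfolding polys_def by (auto intro!: exI[of _ "\<lambda>_. 0"])

lemma polys_sum: "(\<And>i. i \<in> I ==> p i \<in> polys r) ==> (\<lambda>x. \<Sum>i\<in>I. p i x) \<in> polys r"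
  by (induction I rule: infinite_finite_induct) (auto simp: polys_zero polys_add)

lemma polys_induct [consumes 1, case_names monom add scale zero]:
  assumes "p \<in> polys r"
    and "\<And>\<alpha>. int (sum \<alpha> UNIV) \<le> r ==> P (\<lambda>x::real^'n. \<Prod>i\<in>UNIV. (x $ i) ^ \<alpha> i)"
    and "\<And>p q. P p ==> P q ==> P (\<lambda>x. p x + q x)"
    and "\<And>a p. P p ==> P (\<lambda>x. a * p x)"
    and "P (\<lambda>x. 0)"
  shows "P p"
proof -
  obtain c where p: "p = (\<lambda>x. \<Sum>\<alpha> | int (sum \<alpha> (UNIV :: 'n set)) \<le> r. c \<alpha> * (\<Prod>i\<in>UNIV. (x $ i) ^ \<alpha> i))"
    using assms(1) unfolding polys_def by blast
  have "P (\<lambda>x. \<Sum>\<alpha>\<in>A. c \<alpha> * (\<Prod>i\<in>UNIV. (x $ i) ^ \<alpha> i))"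
    if "A \<subseteq> {\<alpha>. int (sum \<alpha> (UNIV :: 'n set)) \<le> r}" for A
    using finite_subset[OF that finite_exponents] that
    by (induction A rule: finite_induct) (use assms in auto)
  then show ?thesis unfolding p by blast
qed

lemma polys_const: "0 \<le> r ==> (\<lambda>x. a) \<in> polys r"
  using polys_scale[OF polys_monomial[of "\<lambda>_. 0" r], of a] by simp

lemma polys_coord: "1 \<le> r ==> (\<lambda>x::real^'n. x $ i) \<in> polys r"
  using polys_monomial[of "\<lambda>j. if j = i then 1 else 0" r]
  by (simp add: sum.delta if_distrib[of "\<lambda>a. _ ^ a"] prod.delta cong: if_cong)

lemma polys_mult:
  assumes "p \<in> polys r" "q \<in> polys s"
  shows "(\<lambda>x. p x * q x) \<in> polys (r + s)"
  using assms(1)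
proof (induction rule: polys_induct)
  case (monom \<alpha>)
  show ?case using assms(2)
  proof (induction rule: polys_induct)
    case (monom \<beta>)
    have "(\<lambda>x::real^'a. \<Prod>i\<in>UNIV. (x $ i) ^ (\<alpha> i + \<beta> i)) \<in> polys (r + s)"
      by (rule polys_monomial) (use monom \<open>int (sum \<alpha> UNIV) \<le> r\<close> in \<open>simp add: sum.distrib\<close>)
    then show ?case by (simp add: power_add prod.distrib)
  next
    case (add p q) then show ?case using polys_add[OF add.IH] by (simp add: distrib_left distrib_right)
  next
    case (scale a p) then show ?case using polys_scale[OF scale.IH, of a] by (simp add: mult.assoc mult.left_commute)
  qed (simp add: polys_zero)
next
  case (add p q) then show ?case using polys_add[OF add.IH] by (simp add: distrib_left distrib_right)
next
  case (scale a p) then show ?case using polys_scale[OF scale.IH, of a] by (simp add: mult.assoc mult.left_commute)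
qed (simp add: polys_zero)

lemma polys_inner_add: "1 \<le> r ==> (\<lambda>x::real^'n. a + g \<bullet> x) \<in> polys r"
  unfolding inner_vec_def inner_real_def
  by (intro polys_add polys_const polys_sum polys_scale polys_coord) auto

lemma polys_minus: "p \<in> polys r ==> q \<in> polys r ==> (\<lambda>x. p x - q x) \<in> polys r"
  using polys_add[OF _ polys_scale[of q r "-1"], of p] by simp

lemma polys_power:
  assumes "p \<in> polys 1" shows "(\<lambda>x. p x ^ m) \<in> polys (int m)"
proof (induction m)
  case (Suc m)
  then show ?case using polys_mult[OF assms Suc] by simp
qed (simp add: polys_const)

lemma polys_prod:
  assumes "\<And>v. v \<in> f ==> p v \<in> polys (int (m v))"
  shows "(\<lambda>x. \<Prod>v\<in>f. p v x) \<in> polys (int (sum m f))"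
  using assms
proof (induction f rule: infinite_finite_induct)
  case (insert v f)
  then have "(\<lambda>x. p v x * (\<Prod>v\<in>f. p v x)) \<in> polys (int (m v) + int (sum m f))"
    by (intro polys_mult) auto
  then show ?case using insert by simp
qed (auto simp: polys_const)

lemma polys_affine:
  assumes "p \<in> polys 1"
  shows "\<exists>a g. p = (\<lambda>x::real^'n. a + g \<bullet> x)"
  using assms
proof (induction rule: polys_induct)
  case (monom \<alpha>)
  show ?case
  proof (cases "\<alpha> = (\<lambda>_. 0)")
    case True
    then show ?thesis by (intro exI[of _ 1] exI[of _ 0]) auto
  next
    case False
    then obtain i where i: "\<alpha> i \<noteq> 0" by auto
    have "sum \<alpha> UNIV = \<alpha> i + sum \<alpha> (UNIV - {i})" by (simp add: sum.remove)
    then have "\<alpha> i = 1" "sum \<alpha> (UNIV - {i}) = 0" using monom i by linarith+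
    then have "\<alpha> = (\<lambda>j. if j = i then 1 else 0)" by (auto simp: fun_eq_iff)
    then have "(\<lambda>x::real^'n. \<Prod>i\<in>UNIV. (x $ i) ^ \<alpha> i) = (\<lambda>x. x $ i)"
      by (simp add: if_distrib[of "\<lambda>a. _ ^ a"] prod.delta cong: if_cong)
    then show ?thesis by (intro exI[of _ 0] exI[of _ "axis i 1"]) (simp add: inner_axis')
  qed
next
  case (add p q)
  then obtain a g b h where "p = (\<lambda>x. a + g \<bullet> x)" "q = (\<lambda>x. b + h \<bullet> x)" by blast
  then show ?case by (intro exI[of _ "a + b"] exI[of _ "g + h"]) (auto simp: inner_add_left)
next
  case (scale c p)
  then obtain a g where "p = (\<lambda>x. a + g \<bullet> x)" by blast
  then show ?case by (intro exI[of _ "c * a"] exI[of _ "c *\<^sub>R g"]) (auto simp: algebra_simps)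
qed (auto intro!: exI[of _ 0])

lemma continuous_polys:
  assumes "p \<in> polys r" shows "continuous_on S p"
  using assms
proof (induction rule: polys_induct)
  case (monom \<alpha>) show ?case by (intro continuous_intros)
qed (auto intro: continuous_on_add continuous_on_mult_left)

section \<open>Homogeneous polynomials\<close>

text \<open>Polynomials in formal variables indexed by the vertices of a face are kept apart from
  the barycentric coordinates, so that one polynomial can be evaluated on every cell and its
  coefficients can be compared.\<close>

definition hexp :: "'v set \<Rightarrow> int \<Rightarrow> ('v \<Rightarrow> nat) set" where
  "hexp f r = {\<alpha>. (\<forall>v. v \<notin> f \<longrightarrow> \<alpha> v = 0) \<and> int (sum \<alpha> f) = r}"

definition mono_at :: "'v set \<Rightarrow> ('v \<Rightarrow> nat) \<Rightarrow> ('v \<Rightarrow> real) \<Rightarrow> real" where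
  "mono_at f \<alpha> y = (\<Prod>v\<in>f. y v ^ \<alpha> v)"

definition hom :: "'v set \<Rightarrow> int \<Rightarrow> (('v \<Rightarrow> real) \<Rightarrow> real) set" where
  "hom f r = {P. \<exists>c. P = (\<lambda>y. \<Sum>\<alpha>\<in>hexp f r. c \<alpha> * mono_at f \<alpha> y)}"

lemma finite_hexp:
  assumes "finite f" shows "finite (hexp f r)"
proof (rule finite_subset)
  show "hexp f r \<subseteq> {\<alpha>. \<forall>x. (x \<in> f \<longrightarrow> \<alpha> x \<in> {..nat r}) \<and> (x \<notin> f \<longrightarrow> \<alpha> x = 0)}"
  proof (clarsimp simp: hexp_def simp del: of_nat_sum)
    fix \<alpha> :: "'a \<Rightarrow> nat" and x assume "x \<in> f"
    then show "\<alpha> x \<le> sum \<alpha> f" using assms by (simp add: member_le_sum)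
  qed
qed (rule finite_set_of_finite_funs; use assms in simp)

lemma hom_add: "P \<in> hom f r ==> Q \<in> hom f r ==> (\<lambda>y. P y + Q y) \<in> hom f r"
  unfolding hom_def by (auto simp: sum.distrib[symmetric] distrib_right[symmetric])

lemma hom_scale: "P \<in> hom f r ==> (\<lambda>y. a * P y) \<in> hom f r"
  unfolding hom_def by (auto simp: sum_distrib_left mult.assoc[symmetric])

lemma hom_zero: "(\<lambda>y. 0) \<in> hom f r"
  unfolding hom_def by (auto intro!: exI[of _ "\<lambda>_. 0"])

lemma hom_sum: "(\<And>i. i \<in> I ==> P i \<in> hom f r) ==> (\<lambda>y. \<Sum>i\<in>I. P i y) \<in> hom f r"
  by (induction I rule: infinite_finite_induct) (auto simp: hom_zero hom_add)

lemma hom_mono_at: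
  assumes "finite f" "\<alpha> \<in> hexp f r" shows "mono_at f \<alpha> \<in> hom f r"
  unfolding hom_def
  apply (rule CollectI)
  apply (rule exI[of _ "\<lambda>\<beta>. if \<beta> = \<alpha> then 1 else 0"])
  using assms by (simp add: if_distrib[of "\<lambda>a. a * _"] sum.delta[OF finite_hexp] cong: if_cong)

lemma hom_induct [consumes 1, case_names monom add scale zero]:
  assumes "P \<in> hom f r"
    and "\<And>\<alpha>. \<alpha> \<in> hexp f r ==> Q (mono_at f \<alpha>)"
    and "\<And>p q. Q p ==> Q q ==> Q (\<lambda>x. p x + q x)"
    and "\<And>a p. Q p ==> Q (\<lambda>x. a * p x)"
    and "Q (\<lambda>x. 0)"
  shows "Q P"
proof -
  obtain c where p: "P = (\<lambda>y. \<Sum>\<alpha>\<in>hexp f r. c \<alpha> * mono_at f \<alpha> y)"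
    using assms(1) unfolding hom_def by blast
  have "Q (\<lambda>y. \<Sum>\<alpha>\<in>A. c \<alpha> * mono_at f \<alpha> y)" if "A \<subseteq> hexp f r" for A
    using that by (induction A rule: infinite_finite_induct) (use assms in auto)
  then show ?thesis unfolding p by blast
qed

lemma hom_const: "finite f ==> (\<lambda>y. a) \<in> hom f 0"
  using hom_scale[OF hom_mono_at[of f "\<lambda>_. 0" 0], of a] by (simp add: hexp_def mono_at_def)

lemma hom_var: "finite f ==> v \<in> f ==> (\<lambda>y. y v) \<in> hom f 1"
  using hom_mono_at[of f "\<lambda>u. if u = v then 1 else 0" 1]
  by (simp add: hexp_def mono_at_def[abs_def] if_distrib[of "\<lambda>a. _ ^ a"] prod.delta del: of_nat_sum cong: if_cong)

lemma hexp_add: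
  "\<alpha> \<in> hexp f r ==> \<beta> \<in> hexp f s ==> (\<lambda>v. \<alpha> v + \<beta> v) \<in> hexp f (r + s)"
  by (auto simp: hexp_def sum.distrib)

lemma mono_at_add: "mono_at f (\<lambda>v. \<alpha> v + \<beta> v) y = mono_at f \<alpha> y * mono_at f \<beta> y"
  by (simp add: mono_at_def power_add prod.distrib)

lemma hom_mult:
  assumes "finite f" "P \<in> hom f r" "Q \<in> hom f s"
  shows "(\<lambda>y. P y * Q y) \<in> hom f (r + s)"
  using assms(2)
proof (induction rule: hom_induct)
  case (monom \<alpha>)
  show ?case using assms(3)
  proof (induction rule: hom_induct)
    case (monom \<beta>)
    then show ?case using hom_mono_at[OF assms(1) hexp_add[OF \<open>\<alpha> \<in> hexp f r\<close> monom]]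
      by (simp add: mono_at_add[abs_def])
  next
    case (add p q) then show ?case using hom_add[OF add.IH] by (simp add: distrib_left distrib_right)
  next
    case (scale a p) then show ?case using hom_scale[OF scale.IH, of a] by (simp add: mult.assoc mult.left_commute)
  qed (simp add: hom_zero)
next
  case (add p q) then show ?case using hom_add[OF add.IH] by (simp add: distrib_left distrib_right)
next
  case (scale a p) then show ?case using hom_scale[OF scale.IH, of a] by (simp add: mult.assoc mult.left_commute)
qed (simp add: hom_zero)

lemma hom_power:
  assumes "finite f" "P \<in> hom f 1" shows "(\<lambda>y. P y ^ m) \<in> hom f (int m)"
proof (induction m)
  case (Suc m)
  then show ?case using hom_mult[OF assms Suc] by simp
qed (simp add: hom_const[OF assms(1)])

lemma hom_prod:
  assumes "finite f" "\<And>v. v \<in> A ==> P v \<in> hom f (int (m v))"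
  shows "(\<lambda>y. \<Prod>v\<in>A. P v y) \<in> hom f (int (sum m A))"
  using assms(2)
proof (induction A rule: infinite_finite_induct)
  case (insert v A)
  then have "(\<lambda>x. P v x * (\<Prod>v\<in>A. P v x)) \<in> hom f (int (m v) + int (sum m A))"
    by (intro hom_mult[OF assms(1)]) auto
  then show ?case using insert by simp
qed (auto simp: hom_const assms)

lemma mono_at_scale:
  assumes "\<alpha> \<in> hexp f r" shows "mono_at f \<alpha> (\<lambda>v. t * y v) = t ^ nat r * mono_at f \<alpha> y"
proof -
  have "sum \<alpha> f = nat r" using assms by (auto simp: hexp_def simp del: of_nat_sum)
  then show ?thesis by (simp add: mono_at_def power_mult_distrib prod.distrib flip: power_sum)
qed

lemma hom_scale_arg:
  assumes "P \<in> hom f r" shows "P (\<lambda>v. t * y v) = t ^ nat r * P y"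
  using assms by (induction rule: hom_induct) (simp_all add: mono_at_scale distrib_left)

lemma hom_cong:
  assumes "P \<in> hom f r" "\<And>v. v \<in> f ==> y v = z v" shows "P y = P z"
  using assms(1)
proof (induction rule: hom_induct)
  case (monom \<alpha>) show ?case unfolding mono_at_def by (rule prod.cong) (use assms(2) in auto)
qed simp_all

text \<open>Induction on the number of variables. With the others fixed, the sum is a polynomial in
  the last variable with infinitely many roots, so each of its coefficients, a polynomial in the
  remaining variables, vanishes.\<close>

lemma monomials_independent:
  fixes c :: "('v \<Rightarrow> nat) \<Rightarrow> real"
  assumes "finite f" "finite A" "\<And>\<alpha> v. \<alpha> \<in> A ==> v \<notin> f ==> \<alpha> v = 0"
    and "\<And>y. (\<And>v. v \<in> f ==> y v > 0) ==> (\<Sum>\<alpha>\<in>A. c \<alpha> * mono_at f \<alpha> y) = 0"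
    and "\<alpha> \<in> A"
  shows "c \<alpha> = 0"
  using assms
proof (induction f arbitrary: A c \<alpha> rule: finite_induct)
  case empty
  have "A \<subseteq> {\<lambda>_. 0}" using empty.prems(2) by (auto simp: fun_eq_iff)
  then have "A = {\<alpha>}" using empty.prems(4) by blast
  then show ?case using empty.prems(3)[of "\<lambda>_. 1"] by (simp add: mono_at_def)
next
  case (insert v f)
  define m where "m = \<alpha> v"
  define B where "B n = {\<beta> \<in> A. \<beta> v = n}" for n
  have fB: "finite (B n)" for n using insert.prems(1) by (simp add: B_def)
  have inj: "inj_on (\<lambda>\<beta>. \<beta>(v := 0)) (B n)" for n
    by (rule inj_on_inverseI[of _ "\<lambda>\<beta>. \<beta>(v := n)"]) (auto simp: B_def)
  obtain N where N: "\<And>\<beta>. \<beta> \<in> A ==> \<beta> v \<le> N"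
  proof -
    have "finite ((\<lambda>\<beta>. \<beta> v) ` A)" using insert.prems(1) by simp
    then show ?thesis using that by (auto simp: finite_nat_set_iff_bounded_le)
  qed
  have mono_upd: "mono_at f (\<beta>(v := n)) y = mono_at f \<beta> y" for \<beta> n y
    using insert.hyps by (auto simp: mono_at_def intro!: prod.cong)
  have coeff0: "(\<Sum>\<beta>\<in>B m. c \<beta> * mono_at f \<beta> y) = 0" if y: "\<And>u. u \<in> f ==> y u > 0" for y
  proof -
    define C where "C n = (\<Sum>\<beta>\<in>B n. c \<beta> * mono_at f \<beta> y)" for n
    have "(\<Sum>n\<le>N. C n * t ^ n) = 0" if t: "t > 0" for t :: real
    proof -
      have "(\<Sum>\<beta>\<in>A. c \<beta> * mono_at (insert v f) \<beta> (y(v := t))) = 0"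
        using y t by (intro insert.prems(3)) auto
      also have "(\<Sum>\<beta>\<in>A. c \<beta> * mono_at (insert v f) \<beta> (y(v := t)))
          = (\<Sum>\<beta>\<in>A. c \<beta> * mono_at f \<beta> y * t ^ \<beta> v)"
      proof (intro sum.cong refl)
        fix \<beta>
        have "(\<Prod>u\<in>f. (y(v := t)) u ^ \<beta> u) = (\<Prod>u\<in>f. y u ^ \<beta> u)"
          using insert.hyps by (intro prod.cong) auto
        then show "c \<beta> * mono_at (insert v f) \<beta> (y(v := t)) = c \<beta> * mono_at f \<beta> y * t ^ \<beta> v"
          using insert.hyps by (simp add: mono_at_def)
      qed
      also have "\<dots> = (\<Sum>n\<le>N. \<Sum>\<beta>\<in>B n. c \<beta> * mono_at f \<beta> y * t ^ \<beta> v)"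
        unfolding B_def by (rule sum.group[symmetric]) (use insert.prems(1) N in auto)
      also have "\<dots> = (\<Sum>n\<le>N. C n * t ^ n)"
        unfolding C_def sum_distrib_right by (intro sum.cong) (auto simp: B_def)
      finally show ?thesis by simp
    qed
    then have "{0<..} \<subseteq> {t. (\<Sum>n\<le>N. C n * t ^ n) = 0}" by auto
    moreover have "infinite {0::real<..}" by (rule infinite_Ioi)
    ultimately have "infinite {t. (\<Sum>n\<le>N. C n * t ^ n) = 0}" using finite_subset by blast
    then have "\<forall>n\<le>N. C n = 0" unfolding polyfun_finite_roots by blast
    then show ?thesis using N[OF insert.prems(4)] by (simp add: C_def m_def)
  qed
  \<comment> \<open>The induction hypothesis speaks of exponents that vanish at \<open>v\<close>;
    the exponent \<open>m\<close> removed here is put back inside the coefficient.\<close>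
  let ?r = "\<lambda>\<beta>. \<beta>(v := 0::nat)"
  have aB: "\<alpha> \<in> B m" using insert.prems(4) by (simp add: B_def m_def)
  have "c ((?r \<alpha>)(v := m)) = 0"
  proof (rule insert.IH[of "?r ` B m" "\<lambda>\<beta>. c (\<beta>(v := m))"])
    fix y :: "'v \<Rightarrow> real" assume y: "\<And>u. u \<in> f ==> 0 < y u"
    have "(\<Sum>\<beta>\<in>?r ` B m. c (\<beta>(v := m)) * mono_at f \<beta> y) = (\<Sum>\<beta>\<in>B m. c \<beta> * mono_at f \<beta> y)"
      unfolding sum.reindex[OF inj] by (intro sum.cong) (auto simp: mono_upd B_def)
    then show "(\<Sum>\<beta>\<in>?r ` B m. c (\<beta>(v := m)) * mono_at f \<beta> y) = 0" using coeff0[OF y] by simp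
  next
    fix \<beta> u assume "\<beta> \<in> ?r ` B m" "u \<notin> f"
    then show "\<beta> u = 0" using insert.prems(2) by (cases "u = v") (auto simp: B_def)
  qed (use fB aB in blast)+
  then show ?case by (simp add: m_def)
qed

text \<open>Rescaling by homogeneity extends vanishing from the open standard simplex to the positive
  orthant.\<close>

lemma hom_coeff_zero:
  assumes f: "finite f" "f \<noteq> {}"
    and *: "\<And>y. (\<And>v. v \<in> f ==> y v > 0) ==> sum y f = 1 ==> (\<Sum>\<alpha>\<in>hexp f r. c \<alpha> * mono_at f \<alpha> y) = 0"
    and "\<alpha> \<in> hexp f r"
  shows "c \<alpha> = 0"
proof (rule monomials_independent[OF f(1) finite_hexp[OF f(1)] _ _ assms(4)])
  fix y :: "'a \<Rightarrow> real" assume y: "\<And>v. v \<in> f ==> 0 < y v"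
  define s where "s = sum y f"
  have s: "s > 0" unfolding s_def using f y by (intro sum_pos) auto
  let ?P = "\<lambda>y. \<Sum>\<alpha>\<in>hexp f r. c \<alpha> * mono_at f \<alpha> y"
  have "?P \<in> hom f r" by (auto simp: hom_def)
  then have "?P (\<lambda>v. s * (y v / s)) = s ^ nat r * ?P (\<lambda>v. y v / s)" by (rule hom_scale_arg)
  moreover have "?P (\<lambda>v. y v / s) = 0"
    using s y by (intro *) (auto simp flip: sum_divide_distrib simp: s_def)
  ultimately show "?P y = 0" using s by simp
qed (auto simp: hexp_def)

text \<open>Setting \<open>y v = 0\<close> deletes exactly the monomials that contain
  \<open>v\<close>; the rest is homogeneous in the other variables, where
  \<open>hom_coeff_zero\<close> applies.\<close>

lemma hom_coeff_zero_facet: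
  assumes f: "finite f" "v \<in> f" and r: "1 \<le> r"
    and *: "\<And>y. (\<And>u. u \<in> f ==> y u \<ge> 0) ==> y v = 0 ==> sum y f = 1 ==>
        (\<Sum>\<alpha>\<in>hexp f r. c \<alpha> * mono_at f \<alpha> y) = 0"
    and "\<alpha> \<in> hexp f r" "\<alpha> v = 0"
  shows "c \<alpha> = 0"
proof -
  let ?g = "f - {v}"
  have sub: "hexp ?g r = {\<beta> \<in> hexp f r. \<beta> v = 0}"
    using f by (auto simp: hexp_def sum.remove[of f v])
  have \<alpha>: "\<alpha> \<in> hexp ?g r" using assms sub by auto
  \<comment> \<open>Degree at least 1 without any power of \<open>v\<close> forces another variable,
    so the facet is not empty.\<close>
  then have "sum \<alpha> ?g \<noteq> 0" using r by (auto simp: hexp_def simp del: of_nat_sum sum_eq_0_iff)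
  then have "?g \<noteq> {}" by (metis sum.empty)
  show ?thesis
  proof (rule hom_coeff_zero[OF _ \<open>?g \<noteq> {}\<close> _ \<alpha>])
    fix y :: "'a \<Rightarrow> real" assume y: "\<And>u. u \<in> ?g ==> 0 < y u" "sum y ?g = 1"
    let ?y = "y(v := 0)"
    have "(\<Sum>\<alpha>\<in>hexp f r. c \<alpha> * mono_at f \<alpha> ?y) = 0"
      using y f by (intro *) (auto simp: sum.remove[of f v] less_imp_le)
    also have "(\<Sum>\<alpha>\<in>hexp f r. c \<alpha> * mono_at f \<alpha> ?y) = (\<Sum>\<alpha>\<in>hexp ?g r. c \<alpha> * mono_at f \<alpha> ?y)"
      unfolding sub using f
      by (intro sum.mono_neutral_right) (auto simp: finite_hexp mono_at_def prod.remove[of f v])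
    also have "\<dots> = (\<Sum>\<alpha>\<in>hexp ?g r. c \<alpha> * mono_at ?g \<alpha> y)"
      using f by (intro sum.cong) (auto simp: mono_at_def sub prod.remove[of f v])
    finally show "(\<Sum>\<alpha>\<in>hexp ?g r. c \<alpha> * mono_at ?g \<alpha> y) = 0" .
  qed (use f in auto)
qed

text \<open>A monomial that lacks some \<open>v\<close> of \<open>S\<close> survives on the facet
  \<open>y v = 0\<close>, so its coefficient is zero; all other monomials are divisible by the
  product over \<open>S\<close>.\<close>

lemma hom_divide:
  assumes f: "finite f" and S: "S \<subseteq> f" and r: "1 \<le> r" and P: "P \<in> hom f r"
    and *: "\<And>v y. v \<in> S ==> (\<And>u. u \<in> f ==> y u \<ge> 0) ==> y v = 0 ==> sum y f = 1 ==> P y = 0"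
  shows "\<exists>Q \<in> hom f (r - int (card S)). P = (\<lambda>y. (\<Prod>v\<in>S. y v) * Q y)"
proof -
  obtain c where p: "P = (\<lambda>y. \<Sum>\<alpha>\<in>hexp f r. c \<alpha> * mono_at f \<alpha> y)"
    using P unfolding hom_def by blast
  define i where "i = (\<lambda>u. if u \<in> S then 1 else 0::nat)"
  have fS: "finite S" using f S finite_subset by blast
  have c0: "c \<alpha> = 0" if "\<alpha> \<in> hexp f r" "v \<in> S" "\<alpha> v = 0" for \<alpha> v
    by (rule hom_coeff_zero_facet[OF f _ r _ that(1,3)]) (use that S * in \<open>auto simp: p\<close>)
  let ?A = "{\<alpha> \<in> hexp f r. \<forall>v\<in>S. \<alpha> v \<noteq> 0}"
  have split: "mono_at f \<alpha> y = (\<Prod>v\<in>S. y v) * mono_at f (\<lambda>u. \<alpha> u - i u) y" if "\<alpha> \<in> ?A" for \<alpha> y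
  proof -
    have "\<alpha> = (\<lambda>u. i u + (\<alpha> u - i u))" using that by (auto simp: i_def fun_eq_iff)
    then have "mono_at f \<alpha> y = mono_at f i y * mono_at f (\<lambda>u. \<alpha> u - i u) y" by (metis mono_at_add)
    moreover have "mono_at f i y = (\<Prod>v\<in>S. y v)"
      unfolding mono_at_def using f S
      by (simp add: i_def prod.inter_restrict[symmetric] Int_absorb1 if_distrib[of "\<lambda>a. _ ^ a"] cong: if_cong)
    ultimately show ?thesis by simp
  qed
  have sumi: "sum i f = card S" using f S by (simp add: i_def sum.inter_restrict[symmetric] Int_absorb1)
  have mem: "(\<lambda>u. \<alpha> u - i u) \<in> hexp f (r - int (card S))" if "\<alpha> \<in> ?A" for \<alpha>
  proof -
    have "sum (\<lambda>u. \<alpha> u - i u) f + sum i f = sum \<alpha> f"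
      unfolding sum.distrib[symmetric] by (rule sum.cong) (use that in \<open>auto simp: i_def\<close>)
    then show ?thesis using that sumi by (auto simp: hexp_def i_def simp del: of_nat_sum)
  qed
  let ?Q = "\<lambda>y. \<Sum>\<alpha>\<in>?A. c \<alpha> * mono_at f (\<lambda>u. \<alpha> u - i u) y"
  have "?Q \<in> hom f (r - int (card S))"
    by (intro hom_sum hom_scale hom_mono_at f mem)
  moreover have "P = (\<lambda>y. (\<Prod>v\<in>S. y v) * ?Q y)"
  proof
    fix y
    have "P y = (\<Sum>\<alpha>\<in>?A. c \<alpha> * mono_at f \<alpha> y)"
      unfolding p by (rule sum.mono_neutral_right) (use c0 finite_hexp[OF f] in auto)
    also have "\<dots> = (\<Prod>v\<in>S. y v) * ?Q y"
      unfolding sum_distrib_left by (intro sum.cong refl) (simp add: split)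
    finally show "P y = (\<Prod>v\<in>S. y v) * ?Q y" .
  qed
  ultimately show ?thesis by (intro bexI[of _ ?Q])
qed

section \<open>Barycentric coordinates\<close>

definition cell :: "(real^'n) set \<Rightarrow> bool" where
  "cell K \<longleftrightarrow> card K = CARD('n) + 1 \<and> \<not> affine_dependent K"

text \<open>The gradient of \<open>lam v K\<close>. For a vertex \<open>v\<close> it is the inward
  normal of the opposite facet, with length one over the height of \<open>v\<close>; it replaces the
  unit normal wherever only the direction matters.\<close>

definition glam :: "real^'n \<Rightarrow> (real^'n) set \<Rightarrow> real^'n" where
  "glam v K = (SOME g. \<forall>x. lam v K x = lam v K 0 + g \<bullet> x)"

lemma cell_finite: "cell K ==> finite K"
  unfolding cell_def by (metis card.infinite add_is_0 zero_neq_one)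

lemma cell_nonempty: "cell K ==> K \<noteq> {}"
  by (auto simp: cell_def)

lemma cell_affine_hull: "cell (K::(real^'n) set) ==> affine hull K = UNIV"
  using aff_dim_affine_independent[of K] by (simp add: cell_def flip: aff_dim_eq_full)

lemma cell_obtain:
  assumes "cell K"
  obtains y where "sum y K = 1" "(\<Sum>v\<in>K. y v *\<^sub>R v) = x"
proof -
  have "x \<in> affine hull K" using cell_affine_hull[OF assms] by simp
  then show ?thesis using that unfolding affine_hull_finite[OF cell_finite[OF assms]] by auto
qed

lemma affine_comb:
  fixes g :: "'a::real_inner"
  assumes "sum y f = 1"
  shows "a + g \<bullet> (\<Sum>v\<in>f. y v *\<^sub>R v) = (\<Sum>v\<in>f. y v * (a + g \<bullet> v))"
proof -
  have "(\<Sum>v\<in>f. y v * a) = a" using assms by (simp flip: sum_distrib_right)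
  then show ?thesis by (simp add: inner_sum_right distrib_left sum.distrib)
qed

lemma polys1_eqI:
  assumes "cell K" "p \<in> polys 1" "q \<in> polys 1" "\<And>w. w \<in> K ==> p w = q w"
  shows "p = q"
proof
  fix x
  obtain y where y: "sum y K = 1" "(\<Sum>v\<in>K. y v *\<^sub>R v) = x" using cell_obtain[OF assms(1)] .
  obtain a g b h where p: "p = (\<lambda>x. a + g \<bullet> x)" and q: "q = (\<lambda>x. b + h \<bullet> x)"
    using polys_affine assms(2,3) by meson
  have "p x = (\<Sum>v\<in>K. y v * p v)" "q x = (\<Sum>v\<in>K. y v * q v)"
    unfolding p q y(2)[symmetric] by (rule affine_comb[OF y(1)])+
  then show "p x = q x" using assms(4) by simp
qed

lemma lam_ex:
  assumes K: "cell (K::(real^'n) set)"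
  shows "\<exists>!p. p \<in> polys 1 \<and> (\<forall>w\<in>K. p w = (if w = v then 1 else 0))"
proof (rule ex_ex1I)
  show "\<exists>p. p \<in> polys 1 \<and> (\<forall>w\<in>K. p w = (if w = v then 1 else 0))"
  proof (cases "v \<in> K")
    case False
    then show ?thesis by (intro exI[of _ "\<lambda>x. 0"]) (auto simp: polys_zero)
  next
    case True
    have "card (K - {v}) = CARD('n)" using K True by (simp add: cell_def)
    then have "K - {v} \<noteq> {}" by (metis card.empty zero_less_card_finite less_irrefl)
    then obtain a where a: "a \<in> K" "a \<noteq> v" by blast
    \<comment> \<open>The edges from \<open>a\<close> are independent, so a linear functional may be
      prescribed on them: 1 on the edge to \<open>v\<close>, 0 on the others.\<close>
    have ind: "independent ((\<lambda>x. - a + x) ` (K - {a}))"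
      using K a(1) by (simp add: cell_def affine_dependent_iff_dependent2)
    obtain h :: "real^'n \<Rightarrow> real" where h: "linear h"
      "\<forall>x\<in>(\<lambda>x. - a + x) ` (K - {a}). h x = (if x = - a + v then 1 else 0)"
      using linear_independent_extend[OF ind, of "\<lambda>x. if x = - a + v then 1 else 0"] by auto
    \<comment> \<open>\<open>adjoint h 1\<close> is the vector that represents the functional
      \<open>h\<close>, hence the gradient of the coordinate.\<close>
    have hx: "h x = adjoint h 1 \<bullet> x" for x
      using adjoint_works[OF h(1), of x 1] by (simp add: inner_commute)
    let ?p = "\<lambda>x. - (adjoint h 1 \<bullet> a) + adjoint h 1 \<bullet> x"
    have p: "?p w = h (- a + w)" for w by (simp add: hx inner_add_right inner_diff_right)
    have "?p w = (if w = v then 1 else 0)" if "w \<in> K" for w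
      unfolding p using h(2) that a linear_0[OF h(1)] by (cases "w = a") auto
    moreover have "?p \<in> polys 1" by (rule polys_inner_add) simp
    ultimately show ?thesis by blast
  qed
next
  fix p q :: "real^'n \<Rightarrow> real"
  assume "p \<in> polys 1 \<and> (\<forall>w\<in>K. p w = (if w = v then 1 else 0))"
    "q \<in> polys 1 \<and> (\<forall>w\<in>K. q w = (if w = v then 1 else 0))"
  then show "p = q" by (intro polys1_eqI[OF K]) auto
qed

lemma lam_polys: "cell K ==> lam v K \<in> polys 1"
  and lam_vertex: "cell K ==> w \<in> K ==> lam v K w = (if w = v then 1 else 0)"
  using theI'[OF lam_ex, of K v] unfolding lam_def[symmetric] by auto

lemma lam_eqI:
  assumes "cell K" "p \<in> polys 1" "\<And>w. w \<in> K ==> p w = (if w = v then 1 else 0)"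
  shows "lam v K = p"
  by (rule polys1_eqI[OF assms(1) lam_polys[OF assms(1)] assms(2)]) (simp add: lam_vertex assms)

lemma lam_outside: "cell K ==> v \<notin> K ==> lam v K = (\<lambda>x. 0)"
  by (rule lam_eqI) (auto simp: polys_zero)

lemma lam_affine:
  assumes "cell K" shows "lam v K x = lam v K 0 + glam v K \<bullet> x"
proof -
  obtain a g where p: "lam v K = (\<lambda>x. a + g \<bullet> x)"
    using polys_affine[OF lam_polys[OF assms]] by blast
  have "\<forall>x. lam v K x = lam v K 0 + glam v K \<bullet> x" unfolding glam_def
    by (rule someI[of _ g]) (simp add: p)
  then show ?thesis by blast
qed

lemma lam_diff: "cell K ==> glam v K \<bullet> (y - x) = lam v K y - lam v K x"
  using lam_affine[of K v x] lam_affine[of K v y] by (simp add: inner_diff_right)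

lemma glam_eqI:
  assumes "cell K" "\<And>x. lam v K x = a + g \<bullet> x"
  shows "glam v K = g"
proof -
  have "glam v K \<bullet> x = g \<bullet> x" for x
    using lam_diff[OF assms(1), of v x 0] by (simp add: assms(2))
  then show ?thesis using vector_eq_rdot[of "glam v K" g] by (auto simp: inner_commute)
qed

lemma continuous_lam: "cell K ==> continuous_on S (lam v K)"
  by (rule continuous_polys[OF lam_polys])

lemma lam_comb:
  assumes "cell K" "sum y f = 1"
  shows "lam u K (\<Sum>v\<in>f. y v *\<^sub>R v) = (\<Sum>v\<in>f. y v * lam u K v)"
  using affine_comb[OF assms(2), of "lam u K 0" "glam u K"] by (simp flip: lam_affine[OF assms(1)])

lemma lam_comb':
  assumes K: "cell K" and "sum y f = 1" "f \<subseteq> K"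
  shows "lam u K (\<Sum>v\<in>f. y v *\<^sub>R v) = (if u \<in> f then y u else 0)"
proof -
  have "finite f" using assms cell_finite finite_subset by blast
  moreover have "(\<Sum>v\<in>f. y v * lam u K v) = (\<Sum>v\<in>f. if v = u then y v else 0)"
    by (intro sum.cong refl) (use assms lam_vertex[OF K] in auto)
  ultimately show ?thesis using lam_comb[OF assms(1,2)] by (simp add: sum.delta)
qed

lemma lam_sum: "cell K ==> (\<Sum>v\<in>K. lam v K x) = 1"
  and lam_sum_vertices: "cell K ==> (\<Sum>v\<in>K. lam v K x *\<^sub>R v) = x"
proof -
  assume K: "cell K"
  obtain y where y: "sum y K = 1" "(\<Sum>v\<in>K. y v *\<^sub>R v) = x" using cell_obtain[OF K] .
  then have "lam v K x = y v" if "v \<in> K" for v using lam_comb'[OF K y(1) order.refl, of v] that by simp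
  then show "(\<Sum>v\<in>K. lam v K x) = 1" "(\<Sum>v\<in>K. lam v K x *\<^sub>R v) = x" using y by auto
qed

lemma mem_affine_hull:
  assumes K: "cell K" "f \<subseteq> K"
  shows "x \<in> affine hull f \<longleftrightarrow> (\<forall>u\<in>K - f. lam u K x = 0)"
proof
  have fin: "finite f" using assms cell_finite finite_subset by blast
  { assume "x \<in> affine hull f"
    then obtain y where "sum y f = 1" "(\<Sum>v\<in>f. y v *\<^sub>R v) = x" unfolding affine_hull_finite[OF fin] by auto
    then show "\<forall>u\<in>K - f. lam u K x = 0" using lam_comb'[OF K(1) _ K(2), of y] by auto }
  assume *: "\<forall>u\<in>K - f. lam u K x = 0"
  have "(\<Sum>v\<in>f. lam v K x) = (\<Sum>v\<in>K. lam v K x)"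
    "(\<Sum>v\<in>f. lam v K x *\<^sub>R v) = (\<Sum>v\<in>K. lam v K x *\<^sub>R v)"
    using * K(2) cell_finite[OF K(1)] by (auto intro!: sum.mono_neutral_left)
  then show "x \<in> affine hull f"
    unfolding affine_hull_finite[OF fin] using lam_sum[OF K(1), of x] lam_sum_vertices[OF K(1), of x]
    by (intro CollectI exI[of _ "\<lambda>v. lam v K x"]) auto
qed

lemma mem_convex_hull:
  assumes K: "cell K" "f \<subseteq> K"
  shows "x \<in> convex hull f \<longleftrightarrow> (\<forall>u\<in>K - f. lam u K x = 0) \<and> (\<forall>u\<in>K. lam u K x \<ge> 0)"
proof
  have fin: "finite f" using assms cell_finite finite_subset by blast
  { assume "x \<in> convex hull f"
    then obtain y where "\<forall>v\<in>f. y v \<ge> 0" "sum y f = 1" "(\<Sum>v\<in>f. y v *\<^sub>R v) = x"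
      unfolding convex_hull_finite[OF fin] by auto
    then show "(\<forall>u\<in>K - f. lam u K x = 0) \<and> (\<forall>u\<in>K. lam u K x \<ge> 0)"
      using lam_comb'[OF K(1) _ K(2), of y] by auto }
  assume *: "(\<forall>u\<in>K - f. lam u K x = 0) \<and> (\<forall>u\<in>K. lam u K x \<ge> 0)"
  have "(\<Sum>v\<in>f. lam v K x) = (\<Sum>v\<in>K. lam v K x)"
    "(\<Sum>v\<in>f. lam v K x *\<^sub>R v) = (\<Sum>v\<in>K. lam v K x *\<^sub>R v)"
    using * K(2) cell_finite[OF K(1)] by (auto intro!: sum.mono_neutral_left)
  then show "x \<in> convex hull f"
    unfolding convex_hull_finite[OF fin] using lam_sum[OF K(1), of x] lam_sum_vertices[OF K(1), of x] * K(2)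
    by (intro CollectI exI[of _ "\<lambda>v. lam v K x"]) auto
qed

lemma mem_cell_hull: "cell K ==> x \<in> convex hull K \<longleftrightarrow> (\<forall>u\<in>K. lam u K x \<ge> 0)"
  using mem_convex_hull[of K K x] by simp

lemma lam_hull_sum:
  assumes "cell K" "f \<subseteq> K" "x \<in> affine hull f"
  shows "(\<Sum>v\<in>f. lam v K x) = 1" "(\<Sum>v\<in>f. lam v K x *\<^sub>R v) = x"
proof -
  have "(\<Sum>v\<in>f. lam v K x) = (\<Sum>v\<in>K. lam v K x)"
    "(\<Sum>v\<in>f. lam v K x *\<^sub>R v) = (\<Sum>v\<in>K. lam v K x *\<^sub>R v)"
    using assms mem_affine_hull[OF assms(1,2), of x] cell_finite[OF assms(1)] by (auto intro!: sum.mono_neutral_left)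
  then show "(\<Sum>v\<in>f. lam v K x) = 1" "(\<Sum>v\<in>f. lam v K x *\<^sub>R v) = x"
    using lam_sum[OF assms(1), of x] lam_sum_vertices[OF assms(1), of x] by auto
qed

text \<open>On a common face the coordinates in both cells are the coefficients of the same affine
  combination of the common vertices. This makes bubbles single-valued.\<close>

lemma lam_indep_cell:
  assumes "cell K" "cell K'" "x \<in> affine hull (K \<inter> K')"
  shows "lam v K x = lam v K' x"
proof -
  have "finite (K \<inter> K')" using assms cell_finite by blast
  then obtain y where y: "sum y (K \<inter> K') = 1" "(\<Sum>v\<in>K \<inter> K'. y v *\<^sub>R v) = x"
    using assms(3) by (auto simp: affine_hull_finite)
  show ?thesis
    unfolding y(2)[symmetric] by (simp add: lam_comb'[OF assms(1) y(1)] lam_comb'[OF assms(2) y(1)])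
qed

text \<open>Where a coordinate is zero, a small step away from its vertex makes it negative and
  leaves the simplex.\<close>

lemma interior_cell:
  assumes K: "cell (K::(real^'n) set)"
  shows "interior (convex hull K) = {x. \<forall>u\<in>K. lam u K x > 0}"
proof
  have "{x. \<forall>u\<in>K. lam u K x > 0} = (\<Inter>u\<in>K. {x. 0 < lam u K x})" by auto
  then have "open {x. \<forall>u\<in>K. lam u K x > 0}"
    using cell_finite[OF K] by (auto intro!: open_INT open_Collect_less continuous_lam[OF K] continuous_intros)
  then show "{x. \<forall>u\<in>K. lam u K x > 0} \<subseteq> interior (convex hull K)"
    by (intro interior_maximal) (auto simp: mem_cell_hull[OF K] less_imp_le)
  show "interior (convex hull K) \<subseteq> {x. \<forall>u\<in>K. lam u K x > 0}"
  proof
    fix x assume x: "x \<in> interior (convex hull K)"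
    have "lam u K x > 0" if u: "u \<in> K" for u
    proof (rule ccontr)
      assume "\<not> lam u K x > 0"
      have hull: "x \<in> convex hull K" using x interior_subset by blast
      then have 0: "lam u K x = 0" using \<open>\<not> lam u K x > 0\<close> u mem_cell_hull[OF K, of x] by force
      obtain e where e: "e > 0" "ball x e \<subseteq> convex hull K" using x by (auto simp: mem_interior)
      \<comment> \<open>This length keeps the displaced point within distance \<open>e / 2\<close>
        of \<open>x\<close>; the added 1 avoids a division by zero.\<close>
      define d where "d = e / (2 * (norm (x - u) + 1))"
      have pos: "norm (x - u) + 1 > 0" by (smt (verit) norm_ge_zero)
      have d: "d > 0" using e(1) pos unfolding d_def by simp
      have "norm (d *\<^sub>R (x - u)) \<le> d * (norm (x - u) + 1)" using d by simp
      also have "\<dots> = e / 2" using pos unfolding d_def by (simp add: field_simps)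
      finally have "x + d *\<^sub>R (x - u) \<in> ball x e" using e(1) by (simp add: dist_norm)
      then have "lam u K (x + d *\<^sub>R (x - u)) \<ge> 0" using e(2) mem_cell_hull[OF K] u by blast
      moreover have "lam u K (x + d *\<^sub>R (x - u)) = lam u K x + d * (lam u K x - lam u K u)"
        using lam_diff[OF K, of u "x + d *\<^sub>R (x - u)" x] lam_diff[OF K, of u x u] by (simp)
      ultimately show False using 0 d lam_vertex[OF K u] by simp
    qed
    then show "x \<in> {x. \<forall>u\<in>K. lam u K x > 0}" by blast
  qed
qed

section \<open>Gradients of the barycentric coordinates, tangent and normal spaces\<close>

lemma glam_sum: "cell K ==> (\<Sum>v\<in>K. glam v K) = 0"
proof -
  assume K: "cell K"
  have "(\<Sum>v\<in>K. glam v K) \<bullet> x = 0" for x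
    using lam_diff[OF K, of _ x 0] lam_sum[OF K] by (simp add: inner_sum_left sum_subtractf)
  then show ?thesis by (metis inner_eq_zero_iff)
qed

text \<open>The difference of the barycentric expansions of \<open>z\<close> and of the origin.
  Since the gradients sum to zero, each vertex may be replaced by its difference to a fixed
  point.\<close>

lemma glam_expand: "cell K ==> (\<Sum>v\<in>K. (glam v K \<bullet> z) *\<^sub>R v) = z"
  using lam_diff[of K _ z 0] lam_sum_vertices[of K z] lam_sum_vertices[of K 0]
  by (simp add: scaleR_diff_left sum_subtractf)

lemma glam_vertex: "cell K ==> u \<in> K ==> w \<in> K ==>
    glam v K \<bullet> (u - w) = (if u = v then 1 else 0) - (if w = v then 1 else 0)"
  by (simp add: lam_diff lam_vertex)

lemma tan_space_glam:
  assumes "cell K" "f \<subseteq> K" "u \<in> K - f" "t \<in> tan_space f"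
  shows "glam u K \<bullet> t = 0"
  using assms(4) unfolding tan_space_def
proof (induction rule: span_induct)
  case base show ?case by (simp add: subspace_hyperplane)
next
  case (step x)
  then obtain y z where "x = z - y" "y \<in> f" "z \<in> f" by blast
  moreover from this have "z \<in> K" "y \<in> K" "z \<noteq> u" "y \<noteq> u" using assms(2,3) by auto
  ultimately show ?case using glam_vertex[OF assms(1), of z y u] by simp
qed

lemma tan_space_diff: "x \<in> f ==> y \<in> f ==> y - x \<in> tan_space f"
  unfolding tan_space_def by (rule span_base) auto

lemma subspace_tan_space: "subspace (tan_space f)"
  by (simp add: tan_space_def)

lemma subspace_nor_space: "subspace (nor_space f)"
  by (simp add: nor_space_def subspace_orthogonal_comp)

lemma nor_space_iff: "n \<in> nor_space f \<longleftrightarrow> (\<forall>x\<in>f. \<forall>y\<in>f. n \<bullet> (y - x) = 0)"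
proof
  assume "n \<in> nor_space f"
  then show "\<forall>x\<in>f. \<forall>y\<in>f. n \<bullet> (y - x) = 0"
    using tan_space_diff[of _ f] unfolding nor_space_def
    by (simp add: orthogonal_comp_def orthogonal_def inner_commute[of n])
next
  assume *: "\<forall>x\<in>f. \<forall>y\<in>f. n \<bullet> (y - x) = 0"
  have "n \<bullet> t = 0" if "t \<in> tan_space f" for t
    using that unfolding tan_space_def
    by (induction rule: span_induct) (use * in \<open>auto simp: subspace_hyperplane\<close>)
  then show "n \<in> nor_space f"
    unfolding nor_space_def by (auto simp: orthogonal_comp_def orthogonal_def inner_commute)
qed

lemma nor_tan_orth: "n \<in> nor_space f ==> t \<in> tan_space f ==> n \<bullet> t = 0"
  unfolding nor_space_def by (auto simp: orthogonal_comp_def orthogonal_def inner_commute)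

lemma nor_space_mono: "f \<subseteq> f' ==> nor_space f' \<subseteq> nor_space f"
  unfolding nor_space_iff subset_iff by blast

lemma glam_nor_space: "cell K ==> f \<subseteq> K ==> u \<in> K - f ==> glam u K \<in> nor_space f"
  by (auto simp: nor_space_iff glam_vertex subset_iff)

text \<open>The edges from \<open>a\<close> to the vertices outside \<open>f\<close> are dual to the
  gradients of these vertices, and the edges inside \<open>f\<close> are annihilated by a
  normal.\<close>

lemma nor_space_expand:
  assumes K: "cell K" "f \<subseteq> K" and a: "a \<in> f" and n: "n \<in> nor_space f"
  shows "n = (\<Sum>v\<in>K - f. (n \<bullet> (v - a)) *\<^sub>R glam v K)"
proof -
  have "n \<bullet> z = (\<Sum>v\<in>K - f. (n \<bullet> (v - a)) *\<^sub>R glam v K) \<bullet> z" for z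
  proof -
    have "(\<Sum>v\<in>K. (glam v K \<bullet> z)) = 0"
      using glam_sum[OF K(1)] by (simp flip: inner_sum_left)
    then have "(\<Sum>v\<in>K. (glam v K \<bullet> z) *\<^sub>R (v - a)) = z"
      using glam_expand[OF K(1), of z]
      by (simp add: scaleR_diff_right sum_subtractf flip: scaleR_sum_left)
    then have "n \<bullet> z = (\<Sum>v\<in>K. (glam v K \<bullet> z) * (n \<bullet> (v - a)))"
      by (metis (no_types, lifting) inner_scaleR_right inner_sum_right sum.cong)
    also have "\<dots> = (\<Sum>v\<in>K - f. (glam v K \<bullet> z) * (n \<bullet> (v - a)))"
      using cell_finite[OF K(1)] n a by (intro sum.mono_neutral_right) (auto simp: nor_space_iff)
    finally show ?thesis by (simp add: inner_sum_left mult.commute)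
  qed
  then have "\<forall>z. n \<bullet> z = (\<Sum>v\<in>K - f. (n \<bullet> (v - a)) *\<^sub>R glam v K) \<bullet> z" by blast
  then show ?thesis unfolding vector_eq_rdot .
qed

lemma nor_space_span:
  assumes "cell K" "f \<subseteq> K" "f \<noteq> {}"
  shows "nor_space f = span ((\<lambda>v. glam v K) ` (K - f))"
proof
  obtain a where a: "a \<in> f" using assms by blast
  show "nor_space f \<subseteq> span ((\<lambda>v. glam v K) ` (K - f))"
  proof
    fix n assume n: "n \<in> nor_space f"
    have "(\<Sum>v\<in>K - f. (n \<bullet> (v - a)) *\<^sub>R glam v K) \<in> span ((\<lambda>v. glam v K) ` (K - f))"
      by (intro span_sum span_scale span_base imageI)
    then show "n \<in> span ((\<lambda>v. glam v K) ` (K - f))"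
      using nor_space_expand[OF assms(1,2) a n] by simp
  qed
  show "span ((\<lambda>v. glam v K) ` (K - f)) \<subseteq> nor_space f"
    by (rule span_minimal) (use assms glam_nor_space subspace_nor_space in blast)+
qed

text \<open>The normal space of a facet is spanned by a single gradient, so the unit normals in the
  degrees of freedom may be traded for gradients at the price of a nonzero factor.\<close>

lemma unit_normal_glam:
  assumes K: "cell (K::(real^'n) set)" and v: "v \<in> K" and n: "unit_normal (K - {v}) n"
  obtains s where "s \<noteq> 0" "n = s *\<^sub>R glam v K"
proof -
  have "card (K - {v}) = CARD('n)" using K v by (simp add: cell_def)
  then have "K - {v} \<noteq> {}" by (metis card.empty zero_less_card_finite less_irrefl)
  then obtain a where a: "a \<in> K - {v}" by blast
  have "K - (K - {v}) = {v}" using v by blast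
  then have "n = (n \<bullet> (v - a)) *\<^sub>R glam v K"
    using nor_space_expand[OF K _ a, of n] n by (auto simp: unit_normal_def)
  moreover from this have "n \<bullet> (v - a) \<noteq> 0" using n by (force simp: unit_normal_def)
  ultimately show ?thesis using that by blast
qed

section \<open>Polynomials on a face as homogeneous polynomials in barycentric coordinates\<close>

lemma hom_lam_polys:
  assumes "cell K" "P \<in> hom f r"
  shows "(\<lambda>x. P (\<lambda>v. lam v K x)) \<in> polys r"
  using assms(2)
proof (induction rule: hom_induct)
  case (monom \<alpha>)
  have "(\<lambda>x. \<Prod>v\<in>f. lam v K x ^ \<alpha> v) \<in> polys (int (sum \<alpha> f))"
    by (intro polys_prod polys_power lam_polys assms)
  then show ?case using monom by (simp add: mono_at_def hexp_def)
qed (auto intro: polys_add polys_scale polys_zero)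

lemma polys_hom:
  assumes K: "cell (K::(real^'n) set)" and f: "f \<subseteq> K" and p: "p \<in> polys r"
  shows "\<exists>P\<in>hom f r. \<forall>x\<in>affine hull f. p x = P (\<lambda>v. lam v K x)"
  using p
proof (induction rule: polys_induct)
  case (monom \<alpha>)
  have fin: "finite f" using K f cell_finite finite_subset by blast
  \<comment> \<open>The degree missing from the monomial is supplied by powers of the sum of the
    coordinates, which is 1 on the affine hull of \<open>f\<close>; each Cartesian coordinate is
    linear in the barycentric ones.\<close>
  define m where "m = nat (r - int (sum \<alpha> UNIV))"
  let ?P = "\<lambda>y. (\<Sum>v\<in>f. y v) ^ m * (\<Prod>i\<in>UNIV. (\<Sum>v\<in>f. v $ i * y v) ^ \<alpha> i)"
  have "?P \<in> hom f (int m + int (sum \<alpha> UNIV))"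
    by (intro hom_mult hom_prod hom_power hom_sum hom_scale hom_var fin)
  moreover have "int m + int (sum \<alpha> UNIV) = r" using monom by (simp add: m_def)
  moreover have "(\<Prod>i\<in>UNIV. (x $ i) ^ \<alpha> i) = ?P (\<lambda>v. lam v K x)" if x: "x \<in> affine hull f" for x
  proof -
    have "x $ i = (\<Sum>v\<in>f. v $ i * lam v K x)" for i
      by (subst lam_hull_sum(2)[OF K f x, symmetric]) (simp add: mult.commute)
    then show ?thesis using lam_hull_sum(1)[OF K f x] by simp
  qed
  ultimately show ?case by (intro bexI[of _ ?P]) auto
next
  case (add p q)
  then obtain P Q where "P \<in> hom f r" "\<forall>x\<in>affine hull f. p x = P (\<lambda>v. lam v K x)"
    "Q \<in> hom f r" "\<forall>x\<in>affine hull f. q x = Q (\<lambda>v. lam v K x)" by blast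
  then show ?case by (intro bexI[of _ "\<lambda>y. P y + Q y"]) (auto intro: hom_add)
next
  case (scale a p)
  then obtain P where "P \<in> hom f r" "\<forall>x\<in>affine hull f. p x = P (\<lambda>v. lam v K x)" by blast
  then show ?case by (intro bexI[of _ "\<lambda>y. a * P y"]) (auto intro: hom_scale)
qed (auto intro: bexI[OF _ hom_zero])

lemma hom_lam_coeff_zero:
  assumes K: "cell K" and f: "f \<subseteq> K" "f \<noteq> {}"
    and *: "\<And>x. (\<And>v. v \<in> f ==> lam v K x > 0) ==> (\<And>v. v \<in> K - f ==> lam v K x = 0) ==>
      (\<Sum>\<alpha>\<in>hexp f r. c \<alpha> * mono_at f \<alpha> (\<lambda>v. lam v K x)) = 0"
    and "\<alpha> \<in> hexp f r"
  shows "c \<alpha> = 0"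
proof (rule hom_coeff_zero[OF _ f(2) _ assms(5)])
  fix y :: "_ \<Rightarrow> real" assume y: "\<And>v. v \<in> f ==> y v > 0" "sum y f = 1"
  let ?x = "\<Sum>v\<in>f. y v *\<^sub>R v"
  have "(\<Sum>\<alpha>\<in>hexp f r. c \<alpha> * mono_at f \<alpha> (\<lambda>v. lam v K ?x)) = 0"
    by (rule *) (auto simp: lam_comb'[OF K y(2) f(1)] y(1))
  moreover have "mono_at f \<alpha> (\<lambda>v. lam v K ?x) = mono_at f \<alpha> y" for \<alpha>
    unfolding mono_at_def by (rule prod.cong) (auto simp: lam_comb'[OF K y(2) f(1)])
  ultimately show "(\<Sum>\<alpha>\<in>hexp f r. c \<alpha> * mono_at f \<alpha> y) = 0" by simp
qed (use K f cell_finite finite_subset in blast)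

text \<open>The interior is the set where all barycentric coordinates are positive, so all
  coefficients of the homogeneous form vanish.\<close>

lemma polys_zero_on_cell:
  assumes K: "cell (K::(real^'n) set)" and p: "p \<in> polys r"
    and 0: "\<And>x. x \<in> interior (convex hull K) ==> p x = 0"
  shows "p x = 0"
proof -
  obtain P where P: "P \<in> hom K r" "\<And>x. p x = P (\<lambda>v. lam v K x)"
    using polys_hom[OF K order.refl p] cell_affine_hull[OF K] by auto
  obtain c where c: "P = (\<lambda>y. \<Sum>\<alpha>\<in>hexp K r. c \<alpha> * mono_at K \<alpha> y)" using P(1) by (auto simp: hom_def)
  have c0: "c \<alpha> = 0" if "\<alpha> \<in> hexp K r" for \<alpha>
  proof (rule hom_lam_coeff_zero[OF K order.refl cell_nonempty[OF K] _ that])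
    fix x assume "\<And>v. v \<in> K ==> lam v K x > 0"
    then have "p x = 0" by (intro 0) (simp add: interior_cell[OF K])
    then show "(\<Sum>\<alpha>\<in>hexp K r. c \<alpha> * mono_at K \<alpha> (\<lambda>v. lam v K x)) = 0"
      using P(2)[of x] fun_cong[OF c] by simp
  qed
  have "P y = 0" for y
    unfolding c by (rule sum.neutral) (use c0 in \<open>simp del: of_nat_sum\<close>)
  then show ?thesis using P(2)[of x] by simp
qed

lemma hom_polys_eq: "hom_polys f r = {\<lambda>K x. P (\<lambda>v. lam v K x) | P. P \<in> hom f r}"
proof -
  let ?P = "\<lambda>c y. \<Sum>\<alpha>\<in>hexp f r. c \<alpha> * mono_at f \<alpha> y"
  have "hom_polys f r = range (\<lambda>c K x. ?P c (\<lambda>v. lam v K x))"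
    unfolding hom_polys_def hexp_def mono_at_def full_SetCompr_eq ..
  moreover have "hom f r = range ?P" unfolding hom_def full_SetCompr_eq ..
  ultimately show ?thesis by (simp add: Setcompr_eq_image image_image)
qed

lemma bub_polys: "cell K ==> bub f K \<in> polys (int (card f))"
  unfolding bub_def[abs_def] using polys_prod[of f "\<lambda>v x. lam v K x" "\<lambda>_. 1"] by (simp add: lam_polys)

section \<open>Smooth functions\<close>

lemma cont_diff_SucD: "cont_diff (Suc m) u ==> cont_diff m u"
proof (induction m arbitrary: u)
  case 0
  then have "continuous (at x) u" for x by (intro differentiable_imp_continuous_within) auto
  then show ?case by (simp add: continuous_on_eq_continuous_within)
next
  case (Suc m)
  then show ?case by (metis cont_diff.simps(2))
qed

lemma cont_diff_0D: "cont_diff m u ==> cont_diff 0 u"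
  by (induction m) (blast dest: cont_diff_SucD)+

lemma cont_diff_continuous: "cont_diff m u ==> continuous_on S u"
  using cont_diff_0D[of m u] continuous_on_subset by auto

lemma cont_diff_SucI:
  assumes "\<And>x. (u has_derivative u' x) (at x)" "\<And>v. cont_diff m (\<lambda>x. u' x v)"
  shows "cont_diff (Suc m) u"
proof -
  have "frechet_derivative u (at x) = u' x" for x
    using frechet_derivative_at[OF assms(1)[of x]] by simp
  then show ?thesis using assms by (auto simp: differentiable_def)
qed

lemma cont_diff_Suc_deriv:
  assumes "cont_diff (Suc m) u"
  shows "(u has_derivative frechet_derivative u (at x)) (at x)"
    and "cont_diff m (\<lambda>x. frechet_derivative u (at x) v)"
  using assms by (auto simp: frechet_derivative_works)

lemma cont_diff_const: "cont_diff m (\<lambda>x. a)"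
proof (induction m arbitrary: a)
  case (Suc m)
  then show ?case by (intro cont_diff_SucI[where u' = "\<lambda>x v. 0"]) auto
qed simp

lemma cont_diff_add: "cont_diff m u ==> cont_diff m v ==> cont_diff m (\<lambda>x. u x + v x)"
proof (induction m arbitrary: u v)
  case 0
  then show ?case by (auto intro: continuous_on_add)
next
  case (Suc m)
  show ?case
    by (rule cont_diff_SucI[OF has_derivative_add[OF cont_diff_Suc_deriv(1)[OF Suc.prems(1)] cont_diff_Suc_deriv(1)[OF Suc.prems(2)]]])
      (intro Suc.IH cont_diff_Suc_deriv(2) Suc.prems)
qed

lemma cont_diff_mult: "cont_diff m u ==> cont_diff m v ==> cont_diff m (\<lambda>x. u x * v x)"
proof (induction m arbitrary: u v)
  case 0
  then show ?case by (auto intro: continuous_on_mult)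
next
  case (Suc m)
  show ?case
    by (rule cont_diff_SucI[OF has_derivative_mult[OF cont_diff_Suc_deriv(1)[OF Suc.prems(1)] cont_diff_Suc_deriv(1)[OF Suc.prems(2)]]])
      (intro cont_diff_add Suc.IH cont_diff_SucD[OF Suc.prems(1)] cont_diff_SucD[OF Suc.prems(2)]
        cont_diff_Suc_deriv(2) Suc.prems)
qed

lemma cont_diff_prod: "(\<And>i. i \<in> I ==> cont_diff m (u i)) ==> cont_diff m (\<lambda>x. \<Prod>i\<in>I. u i x)"
  by (induction I rule: infinite_finite_induct) (auto intro: cont_diff_const cont_diff_mult)

lemma cont_diff_affine: "cont_diff m (\<lambda>x. a + g \<bullet> x)"
proof (cases m)
  case 0 show ?thesis unfolding 0 by (auto intro!: continuous_intros)
next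
  case (Suc k)
  show ?thesis unfolding Suc
    by (rule cont_diff_SucI[where u' = "\<lambda>x v. g \<bullet> v"]) (auto intro!: derivative_eq_intros cont_diff_const)
qed

lemma cont_diff_power: "cont_diff m u ==> cont_diff m (\<lambda>x. u x ^ j)"
  by (induction j) (auto intro: cont_diff_const cont_diff_mult)

lemma polys_cont_diff:
  assumes "p \<in> polys r" shows "cont_diff m p"
  using assms
proof (induction rule: polys_induct)
  case (monom \<alpha>)
  have "cont_diff m (\<lambda>x::real^'a. x $ i)" for i
    using cont_diff_affine[of m 0 "axis i 1"] by (simp add: inner_axis')
  then show ?case by (intro cont_diff_prod cont_diff_power)
qed (auto intro: cont_diff_add cont_diff_mult cont_diff_const)

lemma polys_smooth: "p \<in> polys r ==> smooth p"
  by (simp add: smooth_def polys_cont_diff)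

declare cont_diff.simps [simp del]

lemma smooth_mult: "smooth u ==> smooth v ==> smooth (\<lambda>x. u x * v x)"
  by (simp add: smooth_def cont_diff_mult)

lemma frechet_grad: "cont_diff 1 u ==> frechet_derivative u (at x) h = grad u x \<bullet> h"
proof -
  assume "cont_diff 1 u"
  then have "linear (frechet_derivative u (at x))"
    using cont_diff_Suc_deriv(1)[of 0 u x] has_derivative_linear by auto
  then have "frechet_derivative u (at x) (\<Sum>i\<in>UNIV. h $ i *\<^sub>R axis i 1)
      = (\<Sum>i\<in>UNIV. h $ i * frechet_derivative u (at x) (axis i 1))"
    by (simp add: linear_sum linear_scale)
  moreover have "(\<Sum>i\<in>UNIV. h $ i *\<^sub>R axis i 1) = h"
    using basis_expansion[of h] by (simp add: scalar_mult_eq_scaleR)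
  ultimately show ?thesis by (simp add: grad_def inner_vec_def mult.commute)
qed

lemma has_derivative_grad: "cont_diff 1 u ==> (u has_derivative (\<lambda>h. grad u x \<bullet> h)) (at x)"
proof -
  assume u: "cont_diff 1 u"
  then have "frechet_derivative u (at x) = (\<lambda>h. grad u x \<bullet> h)" by (intro ext frechet_grad)
  then show ?thesis using cont_diff_Suc_deriv(1)[of 0 u x] u by simp
qed

lemma continuous_grad:
  assumes u: "cont_diff 1 u" shows "continuous_on S (grad u)"
proof -
  have "continuous_on S (\<lambda>x. frechet_derivative u (at x) (axis i 1))" for i
    using cont_diff_Suc_deriv(2)[of 0 u "axis i 1"] u by (auto intro: cont_diff_continuous)
  then show ?thesis unfolding grad_def[abs_def] by (rule continuous_on_vec_lambda)
qed

lemma grad_eqI: "(u has_derivative (\<lambda>h. g \<bullet> h)) (at x) ==> grad u x = g"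
  by (simp add: grad_def inner_axis vec_eq_iff flip: frechet_derivative_at)

lemma grad_mult:
  "cont_diff 1 u ==> cont_diff 1 v ==> grad (\<lambda>x. u x * v x) x = u x *\<^sub>R grad v x + v x *\<^sub>R grad u x"
  by (rule grad_eqI) (use has_derivative_mult[OF has_derivative_grad has_derivative_grad, of u v x] in
      \<open>simp add: inner_add_left algebra_simps\<close>)

subsection \<open>Cutoffs\<close>

text \<open>For \<open>j = 0\<close> this is the standard smooth function that is flat at 0. The
  powers in the denominator make the family closed under differentiation.\<close>

definition pw :: "nat \<Rightarrow> real \<Rightarrow> real" where
  "pw j t = (if t > 0 then exp (- 1 / t) / t ^ j else 0)"

lemma exp_ge_power:
  assumes "(x::real) \<ge> 0" shows "x ^ j / fact j \<le> exp x"
proof -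
  have "(\<Sum>n\<in>{j}. inverse (fact n) * x ^ n) \<le> (\<Sum>n. inverse (fact n) * x ^ n)"
    using summable_exp[of x] assms by (intro sum_le_suminf) auto
  then show ?thesis by (simp add: exp_def field_simps)
qed

lemma pw_nonneg: "pw j t \<ge> 0"
  by (simp add: pw_def)

text \<open>A single term of the exponential series bounds exp (1 / t) from below.\<close>

lemma pw_le_fact: "pw j t \<le> fact j"
proof (cases "t > 0")
  case True
  have "(1 / t) ^ j / fact j \<le> exp (1 / t)" using True by (intro exp_ge_power) simp
  then show ?thesis using True by (simp add: pw_def exp_minus field_simps)
qed (simp add: pw_def)

lemma pw_Suc: "pw j t = t * pw (Suc j) t"
  by (simp add: pw_def)

lemma pw_bound: "\<bar>pw j t\<bar> \<le> fact (Suc j) * \<bar>t\<bar>"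
  unfolding pw_Suc[of j t] abs_mult
  using mult_right_mono[OF pw_le_fact[of "Suc j" t], of "\<bar>t\<bar>"] pw_nonneg[of "Suc j" t] by (simp add: mult.commute)

lemma pw_deriv: "(pw j has_real_derivative pw (j + 2) t - j * pw (j + 1) t) (at t)"
proof -
  consider "t > 0" | "t < 0" | "t = 0" by linarith
  then show ?thesis
  proof cases
    case 1
    have "((\<lambda>t. exp (- 1 / t) / t ^ j) has_real_derivative pw (j + 2) t - j * pw (j + 1) t) (at t)"
      using 1 by (cases j) (auto intro!: derivative_eq_intros simp: pw_def divide_simps power2_eq_square, simp_all add: algebra_simps, case_tac nat, simp_all)
    then show ?thesis
      by (rule has_field_derivative_transform_within_open[of _ _ _ "{0<..}"]) (use 1 in \<open>auto simp: pw_def\<close>)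
  next
    case 2
    have "((\<lambda>t. 0) has_real_derivative pw (j + 2) t - j * pw (j + 1) t) (at t)" using 2 by (simp add: pw_def)
    then show ?thesis
      by (rule has_field_derivative_transform_within_open[of _ _ _ "{..<0}"]) (use 2 in \<open>auto simp: pw_def\<close>)
  next
    \<comment> \<open>At the origin the difference quotient of \<open>pw j\<close> is
      \<open>pw (Suc j)\<close>, which is bounded by a multiple of |h| and so tends to 0.\<close>
    case 3
    have "((\<lambda>h. pw (Suc j) h) \<longlongrightarrow> 0) (at 0)"
    proof (rule tendsto_rabs_zero_cancel, rule tendsto_sandwich[of "\<lambda>_. 0" _ _ "\<lambda>h. fact (Suc (Suc j)) * \<bar>h\<bar>"])
      show "((\<lambda>h::real. fact (Suc (Suc j)) * \<bar>h\<bar>) \<longlongrightarrow> 0) (at 0)"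
        by (rule tendsto_eq_intros refl | simp)+
    qed (use pw_bound[of "Suc j"] in auto)
    moreover have "(pw j (0 + h) - pw j 0) / h = pw (Suc j) h" if "h \<noteq> 0" for h
      using that pw_Suc[of j h] by (simp add: pw_def[of j 0])
    ultimately have "((\<lambda>h. (pw j (0 + h) - pw j 0) / h) \<longlongrightarrow> 0) (at 0)"
      by (subst tendsto_cong[where g = "pw (Suc j)"]) (auto simp: eventually_at_filter)
    then show ?thesis unfolding 3 by (simp add: DERIV_def pw_def)
  qed
qed

lemma continuous_pw: "continuous_on S (pw j)"
  using pw_deriv DERIV_isCont by (meson continuous_at_imp_continuous_on)

lemma cont_diff_pw: "cont_diff m (\<lambda>x. pw j (a + g \<bullet> x))"
proof (induction m arbitrary: j)
  case 0
  show ?case unfolding cont_diff.simps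
    by (auto intro!: continuous_on_compose2[OF continuous_pw[of UNIV]] continuous_intros)
next
  case (Suc m)
  show ?case
  proof (rule cont_diff_SucI)
    fix x
    show "((\<lambda>x. pw j (a + g \<bullet> x)) has_derivative
        (\<lambda>v. (g \<bullet> v) * (pw (j + 2) (a + g \<bullet> x) - j * pw (j + 1) (a + g \<bullet> x)))) (at x)"
      by (rule has_derivative_compose[OF _ pw_deriv[unfolded has_field_derivative_def], THEN has_derivative_eq_rhs])
        (auto intro!: derivative_eq_intros simp: mult.commute)
  next
    fix v
    have "cont_diff m (\<lambda>x. (g \<bullet> v) * (pw (j + 2) (a + g \<bullet> x) + (- real j) * pw (j + 1) (a + g \<bullet> x)))"
      by (intro cont_diff_mult cont_diff_add cont_diff_const Suc.IH)
    then show "cont_diff m (\<lambda>x. (g \<bullet> v) * (pw (j + 2) (a + g \<bullet> x) - j * pw (j + 1) (a + g \<bullet> x)))" by simp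
  qed
qed

text \<open>For \<open>m\<close> at least 1 it vanishes where the coordinate is at most 1 / m, and
  it tends to 1 where the coordinate is positive. Being built on \<open>pw\<close>, it has the
  explicit derivative \<open>dcutoff\<close> along the gradient of the coordinate.\<close>

definition cutoff :: "nat \<Rightarrow> real^'n \<Rightarrow> (real^'n) set \<Rightarrow> real^'n \<Rightarrow> real" where
  "cutoff m v K x = pw 0 (real m * lam v K x - 1)"

definition dcutoff :: "nat \<Rightarrow> real^'n \<Rightarrow> (real^'n) set \<Rightarrow> real^'n \<Rightarrow> real" where
  "dcutoff m v K x = real m * pw 2 (real m * lam v K x - 1)"

definition bump :: "nat \<Rightarrow> (real^'n) set \<Rightarrow> real^'n \<Rightarrow> real" where
  "bump m K x = (\<Prod>v\<in>K. cutoff m v K x)"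

lemma cut_eq:
  assumes "cell K"
  shows "cutoff m v K = (\<lambda>x. pw 0 ((real m * lam v K 0 - 1) + (real m *\<^sub>R glam v K) \<bullet> x))"
    and "dcutoff m v K = (\<lambda>x. real m * pw 2 ((real m * lam v K 0 - 1) + (real m *\<^sub>R glam v K) \<bullet> x))"
proof -
  have *: "real m * lam v K x - 1 = (real m * lam v K 0 - 1) + (real m *\<^sub>R glam v K) \<bullet> x" for x
    using lam_affine[OF assms, of v x] by (simp add: algebra_simps)
  show "cutoff m v K = (\<lambda>x. pw 0 ((real m * lam v K 0 - 1) + (real m *\<^sub>R glam v K) \<bullet> x))"
    unfolding cutoff_def[abs_def] by (rule ext, rule arg_cong[OF *])
  show "dcutoff m v K = (\<lambda>x. real m * pw 2 ((real m * lam v K 0 - 1) + (real m *\<^sub>R glam v K) \<bullet> x))"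
    unfolding dcutoff_def[abs_def] by (rule ext, rule arg_cong[OF *])
qed

lemma cut_cont_diff:
  assumes "cell K" shows "cont_diff j (cutoff m v K)"
  unfolding cut_eq[OF assms] by (rule cont_diff_pw)

lemma dcut_cont_diff:
  assumes "cell K" shows "cont_diff j (dcutoff m v K)"
  unfolding cut_eq[OF assms] by (rule cont_diff_mult[OF cont_diff_const cont_diff_pw])

lemma bump_cont_diff: "cell K ==> cont_diff j (bump m K)"
  unfolding bump_def[abs_def] by (intro cont_diff_prod cut_cont_diff)

lemma cut_deriv:
  assumes "cell K"
  shows "(cutoff m v K has_derivative (\<lambda>h. dcutoff m v K x * (glam v K \<bullet> h))) (at x)"
  unfolding cut_eq[OF assms]
  by (rule has_derivative_compose[OF _ pw_deriv[unfolded has_field_derivative_def], THEN has_derivative_eq_rhs])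
    (auto intro!: derivative_eq_intros simp: mult.commute numeral_2_eq_2)

lemma bump_grad:
  assumes K: "cell K"
  shows "grad (bump m K) x = (\<Sum>v\<in>K. (dcutoff m v K x * (\<Prod>u\<in>K - {v}. cutoff m u K x)) *\<^sub>R glam v K)"
  unfolding bump_def[abs_def]
  by (rule grad_eqI, rule has_derivative_eq_rhs[OF has_derivative_prod[OF cut_deriv[OF K]]])
    (auto simp: inner_sum_left fun_eq_iff intro!: sum.cong)

lemma cut_bounds: "0 \<le> cutoff m v K x" "cutoff m v K x \<le> 1"
  using pw_le_fact[of 0] by (auto simp: cutoff_def pw_nonneg)

lemma cut_zero: "lam v K x \<le> 0 ==> cutoff m v K x = 0" "lam v K x \<le> 0 ==> dcutoff m v K x = 0"
  using mult_nonneg_nonpos[of "real m" "lam v K x"] by (auto simp: cutoff_def dcutoff_def pw_def)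

lemma dcut_nonneg: "0 \<le> dcutoff m v K x"
  by (simp add: dcutoff_def pw_nonneg)

lemma bump_bounds: "0 \<le> bump m K x" "bump m K x \<le> 1"
  unfolding bump_def by (auto intro!: prod_nonneg prod_le_1 cut_bounds)

lemma bump_outside: "cell K ==> x \<notin> interior (convex hull K) ==> bump m K x = 0"
  unfolding bump_def using cell_finite[of K] cut_zero(1) by (force simp: interior_cell prod_zero_iff not_less)

lemma weight_outside:
  assumes "cell K" "v \<in> K" "x \<notin> interior (convex hull K)"
  shows "dcutoff m v K x * (\<Prod>u\<in>K - {v}. cutoff m u K x) = 0"
proof -
  obtain u where u: "u \<in> K" "lam u K x \<le> 0" using assms by (auto simp: interior_cell not_less)
  show ?thesis
  proof (cases "u = v")
    case False
    then show ?thesis using cell_finite[OF assms(1)] u cut_zero(1)[OF u(2)] by (auto intro!: prod_zero)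
  qed (use u cut_zero in auto)
qed

lemma filterlim_cut_arg:
  assumes "0 < l" shows "filterlim (\<lambda>m. real m * l - 1) at_top sequentially"
  using filterlim_tendsto_add_at_top[OF tendsto_const[of "- 1::real"]
      filterlim_tendsto_pos_mult_at_top[OF tendsto_const[of l] assms filterlim_real_sequentially]]
  by (simp add: mult.commute)

lemma pw_0_tendsto: "(pw 0 \<longlongrightarrow> 1) at_top"
proof (rule tendsto_cong[THEN iffD1])
  show "((\<lambda>t::real. exp (- inverse t)) \<longlongrightarrow> 1) at_top"
    using tendsto_exp[OF tendsto_minus[OF tendsto_inverse_0_at_top[OF filterlim_ident]]] by simp
  show "\<forall>\<^sub>F t in at_top. exp (- inverse t) = pw 0 t"
    using eventually_gt_at_top[of "0::real"] by eventually_elim (simp add: pw_def divide_simps)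
qed

text \<open>With \<open>t = real m * lam v K x - 1\<close> this is the coordinate times
  \<open>dcutoff\<close>. Together with \<open>pw_2_bound\<close> it provides dominated convergence
  for weights that concentrate at a facet.\<close>

lemma pw_2_tendsto: "((\<lambda>t. (t + 1) * pw 2 t) \<longlongrightarrow> 0) at_top"
proof (rule tendsto_cong[THEN iffD1])
  have i: "((\<lambda>t::real. inverse t) \<longlongrightarrow> 0) at_top"
    by (rule tendsto_inverse_0_at_top[OF filterlim_ident])
  show "((\<lambda>t::real. exp (- inverse t) * (inverse t + inverse t * inverse t)) \<longlongrightarrow> 0) at_top"
    using tendsto_mult[OF tendsto_exp[OF tendsto_minus[OF i]] tendsto_add[OF i tendsto_mult[OF i i]]] by simp
  show "\<forall>\<^sub>F t in at_top. exp (- inverse t) * (inverse t + inverse t * inverse t) = (t + 1) * pw 2 t"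
    using eventually_gt_at_top[of "0::real"]
  proof eventually_elim
    fix t :: real assume "0 < t"
    moreover have "- inverse t = - 1 / t" by (simp add: divide_inverse)
    ultimately show "exp (- inverse t) * (inverse t + inverse t * inverse t) = (t + 1) * pw 2 t"
      by (simp add: pw_def field_simps power2_eq_square)
  qed
qed

lemma pw_2_bound: "(t + 1) * pw 2 t \<le> 3"
proof -
  have "(t + 1) * pw 2 t = pw 1 t + pw 2 t"
    using pw_Suc[of 1 t] by (simp add: algebra_simps numeral_2_eq_2)
  then show ?thesis using pw_le_fact[of 1 t] pw_le_fact[of 2 t] by simp
qed

lemma bump_tendsto:
  assumes K: "cell K" and x: "x \<in> interior (convex hull K)"
  shows "(\<lambda>m. bump m K x) \<longlonglongrightarrow> 1"
proof -
  have "(\<lambda>m. \<Prod>v\<in>K. cutoff m v K x) \<longlonglongrightarrow> (\<Prod>v\<in>K. 1)"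
    unfolding cutoff_def using x
    by (intro tendsto_prod filterlim_compose[OF pw_0_tendsto] filterlim_cut_arg) (auto simp: interior_cell[OF K])
  then show ?thesis by (simp add: bump_def)
qed

lemma lam_dcut: "lam v K x * dcutoff m v K x = (let t = real m * lam v K x - 1 in (t + 1) * pw 2 t)"
  by (simp add: dcutoff_def)

lemma lam_dcut_bound: "0 \<le> lam v K x * dcutoff m v K x" "lam v K x * dcutoff m v K x \<le> 3"
proof -
  show "0 \<le> lam v K x * dcutoff m v K x"
    using dcut_nonneg[of m v K x] cut_zero(2)[of v K x m] by (cases "lam v K x \<le> 0") auto
  show "lam v K x * dcutoff m v K x \<le> 3" unfolding lam_dcut Let_def by (rule pw_2_bound)
qed

lemma lam_dcut_tendsto:
  assumes "lam v K x > 0" shows "(\<lambda>m. lam v K x * dcutoff m v K x) \<longlonglongrightarrow> 0"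
  unfolding lam_dcut Let_def
  by (rule filterlim_compose[OF pw_2_tendsto filterlim_cut_arg[OF assms]])

section \<open>Integration by parts on a simplex\<close>

lemma integrable_compact_support:
  fixes f :: "'a::euclidean_space \<Rightarrow> 'b::euclidean_space"
  assumes "continuous_on UNIV f" "compact S" "\<And>x. x \<notin> S ==> f x = 0"
  shows "integrable lborel f"
proof -
  have "integrable lborel (\<lambda>x. indicator S x *\<^sub>R f x)"
    by (rule borel_integrable_compact[OF assms(2) continuous_on_subset[OF assms(1)]]) simp
  moreover have "(\<lambda>x. indicator S x *\<^sub>R f x) = f" using assms(3) by (auto simp: indicator_def)
  ultimately show ?thesis by simp
qed

lemma integrable_indicator_open:
  fixes f :: "'a::euclidean_space \<Rightarrow> 'b::euclidean_space"
  assumes "continuous_on UNIV f" "open S" "bounded S"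
  shows "integrable lborel (\<lambda>x. indicator S x *\<^sub>R f x)"
proof -
  have "compact (closure S)" using assms by simp
  then have "integrable lborel (\<lambda>x. indicator (closure S) x *\<^sub>R f x)"
    by (rule borel_integrable_compact[OF _ continuous_on_subset[OF assms(1)]]) simp
  then have "integrable lborel (\<lambda>x. indicator S x *\<^sub>R (indicator (closure S) x *\<^sub>R f x))"
    by (rule integrable_mult_indicator[rotated]) (use assms in simp)
  moreover have "(\<lambda>x. indicator S x *\<^sub>R (indicator (closure S) x *\<^sub>R f x)) = (\<lambda>x. indicator S x *\<^sub>R f x)"
    using closure_subset[of S] by (auto simp: indicator_def fun_eq_iff)
  ultimately show ?thesis by simp
qed

lemma lborel_integral_shift:
  fixes f :: "'a::euclidean_space \<Rightarrow> real"
  assumes "f \<in> borel_measurable borel"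
  shows "(LINT x|lborel. f (c + x)) = (LINT x|lborel. f x)"
  by (subst lborel_distr_plus[symmetric, of c], subst integral_distr) (use assms in auto)

text \<open>Translation invariance of the integral makes the difference quotients integrate to zero.\<close>

lemma integral_grad_zero:
  fixes u :: "real^'n \<Rightarrow> real"
  assumes u: "cont_diff 1 u" and S: "compact S" "\<And>x. x \<notin> S ==> u x = 0"
  shows "(LINT x|lborel. grad u x \<bullet> e) = 0"
proof -
  obtain R where R: "R > 0" "S \<subseteq> cball 0 R" using compact_imp_bounded[OF S(1)] by (auto simp: bounded_pos subset_eq)
  \<comment> \<open>Large enough to contain every point of norm at most \<open>R + norm e\<close>
    together with its shift, so that the mean value bound applies there; farther out the quotient is
    zero.\<close>
  define B where "B = cball (0::real^'n) (R + 2 * norm e)"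
  have "compact ((\<lambda>x. norm (grad u x)) ` B)"
    unfolding B_def by (intro compact_continuous_image continuous_on_norm continuous_grad u) simp
  then obtain C where "\<forall>y\<in>(\<lambda>x. norm (grad u x)) ` B. norm y \<le> C"
    using compact_imp_bounded bounded_iff by blast
  then have C: "norm (grad u x) \<le> C" if "x \<in> B" for x using that by auto
  have cu: "continuous_on UNIV u" using u cont_diff_continuous by blast
  define s where "s m x = (u (x + (1 / real (Suc m)) *\<^sub>R e) - u x) * real (Suc m)" for m x
  have iu: "integrable lborel u" by (rule integrable_compact_support[OF cu S])
  have bm: "u \<in> borel_measurable borel" using cu by (rule borel_measurable_continuous_onI)
  have int_s: "(LINT x|lborel. s m x) = 0" for m
  proof -
    have "integrable lborel (\<lambda>x. u ((1 / real (Suc m)) *\<^sub>R e + x))"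
      using integrable_distr[of "(+) ((1 / real (Suc m)) *\<^sub>R e)" lborel borel u] iu
      by (simp add: lborel_distr_plus)
    then show ?thesis using iu lborel_integral_shift[OF bm, of "(1 / real (Suc m)) *\<^sub>R e"]
      by (simp add: s_def add.commute Bochner_Integration.integral_diff)
  qed
  have "(\<lambda>m. LINT x|lborel. s m x) \<longlonglongrightarrow> (LINT x|lborel. grad u x \<bullet> e)"
  proof (rule integral_dominated_convergence[where w = "\<lambda>x. indicator B x * (C * norm e)"])
    show "integrable lborel (\<lambda>x. indicator B x * (C * norm e))"
      unfolding B_def by (intro integrable_mult_left integrable_real_indicator) (auto simp: emeasure_lborel_cball_finite[unfolded infinity_ennreal_def])
    show "AE x in lborel. (\<lambda>m. s m x) \<longlonglongrightarrow> grad u x \<bullet> e"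
    proof (rule AE_I2)
      fix x
      have "((\<lambda>t. x + t *\<^sub>R e) has_derivative (\<lambda>t. t *\<^sub>R e)) (at 0)"
        by (auto intro!: derivative_eq_intros)
      moreover have "(u has_derivative (\<lambda>h. grad u x \<bullet> h)) (at (x + 0 *\<^sub>R e))"
        using has_derivative_grad[OF u] by simp
      ultimately have "((\<lambda>t. u (x + t *\<^sub>R e)) has_derivative (\<lambda>t. grad u x \<bullet> (t *\<^sub>R e))) (at 0)"
        by (rule has_derivative_compose)
      then have "((\<lambda>t. u (x + t *\<^sub>R e)) has_real_derivative grad u x \<bullet> e) (at 0)"
        unfolding has_field_derivative_def by (rule has_derivative_eq_rhs) (auto simp: mult.commute)
      then have "((\<lambda>h. (u (x + h *\<^sub>R e) - u x) / h) \<longlongrightarrow> grad u x \<bullet> e) (at 0)"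
        by (simp add: DERIV_def)
      moreover have "filterlim (\<lambda>m. 1 / real (Suc m)) (at 0) sequentially"
        using LIMSEQ_inverse_real_of_nat by (auto simp: filterlim_at inverse_eq_divide)
      ultimately have "(\<lambda>m. (u (x + (1 / real (Suc m)) *\<^sub>R e) - u x) / (1 / real (Suc m))) \<longlonglongrightarrow> grad u x \<bullet> e"
        by (rule filterlim_compose)
      then show "(\<lambda>m. s m x) \<longlonglongrightarrow> grad u x \<bullet> e" by (simp add: s_def)
    qed
    show "AE x in lborel. norm (s m x) \<le> indicator B x * (C * norm e)" for m
    proof (rule AE_I2)
      fix x
      let ?h = "(1 / real (Suc m)) *\<^sub>R e"
      have h: "norm ?h \<le> norm e" by (simp add: divide_le_eq mult_le_cancel_left1)
      show "norm (s m x) \<le> indicator B x * (C * norm e)"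
      proof (cases "norm x \<le> R + norm e")
        case True
        then have x: "x \<in> B" "x + ?h \<in> B"
          using h norm_triangle_ineq[of x ?h] by (auto simp: B_def intro: order_trans)
        have "norm (u (x + ?h) - u x) \<le> C * norm (x + ?h - x)"
        proof (rule differentiable_bound[of B u "\<lambda>x h. grad u x \<bullet> h"])
          show "convex B" by (simp add: B_def)
          show "(u has_derivative (\<lambda>h. grad u y \<bullet> h)) (at y within B)" for y
            by (rule has_derivative_at_withinI[OF has_derivative_grad[OF u]])
          show "onorm (\<lambda>h. grad u y \<bullet> h) \<le> C" if "y \<in> B" for y
            using C[OF that]
            by (intro onorm_bound order_trans[OF norm_ge_zero C[OF that]])
              (auto intro!: order_trans[OF Cauchy_Schwarz_ineq2] mult_right_mono)
        qed (use x in auto)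
        then have "norm (u (x + ?h) - u x) * real (Suc m) \<le> C * norm e"
          by (simp add: field_simps)
        then show ?thesis using x by (simp add: s_def abs_mult)
      next
        case False
        then have "norm x > R" "norm (x + ?h) > R"
          using h norm_triangle_ineq2[of x "- ?h"] norm_ge_zero[of e] by (auto simp del: norm_ge_zero)
        then have "u x = 0" "u (x + ?h) = 0" using S(2) R(2) by (force simp: subset_eq)+
        moreover have "0 \<le> C * norm e" using C[of 0] R(1) by (intro mult_nonneg_nonneg) (auto simp: B_def intro: order_trans[OF norm_ge_zero])
        ultimately show ?thesis by (simp add: s_def)
      qed
    qed
    show "(\<lambda>x. grad u x \<bullet> e) \<in> borel_measurable lborel"
      using continuous_grad[OF u] by (auto intro!: borel_measurable_continuous_onI continuous_intros)
    show "s m \<in> borel_measurable lborel" for m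
      unfolding s_def by (auto intro!: borel_measurable_continuous_onI continuous_intros continuous_on_compose2[OF cu])
  qed
  then show ?thesis unfolding int_s by (simp add: LIMSEQ_const_iff)
qed

definition pdiv :: "(real^'n \<Rightarrow> real^'n) \<Rightarrow> real^'n \<Rightarrow> real" where
  "pdiv w x = (\<Sum>i\<in>UNIV. grad (\<lambda>x. w x $ i) x $ i)"

definition vec_c1 :: "(real^'n \<Rightarrow> real^'n) \<Rightarrow> bool" where
  "vec_c1 w \<longleftrightarrow> (\<forall>i. cont_diff 1 (\<lambda>x. w x $ i))"

definition cell_int :: "(real^'n) set \<Rightarrow> (real^'n \<Rightarrow> real) \<Rightarrow> real" where
  "cell_int K g = (LINT x|lborel. indicator (interior (convex hull K)) x * g x)"

text \<open>The coefficient of \<open>glam v K\<close> in the gradient of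
  \<open>bump m K\<close>.\<close>

definition facet_weight :: "nat \<Rightarrow> real^'n \<Rightarrow> (real^'n) set \<Rightarrow> real^'n \<Rightarrow> real" where
  "facet_weight m v K x = dcutoff m v K x * (\<Prod>u\<in>K - {v}. cutoff m u K x)"

text \<open>As \<open>m\<close> grows, \<open>facet_int m v K g\<close> concentrates on the facet of \<open>K\<close> opposite to \<open>v\<close>; it
  replaces a surface integral over that facet.\<close>

definition facet_int :: "nat \<Rightarrow> real^'n \<Rightarrow> (real^'n) set \<Rightarrow> (real^'n \<Rightarrow> real) \<Rightarrow> real" where
  "facet_int m v K g = (LINT x|lborel. facet_weight m v K x * g x)"

lemma vec_c1_continuous: "vec_c1 w ==> continuous_on S w"
proof -
  assume "vec_c1 w"
  then have "continuous_on S (\<lambda>x. \<chi> i. w x $ i)"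
    by (intro continuous_on_vec_lambda cont_diff_continuous[of 1]) (simp add: vec_c1_def)
  then show ?thesis by simp
qed

lemma continuous_pdiv: "vec_c1 w ==> continuous_on S (pdiv w)"
  unfolding pdiv_def[abs_def] vec_c1_def by (intro continuous_intros continuous_grad) auto

lemma continuous_facet_weight: "cell K ==> continuous_on S (facet_weight m v K)"
  unfolding facet_weight_def[abs_def]
  by (intro continuous_intros cont_diff_continuous[OF dcut_cont_diff[of _ 0]] cont_diff_continuous[OF cut_cont_diff[of _ 0]])

lemma compact_cell: "cell K ==> compact (convex hull K)"
  by (simp add: cell_finite finite_imp_compact_convex_hull)

lemma bounded_cell_interior: "cell K ==> bounded (interior (convex hull K))"
  using compact_cell[of K] by (meson bounded_subset compact_imp_bounded interior_subset)

lemma facet_weight_outside: "cell K ==> v \<in> K ==> x \<notin> interior (convex hull K) ==> facet_weight m v K x = 0"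
  by (simp add: facet_weight_def weight_outside)

lemma facet_weight_nonneg: "facet_weight m v K x \<ge> 0"
  unfolding facet_weight_def by (intro mult_nonneg_nonneg prod_nonneg dcut_nonneg cut_bounds)

lemma facet_integrable:
  assumes "cell K" "v \<in> K" "continuous_on UNIV g"
  shows "integrable lborel (\<lambda>x. facet_weight m v K x * g x)"
proof (rule integrable_compact_support[OF _ compact_cell[OF assms(1)]])
  show "continuous_on UNIV (\<lambda>x. facet_weight m v K x * g x)"
    by (intro continuous_on_mult continuous_facet_weight assms)
  show "facet_weight m v K x * g x = 0" if "x \<notin> convex hull K" for x
    using facet_weight_outside[OF assms(1,2), of x] that interior_subset[of "convex hull K"] by auto
qed

lemma cell_integrable:
  fixes g :: "real^'n \<Rightarrow> real"
  assumes "cell K" "continuous_on UNIV g"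
  shows "integrable lborel (\<lambda>x. indicator (interior (convex hull K)) x * g x)"
  using integrable_indicator_open[OF assms(2) open_interior bounded_cell_interior[OF assms(1)]] by simp

lemma facet_int_add:
  "cell K ==> v \<in> K ==> continuous_on UNIV g ==> continuous_on UNIV h ==>
    facet_int m v K (\<lambda>x. g x + h x) = facet_int m v K g + facet_int m v K h"
  unfolding facet_int_def by (simp add: distrib_left facet_integrable)

lemma facet_int_scale: "facet_int m v K (\<lambda>x. a * g x) = a * facet_int m v K g"
  unfolding facet_int_def by (simp add: mult.left_commute)

lemma facet_int_mono:
  assumes "cell K" "v \<in> K" "continuous_on UNIV g" "continuous_on UNIV h"
    and le: "\<And>x. x \<in> interior (convex hull K) ==> g x \<le> h x"
  shows "facet_int m v K g \<le> facet_int m v K h"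
  unfolding facet_int_def
proof (rule integral_mono)
  show "facet_weight m v K x * g x \<le> facet_weight m v K x * h x" for x
    using le[of x] facet_weight_outside[OF assms(1,2), of x m] facet_weight_nonneg[of m v K x]
    by (cases "x \<in> interior (convex hull K)") (auto intro: mult_left_mono)
qed (intro facet_integrable assms)+

lemma grad_linear_bump:
  assumes K: "cell K"
  shows "grad (bump m K) x \<bullet> z = (\<Sum>v\<in>K. facet_weight m v K x * (glam v K \<bullet> z))"
  by (simp add: bump_grad[OF K] inner_sum_left facet_weight_def)

text \<open>The divergence of the compactly supported product of \<open>bump m K\<close> and
  \<open>w\<close> has integral zero, and the gradient of the bump contributes one term for each
  facet.\<close>

lemma Green_identity:
  assumes K: "cell K" and w: "vec_c1 w"
  shows "(LINT x|lborel. bump m K x * pdiv w x) + (\<Sum>v\<in>K. facet_int m v K (\<lambda>x. glam v K \<bullet> w x)) = 0"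
proof -
  note wi = w[unfolded vec_c1_def, rule_format]
  have cw: "continuous_on UNIV w" by (rule vec_c1_continuous[OF w])
  have b1: "cont_diff 1 (bump m K)" by (rule bump_cont_diff[OF K])
  have cb: "continuous_on UNIV (bump m K)" by (rule cont_diff_continuous[OF b1])
  have cui: "cont_diff 1 (\<lambda>x. bump m K x * w x $ i)" for i by (intro cont_diff_mult b1 wi)
  have out: "bump m K x = 0" if "x \<notin> convex hull K" for x
    using bump_outside[OF K, of x m] that interior_subset by blast
  have gout: "grad (\<lambda>x. bump m K x * w x $ i) x $ i = 0" if "x \<notin> convex hull K" for i x
  proof -
    have "grad (bump m K) x = 0"
      unfolding bump_grad[OF K]
    proof (rule sum.neutral, rule ballI)
      fix v assume "v \<in> K"
      then show "(dcutoff m v K x * (\<Prod>u\<in>K - {v}. cutoff m u K x)) *\<^sub>R glam v K = 0"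
        using weight_outside[OF K, of v x m] that interior_subset[of "convex hull K"] by auto
    qed
    then show ?thesis using out[OF that] by (simp add: grad_mult[OF b1 wi])
  qed
  have "0 = (\<Sum>i\<in>UNIV. LINT x|lborel. grad (\<lambda>x. bump m K x * w x $ i) x \<bullet> axis i 1)"
    by (intro sum.neutral[symmetric] ballI integral_grad_zero[OF cui compact_cell[OF K]]) (simp add: out)
  also have "\<dots> = (LINT x|lborel. (\<Sum>i\<in>UNIV. grad (\<lambda>x. bump m K x * w x $ i) x $ i))"
    unfolding inner_axis inner_real_def mult_1_right
    by (intro Bochner_Integration.integral_sum[symmetric] integrable_compact_support[OF _ compact_cell[OF K]] gout
        continuous_on_component continuous_grad cui)
  also have "(\<lambda>x. \<Sum>i\<in>UNIV. grad (\<lambda>x. bump m K x * w x $ i) x $ i)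
      = (\<lambda>x. bump m K x * pdiv w x + (\<Sum>v\<in>K. facet_weight m v K x * (glam v K \<bullet> w x)))"
  proof
    fix x
    have "(\<Sum>i\<in>UNIV. grad (\<lambda>x. bump m K x * w x $ i) x $ i)
        = (\<Sum>i\<in>UNIV. bump m K x * grad (\<lambda>x. w x $ i) x $ i + w x $ i * grad (bump m K) x $ i)"
      by (simp add: grad_mult[OF b1 wi])
    also have "\<dots> = bump m K x * pdiv w x + grad (bump m K) x \<bullet> w x"
      by (simp add: pdiv_def sum.distrib inner_vec_def sum_distrib_left mult.commute)
    finally show "(\<Sum>i\<in>UNIV. grad (\<lambda>x. bump m K x * w x $ i) x $ i)
        = bump m K x * pdiv w x + (\<Sum>v\<in>K. facet_weight m v K x * (glam v K \<bullet> w x))"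
      by (simp add: grad_linear_bump[OF K])
  qed
  also have "(LINT x|lborel. bump m K x * pdiv w x + (\<Sum>v\<in>K. facet_weight m v K x * (glam v K \<bullet> w x)))
      = (LINT x|lborel. bump m K x * pdiv w x) + (\<Sum>v\<in>K. facet_int m v K (\<lambda>x. glam v K \<bullet> w x))"
  proof -
    have "integrable lborel (\<lambda>x. bump m K x * pdiv w x)"
      by (rule integrable_compact_support[OF _ compact_cell[OF K]])
        (auto intro!: continuous_on_mult cb continuous_pdiv[OF w] simp: out)
    moreover have "integrable lborel (\<lambda>x. facet_weight m v K x * (glam v K \<bullet> w x))" if "v \<in> K" for v
      by (rule facet_integrable[OF K that]) (intro continuous_intros cw)
    ultimately show ?thesis by (simp add: facet_int_def)
  qed
  finally show ?thesis by simp
qed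

lemma bump_integral_tendsto:
  assumes K: "cell K" and g: "continuous_on UNIV g"
  shows "(\<lambda>m. LINT x|lborel. bump m K x * g x) \<longlonglongrightarrow> cell_int K g"
  unfolding cell_int_def
proof (rule integral_dominated_convergence[where w = "\<lambda>x. norm (indicator (interior (convex hull K)) x * g x)"])
  have cb: "continuous_on UNIV (bump m K)" for m by (rule cont_diff_continuous[OF bump_cont_diff[OF K, of 0]])
  show "(\<lambda>x. bump m K x * g x) \<in> borel_measurable lborel" for m
    by (auto intro!: borel_measurable_continuous_onI continuous_on_mult cb g)
  show "integrable lborel (\<lambda>x. norm (indicator (interior (convex hull K)) x * g x))"
    by (intro integrable_norm cell_integrable K g)
  then show "(\<lambda>x. indicator (interior (convex hull K)) x * g x) \<in> borel_measurable lborel"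
    using cell_integrable[OF K g] by blast
  show "AE x in lborel. (\<lambda>m. bump m K x * g x) \<longlonglongrightarrow> indicator (interior (convex hull K)) x * g x"
  proof (rule AE_I2)
    fix x
    show "(\<lambda>m. bump m K x * g x) \<longlonglongrightarrow> indicator (interior (convex hull K)) x * g x"
    proof (cases "x \<in> interior (convex hull K)")
      case True
      then show ?thesis using tendsto_mult_right[OF bump_tendsto[OF K True], of "g x"] by simp
    qed (simp add: bump_outside[OF K])
  qed
  show "AE x in lborel. norm (bump m K x * g x) \<le> norm (indicator (interior (convex hull K)) x * g x)" for m
  proof (rule AE_I2)
    fix x
    show "norm (bump m K x * g x) \<le> norm (indicator (interior (convex hull K)) x * g x)"
      using bump_bounds[of m K x] bump_outside[OF K, of x m]
      by (cases "x \<in> interior (convex hull K)") (auto simp: abs_mult mult_left_le_one_le)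
  qed
qed

lemma Green_limit:
  assumes K: "cell K" and w: "vec_c1 w"
  shows "(\<lambda>m. \<Sum>v\<in>K. facet_int m v K (\<lambda>x. glam v K \<bullet> w x)) \<longlonglongrightarrow> - cell_int K (pdiv w)"
proof -
  have "(\<Sum>v\<in>K. facet_int m v K (\<lambda>x. glam v K \<bullet> w x)) = - (LINT x|lborel. bump m K x * pdiv w x)" for m
    using Green_identity[OF K w, of m] by simp
  then show ?thesis using tendsto_minus[OF bump_integral_tendsto[OF K continuous_pdiv[OF w]]] by simp
qed

text \<open>The weight becomes large only where the coordinate is of order 1 / m. Its product with
  the coordinate is therefore bounded by 3 and tends to zero pointwise.\<close>

lemma facet_int_lam_tendsto:
  assumes K: "cell (K::(real^'n) set)" "v \<in> K"
  shows "(\<lambda>m. facet_int m v K (lam v K)) \<longlonglongrightarrow> 0"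
proof -
  let ?I = "interior (convex hull K)"
  have "(\<lambda>m. facet_int m v K (lam v K)) \<longlonglongrightarrow> (LINT x|lborel. (\<lambda>x::real^'n. 0::real) x)"
    unfolding facet_int_def
  proof (rule integral_dominated_convergence[where w = "\<lambda>x. indicator ?I x * 3"])
    show "integrable lborel (\<lambda>x. indicator ?I x * (3::real))"
      by (rule cell_integrable[OF K(1)]) simp
    show "(\<lambda>x. facet_weight m v K x * lam v K x) \<in> borel_measurable lborel" for m
      using facet_integrable[OF K continuous_lam[OF K(1)]] by blast
    have eq: "facet_weight m v K x * lam v K x = (lam v K x * dcutoff m v K x) * (\<Prod>u\<in>K - {v}. cutoff m u K x)" for m x
      by (simp add: facet_weight_def)
    have P: "0 \<le> (\<Prod>u\<in>K - {v}. cutoff m u K x)" "(\<Prod>u\<in>K - {v}. cutoff m u K x) \<le> 1" for m x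
      by (auto intro!: prod_nonneg prod_le_1 cut_bounds)
    have le: "norm (facet_weight m v K x * lam v K x) \<le> lam v K x * dcutoff m v K x" for m x
      unfolding eq real_norm_def
      using mult_nonneg_nonneg[OF lam_dcut_bound(1)[of v K x m] P(1)[of m x]]
        mult_left_le[OF P(2)[of m x] lam_dcut_bound(1)[of v K x m]] by linarith
    show "AE x in lborel. norm (facet_weight m v K x * lam v K x) \<le> indicator ?I x * 3" for m
      using order_trans[OF le lam_dcut_bound(2)] facet_weight_outside[OF K]
      by (intro AE_I2) (auto simp: indicator_def)
    show "AE x in lborel. (\<lambda>m. facet_weight m v K x * lam v K x) \<longlonglongrightarrow> 0"
    proof (rule AE_I2)
      fix x
      show "(\<lambda>m. facet_weight m v K x * lam v K x) \<longlonglongrightarrow> 0"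
      proof (cases "x \<in> ?I")
        case True
        then have "(\<lambda>m. lam v K x * dcutoff m v K x) \<longlonglongrightarrow> 0"
          using K by (intro lam_dcut_tendsto) (auto simp: interior_cell)
        then show ?thesis by (rule Lim_null_comparison[OF always_eventually[OF allI], rotated]) (rule le)
      qed (simp add: facet_weight_outside[OF K])
    qed
  qed simp
  then show ?thesis by simp
qed

lemma glam_position: "cell K ==> v \<in> K ==> glam u K \<bullet> (x - v) = lam u K x - (if u = v then 1 else 0)"
  by (auto simp: lam_diff lam_vertex)

lemma cont_diff_coord: "cont_diff m (\<lambda>x::real^'n. x $ i)"
  by (rule polys_cont_diff[OF polys_coord[of 1]]) simp

text \<open>Green's formula for the field \<open>x - v\<close>, whose normal component is constant on the facet opposite
  to \<open>v\<close> and vanishes on the other facets.\<close>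

lemma facet_int_scaled:
  assumes K: "cell K" "v \<in> K" and \<theta>: "cont_diff 1 \<theta>"
  shows "(\<lambda>m. facet_int m v K \<theta>) \<longlonglongrightarrow> cell_int K (pdiv (\<lambda>x. \<theta> x *\<^sub>R (x - v)))"
proof -
  let ?w = "\<lambda>x. \<theta> x *\<^sub>R (x - v)"
  have "cont_diff 1 (\<lambda>x. x $ i + (- v $ i))" for i
    by (intro cont_diff_add cont_diff_coord cont_diff_const)
  then have w: "vec_c1 ?w"
    unfolding vec_c1_def using \<theta> by (auto intro!: cont_diff_mult simp del: One_nat_def)
  have c\<theta>: "continuous_on S \<theta>" for S by (rule cont_diff_continuous[OF \<theta>])
  obtain G where G: "G \<ge> 0" "\<And>x. x \<in> convex hull K ==> \<bar>\<theta> x\<bar> \<le> G"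
  proof -
    have "bounded (\<theta> ` (convex hull K))"
      by (intro compact_imp_bounded compact_continuous_image c\<theta> compact_cell K)
    then obtain G where "\<forall>y\<in>\<theta> ` (convex hull K). norm y \<le> G" by (auto simp: bounded_iff)
    then show ?thesis by (intro that[of "max G 0"]) (auto simp: max.coboundedI1)
  qed
  have lim0: "(\<lambda>m. facet_int m u K (\<lambda>x. lam u K x * \<theta> x)) \<longlonglongrightarrow> 0" if u: "u \<in> K" for u
  proof (rule Lim_null_comparison[OF always_eventually])
    show "(\<lambda>m. G * facet_int m u K (lam u K)) \<longlonglongrightarrow> 0"
      using tendsto_mult_left[OF facet_int_lam_tendsto[OF K(1) u], of G] by simp
    show "\<forall>m. norm (facet_int m u K (\<lambda>x. lam u K x * \<theta> x)) \<le> G * facet_int m u K (lam u K)"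
    proof
      fix m
      have b: "\<bar>lam u K x * \<theta> x\<bar> \<le> G * lam u K x" if "x \<in> interior (convex hull K)" for x
      proof -
        have "lam u K x > 0" "\<bar>\<theta> x\<bar> \<le> G"
          using that u G(2) interior_subset[of "convex hull K"] by (auto simp: interior_cell[OF K(1)])
        then show ?thesis by (simp add: abs_mult mult.commute mult_left_mono)
      qed
      have "facet_int m u K (\<lambda>x. lam u K x * \<theta> x) \<le> facet_int m u K (\<lambda>x. G * lam u K x)"
        using b by (intro facet_int_mono K u continuous_intros continuous_lam c\<theta>) fastforce
      moreover have "facet_int m u K (\<lambda>x. (- G) * lam u K x) \<le> facet_int m u K (\<lambda>x. lam u K x * \<theta> x)"
        using b by (intro facet_int_mono K u continuous_intros continuous_lam c\<theta>) fastforce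
      ultimately show "norm (facet_int m u K (\<lambda>x. lam u K x * \<theta> x)) \<le> G * facet_int m u K (lam u K)"
        unfolding facet_int_scale by simp
    qed
  qed
  \<comment> \<open>By \<open>glam_position\<close> the normal component of the field is the
    coordinate of \<open>u\<close> times \<theta>, minus \<theta> itself if \<open>u = v\<close>.
    The former terms tend to zero by \<open>lim0\<close>.\<close>
  have "facet_int m u K (\<lambda>x. glam u K \<bullet> ?w x) = facet_int m u K (\<lambda>x. lam u K x * \<theta> x)
      + (if u = v then - facet_int m v K \<theta> else 0)" if u: "u \<in> K" for u m
  proof -
    have "(\<lambda>x. glam u K \<bullet> ?w x) = (\<lambda>x. lam u K x * \<theta> x + (if u = v then - 1 else 0) * \<theta> x)"
      unfolding inner_scaleR_right glam_position[OF K] by (auto simp: algebra_simps)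
    then show ?thesis
      using K u by (simp only:) (subst facet_int_add, auto intro!: continuous_intros continuous_lam c\<theta> simp: facet_int_scale simp del: mult_minus_left)
  qed
  then have "facet_int m v K \<theta> = (\<Sum>u\<in>K. facet_int m u K (\<lambda>x. lam u K x * \<theta> x))
      - (\<Sum>u\<in>K. facet_int m u K (\<lambda>x. glam u K \<bullet> ?w x))" for m
    using K cell_finite[OF K(1)] by (simp add: sum.distrib sum.delta)
  moreover have "(\<lambda>m. (\<Sum>u\<in>K. facet_int m u K (\<lambda>x. lam u K x * \<theta> x))
      - (\<Sum>u\<in>K. facet_int m u K (\<lambda>x. glam u K \<bullet> ?w x))) \<longlonglongrightarrow> (\<Sum>u\<in>K. 0) - (- cell_int K (pdiv ?w))"
    by (intro tendsto_diff tendsto_sum lim0 Green_limit K w)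
  ultimately show ?thesis by simp
qed

text \<open>By compactness the coordinate of \<open>v\<close> is bounded below where |g| is at least
  \<delta>, which bounds |g| by \<delta> plus a multiple of the coordinate. The total weight stays
  bounded and the weighted coordinate tends to zero.\<close>

lemma facet_int_vanish:
  assumes K: "cell K" "v \<in> K" and g: "continuous_on UNIV g"
    and 0: "\<And>x. x \<in> convex hull (K - {v}) ==> g x = 0"
  shows "(\<lambda>m. facet_int m v K g) \<longlonglongrightarrow> 0"
proof (rule LIMSEQ_I)
  fix r :: real assume r: "r > 0"
  have "(\<lambda>m. facet_int m v K (\<lambda>_. 1)) \<longlonglongrightarrow> cell_int K (pdiv (\<lambda>x. 1 *\<^sub>R (x - v)))"
    by (rule facet_int_scaled[OF K cont_diff_const])
  then obtain C where C: "\<And>m. norm (facet_int m v K (\<lambda>_. 1)) \<le> C" "C > 0"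
    by (metis convergentI convergent_imp_Bseq BseqE)
  \<comment> \<open>The total weight is at most \<open>C\<close>, so the constant part contributes
    at most \<open>r / 2\<close>.\<close>
  define \<delta> where "\<delta> = r / (2 * C)"
  have \<delta>: "\<delta> > 0" using r C by (simp add: \<delta>_def)
  let ?S = "{x \<in> convex hull K. \<bar>g x\<bar> \<ge> \<delta>}"
  have "?S = convex hull K \<inter> {x. \<delta> \<le> \<bar>g x\<bar>}" by auto
  moreover have "closed {x. \<delta> \<le> \<bar>g x\<bar>}" by (intro closed_Collect_le continuous_intros g)
  ultimately have cS: "compact ?S" using compact_cell[OF K(1)] by (simp add: compact_Int_closed)
  obtain c where c: "c > 0" "\<And>x. x \<in> ?S ==> \<bar>g x\<bar> \<le> c * lam v K x"
  proof (cases "?S = {}")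
    case False
    obtain x0 where x0: "x0 \<in> ?S" "\<And>x. x \<in> ?S ==> lam v K x0 \<le> lam v K x"
      using continuous_attains_inf[OF cS False continuous_lam[OF K(1)], of v] by blast
    obtain x1 where x1: "x1 \<in> ?S" "\<And>x. x \<in> ?S ==> \<bar>g x\<bar> \<le> \<bar>g x1\<bar>"
      using continuous_attains_sup[OF cS False continuous_on_rabs[OF continuous_on_subset[OF g subset_UNIV]]] by blast
    have "lam v K x0 \<noteq> 0"
    proof
      assume "lam v K x0 = 0"
      then have "x0 \<in> convex hull (K - {v})"
        using x0(1) K by (auto simp: mem_convex_hull[OF K(1)] mem_cell_hull[OF K(1)])
      then show False using 0 x0(1) \<delta> by simp
    qed
    then have pos: "lam v K x0 > 0" using x0(1) K(2) mem_cell_hull[OF K(1)] by force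
    show ?thesis
    proof (rule that[of "\<bar>g x1\<bar> / lam v K x0"])
      show "0 < \<bar>g x1\<bar> / lam v K x0" using x1(1) \<delta> pos by auto
      fix x assume x: "x \<in> ?S"
      have "\<bar>g x\<bar> * lam v K x0 \<le> \<bar>g x1\<bar> * lam v K x" using x0(2)[OF x] x1(2)[OF x] pos by (intro mult_mono) auto
      then show "\<bar>g x\<bar> \<le> \<bar>g x1\<bar> / lam v K x0 * lam v K x" using pos by (simp add: field_simps)
    qed
  qed (use that[of 1] in auto)
  have b: "\<bar>g x\<bar> \<le> \<delta> + c * lam v K x" if "x \<in> interior (convex hull K)" for x
  proof (cases "x \<in> ?S")
    case True
    then show ?thesis using c(2)[OF True] \<delta> by simp
  next
    case False
    moreover have "lam v K x > 0" using that K by (simp add: interior_cell)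
    moreover have "x \<in> convex hull K" using that interior_subset by blast
    ultimately have "\<bar>g x\<bar> < \<delta>" "0 < c * lam v K x" using c(1) by auto
    then show ?thesis by linarith
  qed
  have cont: "continuous_on UNIV (\<lambda>x. \<delta> + c * lam v K x)" "continuous_on UNIV (\<lambda>x. \<delta> * 1)"
      "continuous_on UNIV (\<lambda>x. c * lam v K x)" "continuous_on UNIV (\<lambda>x. (-1) * (\<delta> * 1 + c * lam v K x))"
    by (intro continuous_intros continuous_lam K)+
  have le: "\<bar>facet_int m v K g\<bar> \<le> \<delta> * C + c * facet_int m v K (lam v K)" for m
  proof -
    have 1: "facet_int m v K g \<le> facet_int m v K (\<lambda>x. \<delta> * 1 + c * lam v K x)"
      using b cont by (intro facet_int_mono K g) fastforce+
    have 2: "facet_int m v K (\<lambda>x. (-1) * (\<delta> * 1 + c * lam v K x)) \<le> facet_int m v K g"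
      using b cont by (intro facet_int_mono K g) fastforce+
    have "facet_int m v K (\<lambda>x. \<delta> * 1 + c * lam v K x) = \<delta> * facet_int m v K (\<lambda>_. 1) + c * facet_int m v K (lam v K)"
      unfolding facet_int_add[OF K cont(2,3)] facet_int_scale ..
    moreover have "\<delta> * facet_int m v K (\<lambda>_. 1) \<le> \<delta> * C" using C(1)[of m] \<delta> by (intro mult_left_mono) auto
    ultimately show ?thesis using 1 2 unfolding facet_int_scale by linarith
  qed
  have "(\<lambda>m. c * facet_int m v K (lam v K)) \<longlonglongrightarrow> 0"
    using tendsto_mult_left[OF facet_int_lam_tendsto[OF K], of c] by simp
  then have "\<exists>N. \<forall>m\<ge>N. norm (c * facet_int m v K (lam v K) - 0) < r / 2"
    using r by (intro LIMSEQ_D) auto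
  then obtain N where N: "\<And>m. m \<ge> N ==> \<bar>c * facet_int m v K (lam v K)\<bar> < r / 2" by auto
  have "norm (facet_int m v K g - 0) < r" if "m \<ge> N" for m
    using le[of m] N[OF that] C(2) by (simp add: \<delta>_def)
  then show "\<exists>no. \<forall>n\<ge>no. norm (facet_int n v K g - 0) < r" by blast
qed

lemma Green_zero:
  assumes K: "cell K" and w: "vec_c1 w"
    and 0: "\<And>v x. v \<in> K ==> x \<in> convex hull (K - {v}) ==> glam v K \<bullet> w x = 0"
  shows "cell_int K (pdiv w) = 0"
proof -
  have "(\<lambda>m. \<Sum>v\<in>K. facet_int m v K (\<lambda>x. glam v K \<bullet> w x)) \<longlonglongrightarrow> (\<Sum>v\<in>K. 0)"
    using 0 by (intro tendsto_sum facet_int_vanish[OF K] continuous_intros vec_c1_continuous[OF w])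
  then show ?thesis using LIMSEQ_unique[OF _ Green_limit[OF K w]] by fastforce
qed

subsection \<open>Change of variables between neighbouring simplices\<close>

lemma nn_integral_shift:
  fixes f :: "'a::euclidean_space \<Rightarrow> ennreal"
  assumes [measurable]: "f \<in> borel_measurable borel"
  shows "(\<integral>\<^sup>+x. f (c + x) \<partial>lborel) = (\<integral>\<^sup>+x. f x \<partial>lborel)"
  by (subst lborel_distr_plus[symmetric, of c], subst nn_integral_distr) auto

lemma nn_integral_reflect:
  fixes f :: "'a::euclidean_space \<Rightarrow> ennreal"
  assumes [measurable]: "f \<in> borel_measurable borel"
  shows "(\<integral>\<^sup>+x. f (c - x) \<partial>lborel) = (\<integral>\<^sup>+x. f x \<partial>lborel)"
proof -
  have "(lborel :: 'a measure) = distr lborel borel (\<lambda>x. c - x)"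
    using lborel_affine[of "-1" c] by (simp add: density_1)
  then show ?thesis by (subst (2) \<open>lborel = _\<close>, subst nn_integral_distr) auto
qed

text \<open>The standard double-integral argument for the uniqueness of translation invariant integrals.\<close>

lemma nn_integral_linear_proportional:
  fixes P Q :: "'a::euclidean_space \<Rightarrow> 'a" and f h :: "'a \<Rightarrow> ennreal"
  assumes P: "linear P" and Q: "linear Q" and PQ: "\<And>x. P (Q x) = x"
    and [measurable]: "f \<in> borel_measurable borel" "h \<in> borel_measurable borel"
  shows "(\<integral>\<^sup>+x. f (P x) \<partial>lborel) * (\<integral>\<^sup>+x. h x \<partial>lborel) = (\<integral>\<^sup>+x. f x \<partial>lborel) * (\<integral>\<^sup>+x. h (P x) \<partial>lborel)"
proof -
  have [measurable]: "P \<in> borel_measurable borel"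
    by (intro borel_measurable_continuous_onI linear_continuous_on P linear_conv_bounded_linear[THEN iffD1])
  have shift: "(\<integral>\<^sup>+y. g (P y) \<partial>lborel) = (\<integral>\<^sup>+y. g (P y - x) \<partial>lborel)"
    if [measurable]: "g \<in> borel_measurable borel" for g :: "'a \<Rightarrow> ennreal" and x
    using nn_integral_shift[of "\<lambda>y. g (P y)" "- Q x"] PQ
    by (simp add: linear_diff[OF P] linear_neg[OF P] linear_add[OF P])
  have swap: "(\<integral>\<^sup>+x. g x * (\<integral>\<^sup>+y. g' (P y - x) \<partial>lborel) \<partial>lborel)
      = (\<integral>\<^sup>+y. \<integral>\<^sup>+x. g x * g' (P y - x) \<partial>lborel \<partial>lborel)"
    if [measurable]: "g \<in> borel_measurable borel" "g' \<in> borel_measurable borel" for g g' :: "'a \<Rightarrow> ennreal"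
    by (simp add: nn_integral_cmult[symmetric]) (rule lborel_pair.Fubini', measurable)
  have "(\<integral>\<^sup>+x. f x \<partial>lborel) * (\<integral>\<^sup>+x. h (P x) \<partial>lborel) = (\<integral>\<^sup>+x. f x * (\<integral>\<^sup>+y. h (P y) \<partial>lborel) \<partial>lborel)"
    by (simp add: nn_integral_multc)
  also have "\<dots> = (\<integral>\<^sup>+x. f x * (\<integral>\<^sup>+y. h (P y - x) \<partial>lborel) \<partial>lborel)"
    by (intro nn_integral_cong arg_cong2[where f = times] refl shift) measurable
  also have "\<dots> = (\<integral>\<^sup>+y. \<integral>\<^sup>+x. f x * h (P y - x) \<partial>lborel \<partial>lborel)" by (rule swap) measurable
  \<comment> \<open>Replacing \<open>x\<close> by \<open>P y - x\<close> exchanges the roles of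
    \<open>f\<close> and \<open>h\<close>.\<close>
  also have "\<dots> = (\<integral>\<^sup>+y. \<integral>\<^sup>+x. f (P y - x) * h (P y - (P y - x)) \<partial>lborel \<partial>lborel)"
    by (intro nn_integral_cong nn_integral_reflect[symmetric]) measurable
  also have "\<dots> = (\<integral>\<^sup>+y. \<integral>\<^sup>+x. h x * f (P y - x) \<partial>lborel \<partial>lborel)" by (simp add: mult.commute)
  also have "\<dots> = (\<integral>\<^sup>+x. h x * (\<integral>\<^sup>+y. f (P y - x) \<partial>lborel) \<partial>lborel)" by (rule swap[symmetric]) measurable
  also have "\<dots> = (\<integral>\<^sup>+x. h x * (\<integral>\<^sup>+y. f (P y) \<partial>lborel) \<partial>lborel)"
    by (intro nn_integral_cong arg_cong2[where f = times] refl shift[symmetric]) measurable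
  also have "\<dots> = (\<integral>\<^sup>+x. f (P x) \<partial>lborel) * (\<integral>\<^sup>+x. h x \<partial>lborel)"
    by (simp add: nn_integral_multc mult.commute)
  finally show ?thesis ..
qed

lemma emeasure_open_nonzero:
  fixes U :: "'a::euclidean_space set"
  assumes "open U" "U \<noteq> {}" shows "emeasure lborel U \<noteq> 0"
proof
  assume "emeasure lborel U = 0"
  then have "U \<in> null_sets lborel" using assms(1) by (auto simp: null_sets_def)
  then have "negligible U" by (simp add: negligible_iff_null_sets null_sets_completionI)
  then show False using open_not_negligible assms by blast
qed

text \<open>The map multiplies \<open>u\<close> by \<open>s\<close> and fixes the kernel of
  \<open>g\<close>, so it is diagonal in a basis of \<open>u\<close> and kernel vectors and has
  determinant \<open>s\<close>. The change of basis \<open>P\<close> enters only through a factor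
  that cancels, because translation invariant integrals are proportional.\<close>

lemma lborel_rank_one:
  fixes g u :: "real^'n"
  assumes g: "g \<bullet> u \<noteq> 0" and s: "s = 1 + g \<bullet> u" "s \<noteq> 0"
    and [measurable]: "f \<in> borel_measurable borel"
  shows "(\<integral>\<^sup>+x. f (x + (g \<bullet> x) *\<^sub>R u) \<partial>lborel) = ennreal (1 / \<bar>s\<bar>) * (\<integral>\<^sup>+x. f x \<partial>lborel)"
proof -
  have "g \<noteq> 0" using g by auto
  then obtain i where i: "g $ i \<noteq> 0" by (metis vec_eq_iff zero_index)
  \<comment> \<open>Sends the \<open>i\<close>-th axis to \<open>u\<close> and the other axes into
    the kernel of \<open>g\<close>, by means of the nonzero entry \<open>g $ i\<close>.\<close>
  define P where "P x = (x $ i) *\<^sub>R u + (\<Sum>j\<in>UNIV - {i}. (x $ j) *\<^sub>R (axis j 1 - (g $ j / g $ i) *\<^sub>R axis i 1))" for x :: "real^'n"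
  define A where "A x = x + (g \<bullet> x) *\<^sub>R u" for x
  define D where "D x = (\<Sum>j\<in>UNIV. ((if j = i then s else 1) * x $ j) *\<^sub>R axis j (1::real))" for x :: "real^'n"
  have linP: "linear P" unfolding P_def
    by (rule linearI) (simp_all add: scaleR_add_left scaleR_add_right sum.distrib scaleR_sum_right)
  have gP: "g \<bullet> P x = x $ i * (g \<bullet> u)" for x
    using i by (simp add: P_def inner_add_right inner_sum_right inner_diff_right inner_axis)
  have "x = 0" if "P x = 0" for x
  proof -
    have xi: "x $ i = 0" using gP[of x] that g by simp
    have "x $ k = 0" if "k \<noteq> i" for k
    proof -
      have "0 = P x $ k" using \<open>P x = 0\<close> by simp
      also have "\<dots> = (\<Sum>j\<in>UNIV - {i}. x $ j * (if k = j then 1 else 0))"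
        using that by (auto simp: P_def xi axis_def intro!: sum.cong)
      also have "\<dots> = x $ k" using that by (simp add: if_distrib sum.delta cong: if_cong)
      finally show ?thesis ..
    qed
    then show ?thesis using xi by (metis vec_eq_iff zero_index)
  qed
  then have "inj P" using linear_injective_0[OF linP] by blast
  then obtain Q where Q: "linear Q" "\<And>x. P (Q x) = x" "\<And>x. Q (P x) = x"
    using linear_injective_isomorphism[OF linP] by metis
  have Dk: "D x $ k = (if k = i then s else 1) * x $ k" for k and x :: "real^'n"
    by (simp add: D_def axis_def if_distrib[of "\<lambda>a. _ * a"] sum.delta cong: if_cong)
  have conj: "A (P x) = P (D x)" for x
  proof -
    have "P (D x) = (s * x $ i) *\<^sub>R u + (\<Sum>j\<in>UNIV - {i}. (x $ j) *\<^sub>R (axis j 1 - (g $ j / g $ i) *\<^sub>R axis i 1))"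
      by (simp add: P_def Dk)
    also have "\<dots> = P x + ((s - 1) * x $ i) *\<^sub>R u" by (simp add: P_def algebra_simps)
    also have "\<dots> = A (P x)" by (simp add: A_def gP s(1) mult.commute)
    finally show ?thesis ..
  qed
  have meas: "L \<in> borel_measurable borel" if "linear L" for L :: "real^'n \<Rightarrow> real^'n"
    using that by (intro borel_measurable_continuous_onI linear_continuous_on linear_conv_bounded_linear[THEN iffD1])
  have linA: "linear A" unfolding A_def by (rule linearI) (simp_all add: algebra_simps)
  have linD: "linear D" unfolding D_def
    by (rule linearI) (simp_all add: algebra_simps sum.distrib scaleR_sum_right)
  note [measurable] = meas[OF linP] meas[OF Q(1)] meas[OF linA] meas[OF linD]
  \<comment> \<open>Chosen so that its composition with \<open>P\<close> is the indicator of the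
    unit ball, whose integral is finite and nonzero and can be cancelled.\<close>
  let ?h = "\<lambda>x. indicator (ball (0::real^'n) 1) (Q x) :: ennreal"
  have hm: "?h \<in> borel_measurable borel"
    by (rule measurable_compose[OF meas[OF Q(1)] borel_measurable_indicator]) simp
  let ?H = "\<integral>\<^sup>+x. ?h (P x) \<partial>lborel"
  have H: "?H = emeasure lborel (ball (0::real^'n) 1)" by (simp add: Q(3))
  have H0: "?H \<noteq> 0" "?H \<noteq> top" unfolding H
    using emeasure_lborel_ball_finite[of "0::real^'n" 1] emeasure_open_nonzero[of "ball (0::real^'n) 1"] by auto
  have scale: "(\<integral>\<^sup>+x. k (D x) \<partial>lborel) = ennreal (1 / \<bar>s\<bar>) * (\<integral>\<^sup>+x. k x \<partial>lborel)"
    if [measurable]: "k \<in> borel_measurable borel" for k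
  proof -
    let ?c = "\<lambda>b::real^'n. if b = axis i 1 then s else 1"
    have "(\<Sum>j\<in>Basis. (?c j * (x \<bullet> j)) *\<^sub>R j) = D x" for x
    proof (rule iffD2[OF vec_eq_iff], rule allI)
      fix k
      have "(\<Sum>j\<in>Basis. (?c j * (x \<bullet> j)) *\<^sub>R j) \<bullet> axis k 1 = ?c (axis k 1) * (x \<bullet> axis k 1)"
        by (rule inner_sum_left_Basis) (simp add: axis_in_Basis_iff)
      then show "(\<Sum>j\<in>Basis. (?c j * (x \<bullet> j)) *\<^sub>R j) $ k = D x $ k"
        by (simp add: inner_axis Dk axis_eq_axis)
    qed
    moreover have "prod (\<lambda>j. \<bar>?c j\<bar>) Basis = \<bar>s\<bar>"
      using axis_in_Basis_iff[of i "1::real"]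
      by (subst prod.remove[of _ "axis i 1"]) auto
    ultimately have "(lborel :: (real^'n) measure) = density (distr lborel borel D) (\<lambda>_. \<bar>s\<bar>)"
      using lborel_affine_euclidean[of ?c 0] s(2) by (simp add: cong: if_cong)
    then have "(\<integral>\<^sup>+x. k x \<partial>lborel) = (\<integral>\<^sup>+x. k x \<partial>density (distr lborel borel D) (\<lambda>_. \<bar>s\<bar>))" by simp
    also have "\<dots> = ennreal \<bar>s\<bar> * (\<integral>\<^sup>+x. k (D x) \<partial>lborel)"
      by (simp add: nn_integral_density nn_integral_distr nn_integral_cmult)
    finally show ?thesis using s(2) by (simp add: mult.assoc[symmetric] flip: ennreal_mult)
  qed
  have "(\<integral>\<^sup>+x. f (A x) \<partial>lborel) * ?H = (\<integral>\<^sup>+x. f (A (P x)) \<partial>lborel) * (\<integral>\<^sup>+x. ?h x \<partial>lborel)"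
    by (rule nn_integral_linear_proportional[OF linP Q(1,2) _ hm, symmetric]) measurable
  also have "(\<integral>\<^sup>+x. f (A (P x)) \<partial>lborel) = ennreal (1 / \<bar>s\<bar>) * (\<integral>\<^sup>+x. f (P x) \<partial>lborel)"
    unfolding conj by (rule scale[of "\<lambda>x. f (P x)"]) measurable
  also have "\<dots> * (\<integral>\<^sup>+x. ?h x \<partial>lborel) = ennreal (1 / \<bar>s\<bar>) * ((\<integral>\<^sup>+x. f x \<partial>lborel) * ?H)"
    using nn_integral_linear_proportional[OF linP Q(1,2) _ hm, of f] by (simp add: mult.assoc)
  finally have "?H * (\<integral>\<^sup>+x. f (A x) \<partial>lborel) = ?H * (ennreal (1 / \<bar>s\<bar>) * (\<integral>\<^sup>+x. f x \<partial>lborel))"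
    by (simp add: ac_simps)
  then show ?thesis using H0 by (simp add: ennreal_mult_cancel_left A_def)
qed

text \<open>Identifying the image measure with a multiple of Lebesgue measure carries the formula
  over to signed integrands.\<close>

lemma integral_rank_one:
  fixes g u :: "real^'n" and f :: "real^'n \<Rightarrow> real"
  assumes g: "g \<bullet> u \<noteq> 0" and s: "s = 1 + g \<bullet> u" "s \<noteq> 0"
    and [measurable]: "f \<in> borel_measurable borel"
  shows "(LINT x|lborel. f (b + x + (g \<bullet> x) *\<^sub>R u)) = (LINT x|lborel. f x) / \<bar>s\<bar>"
proof -
  let ?A = "\<lambda>x. b + x + (g \<bullet> x) *\<^sub>R u"
  have [measurable]: "?A \<in> borel_measurable borel"
    by (intro borel_measurable_continuous_onI continuous_intros)
  have "distr lborel borel ?A = density lborel (\<lambda>_. ennreal (1 / \<bar>s\<bar>))"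
  proof (rule measure_eqI)
    fix X assume "X \<in> sets (distr lborel borel ?A)"
    then have [measurable]: "X \<in> sets borel" by simp
    have "emeasure (distr lborel borel ?A) X = (\<integral>\<^sup>+x. indicator X (?A x) \<partial>lborel)"
      using nn_integral_distr[of ?A lborel borel "indicator X"] by simp
    also have "\<dots> = ennreal (1 / \<bar>s\<bar>) * (\<integral>\<^sup>+x. indicator X (b + x) \<partial>lborel)"
      using lborel_rank_one[OF g s, of "\<lambda>x. indicator X (b + x)"] by (simp add: add.assoc)
    also have "(\<integral>\<^sup>+x. indicator X (b + x) \<partial>lborel) = (\<integral>\<^sup>+x. indicator X x \<partial>lborel)"
      by (rule nn_integral_shift) measurable
    finally show "emeasure (distr lborel borel ?A) X = emeasure (density lborel (\<lambda>_. ennreal (1 / \<bar>s\<bar>))) X"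
      by (simp add: emeasure_density nn_integral_cmult)
  qed simp
  then have "(LINT x|lborel. f (?A x)) = (LINT x|density lborel (\<lambda>_. ennreal (1 / \<bar>s\<bar>)). f x)"
    using integral_distr[of ?A lborel borel f] by simp
  also have "\<dots> = (LINT x|lborel. f x) / \<bar>s\<bar>"
    by (subst integral_density) auto
  finally show ?thesis .
qed

text \<open>The affine map fixing \<open>F\<close> pointwise and mapping \<open>v\<close> to \<open>v'\<close> transports one facet integral to the other.\<close>

lemma facet_int_opposite:
  assumes K: "cell (insert v F)" "v \<notin> F" and K': "cell (insert v' F)" "v' \<notin> F"
    and opp: "lam v (insert v F) v' < 0"
    and w: "continuous_on UNIV w" "continuous_on UNIV w'"
    and eq: "\<And>x. x \<in> convex hull F ==> glam v (insert v F) \<bullet> w x = glam v (insert v F) \<bullet> w' x"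
  shows "(\<lambda>m. facet_int m v (insert v F) (\<lambda>x. glam v (insert v F) \<bullet> w x)
      + facet_int m v' (insert v' F) (\<lambda>x. glam v' (insert v' F) \<bullet> w' x)) \<longlonglongrightarrow> 0"
proof -
  let ?K = "insert v F" and ?K' = "insert v' F"
  \<comment> \<open>The determinant of the affine map \<open>A\<close> below, negative because
    \<open>v'\<close> lies on the other side of the facet.\<close>
  define s where "s = lam v ?K v'"
  define u where "u = v' - v"
  let ?g = "glam v ?K"
  have gu: "?g \<bullet> u = s - 1" unfolding u_def s_def by (simp add: glam_position[OF K(1)])
  define A where "A x = x + lam v ?K x *\<^sub>R u" for x
  have A: "A x = lam v ?K 0 *\<^sub>R u + x + (?g \<bullet> x) *\<^sub>R u" for x
    unfolding A_def using lam_affine[OF K(1), of v x] by (simp add: algebra_simps)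
  have cA: "continuous_on UNIV A" unfolding A_def by (intro continuous_intros continuous_lam K)
  have lamA: "lam u' ?K' (A x) = lam (if u' = v' then v else u') ?K x" if u': "u' \<in> ?K'" for u' x
  proof -
    let ?q = "\<lambda>x. lam u' ?K' (A x)"
    have q: "?q x = (lam u' ?K' 0 + lam v ?K 0 * (glam u' ?K' \<bullet> u)) + (glam u' ?K' + (glam u' ?K' \<bullet> u) *\<^sub>R ?g) \<bullet> x" for x
    proof -
      have "glam u' ?K' \<bullet> A x = lam v ?K 0 * (glam u' ?K' \<bullet> u) + glam u' ?K' \<bullet> x + (?g \<bullet> x) * (glam u' ?K' \<bullet> u)"
        by (simp add: A inner_add_right)
      then show ?thesis
        using lam_affine[OF K'(1), of u' "A x"] by (simp add: inner_add_left mult.commute)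
    qed
    have "?q \<in> polys 1" unfolding ext[OF q] by (rule polys_inner_add) simp
    moreover have "?q y = (if y = (if u' = v' then v else u') then 1 else 0)" if "y \<in> ?K" for y
      using that u' K(2) K'(2) by (auto simp: A_def lam_vertex[OF K(1)] lam_vertex[OF K'(1)] u_def)
    ultimately have "lam (if u' = v' then v else u') ?K = ?q" by (rule lam_eqI[OF K(1)])
    then show ?thesis by (rule fun_cong[symmetric])
  qed
  have weight: "facet_weight m v' ?K' (A x) = facet_weight m v ?K x" for m x
  proof -
    have "(\<Prod>u\<in>F. cutoff m u ?K' (A x)) = (\<Prod>u\<in>F. cutoff m u ?K x)"
      using K'(2) by (intro prod.cong refl) (auto simp: cutoff_def lamA)
    moreover have "?K - {v} = F" "?K' - {v'} = F" using K K' by auto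
    ultimately show ?thesis by (simp add: facet_weight_def dcutoff_def lamA)
  qed
  have glam': "?g = s *\<^sub>R glam v' ?K'"
  proof (rule glam_eqI[OF K(1), of _ "s * lam v' ?K' 0"])
    fix x
    have "lam v ?K = (\<lambda>x. s * lam v' ?K' x)"
    proof (rule polys1_eqI[OF K'(1) lam_polys[OF K(1)] polys_scale[OF lam_polys[OF K'(1)]]])
      fix y assume "y \<in> ?K'"
      then show "lam v ?K y = s * lam v' ?K' y"
        using K(2) K'(2) by (auto simp: lam_vertex[OF K'(1)] lam_vertex[OF K(1)] s_def)
    qed
    then show "lam v ?K x = s * lam v' ?K' 0 + s *\<^sub>R glam v' ?K' \<bullet> x"
      using lam_affine[OF K'(1), of v' x] by (simp add: distrib_left)
  qed
  have s: "s < 0" using opp s_def by simp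
  have c': "continuous_on UNIV (\<lambda>x. ?g \<bullet> w' (A x))"
    by (intro continuous_intros continuous_on_compose2[OF w(2)] cA) auto
  have cw: "continuous_on UNIV (\<lambda>x. ?g \<bullet> w x)" by (intro continuous_intros w)
  \<comment> \<open>The Jacobian factor |s| and the ratio \<open>s\<close> of the two gradients
    leave only the sign -1. The difference of the two integrands then vanishes on \<open>F\<close>,
    where \<open>A\<close> is the identity.\<close>
  have trans: "facet_int m v' ?K' (\<lambda>x. glam v' ?K' \<bullet> w' x) = facet_int m v ?K (\<lambda>x. (-1) * (?g \<bullet> w' (A x)))" for m
  proof -
    let ?f = "\<lambda>x. facet_weight m v' ?K' x * (glam v' ?K' \<bullet> w' x)"
    have "?f \<in> borel_measurable borel"
      by (intro borel_measurable_continuous_onI continuous_intros continuous_facet_weight K' w)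
    then have "(LINT x|lborel. ?f (A x)) = (LINT x|lborel. ?f x) / \<bar>s\<bar>"
      unfolding A using s by (intro integral_rank_one) (auto simp: gu)
    then have "facet_int m v' ?K' (\<lambda>x. glam v' ?K' \<bullet> w' x) = \<bar>s\<bar> * (LINT x|lborel. ?f (A x))"
      using s by (simp add: facet_int_def)
    also have "\<dots> = facet_int m v ?K (\<lambda>x. \<bar>s\<bar> * (glam v' ?K' \<bullet> w' (A x)))"
      unfolding facet_int_scale by (simp add: facet_int_def weight)
    also have "(\<lambda>x. \<bar>s\<bar> * (glam v' ?K' \<bullet> w' (A x))) = (\<lambda>x. (-1) * (?g \<bullet> w' (A x)))"
      unfolding glam' using s by simp
    finally show ?thesis .
  qed
  have "(\<lambda>m. facet_int m v ?K (\<lambda>x. ?g \<bullet> w x + (-1) * (?g \<bullet> w' (A x)))) \<longlonglongrightarrow> 0"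
  proof (rule facet_int_vanish[OF K(1)])
    fix x assume "x \<in> convex hull (?K - {v})"
    then have x: "x \<in> convex hull F" using K(2) by simp
    then have "lam v ?K x = 0" using mem_convex_hull[OF K(1), of F x] K(2) by auto
    then show "?g \<bullet> w x + (-1) * (?g \<bullet> w' (A x)) = 0" using eq[OF x] by (simp add: A_def)
  qed (auto intro!: continuous_intros c' cw)
  moreover have c'': "continuous_on UNIV (\<lambda>x. (-1) * (?g \<bullet> w' (A x)))"
    by (intro continuous_intros c')
  ultimately show ?thesis unfolding trans facet_int_add[OF K(1) insertI1 cw c''] by simp
qed

section \<open>Surface integrals\<close>

lemma surface_measure_param:
  fixes f :: "(real^'n) set"
  assumes "f \<noteq> {}"
  shows "\<exists>a B. a \<in> f \<and> finite B \<and> pairwise orthogonal B \<and> (\<forall>b\<in>B. norm b = 1) \<and> span B = tan_space f \<and>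
    surface_measure f = distr (\<Pi>\<^sub>M b\<in>B. lborel) borel (\<lambda>s. a + (\<Sum>b\<in>B. s b *\<^sub>R b))"
proof -
  define a where "a = (SOME a. a \<in> f)"
  define B where "B = (SOME B. pairwise orthogonal B \<and> (\<forall>b\<in>B. norm b = 1) \<and> span B = tan_space f)"
  have a: "a \<in> f" unfolding a_def using assms by (simp add: some_in_eq)
  have "\<exists>B. pairwise orthogonal B \<and> (\<forall>b\<in>B. norm b = 1) \<and> span B = tan_space f"
    using orthonormal_basis_subspace[OF subspace_tan_space[of f]] by metis
  then have B: "pairwise orthogonal B \<and> (\<forall>b\<in>B. norm b = 1) \<and> span B = tan_space f"
    unfolding B_def by (rule someI_ex)
  moreover have "0 \<notin> B" using B by force
  ultimately have "finite B" using pairwise_orthogonal_independent independent_imp_finite by blast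
  moreover have "surface_measure f = distr (\<Pi>\<^sub>M b\<in>B. lborel) borel (\<lambda>s. a + (\<Sum>b\<in>B. s b *\<^sub>R b))"
    unfolding surface_measure_def a_def[symmetric] B_def[symmetric] Let_def ..
  ultimately show ?thesis using a B by blast
qed

lemma affine_hull_tan_space:
  assumes "a \<in> f" "span B = tan_space f" "finite B"
  shows "y \<in> affine hull f \<longleftrightarrow> (\<exists>t. y = a + (\<Sum>b\<in>B. t b *\<^sub>R b))"
proof -
  have "tan_space f = span ((\<lambda>x. - a + x) ` f)"
  proof (rule subset_antisym)
    show "tan_space f \<subseteq> span ((\<lambda>x. - a + x) ` f)"
      unfolding tan_space_def
    proof (rule span_minimal)
      show "{y - x |x y. x \<in> f \<and> y \<in> f} \<subseteq> span ((\<lambda>x. - a + x) ` f)"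
      proof (rule subsetI)
        fix z assume "z \<in> {y - x |x y. x \<in> f \<and> y \<in> f}"
        then obtain x y where z: "z = y - x" and "x \<in> f" "y \<in> f" by blast
        then have "(- a + y) - (- a + x) \<in> span ((\<lambda>x. - a + x) ` f)" by (intro span_diff span_base imageI)
        then show "z \<in> span ((\<lambda>x. - a + x) ` f)" by (simp add: z)
      qed
    qed simp
    show "span ((\<lambda>x. - a + x) ` f) \<subseteq> tan_space f"
      by (rule span_minimal) (auto intro: tan_space_diff[OF assms(1)] subspace_tan_space)
  qed
  then have "y \<in> affine hull f \<longleftrightarrow> y - a \<in> tan_space f"
  proof -
    have "y = a + z \<longleftrightarrow> z = y - a" for z by auto
    then show ?thesis unfolding affine_hull_span_gen[OF hull_inc[OF assms(1)]] image_iff \<open>tan_space f = _\<close> by simp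
  qed
  also have "\<dots> \<longleftrightarrow> (\<exists>t. y - a = (\<Sum>b\<in>B. t b *\<^sub>R b))"
    unfolding assms(2)[symmetric] span_finite[OF assms(3)] by auto
  finally show ?thesis by (simp add: algebra_simps)
qed

lemma measurable_param: "finite B ==> (\<lambda>s. a + (\<Sum>b\<in>B. s b *\<^sub>R b)) \<in> measurable (\<Pi>\<^sub>M b\<in>B. lborel) (borel :: 'a::euclidean_space measure)"
  by (intro borel_measurable_add borel_measurable_const borel_measurable_sum borel_measurable_scaleR)
    (auto intro: measurable_component_singleton[THEN measurable_compose] simp: measurable_lborel1)

lemma sets_surface_measure: "sets (surface_measure f) = sets borel" "space (surface_measure f) = UNIV"
  by (simp_all add: surface_measure_def Let_def)

lemma orthonormal_coeff:
  assumes "finite B" "pairwise orthogonal B" "\<forall>b\<in>B. norm b = 1" "c \<in> B"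
  shows "(\<Sum>b\<in>B. s b *\<^sub>R b) \<bullet> c = s c"
proof -
  have "(\<Sum>b\<in>B. s b *\<^sub>R b) \<bullet> c = (\<Sum>b\<in>B. if b = c then s b else 0)"
    unfolding inner_sum_left using assms
    by (intro sum.cong refl) (auto simp: pairwise_def orthogonal_def norm_eq_1)
  then show ?thesis using assms by (simp add: sum.delta)
qed

lemma surface_measure_finite:
  fixes f :: "(real^'n) set"
  assumes "f \<noteq> {}" "bounded X" and [measurable]: "X \<in> sets borel"
  shows "emeasure (surface_measure f) X < \<infinity>"
proof -
  obtain a B where B: "a \<in> f" "finite B" "pairwise orthogonal B" "\<forall>b\<in>B. norm b = 1" "span B = tan_space f"
    "surface_measure f = distr (\<Pi>\<^sub>M b\<in>B. lborel) borel (\<lambda>s. a + (\<Sum>b\<in>B. s b *\<^sub>R b))"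
    using surface_measure_param[OF assms(1)] by blast
  let ?M = "\<Pi>\<^sub>M b\<in>B. (lborel :: real measure)" and ?p = "\<lambda>s. a + (\<Sum>b\<in>B. s b *\<^sub>R b)"
  interpret product_sigma_finite "\<lambda>_::real^'n. lborel :: real measure" ..
  note [measurable] = measurable_param[OF B(2), of a]
  obtain R where R: "\<And>x. x \<in> X ==> norm x \<le> R" using assms(2) by (auto simp: bounded_iff)
  let ?I = "{- (R + norm a)..R + norm a}"
  have "?p -` X \<inter> space ?M \<subseteq> Pi\<^sub>E B (\<lambda>_. ?I)"
  proof
    fix s assume s: "s \<in> ?p -` X \<inter> space ?M"
    have "\<bar>s b\<bar> \<le> R + norm a" if "b \<in> B" for b
    proof -
      have "s b = (?p s - a) \<bullet> b" using orthonormal_coeff[OF B(2-4) that, of s] by simp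
      then have "\<bar>s b\<bar> \<le> norm (?p s - a)" using Cauchy_Schwarz_ineq2[of "?p s - a" b] B(4) that by simp
      also have "\<dots> \<le> norm (?p s) + norm a" by (rule norm_triangle_ineq4)
      finally show ?thesis using R[of "?p s"] s by auto
    qed
    then have "\<forall>b\<in>B. s b \<in> ?I" by (simp add: abs_le_iff) force
    then show "s \<in> Pi\<^sub>E B (\<lambda>_. ?I)" using s by (simp add: space_PiM PiE_iff)
  qed
  then have "emeasure ?M (?p -` X \<inter> space ?M) \<le> emeasure ?M (Pi\<^sub>E B (\<lambda>_. ?I))"
    by (rule emeasure_mono) (auto intro!: sets_PiM_I_finite B(2))
  also have "\<dots> = (\<Prod>b\<in>B. emeasure lborel ?I)" by (rule emeasure_PiM[OF B(2)]) auto
  also have "\<dots> < \<infinity>" by (simp add: power_less_top_ennreal emeasure_lborel_Icc_eq)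
  finally show ?thesis unfolding B(6) by (simp add: emeasure_distr)
qed

lemma surface_measure_pos:
  fixes f :: "(real^'n) set"
  assumes "f \<noteq> {}" "y \<in> affine hull f" "r > 0" "ball y r \<inter> affine hull f \<subseteq> X" and [measurable]: "X \<in> sets borel"
  shows "emeasure (surface_measure f) X \<noteq> 0"
proof -
  obtain a B where B: "a \<in> f" "finite B" "pairwise orthogonal B" "\<forall>b\<in>B. norm b = 1" "span B = tan_space f"
    "surface_measure f = distr (\<Pi>\<^sub>M b\<in>B. lborel) borel (\<lambda>s. a + (\<Sum>b\<in>B. s b *\<^sub>R b))"
    using surface_measure_param[OF assms(1)] by blast
  let ?M = "\<Pi>\<^sub>M b\<in>B. (lborel :: real measure)" and ?p = "\<lambda>s. a + (\<Sum>b\<in>B. s b *\<^sub>R b)"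
  interpret product_sigma_finite "\<lambda>_::real^'n. lborel :: real measure" ..
  note [measurable] = measurable_param[OF B(2), of a]
  note hull = affine_hull_tan_space[OF B(1,5,2)]
  obtain t where t: "y = ?p t" using assms(2) unfolding hull by blast
  \<comment> \<open>With \<open>card B\<close> coordinates each off by less than \<open>d\<close>,
    the point stays within \<open>r\<close>; the added 1 covers the case of a vertex, where
    \<open>B\<close> is empty, and makes the inequality strict.\<close>
  define d where "d = r / (real (card B) + 1)"
  have d: "d > 0" "d * card B < r" using assms(3) by (auto simp: d_def field_simps)
  let ?I = "\<lambda>b. {t b - d<..<t b + d}"
  have "Pi\<^sub>E B ?I \<subseteq> ?p -` X \<inter> space ?M"
  proof
    fix s assume s: "s \<in> Pi\<^sub>E B ?I"
    have "norm (?p t - ?p s) = norm (\<Sum>b\<in>B. (t b - s b) *\<^sub>R b)" by (simp add: scaleR_diff_left sum_subtractf)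
    also have "\<dots> \<le> (\<Sum>b\<in>B. d)"
    proof (rule sum_norm_le)
      fix b assume b: "b \<in> B"
      then have "s b \<in> ?I b" using s by auto
      then show "norm ((t b - s b) *\<^sub>R b) \<le> d" using B(4) b by auto
    qed
    also have "\<dots> < r" using d(2) by (simp add: mult.commute)
    finally have "?p s \<in> ball y r" by (simp add: t dist_norm)
    moreover have "?p s \<in> affine hull f" unfolding hull by blast
    ultimately have "?p s \<in> X" using assms(4) by blast
    then show "s \<in> ?p -` X \<inter> space ?M" using s by (simp add: space_PiM PiE_iff)
  qed
  then have "emeasure ?M (Pi\<^sub>E B ?I) \<le> emeasure ?M (?p -` X \<inter> space ?M)"
    by (rule emeasure_mono) measurable
  moreover have "emeasure ?M (Pi\<^sub>E B ?I) = (\<Prod>b\<in>B. emeasure lborel (?I b))" by (rule emeasure_PiM[OF B(2)]) auto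
  ultimately have "(\<Prod>b\<in>B. emeasure lborel (?I b)) \<le> emeasure (surface_measure f) X"
    unfolding B(6) by (simp add: emeasure_distr)
  moreover have "(\<Prod>b\<in>B. emeasure lborel (?I b)) \<noteq> 0" using d(1) B(2) by (simp add: prod_zero_iff)
  ultimately show ?thesis by auto
qed

lemma surface_integrable:
  fixes f :: "(real^'n) set" and u :: "real^'n \<Rightarrow> real"
  assumes f: "finite f" "f \<noteq> {}" and u: "continuous_on (convex hull f) u"
  shows "integrable (surface_measure f) (\<lambda>x. indicator (convex hull f) x *\<^sub>R u x)"
proof -
  have c: "compact (convex hull f)" using f(1) by (simp add: finite_imp_compact_convex_hull)
  then have [measurable]: "convex hull f \<in> sets borel" by (simp add: borel_compact)
  obtain C where C: "\<And>x. x \<in> convex hull f ==> norm (u x) \<le> C"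
    using compact_imp_bounded[OF compact_continuous_image[OF u c]] by (auto simp: bounded_iff)
  show ?thesis
  proof (rule integrableI_bounded_set[where A = "convex hull f" and B = C])
    show "convex hull f \<in> sets (surface_measure f)" by (simp add: sets_surface_measure)
    show "(\<lambda>x. indicator (convex hull f) x *\<^sub>R u x) \<in> borel_measurable (surface_measure f)"
      using borel_measurable_continuous_on_indicator[OF _ u]
      by (simp add: measurable_cong_sets[OF sets_surface_measure(1) refl])
    show "emeasure (surface_measure f) (convex hull f) < \<infinity>"
      by (rule surface_measure_finite[OF f(2) compact_imp_bounded[OF c]]) simp
  qed (use C in auto)
qed

lemma surface_integral_add:
  fixes u w :: "real^'n \<Rightarrow> real"
  assumes "finite f" "f \<noteq> {}" "continuous_on (convex hull f) u" "continuous_on (convex hull f) w"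
  shows "surface_integral f (\<lambda>x. u x + w x) = surface_integral f u + surface_integral f w"
  unfolding surface_integral_def set_lebesgue_integral_def scaleR_add_right
  by (intro Bochner_Integration.integral_add surface_integrable assms)

lemma surface_integral_scale: "surface_integral f (\<lambda>x. a * u x) = a * surface_integral f u"
  unfolding surface_integral_def set_lebesgue_integral_def by (simp add: mult.left_commute[of _ a])

lemma surface_integral_cong:
  "(\<And>x. x \<in> convex hull f ==> u x = w x) ==> surface_integral f u = surface_integral f w"
  unfolding surface_integral_def set_lebesgue_integral_def
  by (intro Bochner_Integration.integral_cong refl) (auto simp: indicator_def)

lemma surface_integral_zero: "(\<And>x. x \<in> convex hull f ==> u x = 0) ==> surface_integral f u = 0"
  using surface_integral_cong[of f u "\<lambda>_. 0"] by (simp add: surface_integral_def)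

lemma surface_integral_nonneg:
  "(\<And>x. x \<in> convex hull f ==> u x \<ge> 0) ==> surface_integral f u \<ge> 0"
  unfolding surface_integral_def set_lebesgue_integral_def
  by (intro Bochner_Integration.integral_nonneg) (auto simp: indicator_def)

text \<open>If \<open>u\<close> were positive at \<open>x\<close>, it would be positive at a nearby
  relatively interior point and on a relative ball around it, which has positive surface measure.
  The detour handles points on the relative boundary.\<close>

lemma surface_integral_definite:
  fixes u :: "real^'n \<Rightarrow> real"
  assumes f: "finite f" "f \<noteq> {}" and u: "continuous_on (convex hull f) u"
    and pos: "\<And>x. x \<in> convex hull f ==> u x \<ge> 0" and 0: "surface_integral f u = 0"
    and x: "x \<in> convex hull f"
  shows "u x = 0"
proof (rule ccontr)
  assume "u x \<noteq> 0"
  then have ux: "u x > 0" using pos[OF x] by simp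
  let ?H = "convex hull f"
  have c: "compact ?H" using f(1) by (simp add: finite_imp_compact_convex_hull)
  then have [measurable]: "?H \<in> sets borel" by (simp add: borel_compact)
  obtain e where e: "e > 0" "\<And>z. z \<in> ?H ==> dist z x < e ==> u z > 0"
  proof -
    obtain e where e: "e > 0" "\<And>z. z \<in> ?H ==> dist z x < e ==> dist (u z) (u x) < u x"
      using u x ux unfolding continuous_on_iff by meson
    have "u z > 0" if "z \<in> ?H" "dist z x < e" for z
      using e(2)[OF that] by (simp add: dist_real_def abs_less_iff)
    then show ?thesis using e(1) that by blast
  qed
  have "closure (rel_interior ?H) = closure ?H" by (rule convex_closure_rel_interior[OF convex_convex_hull])
  then have "x \<in> closure (rel_interior ?H)" using x closure_subset by blast
  then obtain y where y: "y \<in> rel_interior ?H" "dist y x < e" using e(1) by (auto simp: closure_approachable)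
  obtain r where r: "r > 0" "ball y r \<inter> affine hull ?H \<subseteq> ?H" using y(1) by (auto simp: mem_rel_interior_ball)
  have yH: "y \<in> affine hull f" using y(1) rel_interior_subset hull_subset[of ?H affine] by (auto simp: affine_hull_convex_hull)
  let ?r = "min r (e - dist y x)"
  have "AE z in surface_measure f. indicator ?H z *\<^sub>R u z = 0"
    using 0 pos unfolding surface_integral_def set_lebesgue_integral_def
    by (subst integral_nonneg_eq_0_iff_AE[symmetric, OF surface_integrable[OF f u]]) (auto simp: indicator_def)
  then obtain N where N: "{z. indicator ?H z *\<^sub>R u z \<noteq> 0} \<subseteq> N" "N \<in> sets borel" "emeasure (surface_measure f) N = 0"
    by (auto simp: sets_surface_measure elim!: AE_E)
  have "ball y ?r \<inter> affine hull f \<subseteq> N"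
  proof
    fix z assume z: "z \<in> ball y ?r \<inter> affine hull f"
    then have "z \<in> ?H" using r(2) by (auto simp: affine_hull_convex_hull)
    moreover have "dist z x < e" using z dist_triangle[of z x y] by (auto simp: dist_commute)
    ultimately show "z \<in> N" using e(2)[of z] N(1) by auto
  qed
  then show False using surface_measure_pos[OF f(2) yH _ _ N(2)] N(3) r(1) y(2) by fastforce
qed

section \<open>Representation of linear functionals\<close>

text \<open>Gram-Schmidt over a finite generating set. The form is an inner product on the span
  only, since weighted integrals are definite only on the polynomial spaces considered.\<close>

lemma riesz_representation:
  fixes scale :: "real \<Rightarrow> 'b::ab_group_add \<Rightarrow> 'b"
  assumes vs: "vector_space scale" and E: "finite E"
    and add: "\<And>x y z. x \<in> module.span scale E ==> y \<in> module.span scale E ==> z \<in> module.span scale E ==> B (x + y) z = B x z + B y z"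
    and scale: "\<And>a x z. x \<in> module.span scale E ==> z \<in> module.span scale E ==> B (scale a x) z = a * B x z"
    and sym: "\<And>x y. x \<in> module.span scale E ==> y \<in> module.span scale E ==> B x y = B y x"
    and pos: "\<And>x. x \<in> module.span scale E ==> x \<noteq> 0 ==> B x x > (0::real)"
    and L: "\<And>x y. x \<in> module.span scale E ==> y \<in> module.span scale E ==> L (x + y) = L x + L y"
      "\<And>a x. x \<in> module.span scale E ==> L (scale a x) = a * L x"
  shows "\<exists>q\<in>module.span scale E. \<forall>x\<in>module.span scale E. B q x = L x"
proof -
  interpret vector_space scale by fact
  let ?V = "span E"
  have "\<exists>q\<in>span F. \<forall>x\<in>span F. B q x = L x"
    if "finite F" "F \<subseteq> E" "\<And>x y. x \<in> ?V ==> y \<in> ?V ==> L (x + y) = L x + L y"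
      "\<And>a x. x \<in> ?V ==> L (scale a x) = a * L x" for F L
    using that
  proof (induction F arbitrary: L rule: finite_induct)
    case empty
    have "B 0 0 = 0" "L 0 = 0"
      using scale[of 0 0 0] empty(3)[of 0 0] span_zero by auto
    then show ?case by simp
  next
    case (insert e F)
    have FV: "x \<in> ?V" if "x \<in> span F" for x using that insert.prems(1) span_mono[of F E] by blast
    have eV: "e \<in> ?V" using insert.prems(1) by (simp add: span_base)
    have Fe: "F \<subseteq> E" using insert.prems by simp
    show ?case
    proof (cases "e \<in> span F")
      case True
      then show ?thesis using insert.IH[OF Fe insert.prems(2,3)] by (simp add: span_redundant)
    next
      case False
      obtain r where r: "r \<in> span F" "\<And>x. x \<in> span F ==> B r x = B e x"
      proof -
        have "B e (x + y) = B e x + B e y" if "x \<in> ?V" "y \<in> ?V" for x y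
          using add[OF that eV] sym[OF eV that(1)] sym[OF eV that(2)] sym[OF eV span_add[OF that]] by simp
        moreover have "B e (scale a x) = a * B e x" if "x \<in> ?V" for a x
          using scale[OF that eV] sym[OF eV that] sym[OF eV span_scale[OF that]] by simp
        ultimately show ?thesis using insert.IH[OF Fe, of "B e"] that by blast
      qed
      obtain q where q: "q \<in> span F" "\<And>x. x \<in> span F ==> B q x = L x"
        using insert.IH[OF Fe insert.prems(2,3)] by blast
      \<comment> \<open>\<open>r\<close> represents \<open>B e\<close> on the span of
        \<open>F\<close>, so \<open>e'\<close> is the part of \<open>e\<close> orthogonal to that
        span, and the solution is corrected along it.\<close>
      define e' where "e' = e + scale (-1) r"
      have e'V: "e' \<in> ?V" unfolding e'_def by (intro span_add span_scale eV FV r)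
      have e'F: "B e' x = 0" if "x \<in> span F" for x
        unfolding e'_def using r(2)[OF that] eV FV[OF r(1)] FV[OF that] by (simp add: add scale span_scale del: scale_minus_left)
      have "e' \<noteq> 0" using False r(1) by (auto simp: e'_def)
      then have pos': "B e' e' > 0" using pos e'V by blast
      define q' where "q' = q + scale (L e' / B e' e') e'"
      have qV: "q \<in> ?V" using FV q(1) by blast
      have "q' \<in> span (insert e F)" unfolding q'_def e'_def
        using q(1) r(1) by (intro span_add span_scale) (auto intro: span_base span_mono[THEN subsetD, rotated])
      moreover have "B q' x = L x" if x: "x \<in> span (insert e F)" for x
      proof -
        obtain k where "x - scale k e \<in> span F" using x by (auto simp: span_insert)
        then have yF: "(x - scale k e) + scale k r \<in> span F" (is "?y \<in> _") by (intro span_add span_scale r)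
        have xy: "x = ?y + scale k e'" by (simp add: e'_def scale_right_diff_distrib)
        have yV: "?y \<in> ?V" using FV yF by blast
        have q'V: "q' \<in> ?V" unfolding q'_def by (intro span_add span_scale qV e'V)
        have keV: "scale k e' \<in> ?V" by (intro span_scale e'V)
        have *: "B z x = B z ?y + k * B z e'" if "z \<in> ?V" for z
        proof -
          have "B z x = B (?y + scale k e') z" using sym[OF that] xy span_add[OF yV keV] by metis
          also have "\<dots> = B ?y z + k * B e' z" using add[OF yV keV that] scale[OF e'V that] by simp
          finally show ?thesis using sym[OF that yV] sym[OF that e'V] by simp
        qed
        have "B q' z = B q z + L e' / B e' e' * B e' z" if "z \<in> ?V" for z
          unfolding q'_def using add[OF qV span_scale[OF e'V] that] scale[OF e'V that] by simp
        then have "B q' x = (B q ?y + L e' / B e' e' * B e' ?y) + k * (B q e' + L e' / B e' e' * B e' e')"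
          using *[OF q'V] yV e'V by simp
        also have "\<dots> = L ?y + k * L e'"
          using q(2)[OF yF] e'F[OF yF] e'F[OF q(1)] sym[OF qV e'V] pos' by simp
        also have "\<dots> = L (?y + scale k e')"
          using insert.prems(2)[OF yV keV] insert.prems(3)[OF e'V] by simp
        finally show ?thesis using xy by simp
      qed
      ultimately show ?thesis by blast
    qed
  qed
  then show ?thesis using E L by blast
qed

definition fscale :: "real \<Rightarrow> ('a \<Rightarrow> 'b::real_vector) \<Rightarrow> 'a \<Rightarrow> 'b" where
  "fscale a f = (\<lambda>x. a *\<^sub>R f x)"

global_interpretation fs: vector_space fscale
  by standard (simp_all add: fscale_def fun_eq_iff scaleR_add_left scaleR_add_right)

text \<open>A subspace of a finitely generated space has a finite basis of its own, so the
  generators in \<open>S\<close> may lie outside \<open>Q\<close>.\<close>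

lemma riesz_fun:
  fixes Q :: "('a \<Rightarrow> 'b::real_vector) set"
  assumes S: "finite S" "Q \<subseteq> fs.span S" and ne: "Q \<noteq> {}"
    and closed: "\<And>q r a b. q \<in> Q ==> r \<in> Q ==> (\<lambda>x. a *\<^sub>R q x + b *\<^sub>R r x) \<in> Q"
    and lin: "\<And>q r z a b. q \<in> Q ==> r \<in> Q ==> z \<in> Q ==> B (\<lambda>x. a *\<^sub>R q x + b *\<^sub>R r x) z = a * B q z + b * B r z"
    and sym: "\<And>q r. q \<in> Q ==> r \<in> Q ==> B q r = B r q"
    and pos: "\<And>q. q \<in> Q ==> q \<noteq> (\<lambda>x. 0) ==> B q q > (0::real)"
    and L: "linear_on Q L"
  shows "\<exists>q\<in>Q. \<forall>r\<in>Q. B q r = L r"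
proof -
  have comb: "q + r \<in> Q" "fscale a q \<in> Q" if "q \<in> Q" "r \<in> Q" for q r a
    using closed[OF that, of 1 1] closed[OF that, of a 0] by (auto simp: fscale_def plus_fun_def)
  have "0 \<in> Q" using ne comb(2)[of _ _ 0] by fastforce
  then have "fs.subspace Q" using comb by (auto simp: fs.subspace_def)
  obtain E where E: "E \<subseteq> Q" "\<not> fs.dependent E" "Q \<subseteq> fs.span E"
    using fs.maximal_independent_subset[of Q] by blast
  have "finite E" using fs.independent_span_bound[OF S(1) E(2)] E(1) S(2) by blast
  have Q: "fs.span E = Q" using E fs.span_minimal[OF E(1) \<open>fs.subspace Q\<close>] by blast
  have "\<exists>q\<in>fs.span E. \<forall>r\<in>fs.span E. B q r = L r"
  proof (rule riesz_representation[OF fs.vector_space_axioms \<open>finite E\<close>]; unfold Q)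
    fix x y z a assume *: "x \<in> Q" "y \<in> Q" "z \<in> Q"
    show "B (x + y) z = B x z + B y z" using lin[OF *, of 1 1] by (simp add: plus_fun_def)
  next
    fix a x z assume *: "x \<in> Q" "z \<in> Q"
    show "B (fscale a x) z = a * B x z" using lin[OF *(1,1,2), of a 0] by (simp add: fscale_def)
  next
    fix x assume "x \<in> Q" "x \<noteq> 0"
    then show "B x x > 0" by (intro pos) (auto simp: zero_fun_def)
  next
    fix x y assume *: "x \<in> Q" "y \<in> Q"
    show "L (x + y) = L x + L y"
      using L[unfolded linear_on_def, rule_format, OF *, of 1 1] by (simp add: plus_fun_def)
  next
    fix a x assume *: "x \<in> Q"
    show "L (fscale a x) = a * L x"
      using L[unfolded linear_on_def, rule_format, OF * *, of a 0] by (simp add: fscale_def)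
  qed (use sym in blast)+
  then show ?thesis unfolding Q .
qed

lemma sum_fun_apply: "(\<Sum>i\<in>I. (f i :: 'a \<Rightarrow> 'b::comm_monoid_add)) x = (\<Sum>i\<in>I. f i x)"
  by (induction I rule: infinite_finite_induct) auto

text \<open>The factor \<rho> is the indicator of a simplex for functions extended by zero, and 1
  for polynomials on the whole space.\<close>

lemma polys_finite_dim:
  fixes \<rho> :: "real^'n \<Rightarrow> real"
  shows "\<exists>S. finite S \<and>
    {\<lambda>x. \<rho> x *\<^sub>R q x | q :: real^'n \<Rightarrow> 'b::euclidean_space. \<forall>b\<in>Basis. (\<lambda>x. q x \<bullet> b) \<in> polys r} \<subseteq> fs.span S"
proof -
  let ?m = "\<lambda>(\<alpha>, b) x. (\<rho> x * (\<Prod>i\<in>UNIV. (x $ i) ^ \<alpha> i)) *\<^sub>R b"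
  let ?S = "?m ` ({\<alpha>::'n \<Rightarrow> nat. int (sum \<alpha> UNIV) \<le> r} \<times> (Basis :: 'b set))"
  have "(\<lambda>x. (\<rho> x * p x) *\<^sub>R b) \<in> fs.span ?S" if "p \<in> polys r" "b \<in> Basis" for p and b :: 'b
    using that(1)
  proof (induction rule: polys_induct)
    case (monom \<alpha>)
    then show ?case using that(2) by (intro fs.span_base image_eqI[of _ _ "(\<alpha>, b)"]) auto
  next
    case (add p q)
    then show ?case using fs.span_add[OF add.IH] by (simp add: plus_fun_def algebra_simps)
  next
    case (scale a p)
    have "fscale a (\<lambda>x. (\<rho> x * p x) *\<^sub>R b) = (\<lambda>x. (\<rho> x * (a * p x)) *\<^sub>R b)"
      by (simp add: fscale_def mult.left_commute)
    then show ?case using fs.span_scale[OF scale.IH, of a] by simp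
  next
    case zero
    show ?case using fs.span_zero by (simp add: zero_fun_def)
  qed
  then have "(\<Sum>b\<in>Basis. (\<lambda>x. (\<rho> x * (q x \<bullet> b)) *\<^sub>R b)) \<in> fs.span ?S"
    if "\<forall>b\<in>Basis. (\<lambda>x. q x \<bullet> b) \<in> polys r" for q :: "real^'n \<Rightarrow> 'b"
    using that by (intro fs.span_sum) auto
  moreover have "(\<Sum>b\<in>Basis. (\<lambda>x. (\<rho> x * (q x \<bullet> b)) *\<^sub>R b)) = (\<lambda>x. \<rho> x *\<^sub>R q x)" for q :: "real^'n \<Rightarrow> 'b"
  proof
    fix x
    have "(\<Sum>b\<in>Basis. (\<lambda>x. (\<rho> x * (q x \<bullet> b)) *\<^sub>R b)) x = (\<Sum>b\<in>Basis. (\<rho> x * (q x \<bullet> b)) *\<^sub>R b)"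
      by (rule sum_fun_apply)
    also have "\<dots> = \<rho> x *\<^sub>R (\<Sum>b\<in>Basis. (q x \<bullet> b) *\<^sub>R b)" by (simp add: scaleR_sum_right)
    finally show "(\<Sum>b\<in>Basis. (\<lambda>x. (\<rho> x * (q x \<bullet> b)) *\<^sub>R b)) x = \<rho> x *\<^sub>R q x"
      by (simp add: euclidean_representation)
  qed
  ultimately show ?thesis
    by (intro exI[of _ ?S] conjI finite_imageI finite_cartesian_product finite_exponents finite_Basis) auto
qed

section \<open>Fields with vanishing normal trace\<close>

definition row_div :: "(real^'n \<Rightarrow> real^'n^'n) \<Rightarrow> real^'n \<Rightarrow> real^'n" where
  "row_div \<tau> x = (\<chi> i. pdiv (\<lambda>x. \<tau> x $ i) x)"

lemma sym_polys_row: "\<tau> \<in> sym_polys r ==> vec_c1 (\<lambda>x. \<tau> x $ i)"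
  unfolding sym_polys_def vec_c1_def by (auto intro: polys_cont_diff)

lemma sym_polys_row_mult: "\<tau> \<in> sym_polys r ==> cont_diff 1 u ==> vec_c1 (\<lambda>x. u x *\<^sub>R \<tau> x $ i)"
  using sym_polys_row[of \<tau> r i] unfolding vec_c1_def by (auto intro!: cont_diff_mult simp del: One_nat_def)

lemma sym_polys_continuous: "\<tau> \<in> sym_polys r ==> continuous_on S \<tau>"
proof -
  assume "\<tau> \<in> sym_polys r"
  then have "continuous_on S (\<lambda>x. \<chi> i. \<tau> x $ i)"
    by (intro continuous_on_vec_lambda vec_c1_continuous sym_polys_row)
  then show ?thesis by simp
qed

lemma continuous_row_div: "\<tau> \<in> sym_polys r ==> continuous_on S (row_div \<tau>)"
  unfolding row_div_def[abs_def] by (intro continuous_on_vec_lambda continuous_pdiv sym_polys_row)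

lemma continuous_matrix_mult:
  fixes A :: "'a::topological_space \<Rightarrow> real^'n^'m"
  assumes "continuous_on S A" "continuous_on S w"
  shows "continuous_on S (\<lambda>x. A x *v w x)"
  unfolding matrix_vector_mult_def
  by (intro continuous_on_vec_lambda continuous_intros continuous_on_component assms)

lemma pdiv_row_mult:
  assumes "\<tau> \<in> sym_polys r" "cont_diff 1 u"
  shows "pdiv (\<lambda>x. u x *\<^sub>R \<tau> x $ i) x = (\<tau> x *v grad u x + u x *\<^sub>R row_div \<tau> x) $ i"
proof -
  have "cont_diff 1 (\<lambda>x. \<tau> x $ i $ j)" for j using sym_polys_row[OF assms(1)] by (simp add: vec_c1_def)
  then show ?thesis
    by (simp add: pdiv_def row_div_def grad_mult[OF assms(2)] sum.distrib sum_distrib_left matrix_vector_mult_def)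
qed

lemma integral_lebesgue_on:
  fixes f :: "real^'n \<Rightarrow> 'b::euclidean_space"
  assumes "open D" "f \<in> borel_measurable borel"
  shows "(LINT x|lebesgue_on D. f x) = (LINT x|lborel. indicator D x *\<^sub>R f x)"
proof -
  have "(\<lambda>x. indicator D x *\<^sub>R f x) \<in> borel_measurable lborel" using assms by simp
  then show ?thesis
    using assms by (simp add: integral_restrict_space integral_completion)
qed

lemma integrable_lebesgue_on:
  fixes f :: "real^'n \<Rightarrow> 'b::euclidean_space"
  assumes D: "open D" "bounded D" and f: "continuous_on UNIV f"
  shows "integrable (lebesgue_on D) f"
proof -
  have "integrable lborel (\<lambda>x. indicator D x *\<^sub>R f x)" by (rule integrable_indicator_open[OF f D])
  then have "integrable lebesgue (\<lambda>x. indicator D x *\<^sub>R f x)"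
    using integrable_completion[of "\<lambda>x. indicator D x *\<^sub>R f x" lborel] by auto
  then show ?thesis using D by (simp add: integrable_restrict_space)
qed

lemma L2_continuous:
  fixes f :: "real^'n \<Rightarrow> 'b::euclidean_space"
  assumes "open D" "bounded D" "continuous_on UNIV f"
  shows "L2 D f"
  unfolding L2_def
  using integrable_lebesgue_on[OF assms]
    integrable_lebesgue_on[OF assms(1,2) continuous_on_power[OF continuous_on_norm[OF assms(3)]]] by auto

lemma L2_integrable:
  fixes g :: "real^'n \<Rightarrow> 'b::euclidean_space"
  assumes D: "open D" "bounded D" and g: "L2 D g"
  shows "integrable (lebesgue_on D) g"
proof (rule Bochner_Integration.integrable_bound)
  show "integrable (lebesgue_on D) (\<lambda>x. 1 + (norm (g x))\<^sup>2)"
    using g integrable_lebesgue_on[OF D, of "\<lambda>x. 1::real"] unfolding L2_def by (intro Bochner_Integration.integrable_add) auto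
  show "g \<in> borel_measurable (lebesgue_on D)" using g by (simp add: L2_def)
  show "AE x in lebesgue_on D. norm (g x) \<le> norm (1 + (norm (g x))\<^sup>2)"
  proof (rule AE_I2)
    fix x
    have "norm (g x) \<le> 1 + (norm (g x))\<^sup>2"
      using sum_squares_ge_zero[of "norm (g x) - 1" 0] norm_ge_zero[of "g x"] by (simp add: power2_eq_square algebra_simps, linarith)
    then show "norm (g x) \<le> norm (1 + (norm (g x))\<^sup>2)" by simp
  qed
qed

lemma normal_trace_cell:
  assumes K: "cell K" and \<tau>: "\<tau> \<in> sym_polys r" and u: "cont_diff 1 u"
  shows "normal_trace (interior (convex hull K)) \<tau> (row_div \<tau>) u $ i = cell_int K (pdiv (\<lambda>x. u x *\<^sub>R \<tau> x $ i))"
proof -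
  let ?D = "interior (convex hull K)"
  let ?f = "\<lambda>x. \<tau> x *v grad u x + u x *\<^sub>R row_div \<tau> x"
  have c: "continuous_on UNIV ?f"
    by (intro continuous_intros continuous_matrix_mult sym_polys_continuous[OF \<tau>] continuous_grad u
        cont_diff_continuous[OF u] continuous_row_div[OF \<tau>])
  have "normal_trace ?D \<tau> (row_div \<tau>) u = (LINT x|lborel. indicator ?D x *\<^sub>R ?f x)"
    unfolding normal_trace_def by (rule integral_lebesgue_on) (auto intro: borel_measurable_continuous_onI c)
  also have "\<dots> $ i = (LINT x|lborel. (indicator ?D x *\<^sub>R ?f x) $ i)"
    using integral_bounded_linear[OF bounded_linear_vec_nth integrable_indicator_open[OF c open_interior bounded_cell_interior[OF K]], of i] by simp
  finally show ?thesis by (simp add: cell_int_def pdiv_row_mult[OF \<tau> u] algebra_simps)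
qed

lemma row_inner: "g \<bullet> A $ i = (A *v g) $ i" for A :: "real^'n^'m"
  by (simp add: matrix_vector_mult_def inner_vec_def mult.commute)

text \<open>The factor \<open>u\<close> in the hypothesis lets this serve two cases: test functions,
  which vanish on the facets, and fields whose normal trace vanishes.\<close>

lemma normal_trace_zero:
  assumes K: "cell K" and \<tau>: "\<tau> \<in> sym_polys r" and u: "cont_diff 1 u"
    and 0: "\<And>v x. v \<in> K ==> x \<in> convex hull (K - {v}) ==> u x *\<^sub>R (\<tau> x *v glam v K) = 0"
  shows "normal_trace (interior (convex hull K)) \<tau> (row_div \<tau>) u = 0"
proof (rule iffD2[OF vec_eq_iff], rule allI)
  fix i
  have "cell_int K (pdiv (\<lambda>x. u x *\<^sub>R \<tau> x $ i)) = 0"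
  proof (rule Green_zero[OF K sym_polys_row_mult[OF \<tau> u]])
    fix v x assume "v \<in> K" "x \<in> convex hull (K - {v})"
    then have "(u x *\<^sub>R (\<tau> x *v glam v K)) $ i = 0" by (simp only: 0 zero_index)
    then show "glam v K \<bullet> u x *\<^sub>R \<tau> x $ i = 0"
      by (simp add: row_inner)
  qed
  then show "normal_trace (interior (convex hull K)) \<tau> (row_div \<tau>) u $ i = 0 $ i"
    by (simp add: normal_trace_cell[OF K \<tau> u])
qed

lemma normal_trace_split:
  assumes D: "open D" "bounded D" and \<tau>: "continuous_on UNIV \<tau>" and u: "cont_diff 1 u" and g: "L2 D g"
  shows "normal_trace D \<tau> g u = (LINT x|lebesgue_on D. \<tau> x *v grad u x) + (LINT x|lebesgue_on D. u x *\<^sub>R g x)"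
    and "integrable (lebesgue_on D) (\<lambda>x. u x *\<^sub>R g x)"
proof -
  have cu: "continuous_on S u" for S by (rule cont_diff_continuous[OF u])
  have 1: "integrable (lebesgue_on D) (\<lambda>x. \<tau> x *v grad u x)"
    by (intro integrable_lebesgue_on D continuous_matrix_mult \<tau> continuous_grad u)
  have "compact (closure D)" using D by simp
  then have "bounded (u ` closure D)" by (intro compact_imp_bounded compact_continuous_image cu)
  then obtain C where "\<forall>y\<in>u ` closure D. norm y \<le> C" by (auto simp: bounded_iff)
  then have C: "\<And>x. x \<in> D ==> \<bar>u x\<bar> \<le> C" using closure_subset by force
  have um: "u \<in> borel_measurable (lebesgue_on D)"
    using integrable_lebesgue_on[OF D cu] by auto
  show 2: "integrable (lebesgue_on D) (\<lambda>x. u x *\<^sub>R g x)"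
  proof (rule Bochner_Integration.integrable_bound)
    show "integrable (lebesgue_on D) (\<lambda>x. C * norm (g x))"
      by (intro integrable_mult_right integrable_norm L2_integrable[OF D g])
    show "(\<lambda>x. u x *\<^sub>R g x) \<in> borel_measurable (lebesgue_on D)"
      using um g by (auto simp: L2_def)
    show "AE x in lebesgue_on D. norm (u x *\<^sub>R g x) \<le> norm (C * norm (g x))"
      using C by (intro AE_I2) (auto simp: abs_mult space_restrict_space intro!: mult_right_mono order_trans[OF _ abs_ge_self])
  qed
  show "normal_trace D \<tau> g u = (LINT x|lebesgue_on D. \<tau> x *v grad u x) + (LINT x|lebesgue_on D. u x *\<^sub>R g x)"
    unfolding normal_trace_def by (rule Bochner_Integration.integral_add[OF 1 2])
qed

section \<open>Element bubbles: weak definition and pointwise normal trace\<close>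

lemma test_function_cont_diff: "test_function D u ==> cont_diff m u"
  by (simp add: test_function_def smooth_def)

lemma test_function_zero: "test_function D u ==> x \<notin> D ==> u x = 0"
  unfolding test_function_def using closure_subset[of "{x. u x \<noteq> 0}"] by blast

lemma facet_not_interior: "cell K ==> v \<in> K ==> x \<in> convex hull (K - {v}) ==> x \<notin> interior (convex hull K)"
  by (auto simp: interior_cell mem_convex_hull[of K "K - {v}"] intro!: bexI[of _ v])

lemma weak_div_row_div:
  assumes K: "cell K" and \<tau>: "\<tau> \<in> sym_polys r"
  shows "weak_div (interior (convex hull K)) \<tau> (row_div \<tau>)"
  unfolding weak_div_def
proof (intro allI impI)
  fix u assume u: "test_function (interior (convex hull K)) u"
  note u1 = test_function_cont_diff[OF u, of 1]
  have "normal_trace (interior (convex hull K)) \<tau> (row_div \<tau>) u = 0"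
    by (rule normal_trace_zero[OF K \<tau> u1]) (use test_function_zero[OF u] facet_not_interior[OF K] in auto)
  then show "(LINT x|lebesgue_on (interior (convex hull K)). \<tau> x *v grad u x)
      = - (LINT x|lebesgue_on (interior (convex hull K)). u x *\<^sub>R row_div \<tau> x)"
    using normal_trace_split(1)[OF open_interior bounded_cell_interior[OF K] sym_polys_continuous[OF \<tau>] u1
        L2_continuous[OF open_interior bounded_cell_interior[OF K] continuous_row_div[OF \<tau>]]]
    by (simp add: add_eq_0_iff2)
qed

text \<open>The support lies where all coordinates are at least 1 / (m + 1), a closed subset of the
  interior; \<open>Suc m\<close> keeps this bound positive.\<close>

lemma bump_test_function:
  assumes K: "cell K" and u: "smooth u"
  shows "test_function (interior (convex hull K)) (\<lambda>x. u x * bump (Suc m) K x)"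
proof -
  let ?C = "{x. \<forall>v\<in>K. lam v K x \<ge> 1 / real (Suc m)}"
  have "?C = (\<Inter>v\<in>K. {x. 1 / real (Suc m) \<le> lam v K x})" by auto
  then have cl: "closed ?C"
    by (auto intro!: closed_INT closed_Collect_le continuous_lam[OF K] continuous_intros)
  have sub: "?C \<subseteq> interior (convex hull K)"
    unfolding interior_cell[OF K]
  proof (clarify)
    fix x v assume "\<forall>v\<in>K. 1 / real (Suc m) \<le> lam v K x" "v \<in> K"
    then show "0 < lam v K x" by (smt (verit) divide_pos_pos of_nat_0_less_iff zero_less_Suc)
  qed
  have "{x. u x * bump (Suc m) K x \<noteq> 0} \<subseteq> ?C"
  proof (rule subsetI, rule ccontr)
    fix x assume x: "x \<in> {x. u x * bump (Suc m) K x \<noteq> 0}" and "x \<notin> ?C"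
    then obtain v where v: "v \<in> K" "lam v K x < 1 / real (Suc m)" by (auto simp: not_le)
    then have "real (Suc m) * lam v K x - 1 \<le> 0" by (simp add: field_simps)
    then have "cutoff (Suc m) v K x = 0" by (simp add: cutoff_def pw_def)
    then have "bump (Suc m) K x = 0" unfolding bump_def using v cell_finite[OF K] by (auto intro: prod_zero)
    then show False using x by simp
  qed
  then have c: "closure {x. u x * bump (Suc m) K x \<noteq> 0} \<subseteq> ?C" using cl by (rule closure_minimal)
  moreover have "smooth (\<lambda>x. u x * bump (Suc m) K x)"
    using u bump_cont_diff[OF K] by (auto simp: smooth_def intro: cont_diff_mult)
  moreover have "bounded (closure {x. u x * bump (Suc m) K x \<noteq> 0})"
    by (rule bounded_subset[OF bounded_cell_interior[OF K] order_trans[OF c sub]])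
  ultimately show ?thesis
    unfolding test_function_def using sub by (auto simp: compact_eq_bounded_closed)
qed

text \<open>Weak divergences are compared by test functions only. Cutting \<open>u\<close> off by
  bumps and passing to the limit extends the comparison to smooth functions that do not vanish on
  the boundary.\<close>

lemma weak_div_smooth:
  assumes K: "cell K" and g: "L2 (interior (convex hull K)) g" "weak_div (interior (convex hull K)) \<tau> g"
    and g': "L2 (interior (convex hull K)) g'" "weak_div (interior (convex hull K)) \<tau> g'"
    and \<tau>: "continuous_on UNIV \<tau>" and u: "smooth u"
  shows "(LINT x|lebesgue_on (interior (convex hull K)). u x *\<^sub>R g x) = (LINT x|lebesgue_on (interior (convex hull K)). u x *\<^sub>R g' x)"
proof -
  let ?D = "interior (convex hull K)"
  let ?u = "\<lambda>m x. u x * bump (Suc m) K x"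
  note D = open_interior[of "convex hull K"] bounded_cell_interior[OF K]
  have u1: "cont_diff 1 u" using u by (simp add: smooth_def)
  have um1: "cont_diff 1 (?u m)" for m by (rule test_function_cont_diff[OF bump_test_function[OF K u]])
  have lim: "(\<lambda>m. LINT x|lebesgue_on ?D. ?u m x *\<^sub>R h x) \<longlonglongrightarrow> (LINT x|lebesgue_on ?D. u x *\<^sub>R h x)"
    if h: "L2 ?D h" for h :: "real^'a \<Rightarrow> real^'a"
  proof (rule integral_dominated_convergence[where w = "\<lambda>x. norm (u x *\<^sub>R h x)"])
    note ih = normal_trace_split(2)[OF D \<tau> _ h]
    show "(\<lambda>x. u x *\<^sub>R h x) \<in> borel_measurable (lebesgue_on ?D)" using ih[OF u1] by auto
    show "(\<lambda>x. ?u m x *\<^sub>R h x) \<in> borel_measurable (lebesgue_on ?D)" for m using ih[OF um1[of m]] by auto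
    show "integrable (lebesgue_on ?D) (\<lambda>x. norm (u x *\<^sub>R h x))" using ih[OF u1] by (rule integrable_norm)
    show "AE x in lebesgue_on ?D. (\<lambda>m. ?u m x *\<^sub>R h x) \<longlonglongrightarrow> u x *\<^sub>R h x"
    proof (rule AE_I2)
      fix x assume "x \<in> space (lebesgue_on ?D)"
      then have "x \<in> ?D" by (simp add: space_restrict_space)
      then have "(\<lambda>m. bump (Suc m) K x) \<longlonglongrightarrow> 1" using bump_tendsto[OF K] LIMSEQ_Suc by blast
      then have "(\<lambda>m. (u x * bump (Suc m) K x) *\<^sub>R h x) \<longlonglongrightarrow> (u x * 1) *\<^sub>R h x" by (intro tendsto_intros)
      then show "(\<lambda>m. ?u m x *\<^sub>R h x) \<longlonglongrightarrow> u x *\<^sub>R h x" by simp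
    qed
    show "AE x in lebesgue_on ?D. norm (?u m x *\<^sub>R h x) \<le> norm (u x *\<^sub>R h x)" for m
    proof (rule AE_I2)
      fix x
      have "\<bar>u x\<bar> * bump (Suc m) K x \<le> \<bar>u x\<bar>" using bump_bounds[of "Suc m" K x] by (simp add: mult_left_le)
      then show "norm (?u m x *\<^sub>R h x) \<le> norm (u x *\<^sub>R h x)"
        using bump_bounds(1)[of "Suc m" K x] by (simp add: abs_mult mult_right_mono)
    qed
  qed
  have "(LINT x|lebesgue_on ?D. ?u m x *\<^sub>R g x) = (LINT x|lebesgue_on ?D. ?u m x *\<^sub>R g' x)" for m
  proof -
    have "- (LINT x|lebesgue_on ?D. ?u m x *\<^sub>R g x) = - (LINT x|lebesgue_on ?D. ?u m x *\<^sub>R g' x)"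
      using g(2)[unfolded weak_div_def, rule_format, OF bump_test_function[OF K u, of m]]
        g'(2)[unfolded weak_div_def, rule_format, OF bump_test_function[OF K u, of m]] by simp
    then show ?thesis by simp
  qed
  then show ?thesis using LIMSEQ_unique[OF lim[OF g(1)]] lim[OF g'(1)] by simp
qed

lemma Bdiv_I:
  assumes K: "cell K" and \<tau>: "\<tau> \<in> sym_polys (int k)"
    and 0: "\<And>v x. v \<in> K ==> x \<in> convex hull (K - {v}) ==> \<tau> x *v glam v K = 0"
  shows "\<tau> \<in> Bdiv k K"
proof -
  let ?D = "interior (convex hull K)"
  note D = open_interior[of "convex hull K"] bounded_cell_interior[OF K]
  note c\<tau> = sym_polys_continuous[OF \<tau>]
  have L2: "L2 ?D \<tau>" "L2 ?D (row_div \<tau>)" by (intro L2_continuous D c\<tau> continuous_row_div[OF \<tau>])+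
  have wd: "weak_div ?D \<tau> (row_div \<tau>)" by (rule weak_div_row_div[OF K \<tau>])
  have "normal_trace ?D \<tau> g u = 0" if g: "L2 ?D g" "weak_div ?D \<tau> g" and u: "smooth u" for g u
  proof -
    have u1: "cont_diff 1 u" using u by (simp add: smooth_def)
    \<comment> \<open>\<open>H0div\<close> quantifies over all weak divergences; each of them may be
      replaced by the classical one.\<close>
    have "normal_trace ?D \<tau> g u = normal_trace ?D \<tau> (row_div \<tau>) u"
      using normal_trace_split(1)[OF D c\<tau> u1 g(1)] normal_trace_split(1)[OF D c\<tau> u1 L2(2)]
        weak_div_smooth[OF K g L2(2) wd c\<tau> u] by simp
    also have "\<dots> = 0" by (rule normal_trace_zero[OF K \<tau> u1]) (simp add: 0)
    finally show ?thesis .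
  qed
  then show ?thesis
    unfolding Bdiv_def H0div_def Hdiv_def using \<tau> L2 wd by (auto simp: sym_polys_def)
qed

lemma cell_int_definite:
  assumes K: "cell K" and g: "continuous_on UNIV g" and pos: "\<And>x. x \<in> interior (convex hull K) ==> g x \<ge> 0"
    and 0: "cell_int K g = 0" and x: "x \<in> interior (convex hull K)"
  shows "g x = 0"
proof (rule ccontr)
  let ?D = "interior (convex hull K)"
  assume "g x \<noteq> 0"
  then have gx: "g x > 0" using pos[OF x] by simp
  have op: "open (?D \<inter> {y. 0 < g y})" by (intro open_Int open_Collect_less continuous_intros g) auto
  have "AE y in lborel. indicator ?D y * g y = 0"
    using 0 pos unfolding cell_int_def
    by (subst integral_nonneg_eq_0_iff_AE[symmetric, OF cell_integrable[OF K g]]) (auto simp: indicator_def)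
  then have "AE y in lborel. y \<notin> ?D \<inter> {y. 0 < g y}" by eventually_elim auto
  then have "emeasure lborel (?D \<inter> {y. 0 < g y}) = 0"
    using op by (subst (asm) AE_iff_measurable[where N = "?D \<inter> {y. 0 < g y}"]) auto
  then show False using emeasure_open_nonzero[OF op] x gx by blast
qed

lemma cell_int_scale: "cell_int K (\<lambda>x. a * g x) = a * cell_int K g"
  by (simp add: cell_int_def mult.left_commute)

text \<open>Euler's relation for \<open>\<theta>\<close>, homogeneous about \<open>v\<close>, evaluates the limit in \<open>facet_int_scaled\<close>.\<close>

lemma facet_int_hom:
  assumes K: "cell (K::(real^'n) set)" "v \<in> K" and R: "R \<in> hom (K - {v}) (int N)"
  shows "(\<lambda>m. facet_int m v K (\<lambda>x. R (\<lambda>u. lam u K x)))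
    \<longlonglongrightarrow> (real CARD('n) + real N) * cell_int K (\<lambda>x. R (\<lambda>u. lam u K x))"
proof -
  let ?\<theta> = "\<lambda>x. R (\<lambda>u. lam u K x)"
  have \<theta>: "cont_diff 1 ?\<theta>" by (rule polys_cont_diff[OF hom_lam_polys[OF K(1) R]])
  \<comment> \<open>The homogeneity of \<theta> is differentiated along the ray from
    \<open>v\<close> through \<open>x\<close>, at parameter 1.\<close>
  have euler: "grad ?\<theta> x \<bullet> (x - v) = real N * ?\<theta> x" for x
  proof -
    have lt: "lam u K (v + t *\<^sub>R (x - v)) = t * lam u K x" if "u \<in> K - {v}" for u t
      using lam_diff[OF K(1), of u "v + t *\<^sub>R (x - v)" v] lam_diff[OF K(1), of u x v] that K by (auto simp: lam_vertex)
    have "?\<theta> (v + t *\<^sub>R (x - v)) = R (\<lambda>u. t * lam u K x)" for t by (rule hom_cong[OF R]) (rule lt)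
    then have scaled: "?\<theta> (v + t *\<^sub>R (x - v)) = t ^ N * ?\<theta> x" for t using hom_scale_arg[OF R, of t] by simp
    have "((\<lambda>t. v + t *\<^sub>R (x - v)) has_derivative (\<lambda>t. t *\<^sub>R (x - v))) (at 1)"
      by (auto intro!: derivative_eq_intros)
    moreover have "(?\<theta> has_derivative (\<lambda>h. grad ?\<theta> x \<bullet> h)) (at (v + 1 *\<^sub>R (x - v)))"
      using has_derivative_grad[OF \<theta>] by simp
    ultimately have "((\<lambda>t. ?\<theta> (v + t *\<^sub>R (x - v))) has_derivative (\<lambda>t. grad ?\<theta> x \<bullet> (t *\<^sub>R (x - v)))) (at 1)"
      by (rule has_derivative_compose)
    then have "((\<lambda>t. t ^ N * ?\<theta> x) has_real_derivative grad ?\<theta> x \<bullet> (x - v)) (at 1)"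
      unfolding scaled has_field_derivative_def by (rule has_derivative_eq_rhs) (auto simp: mult.commute)
    moreover have "((\<lambda>t. t ^ N * ?\<theta> x) has_real_derivative real N * ?\<theta> x) (at 1)"
      by (auto intro!: derivative_eq_intros)
    ultimately show ?thesis by (rule DERIV_unique)
  qed
  have "pdiv (\<lambda>x. ?\<theta> x *\<^sub>R (x - v)) x = (real CARD('n) + real N) * ?\<theta> x" for x
  proof -
    have gi: "grad (\<lambda>x. x $ i - v $ i) x = axis i 1" for i x
      by (rule grad_eqI, rule has_derivative_eq_rhs[OF has_derivative_diff[OF
            bounded_linear_imp_has_derivative[OF bounded_linear_vec_nth] has_derivative_const]])
        (simp add: inner_axis' fun_eq_iff)
    have ci: "cont_diff 1 (\<lambda>x. x $ i - v $ i)" for i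
      using cont_diff_add[OF cont_diff_coord cont_diff_const, of 1 i "- v $ i"] by simp
    have "pdiv (\<lambda>x. ?\<theta> x *\<^sub>R (x - v)) x = (\<Sum>i\<in>UNIV. ?\<theta> x + (x - v) $ i * grad ?\<theta> x $ i)"
      unfolding pdiv_def by (simp add: grad_mult[OF \<theta> ci] gi)
    also have "\<dots> = real CARD('n) * ?\<theta> x + grad ?\<theta> x \<bullet> (x - v)"
      by (simp add: sum.distrib inner_vec_def mult.commute)
    finally show ?thesis by (simp only: euler distrib_right)
  qed
  then have "pdiv (\<lambda>x. ?\<theta> x *\<^sub>R (x - v)) = (\<lambda>x. (real CARD('n) + real N) * ?\<theta> x)" by (rule ext)
  then have "cell_int K (pdiv (\<lambda>x. ?\<theta> x *\<^sub>R (x - v))) = (real CARD('n) + real N) * cell_int K ?\<theta>"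
    by (simp only: cell_int_scale)
  then show ?thesis using facet_int_scaled[OF K \<theta>] by simp
qed

text \<open>Green's formula is tested with the bubble of the facet times the trace component itself.
  The bubble removes the other facets and leaves the facet integral of bubble times squared trace;
  by \<open>facet_int_hom\<close> its limit is a positive multiple of an integral over the cell with
  a nonnegative integrand.\<close>

lemma Bdiv_D:
  assumes K: "cell (K::(real^'n) set)" and \<tau>: "\<tau> \<in> Bdiv k K" and v: "v \<in> K" and x: "x \<in> convex hull (K - {v})"
  shows "\<tau> x *v glam v K = 0"
proof (rule iffD2[OF vec_eq_iff], rule allI)
  fix i
  let ?D = "interior (convex hull K)" and ?F = "K - {v}"
  note D = open_interior[of "convex hull K"] bounded_cell_interior[OF K]
  have \<tau>p: "\<tau> \<in> sym_polys (int k)" and \<tau>0: "\<tau> \<in> H0div ?D" using \<tau> by (auto simp: Bdiv_def)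
  have fin: "finite ?F" using cell_finite[OF K] by simp
  let ?h = "\<lambda>x. (\<tau> x *v glam v K) $ i"
  have h: "?h \<in> polys (int k)"
    unfolding matrix_vector_mult_def using \<tau>p polys_scale
    by (auto simp: sym_polys_def mult.commute intro!: polys_sum polys_scale)
  \<comment> \<open>Written in the coordinates of the facet alone, the trace extends to the cell as
    a function homogeneous about \<open>v\<close>, as \<open>facet_int_hom\<close> requires.\<close>
  then obtain P where P: "P \<in> hom ?F (int k)" "\<And>x. x \<in> affine hull ?F ==> ?h x = P (\<lambda>u. lam u K x)"
    using polys_hom[OF K Diff_subset h, of "{v}"] by auto
  let ?p = "\<lambda>x. P (\<lambda>u. lam u K x)"
  let ?u = "\<lambda>x. bub ?F K x * ?p x"
  let ?R = "\<lambda>y. (\<Prod>u\<in>?F. y u) * (P y * P y)"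
  have R: "?R \<in> hom ?F (int (card ?F + (k + k)))"
    using hom_mult[OF fin hom_prod[OF fin, of ?F "\<lambda>u y. y u" "\<lambda>_. 1"] hom_mult[OF fin P(1) P(1)]] hom_var[OF fin]
    by simp
  have u: "smooth ?u"
    by (intro smooth_mult polys_smooth[OF bub_polys[OF K]] polys_smooth[OF hom_lam_polys[OF K P(1)]])
  then have u1: "cont_diff 1 ?u" by (simp add: smooth_def)
  let ?w = "\<lambda>x. ?u x *\<^sub>R \<tau> x $ i"
  have w: "vec_c1 ?w" by (rule sym_polys_row_mult[OF \<tau>p u1])
  have cw: "continuous_on UNIV (\<lambda>x. glam l K \<bullet> ?w x)" for l by (intro continuous_intros vec_c1_continuous[OF w])
  have cR: "continuous_on UNIV (\<lambda>x. ?R (\<lambda>u. lam u K x))" by (rule continuous_polys[OF hom_lam_polys[OF K R]])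
  have gv: "glam v K \<bullet> ?w x = ?u x * ?h x" for x
    by (simp add: row_inner)
  have "L2 ?D (row_div \<tau>)" "weak_div ?D \<tau> (row_div \<tau>)"
    by (intro L2_continuous D continuous_row_div[OF \<tau>p] weak_div_row_div[OF K \<tau>p])+
  then have "normal_trace ?D \<tau> (row_div \<tau>) ?u = 0" using \<tau>0 u by (auto simp: H0div_def)
  then have "cell_int K (pdiv ?w) = 0" using normal_trace_cell[OF K \<tau>p u1, of i] by simp
  then have 1: "(\<lambda>m. \<Sum>l\<in>K. facet_int m l K (\<lambda>x. glam l K \<bullet> ?w x)) \<longlonglongrightarrow> 0"
    using Green_limit[OF K w] by simp
  have rest: "(\<lambda>m. \<Sum>l\<in>?F. facet_int m l K (\<lambda>x. glam l K \<bullet> ?w x)) \<longlonglongrightarrow> (\<Sum>l\<in>?F. 0)"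
  proof (intro tendsto_sum facet_int_vanish[OF K] cw)
    fix l x assume l: "l \<in> ?F" "x \<in> convex hull (K - {l})"
    then have "lam l K x = 0" using mem_convex_hull[OF K, of "K - {l}"] by auto
    then have "bub ?F K x = 0" unfolding bub_def using l fin by (auto intro: prod_zero)
    then show "glam l K \<bullet> ?w x = 0" by simp
  qed simp
  have 2: "(\<lambda>m. facet_int m v K (\<lambda>x. glam v K \<bullet> ?w x)) \<longlonglongrightarrow> 0"
    using tendsto_diff[OF 1 rest] by (simp add: sum.remove[OF cell_finite[OF K] v])
  have 3: "(\<lambda>m. facet_int m v K (\<lambda>x. ?R (\<lambda>u. lam u K x) + (-1) * (glam v K \<bullet> ?w x))) \<longlonglongrightarrow> 0"
  proof (rule facet_int_vanish[OF K v])
    fix x assume "x \<in> convex hull ?F"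
    then have "?h x = ?p x" using convex_hull_subset_affine_hull by (intro P(2)) blast
    then show "?R (\<lambda>u. lam u K x) + (-1) * (glam v K \<bullet> ?w x) = 0"
      unfolding gv by (simp add: bub_def)
  qed (intro continuous_intros cR cw)
  have c': "continuous_on UNIV (\<lambda>x. (-1) * (glam v K \<bullet> ?w x))" by (intro continuous_intros cw)
  have "(\<lambda>m. facet_int m v K (\<lambda>x. ?R (\<lambda>u. lam u K x))) \<longlonglongrightarrow> 0"
    using tendsto_add[OF 3 2] unfolding facet_int_add[OF K v cR c'] facet_int_scale by simp
  then have "(real CARD('n) + real (card ?F + (k + k))) * cell_int K (\<lambda>x. ?R (\<lambda>u. lam u K x)) = 0"
    by (rule LIMSEQ_unique[OF facet_int_hom[OF K v R]])
  then have 0: "cell_int K (\<lambda>x. ?R (\<lambda>u. lam u K x)) = 0"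
  proof -
    have "0 < real CARD('n)" by simp
    then have "real CARD('n) + real (card ?F + (k + k)) \<noteq> 0" by linarith
    then show ?thesis using \<open>_ * cell_int K _ = 0\<close> by (simp only: mult_eq_0_iff) blast
  qed
  have "?p x = 0" for x
  proof (rule polys_zero_on_cell[OF K hom_lam_polys[OF K P(1)]])
    fix y assume y: "y \<in> ?D"
    then have pos: "(\<Prod>u\<in>?F. lam u K y) > 0" if "y \<in> ?D" for y
      using that by (intro prod_pos) (auto simp: interior_cell[OF K])
    have "?R (\<lambda>u. lam u K y) = 0"
      by (rule cell_int_definite[OF K cR _ 0 y]) (rule mult_nonneg_nonneg[OF less_imp_le[OF pos] zero_le_square])
    then show "?p y = 0" using pos[OF y] by simp
  qed
  then show "(\<tau> x *v glam v K) $ i = 0 $ i"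
    using P(2)[of x] x convex_hull_subset_affine_hull by auto
qed

lemma Bdiv_iff:
  assumes "cell K"
  shows "\<tau> \<in> Bdiv k K \<longleftrightarrow>
    \<tau> \<in> sym_polys (int k) \<and> (\<forall>v\<in>K. \<forall>x\<in>convex hull (K - {v}). \<tau> x *v glam v K = 0)"
  using Bdiv_I[OF assms] Bdiv_D[OF assms] by (auto simp: Bdiv_def)

section \<open>The barycentric split of a simplex\<close>

lemma sym_tensor_mult: "sym_part (tensor u v) *v n = (1/2) *\<^sub>R ((v \<bullet> n) *\<^sub>R u + (u \<bullet> n) *\<^sub>R v)"
  by (simp add: vec_eq_iff sym_part_def tensor_def matrix_vector_mult_def inner_vec_def transpose_def
      sum.distrib distrib_right distrib_left sum_distrib_left sum_divide_distrib add_divide_distrib mult.commute mult.left_commute)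

lemma sym_tensor_transpose: "transpose (sym_part (tensor u v)) = sym_part (tensor u v)"
  by (simp add: vec_eq_iff sym_part_def tensor_def transpose_def)

lemma sym_tensors_transpose: "A \<in> sym_tensors U V ==> transpose A = A"
  unfolding sym_tensors_def
proof (induction rule: span_induct_alt)
  case base show ?case by (simp add: transpose_def vec_eq_iff)
next
  case (step c x y)
  then have "transpose x = x" by (auto simp: sym_tensor_transpose)
  then show ?case using step(2) by (simp add: transpose_def vec_eq_iff)
qed

lemma sym_tensorsI: "u \<in> U ==> v \<in> V ==> sym_part (tensor u v) \<in> sym_tensors U V"
  unfolding sym_tensors_def by (rule span_base) blast

lemma NS_transpose: "A \<in> NS f ==> transpose A = A"
proof -
  assume "A \<in> NS f"
  then obtain B C where "A = B + C" "transpose B = B" "transpose C = C"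
    unfolding NS_def SS_def using sym_tensors_transpose by blast
  then show ?thesis by (simp add: transpose_def vec_eq_iff)
qed

lemma tan_nor_decompose: "\<exists>t\<in>tan_space f. u - t \<in> nor_space f"
proof -
  obtain y z where "y \<in> span (tan_space f)" "\<And>w. w \<in> span (tan_space f) ==> orthogonal z w" "u = y + z"
    using orthogonal_subspace_decomp_exists[of "tan_space f" u] by blast
  moreover have "span (tan_space f) = tan_space f" by (simp add: tan_space_def)
  ultimately show ?thesis
    unfolding nor_space_def by (intro bexI[of _ y]) (auto simp: orthogonal_comp_def orthogonal_commute)
qed

text \<open>Removing the tangential-tangential part of a symmetric tensor does not change its action
  on the normals of \<open>f\<close>, so \<open>NS f\<close> still realizes the traces of constant
  symmetric tensors on the facets through \<open>f\<close>.\<close>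

lemma NS_part: "\<exists>A\<in>NS f. \<forall>n\<in>nor_space f. A *v n = sym_part (tensor u v) *v n"
proof -
  obtain s t where s: "s \<in> tan_space f" "u - s \<in> nor_space f" and t: "t \<in> tan_space f" "v - t \<in> nor_space f"
    using tan_nor_decompose by meson
  let ?A = "sym_part (tensor (u - s) (v - t)) + (sym_part (tensor s (v - t)) + sym_part (tensor t (u - s)))"
  have "sym_part (tensor (u - s) (v - t)) \<in> SS (nor_space f)"
    unfolding SS_def by (rule sym_tensorsI[OF s(2) t(2)])
  moreover have "sym_part (tensor s (v - t)) + sym_part (tensor t (u - s)) \<in> sym_tensors (tan_space f) (nor_space f)"
    using sym_tensorsI[OF s(1) t(2)] sym_tensorsI[OF t(1) s(2)] unfolding sym_tensors_def by (rule span_add)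
  ultimately have "?A \<in> NS f" unfolding NS_def by blast
  moreover have "?A *v n = sym_part (tensor u v) *v n" if "n \<in> nor_space f" for n
    using nor_tan_orth[OF that s(1)] nor_tan_orth[OF that t(1)]
    by (simp add: matrix_vector_mult_add_rdistrib sym_tensor_mult inner_diff_left inner_commute[of _ n] algebra_simps)
  ultimately show ?thesis by blast
qed

lemma transpose_inner: "transpose A = A ==> x \<bullet> (A *v y) = y \<bullet> (A *v x)" for A :: "real^'n^'n"
  by (metis dot_lmul_matrix inner_commute transpose_matrix_vector)

lemma matrix_vector_mult_span:
  assumes "n \<in> span S" "\<And>s. s \<in> S ==> A *v s = B *v s"
  shows "A *v n = B *v (n :: real^'n)"
  using assms(1)
  by (induction rule: span_induct_alt) (simp_all add: matrix_vector_right_distrib matrix_vector_mult_scaleR assms(2))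

lemma bub_zero:
  assumes "cell K" "f' \<subseteq> K" "x \<in> convex hull f'" "\<not> f \<subseteq> f'" "finite f"
  shows "bub f K x = 0"
proof -
  obtain v where v: "v \<in> f" "v \<notin> f'" using assms(4) by blast
  have "lam v K x = 0"
    using mem_convex_hull[OF assms(1,2), of x] assms(3) v lam_outside[OF assms(1), of v] by (cases "v \<in> K") auto
  then show ?thesis unfolding bub_def using v assms(5) by (auto intro: prod_zero)
qed

definition bub_hom :: "(real^'n) set \<Rightarrow> ((real^'n \<Rightarrow> real) \<Rightarrow> real) \<Rightarrow> (real^'n) set \<Rightarrow> real^'n \<Rightarrow> real" where
  "bub_hom f P K x = bub f K x * P (\<lambda>v. lam v K x)"

lemma bub_hom_polys:
  assumes "cell K" "P \<in> hom f (int k - int l - 1)" "card f = l + 1"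
  shows "bub_hom f P K \<in> polys (int k)"
  unfolding bub_hom_def[abs_def]
  using polys_mult[OF bub_polys[OF assms(1), of f] hom_lam_polys[OF assms(1,2)]] assms(3) by simp

lemma bub_hom_single_valued:
  assumes "cell K" "cell K'" "f' \<subseteq> K" "f' \<subseteq> K'" "x \<in> convex hull f'"
  shows "bub_hom f P K x = bub_hom f P K' x"
proof -
  have "x \<in> affine hull (K \<inter> K')"
    using assms(3-5) convex_hull_subset_affine_hull hull_mono[of f' "K \<inter> K'" affine] by blast
  then show ?thesis using lam_indep_cell[OF assms(1,2)] by (simp add: bub_hom_def bub_def)
qed

lemma bub_hom_zero:
  assumes "cell K" "f' \<subseteq> K" "x \<in> convex hull f'" "\<not> f \<subseteq> f'" "finite f"
  shows "bub_hom f P K x = 0"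
  using bub_zero[OF assms] by (simp add: bub_hom_def)

lemma scaled_sym_polys: "p \<in> polys r ==> transpose A = A ==> (\<lambda>x. p x *\<^sub>R A) \<in> sym_polys r"
  unfolding sym_polys_def by (auto simp: mult.commute[of "p _"] transpose_def vec_eq_iff intro!: polys_scale)

lemma sym_polys_add: "p \<in> sym_polys r ==> q \<in> sym_polys r ==> (\<lambda>x. p x + q x) \<in> sym_polys r"
  unfolding sym_polys_def by (auto simp: transpose_def vec_eq_iff intro!: polys_add)

lemma sym_polys_scale: "p \<in> sym_polys r ==> (\<lambda>x. a *\<^sub>R p x) \<in> sym_polys r"
  unfolding sym_polys_def by (auto simp: transpose_def vec_eq_iff intro!: polys_scale)

lemma sym_polys_zero: "(\<lambda>x. 0) \<in> sym_polys r"
  unfolding sym_polys_def by (auto simp: transpose_def vec_eq_iff polys_zero)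

locale split_simplex =
  fixes T :: "(real^'n) set"
  assumes cell_T: "cell T" and dim2: "CARD('n) \<ge> 2"
begin

abbreviation "c \<equiv> barycenter T"
abbreviation "g v \<equiv> glam v T"
abbreviation "sub i \<equiv> subcell T i"
abbreviation "interior_facets \<equiv> interior_faces (CARD('n) - 1) {T}"

lemma finite_T: "finite T" by (rule cell_finite[OF cell_T])

lemma card_T: "card T = CARD('n) + 1" using cell_T by (simp add: cell_def)

lemma lam_c: "v \<in> T ==> lam v T c = 1 / (real CARD('n) + 1)"
proof -
  assume v: "v \<in> T"
  have "c = (\<Sum>v\<in>T. (1 / real (card T)) *\<^sub>R v)" by (simp add: barycenter_def scaleR_sum_right)
  moreover have "(\<Sum>v\<in>T. 1 / real (card T)) = 1" by (simp add: card_T)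
  ultimately show ?thesis using lam_comb'[OF cell_T, of "\<lambda>_. 1 / real (card T)" T v] v by (simp add: card_T add.commute)
qed

lemma c_notin: "c \<notin> T"
proof
  assume "c \<in> T"
  then show False using lam_c[of c] lam_vertex[OF cell_T, of c c] dim2 by simp
qed

lemma c_interior: "c \<in> interior (convex hull T)"
  unfolding interior_cell[OF cell_T] by (auto simp: lam_c intro!: divide_pos_pos add_nonneg_pos)

lemma cell_sub: "i \<in> T ==> cell (sub i)"
proof -
  assume i: "i \<in> T"
  have "c \<notin> affine hull (T - {i})"
  proof
    assume "c \<in> affine hull (T - {i})"
    then have "lam i T c = 0" using mem_affine_hull[OF cell_T, of "T - {i}"] i by auto
    moreover have "1 / (real CARD('n) + 1) \<noteq> 0" by (simp add: add_nonneg_eq_0_iff)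
    ultimately show False using lam_c[OF i] by simp
  qed
  moreover have "\<not> affine_dependent (T - {i})"
    using cell_T affine_independent_subset[of T "T - {i}"] by (auto simp: cell_def)
  ultimately have "\<not> affine_dependent (sub i)" unfolding subcell_def by (intro affine_independent_insert)
  moreover have "card (sub i) = CARD('n) + 1"
    using c_notin i by (simp add: subcell_def finite_T card_T)
  ultimately show ?thesis by (simp add: cell_def)
qed

text \<open>All coordinates of \<open>T\<close> agree at the barycenter, so subtracting that of
  \<open>i\<close> removes the value there and keeps the values at the remaining vertices of the
  cell.\<close>

lemma lam_sub: "i \<in> T ==> j \<in> T ==> j \<noteq> i ==> lam j (sub i) = (\<lambda>x. lam j T x - lam i T x)"
  by (rule lam_eqI[OF cell_sub]) (auto intro: polys_minus lam_polys[OF cell_T] simp: subcell_def lam_c lam_vertex[OF cell_T] c_notin)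

lemma lam_sub_c: "i \<in> T ==> lam c (sub i) = (\<lambda>x. (real CARD('n) + 1) * lam i T x)"
proof (rule lam_eqI[OF cell_sub])
  assume i: "i \<in> T"
  fix w assume w: "w \<in> sub i"
  have "real CARD('n) + 1 \<noteq> 0" by (simp add: add_nonneg_eq_0_iff)
  then show "(real CARD('n) + 1) * lam i T w = (if w = c then 1 else 0)"
    using w i c_notin by (auto simp: subcell_def lam_c lam_vertex[OF cell_T])
qed (auto intro: polys_scale lam_polys[OF cell_T])

lemma glam_sub:
  assumes "i \<in> T" "j \<in> T" "j \<noteq> i" shows "glam j (sub i) = g j - g i"
proof (rule glam_eqI[OF cell_sub[OF assms(1)], of _ "lam j T 0 - lam i T 0"])
  fix x
  show "lam j (sub i) x = lam j T 0 - lam i T 0 + (g j - g i) \<bullet> x"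
    using lam_affine[OF cell_T, of i x] lam_affine[OF cell_T, of j x] assms
    by (simp add: lam_sub inner_diff_left)
qed

lemma glam_sub_c: "i \<in> T ==> glam c (sub i) = (real CARD('n) + 1) *\<^sub>R g i"
proof (rule glam_eqI[OF cell_sub, of _ _ "(real CARD('n) + 1) * lam i T 0"])
  fix x assume "i \<in> T"
  then show "lam c (sub i) x = (real CARD('n) + 1) * lam i T 0 + (real CARD('n) + 1) *\<^sub>R g i \<bullet> x"
    using lam_affine[OF cell_T, of i x] by (simp add: lam_sub_c distrib_left)
qed

lemma sub_inj: "i \<in> T ==> j \<in> T ==> sub i = sub j \<longleftrightarrow> i = j"
proof
  assume *: "i \<in> T" "j \<in> T" "sub i = sub j"
  then have "j \<notin> sub i" using c_notin by (auto simp: subcell_def)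
  then show "i = j" using *(2) by (auto simp: subcell_def)
qed simp

lemma split_iff: "K \<in> split T \<longleftrightarrow> (\<exists>i\<in>T. K = sub i)"
  by (auto simp: split_def)

lemma facet_sub: "i \<in> T ==> j \<in> T ==> sub i - {j} = insert c (T - {i, j})"
  using c_notin by (auto simp: subcell_def)

lemma faces_T: "f \<in> faces l {T} \<longleftrightarrow> f \<subseteq> T \<and> card f = l + 1"
  by (simp add: faces_def)

lemma interior_faces_T: "f \<in> interior_faces l {T} \<longleftrightarrow> c \<in> f \<and> card f = l + 1 \<and> (\<exists>i\<in>T. f \<subseteq> sub i)"
  using c_notin by (auto simp: interior_faces_def faces_def refine_def split_def subcell_def)

lemma interior_face_subset: "f \<in> interior_faces l {T} ==> c \<in> f" "f \<in> interior_faces l {T} ==> f \<subseteq> insert c T"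
  "f \<in> interior_faces l {T} ==> finite f"
  unfolding interior_faces_T using finite_T by (auto simp: subcell_def intro: finite_subset[of _ "insert c T"])

lemma interior_facetE:
  assumes "F \<in> interior_facets"
  obtains i j where "i \<in> T" "j \<in> T" "i \<noteq> j" "F = sub i - {j}" "F = sub j - {i}"
proof -
  obtain i where i: "i \<in> T" "F \<subseteq> sub i" and F: "c \<in> F" "card F = CARD('n)"
    using assms dim2 by (auto simp: interior_faces_T)
  have cs: "card (sub i) = CARD('n) + 1" "finite (sub i)" using cell_sub[OF i(1)] cell_finite by (auto simp: cell_def)
  then have "card (sub i - F) = 1" using F i(2) by (simp add: card_Diff_subset finite_subset)
  then obtain j where j: "sub i - F = {j}" by (auto simp: card_1_singleton_iff)
  then have "F = sub i - {j}" using i(2) by auto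
  moreover have "j \<in> T" "j \<noteq> i" using j F(1) i(1) c_notin by (auto simp: subcell_def)
  ultimately show ?thesis using that[of i j] i(1) facet_sub[of i j] facet_sub[of j i] by (metis insert_commute)
qed

lemma interior_facetI:
  assumes "i \<in> T" "j \<in> T" "i \<noteq> j"
  shows "sub i - {j} \<in> interior_facets"
proof -
  have "card (sub i - {j}) = CARD('n)"
    using cell_sub[OF assms(1)] assms c_notin by (auto simp: cell_def subcell_def)
  then show ?thesis using assms c_notin dim2 unfolding interior_faces_T by (auto simp: subcell_def)
qed

lemma facet_sub_commute: "i \<in> T ==> j \<in> T ==> sub i - {j} = sub j - {i}"
  by (simp add: facet_sub insert_commute)

lemma cells_containing_facet:
  assumes "i \<in> T" "j \<in> T" "i \<noteq> j" "l \<in> T" "sub i - {j} \<subseteq> sub l"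
  shows "l = i \<or> l = j"
  using assms c_notin by (auto simp: facet_sub subcell_def)

end

section \<open>The local space and the continuity shared by its generators\<close>

locale local_space = split_simplex T for T :: "(real^'n) set" +
  fixes nrm :: "(real^'n) set \<Rightarrow> real^'n" and v0 :: "(real^'n) set \<Rightarrow> real^'n" and k :: nat
  assumes k1: "1 \<le> k"
    and unit_nrm: "\<And>F. F \<in> faces (CARD('n) - 1) (refine {T}) ==> unit_normal F (nrm F)"
    and v0_mem: "\<And>l f. l < CARD('n) ==> f \<in> faces l {T} ==> v0 f \<in> f"
begin

lemma refine_T: "refine {T} = split T" by (simp add: refine_def)

lemma nrm_facet:
  assumes "i \<in> T" "j \<in> sub i"
  obtains s where "s \<noteq> 0" "nrm (sub i - {j}) = s *\<^sub>R glam j (sub i)"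
proof -
  have "card (sub i - {j}) = CARD('n)" using cell_sub[OF assms(1)] assms(2) by (simp add: cell_def)
  then have "sub i - {j} \<in> faces (CARD('n) - 1) (refine {T})"
    unfolding refine_T faces_def using assms(1) dim2 by (auto simp: split_def)
  then have "unit_normal (sub i - {j}) (nrm (sub i - {j}))" by (rule unit_nrm)
  then show ?thesis using unit_normal_glam[OF cell_sub[OF assms(1)] assms(2)] that by metis
qed

lemma nrm_boundary:
  assumes "i \<in> T"
  obtains s where "s \<noteq> 0" "nrm (T - {i}) = s *\<^sub>R g i"
proof -
  have "sub i - {c} = T - {i}" using c_notin by (auto simp: subcell_def)
  then obtain s where "s \<noteq> 0" "nrm (T - {i}) = s *\<^sub>R glam c (sub i)"
    using nrm_facet[OF assms, of c] by (auto simp: subcell_def)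
  then show ?thesis using that[of "s * (real CARD('n) + 1)"] assms by (simp add: glam_sub_c add_nonneg_eq_0_iff)
qed

lemma nrm_interior:
  assumes "i \<in> T" "j \<in> T" "i \<noteq> j"
  obtains s where "s \<noteq> 0" "nrm (sub i - {j}) = s *\<^sub>R (g i - g j)"
proof -
  obtain s where "s \<noteq> 0" "nrm (sub i - {j}) = s *\<^sub>R glam j (sub i)"
    using nrm_facet[OF assms(1), of j] assms by (auto simp: subcell_def)
  then show ?thesis using that[of "- s"] assms by (simp add: glam_sub algebra_simps)
qed

text \<open>\<open>g i - g j\<close> is an unnormalized normal of the common facet of the two
  cells.\<close>

definition normal_continuous :: "'n field \<Rightarrow> bool" where
  "normal_continuous \<tau> \<longleftrightarrow> (\<forall>i\<in>T. \<forall>j\<in>T. i \<noteq> j \<longrightarrow> (\<forall>x\<in>convex hull (sub i - {j}).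
      \<tau> (sub i) x *v (g i - g j) = \<tau> (sub j) x *v (g i - g j)))"

text \<open>Makes the degrees of freedom (b) independent of the cell from which the trace is
  taken.\<close>

definition nn_continuous :: "'n field \<Rightarrow> bool" where
  "nn_continuous \<tau> \<longleftrightarrow> (\<forall>f. \<forall>i\<in>T. \<forall>j\<in>T. c \<in> f \<longrightarrow> f \<subseteq> sub i \<longrightarrow> f \<subseteq> sub j \<longrightarrow>
      (\<forall>x\<in>convex hull f. \<forall>m\<in>nor_space f. \<forall>n\<in>nor_space f. m \<bullet> (\<tau> (sub i) x *v n) = m \<bullet> (\<tau> (sub j) x *v n)))"

text \<open>All that the uniqueness proof uses about an element of the local space. The condition is
  linear in the field, so it can be checked on generators.\<close>

definition conforming :: "'n field \<Rightarrow> bool" where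
  "conforming \<tau> \<longleftrightarrow> (\<forall>K. K \<notin> split T \<longrightarrow> \<tau> K = (\<lambda>x. 0)) \<and> (\<forall>K\<in>split T. \<tau> K \<in> sym_polys (int k)) \<and>
      normal_continuous \<tau> \<and> nn_continuous \<tau>"

lemma normal_continuousD:
  "normal_continuous \<tau> ==> i \<in> T ==> j \<in> T ==> i \<noteq> j ==> x \<in> convex hull (sub i - {j}) ==>
    \<tau> (sub i) x *v (g i - g j) = \<tau> (sub j) x *v (g i - g j)"
  unfolding normal_continuous_def by blast

lemma nn_continuousD:
  "nn_continuous \<tau> ==> i \<in> T ==> j \<in> T ==> c \<in> f ==> f \<subseteq> sub i ==> f \<subseteq> sub j ==> x \<in> convex hull f ==>
    m \<in> nor_space f ==> n \<in> nor_space f ==> m \<bullet> (\<tau> (sub i) x *v n) = m \<bullet> (\<tau> (sub j) x *v n)"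
  unfolding nn_continuous_def by blast

lemma field_add_apply: "(\<tau> + \<sigma>) K x = \<tau> K x + \<sigma> K x" for \<tau> \<sigma> :: "'n field"
  by simp

lemma conforming_subspace: "field.subspace {\<tau>. conforming \<tau>}"
  unfolding field.subspace_def
proof (intro conjI ballI allI)
  show "0 \<in> {\<tau>. conforming \<tau>}"
    by (auto simp: conforming_def normal_continuous_def nn_continuous_def sym_polys_zero zero_fun_def)
next
  fix \<tau> \<sigma> :: "'n field"
  assume "\<tau> \<in> {\<tau>. conforming \<tau>}" "\<sigma> \<in> {\<tau>. conforming \<tau>}"
  then have \<tau>: "conforming \<tau>" and \<sigma>: "conforming \<sigma>" by auto
  have "normal_continuous (\<tau> + \<sigma>)"
    unfolding normal_continuous_def field_add_apply matrix_vector_mult_add_rdistrib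
    using \<tau> \<sigma> by (intro ballI impI arg_cong2[where f = "(+)"] normal_continuousD) (simp_all add: conforming_def)
  moreover have "nn_continuous (\<tau> + \<sigma>)"
    unfolding nn_continuous_def field_add_apply matrix_vector_mult_add_rdistrib inner_add_right
    using \<tau> \<sigma> by (intro allI ballI impI arg_cong2[where f = "(+)"] nn_continuousD) (simp_all add: conforming_def)
  moreover have "(\<tau> + \<sigma>) K = (\<lambda>x. \<tau> K x + \<sigma> K x)" for K by (rule ext) simp
  ultimately show "\<tau> + \<sigma> \<in> {\<tau>. conforming \<tau>}"
    using \<tau> \<sigma> by (simp add: conforming_def sym_polys_add zero_fun_def)
next
  fix a and \<tau> :: "'n field" assume "\<tau> \<in> {\<tau>. conforming \<tau>}"
  then have \<tau>: "conforming \<tau>" by simp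
  have "normal_continuous (scale_field a \<tau>)"
    unfolding normal_continuous_def scale_field_def scaleR_matrix_vector_assoc[symmetric]
    using \<tau> by (intro ballI impI arg_cong[where f = "scaleR a"] normal_continuousD) (simp_all add: conforming_def)
  moreover have "nn_continuous (scale_field a \<tau>)"
    unfolding nn_continuous_def scale_field_def scaleR_matrix_vector_assoc[symmetric] inner_scaleR_right
    using \<tau> by (intro allI ballI impI arg_cong[where f = "(*) a"] nn_continuousD) (simp_all add: conforming_def)
  ultimately show "scale_field a \<tau> \<in> {\<tau>. conforming \<tau>}"
    using \<tau> by (simp add: conforming_def scale_field_def sym_polys_scale)
qed

text \<open>The bubble of \<open>f\<close> vanishes on every face that does not contain
  \<open>f\<close> and is single-valued on the others, so only the cellwise constant tensors have to
  be compared, and only on faces containing \<open>f\<close>.\<close>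

lemma conforming_bub:
  assumes f: "card f = l + 1" and P: "P \<in> hom f (int k - int l - 1)"
    and tr: "\<And>K. transpose (A K) = A K"
    and nc: "\<And>i j. i \<in> T ==> j \<in> T ==> i \<noteq> j ==> f \<subseteq> sub i - {j} ==> A (sub i) *v (g i - g j) = A (sub j) *v (g i - g j)"
    and nn: "\<And>f' i j m n. i \<in> T ==> j \<in> T ==> c \<in> f' ==> f \<subseteq> f' ==> f' \<subseteq> sub i ==> f' \<subseteq> sub j ==>
      m \<in> nor_space f' ==> n \<in> nor_space f' ==> m \<bullet> (A (sub i) *v n) = m \<bullet> (A (sub j) *v n)"
  shows "conforming (restrict_field (split T) (\<lambda>K x. bub_hom f P K x *\<^sub>R A K))" (is "conforming ?\<tau>")
proof -
  have fin: "finite f" using f by (metis card.infinite add_is_0 zero_neq_one)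
  have \<tau>: "?\<tau> (sub i) x = bub_hom f P (sub i) x *\<^sub>R A (sub i)" if "i \<in> T" for i x
    using that by (auto simp: restrict_field_def split_iff)
  have "?\<tau> K \<in> sym_polys (int k)" if "K \<in> split T" for K
    using that scaled_sym_polys[OF bub_hom_polys[OF cell_sub P f] tr] by (auto simp: restrict_field_def split_iff)
  moreover have "normal_continuous ?\<tau>"
    unfolding normal_continuous_def
  proof (intro ballI impI)
    fix i j x assume ij: "i \<in> T" "j \<in> T" "i \<noteq> j" and x: "x \<in> convex hull (sub i - {j})"
    have sub: "sub i - {j} \<subseteq> sub i" "sub i - {j} \<subseteq> sub j" using facet_sub_commute[of i j] ij by auto
    show "?\<tau> (sub i) x *v (g i - g j) = ?\<tau> (sub j) x *v (g i - g j)"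
    proof (cases "f \<subseteq> sub i - {j}")
      case True
      have "bub_hom f P (sub i) x = bub_hom f P (sub j) x"
        by (rule bub_hom_single_valued[OF cell_sub cell_sub sub x]) (use ij in auto)
      then show ?thesis using nc[OF ij True] ij by (simp add: \<tau> scaleR_matrix_vector_assoc[symmetric])
    next
      case False
      then show ?thesis
        using bub_hom_zero[OF cell_sub sub(1) x False fin] bub_hom_zero[OF cell_sub sub(2) x False fin] ij
        by (simp add: \<tau>)
    qed
  qed
  moreover have "nn_continuous ?\<tau>"
    unfolding nn_continuous_def
  proof (intro allI ballI impI)
    fix f' i j x m n assume *: "i \<in> T" "j \<in> T" "c \<in> f'" "f' \<subseteq> sub i" "f' \<subseteq> sub j" "x \<in> convex hull f'"
      "m \<in> nor_space f'" "n \<in> nor_space f'"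
    show "m \<bullet> (?\<tau> (sub i) x *v n) = m \<bullet> (?\<tau> (sub j) x *v n)"
    proof (cases "f \<subseteq> f'")
      case True
      have "bub_hom f P (sub i) x = bub_hom f P (sub j) x"
        by (rule bub_hom_single_valued[OF cell_sub cell_sub *(4-6)]) (use * in auto)
      then show ?thesis using nn[OF *(1-3) True *(4,5,7,8)] *
        by (simp add: \<tau> scaleR_matrix_vector_assoc[symmetric])
    next
      case False
      then show ?thesis
        using bub_hom_zero[OF cell_sub *(4,6) False fin] bub_hom_zero[OF cell_sub *(5,6) False fin] *
        by (simp add: \<tau>)
    qed
  qed
  ultimately show ?thesis by (simp add: conforming_def restrict_field_def)
qed

lemma bubbles_subset:
  assumes "\<And>P A. P \<in> hom f (int k - int l - 1) ==> A \<in> V ==>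
      conforming (restrict_field (split T) (\<lambda>K x. bub_hom f P K x *\<^sub>R A K))"
  shows "bubbles k l T f V \<subseteq> {\<tau>. conforming \<tau>}"
  unfolding bubbles_def
  by (rule field.span_minimal[OF _ conforming_subspace])
    (use assms in \<open>auto simp: hom_polys_eq bub_hom_def\<close>)

lemma phi_sub: "i \<in> T ==> j \<in> T ==> p \<in> T ==> phi v0 T f i j (sub p) =
    (if p = i then sym_part (tensor (c - v0 f) (j - v0 f)) else 0) - (if p = j then sym_part (tensor (c - v0 f) (i - v0 f)) else 0)"
  by (simp add: phi_def sub_inj)

lemma glam_vertex_T: "l \<in> T ==> v \<in> T ==> a \<in> T ==> l \<noteq> a ==> g l \<bullet> (v - a) = (if v = l then 1 else 0)"
  by (auto simp: glam_vertex[OF cell_T])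

lemma glam_c: "l \<in> T ==> a \<in> T ==> l \<noteq> a ==> g l \<bullet> (c - a) = 1 / (real CARD('n) + 1)"
  by (simp add: lam_diff[OF cell_T] lam_c lam_vertex[OF cell_T])

text \<open>Let a be the vertex \<open>v0 f\<close>. The edge c - a is orthogonal to
  \<open>g p - g q\<close>, so the tensors map this normal to multiples of c - a; these are equal on
  the two cells if \<open>p\<close> and \<open>q\<close> are \<open>i\<close> and \<open>j\<close>,
  and zero otherwise. On faces containing \<open>f\<close> and the barycenter the edge c - a is
  tangential, which leaves no normal-normal part.\<close>

lemma conforming_phi:
  assumes f: "f \<in> faces l {T}" "l < CARD('n)" and P: "P \<in> hom f (int k - int l - 1)"
    and ij: "i \<in> T - f" "j \<in> T - f" "i \<noteq> j"
  shows "conforming (restrict_field (split T) (\<lambda>K x. bub_hom f P K x *\<^sub>R phi v0 T f i j K))"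
proof (rule conforming_bub[OF _ P])
  let ?a = "v0 f"
  have a: "?a \<in> f" "f \<subseteq> T" by (use v0_mem[OF f(2,1)] f in \<open>auto simp: faces_T\<close>)
  then have aT: "?a \<in> T" by blast
  show "card f = l + 1" using f by (simp add: faces_T)
  show "transpose (phi v0 T f i j K) = phi v0 T f i j K" for K
    using sym_tensor_transpose by (auto simp: phi_def transpose_def vec_eq_iff)
  show "phi v0 T f i j (sub p) *v (g p - g q) = phi v0 T f i j (sub q) *v (g p - g q)"
    if pq: "p \<in> T" "q \<in> T" "p \<noteq> q" "f \<subseteq> sub p - {q}" for p q
  proof -
    have ap: "p \<noteq> ?a" "q \<noteq> ?a" using pq a c_notin by (auto simp: subcell_def)
    have 0: "(c - ?a) \<bullet> (g p - g q) = 0"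
      using glam_c[OF pq(1) aT ap(1)] glam_c[OF pq(2) aT ap(2)] by (simp add: inner_diff_right inner_commute[of "c - ?a"])
    have "(v - ?a) \<bullet> (g p - g q) = (if v = p then 1 else 0) - (if v = q then 1 else 0)" if "v \<in> T" for v
      using glam_vertex_T[OF pq(1) that aT ap(1)] glam_vertex_T[OF pq(2) that aT ap(2)]
      by (simp add: inner_diff_right inner_commute[of "v - ?a"])
    then have e: "sym_part (tensor (c - ?a) (v - ?a)) *v (g p - g q)
        = ((if v = p then 1 / 2 else 0) - (if v = q then 1 / 2 else 0)) *\<^sub>R (c - ?a)" if "v \<in> T" for v
      using that by (simp add: sym_tensor_mult 0)
    have "phi v0 T f i j (sub r) *v (g p - g q)
        = (if r = i then sym_part (tensor (c - ?a) (j - ?a)) *v (g p - g q) else 0)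
          - (if r = j then sym_part (tensor (c - ?a) (i - ?a)) *v (g p - g q) else 0)" if "r \<in> T" for r
      using that ij by (simp add: phi_sub matrix_vector_mult_diff_rdistrib)
    then show ?thesis using ij pq(1-3) e[of i] e[of j] by auto
  qed
  fix f' p q m n assume *: "p \<in> T" "q \<in> T" "c \<in> f'" "f \<subseteq> f'" "m \<in> nor_space f'" "n \<in> nor_space f'"
  have "?a \<in> f'" using a *(4) by blast
  then have "m \<bullet> (c - ?a) = 0" "n \<bullet> (c - ?a) = 0" using *(3,5,6) by (auto simp: nor_space_iff)
  then have "m \<bullet> (phi v0 T f i j (sub r) *v n) = 0" if "r \<in> T" for r
    using that ij by (auto simp: phi_sub matrix_vector_mult_diff_rdistrib sym_tensor_mult inner_diff_right inner_commute[of _ n])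
  then show "m \<bullet> (phi v0 T f i j (sub p) *v n) = m \<bullet> (phi v0 T f i j (sub q) *v n)" using * by simp
qed

lemma conforming_const:
  assumes "card f = l + 1" "P \<in> hom f (int k - int l - 1)" "transpose A = A"
  shows "conforming (restrict_field (split T) (\<lambda>K x. bub_hom f P K x *\<^sub>R A))"
  by (rule conforming_bub[OF assms(1,2)]) (simp_all add: assms(3))

definition tn_tensor :: "(real^'n) set \<Rightarrow> real^'n \<Rightarrow> ((real^'n) set \<Rightarrow> real^'n) \<Rightarrow> (real^'n) set \<Rightarrow> real^'n^'n" where
  "tn_tensor F t n K = (if F \<subseteq> K then sym_part (tensor t (n K)) else 0)"

text \<open>\<open>t\<close> is tangential to \<open>f\<close> and thus orthogonal to the normals of
  all facets containing \<open>f\<close>; among these facets, the vectors in \<open>nhat\<close> see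
  only \<open>F\<close>. The factor 1/2 comes from symmetrization.\<close>

lemma tn_tensor_normal:
  assumes F: "F \<in> interior_facets" "f \<subseteq> F" and t: "t \<in> tan_space f"
    and n: "\<And>K. K \<in> split T ==> F \<subseteq> K ==> n K \<in> nhat nrm f F K"
    and i: "i \<in> T" "j \<in> sub i" "f \<subseteq> sub i - {j}"
  shows "tn_tensor F t n (sub i) *v nrm (sub i - {j}) = (if sub i - {j} = F then (1/2) *\<^sub>R t else 0)"
proof -
  obtain s where s: "nrm (sub i - {j}) = s *\<^sub>R glam j (sub i)" using nrm_facet[OF i(1,2)] by metis
  have t0: "t \<bullet> nrm (sub i - {j}) = 0"
    using tan_space_glam[OF cell_sub[OF i(1)], of f j t] t i by (auto simp: s inner_commute)
  show ?thesis
  proof (cases "F \<subseteq> sub i")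
    case True
    then have nK: "n (sub i) \<in> nhat nrm f F (sub i)" using n i(1) by (auto simp: split_iff)
    have "sub i - {j} \<in> faces (CARD('n) - 1) {sub i}"
      using cell_sub[OF i(1)] i dim2 by (auto simp: faces_def cell_def)
    then have "n (sub i) \<bullet> nrm (sub i - {j}) = (if sub i - {j} = F then 1 else 0)"
      using nK i(3) by (auto simp: nhat_def)
    then show ?thesis using True t0 by (simp add: tn_tensor_def sym_tensor_mult)
  qed (auto simp: tn_tensor_def)
qed

lemma tn_tensor_nn:
  assumes "t \<in> tan_space f" "f \<subseteq> f'" "m \<in> nor_space f'" "n' \<in> nor_space f'"
  shows "m \<bullet> (tn_tensor F t n K *v n') = 0"
proof -
  have "m \<bullet> t = 0" "n' \<bullet> t = 0" using assms nor_space_mono[OF assms(2)] nor_tan_orth by blast+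
  then show ?thesis by (simp add: tn_tensor_def sym_tensor_mult inner_add_right inner_commute[of t])
qed

lemma tn_tensor_transpose: "transpose (tn_tensor F t n K) = tn_tensor F t n K"
  by (simp add: tn_tensor_def sym_tensor_transpose, simp add: transpose_def vec_eq_iff)

lemma conforming_tn:
  assumes F: "F \<in> interior_facets" and f: "f \<subseteq> F" "card f = l + 1" and P: "P \<in> hom f (int k - int l - 1)"
    and t: "t \<in> tan_space f" and n: "\<And>K. K \<in> split T ==> F \<subseteq> K ==> n K \<in> nhat nrm f F K"
  shows "conforming (restrict_field (split T) (\<lambda>K x. bub_hom f P K x *\<^sub>R tn_tensor F t n K))"
proof (rule conforming_bub[OF f(2) P tn_tensor_transpose])
  fix i j assume ij: "i \<in> T" "j \<in> T" "i \<noteq> j" "f \<subseteq> sub i - {j}"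
  have com: "sub i - {j} = sub j - {i}" using ij by (intro facet_sub_commute)
  have mem: "j \<in> sub i" "i \<in> sub j" using ij by (auto simp: subcell_def)
  obtain s where s: "s \<noteq> 0" "nrm (sub i - {j}) = s *\<^sub>R (g i - g j)" using nrm_interior[OF ij(1-3)] .
  have "tn_tensor F t n (sub i) *v nrm (sub i - {j}) = tn_tensor F t n (sub j) *v nrm (sub i - {j})"
    using tn_tensor_normal[OF F f(1) t n ij(1) mem(1) ij(4)]
      tn_tensor_normal[OF F f(1) t n ij(2) mem(2) ij(4)[unfolded com]] com by simp
  then show "tn_tensor F t n (sub i) *v (g i - g j) = tn_tensor F t n (sub j) *v (g i - g j)"
    using s by (simp add: matrix_vector_mult_scaleR)
qed (simp add: tn_tensor_nn[OF t])

lemma conforming_cell: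
  assumes K: "K \<in> split T" and q: "q \<in> Bdiv k K"
  shows "conforming (restrict_field {K} (\<lambda>K'. q))" (is "conforming ?\<tau>")
proof -
  obtain p where p: "p \<in> T" "K = sub p" using K split_iff by blast
  note cK = cell_sub[OF p(1)]
  have q0: "q x *v glam j K = 0" if "j \<in> K" "x \<in> convex hull (K - {j})" for j x
    using Bdiv_D[OF _ q that] p cK by simp
  have qs: "q \<in> sym_polys (int k)" using q by (simp add: Bdiv_def)
  have "?\<tau> K' \<in> sym_polys (int k)" for K'
    using qs sym_polys_zero by (cases "K' = K") (auto simp: restrict_field_def)
  moreover have "normal_continuous ?\<tau>"
  proof -
    have "?\<tau> (sub i) x *v (g i - g j) = 0" if ij: "i \<in> T" "j \<in> T" "i \<noteq> j" and x: "x \<in> convex hull (sub i - {j})" for i j x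
    proof (cases "sub i = K")
      case True
      have "q x *v (g j - g i) = 0" using q0[of j x] x True ij glam_sub[OF ij(1,2)] by (auto simp: subcell_def)
      then have "q x *v (g i - g j) = 0" by (simp add: matrix_vector_mult_diff_distrib)
      then show ?thesis using True by (simp add: restrict_field_def)
    qed (simp add: restrict_field_def)
    note Z = this
    show ?thesis unfolding normal_continuous_def
    proof (intro ballI impI)
      fix i j x assume ij: "i \<in> T" "j \<in> T" "i \<noteq> j" and x: "x \<in> convex hull (sub i - {j})"
      have "?\<tau> (sub j) x *v (g j - g i) = 0"
        using Z[OF ij(2,1) ij(3)[symmetric]] x facet_sub_commute[OF ij(1,2)] by simp
      then show "?\<tau> (sub i) x *v (g i - g j) = ?\<tau> (sub j) x *v (g i - g j)"
        using Z[OF ij x] by (simp add: matrix_vector_mult_diff_distrib)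
    qed
  qed
  moreover have "nn_continuous ?\<tau>"
  proof -
    have "?\<tau> (sub i) x *v n = 0" if i: "i \<in> T" "c \<in> f" "f \<subseteq> sub i" and x: "x \<in> convex hull f" and n: "n \<in> nor_space f" for f i x n
    proof (cases "sub i = K")
      case True
      have "q x *v n = 0 *v n"
      proof (rule matrix_vector_mult_span)
        show "n \<in> span ((\<lambda>v. glam v K) ` (K - f))" using nor_space_span[of K f] n i True cK p by auto
        fix m assume "m \<in> (\<lambda>v. glam v K) ` (K - f)"
        then obtain v where v: "v \<in> K" "v \<notin> f" "m = glam v K" by blast
        have "f \<subseteq> K - {v}" using v i(3) True by auto
        then have "x \<in> convex hull (K - {v})" using x hull_mono by blast
        then show "q x *v m = 0 *v m" using q0 v by simp
      qed
      then show ?thesis using True by (simp add: restrict_field_def)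
    qed (simp add: restrict_field_def)
    then show ?thesis unfolding nn_continuous_def by simp
  qed
  ultimately show ?thesis using K by (auto simp: conforming_def restrict_field_def)
qed

abbreviation "\<Sigma> \<equiv> Sigma_loc nrm v0 k T"

lemma Sigma_conforming: "\<Sigma> \<subseteq> {\<tau>. conforming \<tau>}"
  unfolding Sigma_loc_def
proof (rule field.span_minimal[OF _ conforming_subspace], intro Un_least UN_least)
  fix l f assume l: "l \<in> {..<CARD('n)}" and f: "f \<in> faces l {T}"
  show "bubbles k l T f (constant_fields (NS f)) \<subseteq> {\<tau>. conforming \<tau>}"
    by (rule bubbles_subset) (use f in \<open>auto simp: constant_fields_def faces_T intro!: conforming_const NS_transpose\<close>)
  show "bubbles k l T f (phi_generators v0 T f) \<subseteq> {\<tau>. conforming \<tau>}"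
    by (rule bubbles_subset) (use l f in \<open>auto simp: phi_generators_def intro!: conforming_phi\<close>)
next
  fix l f assume l: "l \<in> {..<CARD('n)}" and f: "f \<in> interior_faces l {T}"
  show "bubbles k l T f (constant_fields (SS (nor_space f))) \<subseteq> {\<tau>. conforming \<tau>}"
    by (rule bubbles_subset)
      (use f in \<open>auto simp: constant_fields_def interior_faces_T SS_def intro!: conforming_const sym_tensors_transpose\<close>)
next
  fix F l f assume F: "F \<in> interior_facets" and f: "f \<in> faces l {F}"
  show "tn_bubbles nrm k l T F f \<subseteq> {\<tau>. conforming \<tau>}"
    unfolding tn_bubbles_def
  proof (rule field.span_minimal[OF _ conforming_subspace], clarsimp simp: hom_polys_eq)
    fix t n P assume t: "t \<in> tan_space f" and n: "\<forall>K\<in>split T. F \<subseteq> K \<longrightarrow> n K \<in> nhat nrm f F K"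
      and P: "P \<in> hom f (int k - int l - 1)"
    have "restrict_field {K \<in> split T. F \<subseteq> K} (\<lambda>K x. (bub f K x * P (\<lambda>v. lam v K x)) *\<^sub>R sym_part (tensor t (n K)))
        = restrict_field (split T) (\<lambda>K x. bub_hom f P K x *\<^sub>R tn_tensor F t n K)"
      by (auto simp: restrict_field_def fun_eq_iff bub_hom_def tn_tensor_def)
    then show "conforming (restrict_field {K \<in> split T. F \<subseteq> K} (\<lambda>K x. (bub f K x * P (\<lambda>v. lam v K x)) *\<^sub>R sym_part (tensor t (n K))))"
      using conforming_tn[OF F _ _ P t] f n by (auto simp: faces_def)
  qed
next
  fix K assume "K \<in> split T"
  then show "cell_bubbles k K \<subseteq> {\<tau>. conforming \<tau>}"
    unfolding cell_bubbles_def using conforming_cell by auto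
qed

end

section \<open>Vanishing degrees of freedom\<close>

lemma polys_facet_divide:
  assumes K: "cell (K::(real^'n) set)" "f \<subseteq> K" "f \<noteq> {}" and S: "S \<subseteq> f" and r: "1 \<le> r" and p: "p \<in> polys r"
    and 0: "\<And>v x. v \<in> S ==> x \<in> convex hull (f - {v}) ==> p x = 0"
  shows "\<exists>Q\<in>hom f (r - int (card S)). \<forall>x\<in>convex hull f. p x = (\<Prod>v\<in>S. lam v K x) * Q (\<lambda>v. lam v K x)"
proof -
  have fin: "finite f" using K cell_finite finite_subset by blast
  obtain P where P: "P \<in> hom f r" "\<And>x. x \<in> affine hull f ==> p x = P (\<lambda>v. lam v K x)"
    using polys_hom[OF K(1,2) p] by auto
  have "\<exists>Q\<in>hom f (r - int (card S)). P = (\<lambda>y. (\<Prod>v\<in>S. y v) * Q y)"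
  proof (rule hom_divide[OF fin S r P(1)])
    fix v and y :: "real^'n \<Rightarrow> real"
    assume y: "v \<in> S" "\<And>u. u \<in> f ==> 0 \<le> y u" "y v = 0" "sum y f = 1"
    let ?x = "\<Sum>u\<in>f. y u *\<^sub>R u"
    have l: "lam u K ?x = (if u \<in> f then y u else 0)" for u by (rule lam_comb'[OF K(1) y(4) K(2)])
    have "f - {v} \<subseteq> K" using K(2) by blast
    then have "?x \<in> convex hull (f - {v})"
      by (subst mem_convex_hull[OF K(1)]) (use K(2) y(2,3) in \<open>auto simp: l\<close>)
    then have x: "p ?x = 0" "?x \<in> affine hull f"
      using 0 y(1) hull_mono[of "f - {v}" f] convex_hull_subset_affine_hull by blast+
    have "P y = P (\<lambda>u. lam u K ?x)" by (rule hom_cong[OF P(1)]) (simp add: l)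
    then show "P y = 0" using P(2)[OF x(2)] x(1) by simp
  qed
  then show ?thesis using P(2) convex_hull_subset_affine_hull by fastforce
qed

lemma polys_zero_on_face:
  assumes K: "cell (K::(real^'n) set)" "f \<subseteq> K" "f \<noteq> {}" and p: "p \<in> polys r"
    and 0: "\<And>x. x \<in> convex hull f ==> (\<And>v. v \<in> f ==> lam v K x > 0) ==> p x = 0"
    and x: "x \<in> convex hull f"
  shows "p x = 0"
proof -
  obtain P where P: "P \<in> hom f r" "\<And>x. x \<in> affine hull f ==> p x = P (\<lambda>v. lam v K x)"
    using polys_hom[OF K(1,2) p] by auto
  obtain c where c: "P = (\<lambda>y. \<Sum>\<alpha>\<in>hexp f r. c \<alpha> * mono_at f \<alpha> y)" using P(1) by (auto simp: hom_def)
  have "c \<alpha> = 0" if "\<alpha> \<in> hexp f r" for \<alpha>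
  proof (rule hom_lam_coeff_zero[OF K _ that])
    fix x assume l: "\<And>v. v \<in> f ==> lam v K x > 0" "\<And>v. v \<in> K - f ==> lam v K x = 0"
    have "x \<in> convex hull f" unfolding mem_convex_hull[OF K(1,2)] using l less_imp_le by (metis DiffI order_refl)
    moreover from this have "x \<in> affine hull f" using convex_hull_subset_affine_hull by blast
    ultimately show "(\<Sum>\<alpha>\<in>hexp f r. c \<alpha> * mono_at f \<alpha> (\<lambda>v. lam v K x)) = 0"
      using 0[OF _ l(1)] P(2)[of x] fun_cong[OF c] by simp
  qed
  then have "P y = 0" for y unfolding c by (intro sum.neutral) simp
  moreover have "x \<in> affine hull f" using x convex_hull_subset_affine_hull by blast
  ultimately show ?thesis using P(2) by simp
qed

lemma polys_const_mult: "p \<in> polys r ==> (\<lambda>x. p x * a) \<in> polys r"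
  using polys_scale[of p r a] by (simp add: mult.commute)

lemma sym_polys_entry: "\<tau> \<in> sym_polys r ==> (\<lambda>x. m \<bullet> (\<tau> x *v n)) \<in> polys r"
  unfolding inner_vec_def inner_real_def matrix_vector_mult_def
  by (simp add: sym_polys_def polys_sum polys_scale polys_const_mult)

lemma on_simplex_apply: "x \<in> convex hull f ==> on_simplex f p x = p x"
  by (simp add: on_simplex_def)

lemma polys_on_I: "p \<in> polys r ==> on_simplex f p \<in> polys_on f r"
  by (simp add: polys_on_def)

lemma continuous_polys_on: "q \<in> polys_on f r ==> continuous_on (convex hull f) q"
  unfolding polys_on_def by (auto simp: on_simplex_apply cong: continuous_on_cong intro: continuous_polys)

lemma vec_polys_continuous: "q \<in> vec_polys r ==> continuous_on S q"
proof -
  assume "q \<in> vec_polys r"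
  then have "continuous_on S (\<lambda>x. \<chi> i. q x $ i)"
    by (intro continuous_on_vec_lambda) (auto simp: vec_polys_def intro: continuous_polys)
  then show ?thesis by simp
qed

lemma continuous_vec_polys_on: "q \<in> vec_polys_on f r ==> continuous_on (convex hull f) q"
  unfolding vec_polys_on_def by (auto simp: on_simplex_apply cong: continuous_on_cong intro: vec_polys_continuous)

lemma cell_int_closed:
  assumes K: "cell (K::(real^'n) set)" and h: "continuous_on UNIV h"
  shows "(LINT x:convex hull K|lebesgue. h x) = cell_int K h"
proof -
  let ?H = "convex hull K"
  have "frontier ?H \<in> null_sets lebesgue"
    using negligible_convex_frontier[OF convex_convex_hull] by (simp add: negligible_iff_null_sets)
  then have "AE x in lebesgue. x \<notin> frontier ?H" by (rule AE_not_in)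
  moreover have "closed ?H" using compact_cell[OF K] compact_imp_closed by blast
  ultimately have ae: "AE x in lebesgue. indicator ?H x *\<^sub>R h x = indicator (interior ?H) x * h x"
    using interior_subset[of ?H] by (auto simp: frontier_def indicator_def elim!: eventually_mono)
  have hm: "h \<in> borel_measurable borel" by (rule borel_measurable_continuous_onI[OF h])
  have "(LINT x:?H|lebesgue. h x) = (LINT x|lebesgue. indicator (interior ?H) x * h x)"
    unfolding set_lebesgue_integral_def
  proof (rule integral_cong_AE[OF _ _ ae])
    have "(\<lambda>x. indicator ?H x *\<^sub>R h x) \<in> borel_measurable lborel"
      using hm borel_compact[OF compact_cell[OF K]] by simp
    then show "(\<lambda>x. indicator ?H x *\<^sub>R h x) \<in> borel_measurable lebesgue" by (rule measurable_completion)
    have "(\<lambda>x. indicator (interior ?H) x * h x) \<in> borel_measurable lborel" using hm by simp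
    then show "(\<lambda>x. indicator (interior ?H) x * h x) \<in> borel_measurable lebesgue" by (rule measurable_completion)
  qed
  also have "\<dots> = cell_int K h" unfolding cell_int_def by (rule integral_completion) (use hm in simp)
  finally show ?thesis .
qed

text \<open>A Whitney type construction. If t v is the tangential part of \<open>glam v K\<close>,
  then t v . (u - x) is the Kronecker delta minus the coordinate of v. In the sum of the w v t v the
  first terms give w u, and the second ones cancel by the hypothesis. Since q . x = q . u - w u on
  the facet, the field lies in \<open>ND\<close>.\<close>

lemma ND_exists:
  assumes K: "cell (K::(real^'n) set)" "F \<subseteq> K" "F \<noteq> {}"
    and w: "\<And>v. v \<in> F ==> w v \<in> polys (int k - 1)"
    and 0: "\<And>x. x \<in> convex hull F ==> (\<Sum>v\<in>F. lam v K x * w v x) = 0"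
  shows "\<exists>q\<in>ND k F. \<forall>x\<in>convex hull F. \<forall>v\<in>F. q x \<bullet> (v - x) = w v x"
proof -
  have fin: "finite F" using K cell_finite finite_subset by blast
  have "\<forall>v. \<exists>s. s \<in> tan_space F \<and> glam v K - s \<in> nor_space F"
    using tan_nor_decompose by blast
  then obtain t where t: "\<And>v. t v \<in> tan_space F \<and> glam v K - t v \<in> nor_space F" by metis
  let ?q = "\<lambda>x. \<Sum>v\<in>F. w v x *\<^sub>R t v"
  have q: "?q x \<bullet> (u - x) = w u x" if x: "x \<in> convex hull F" and u: "u \<in> F" for x u
  proof -
    have xa: "x \<in> affine hull F" using x convex_hull_subset_affine_hull by blast
    have tv: "t v \<bullet> (u - y) = glam v K \<bullet> (u - y)" if "y \<in> F" for v y
      using nor_tan_orth[of "glam v K - t v" F "u - y"] t[of v] tan_space_diff[OF that u] by (simp add: inner_diff_left)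
    have ux: "u - x = (\<Sum>y\<in>F. lam y K x *\<^sub>R (u - y))"
      using lam_hull_sum[OF K(1,2) xa] by (simp add: scaleR_diff_right sum_subtractf flip: scaleR_sum_left)
    have "t v \<bullet> (u - x) = glam v K \<bullet> (u - x)" for v
      unfolding ux inner_sum_right inner_scaleR_right by (intro sum.cong refl) (simp add: tv)
    then have tx: "t v \<bullet> (u - x) = (if v = u then 1 else 0) - lam v K x" for v
      using u K by (auto simp: lam_diff lam_vertex subset_iff)
    have "?q x \<bullet> (u - x) = (\<Sum>v\<in>F. w v x * (if v = u then 1 else 0)) - (\<Sum>v\<in>F. w v x * lam v K x)"
      by (simp add: inner_sum_left tx right_diff_distrib sum_subtractf)
    also have "(\<Sum>v\<in>F. w v x * (if v = u then 1 else 0)) = w u x"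
      using fin u by (simp add: if_distrib[of "\<lambda>a. _ * a"] sum.delta cong: if_cong)
    also have "(\<Sum>v\<in>F. w v x * lam v K x) = 0" using 0[OF x] by (simp add: mult.commute)
    finally show ?thesis by simp
  qed
  have qp: "?q \<in> vec_polys (int k - 1)"
    unfolding vec_polys_def using w by (auto intro!: polys_sum polys_const_mult)
  obtain u where u: "u \<in> F" using K(3) by blast
  let ?r = "\<lambda>x. ?q x \<bullet> u - w u x"
  have "(\<lambda>x. ?q x \<bullet> u) \<in> polys (int k - 1)"
    unfolding inner_vec_def inner_real_def using qp by (intro polys_sum polys_const_mult) (simp add: vec_polys_def)
  then have r: "?r \<in> polys (int k - 1)" using w[OF u] by (rule polys_minus)
  have "on_simplex F ?q \<in> ND k F"
    unfolding ND_def
  proof (intro CollectI conjI ballI)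
    show "on_simplex F ?q \<in> vec_polys_on F (int k - 1)" using qp by (simp add: vec_polys_on_def)
    show "on_simplex F ?q x \<in> tan_space F" if "x \<in> convex hull F" for x
      using that t by (auto simp: on_simplex_apply intro!: subspace_sum subspace_scale subspace_tan_space)
    have "(\<lambda>x. on_simplex F ?q x \<bullet> x) = on_simplex F ?r"
    proof
      fix x show "on_simplex F ?q x \<bullet> x = on_simplex F ?r x"
        using q[OF _ u, of x] by (cases "x \<in> convex hull F") (simp_all add: on_simplex_def inner_diff_right)
    qed
    then show "(\<lambda>x. on_simplex F ?q x \<bullet> x) \<in> polys_on F (int k - 1)" using r by (simp add: polys_on_def)
  qed
  then show ?thesis using q by (intro bexI[of _ "on_simplex F ?q"]) (auto simp: on_simplex_apply)
qed

context local_space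
begin

lemma conforming_sym_polys: "conforming \<tau> ==> i \<in> T ==> \<tau> (sub i) \<in> sym_polys (int k)"
  by (simp add: conforming_def split_def)

lemma boundary_nn_zero:
  assumes \<tau>: "conforming \<tau>"
    and a: "\<And>i x. i \<in> T ==> x \<in> convex hull (T - {i}) ==> \<tau> (sub i) x *v g i = 0"
    and f: "f \<subseteq> T" "f \<noteq> {}" and i: "i \<in> T - f" and x: "x \<in> convex hull f"
    and m: "m \<in> nor_space f" and n: "n \<in> nor_space f"
  shows "m \<bullet> (\<tau> (sub i) x *v n) = 0"
proof -
  let ?t = "\<lambda>l i j. g l \<bullet> (\<tau> (sub i) x *v g j)"
  have aT: "\<tau> (sub i) x *v g i = 0" if "i \<in> T - f" for i
  proof -
    have "f \<subseteq> T - {i}" using that f by auto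
    then show ?thesis using a[of i x] that x hull_mono by blast
  qed
  have sym: "?t l i j = ?t j i l" if "i \<in> T" for i j l
  proof (rule transpose_inner)
    have "\<tau> (sub i) \<in> sym_polys (int k)" by (rule conforming_sym_polys[OF \<tau> that])
    then show "transpose (\<tau> (sub i) x) = \<tau> (sub i) x" by (simp add: sym_polys_def)
  qed
  have anti: "?t l i j = - ?t l j i" if ij: "i \<in> T - f" "j \<in> T - f" for i j l
  proof (cases "i = j")
    case True
    then show ?thesis using aT[OF ij(1)] by simp
  next
    case False
    have "f \<subseteq> sub i - {j}" using ij f by (auto simp: subcell_def)
    then have "x \<in> convex hull (sub i - {j})" using x hull_mono by blast
    then have "\<tau> (sub i) x *v (g i - g j) = \<tau> (sub j) x *v (g i - g j)"
      using normal_continuousD[of \<tau> i j x] \<tau> ij False by (simp add: conforming_def)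
    then have "- (\<tau> (sub i) x *v g j) = \<tau> (sub j) x *v g i"
      using aT ij by (simp add: matrix_vector_mult_diff_distrib)
    then show ?thesis by (metis inner_minus_right minus_minus)
  qed
  have t0: "?t l i j = 0" if "l \<in> T - f" "i \<in> T - f" "j \<in> T - f" for l i j
  proof -
    \<comment> \<open>Antisymmetry and symmetry are applied alternately; after six exchanges the
      entry returns with the opposite sign, as in the uniqueness of the Levi-Civita
      connection.\<close>
    have "?t l i j = - ?t l j i" using anti that by blast
    also have "\<dots> = - ?t i j l" using sym[of j l i] that by simp
    also have "\<dots> = ?t i l j" using anti[of j l i] that by simp
    also have "\<dots> = ?t j l i" using sym[of l i j] that by simp
    also have "\<dots> = - ?t j i l" using anti[of l i j] that by simp
    also have "\<dots> = - ?t l i j" using sym[of i j l] that by simp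
    finally show ?thesis by simp
  qed
  have span: "nor_space f = span (g ` (T - f))" by (rule nor_space_span[OF cell_T f])
  have m0: "m \<bullet> (\<tau> (sub i) x *v g j) = 0" if j: "j \<in> T - f" for j
    using m unfolding span
    by (induction rule: span_induct_alt) (use t0[OF _ i j] in \<open>auto simp: inner_add_left\<close>)
  show ?thesis
    using n unfolding span
    by (induction rule: span_induct_alt)
      (use m0 in \<open>auto simp: matrix_vector_right_distrib matrix_vector_mult_scaleR inner_add_right\<close>)
qed

text \<open>Induction on the number of vertices. The facet of \<open>f\<close> opposite to the
  barycenter is a face of \<open>T\<close> and falls under \<open>boundary_nn_zero\<close>; the
  other facets contain the barycenter and are covered by the induction hypothesis.\<close>

lemma interior_nn_zero:
  assumes \<tau>: "conforming \<tau>"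
    and a: "\<And>i x. i \<in> T ==> x \<in> convex hull (T - {i}) ==> \<tau> (sub i) x *v g i = 0"
    and b: "\<And>l f i m n q. l < CARD('n) ==> f \<in> interior_faces l {T} ==> i \<in> T ==> f \<subseteq> sub i ==>
      m \<in> nor_space f ==> n \<in> nor_space f ==> q \<in> polys_on f (int k - (int l + 1)) ==>
      surface_integral f (\<lambda>x. (m \<bullet> (\<tau> (sub i) x *v n)) * q x) = 0"
    and f: "c \<in> f" "i \<in> T" "f \<subseteq> sub i" "card f \<le> CARD('n)" and x: "x \<in> convex hull f"
    and m: "m \<in> nor_space f" and n: "n \<in> nor_space f"
  shows "m \<bullet> (\<tau> (sub i) x *v n) = 0"
  using f x m n
proof (induction "card f" arbitrary: f x m n rule: less_induct)
  case less
  note f = less.prems(1-4)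
  have K: "cell (sub i)" by (rule cell_sub[OF f(2)])
  have fin: "finite f" using f(3) cell_finite[OF K] finite_subset by blast
  let ?u = "\<lambda>x. m \<bullet> (\<tau> (sub i) x *v n)"
  have "\<tau> (sub i) \<in> sym_polys (int k)" by (rule conforming_sym_polys[OF \<tau> f(2)])
  then have u: "?u \<in> polys (int k)" by (rule sym_polys_entry)
  have fne: "f \<noteq> {}" using f by auto
  have facet: "?u y = 0" if v: "v \<in> f" and y: "y \<in> convex hull (f - {v})" for v y
  proof -
    have mn: "m \<in> nor_space (f - {v})" "n \<in> nor_space (f - {v})"
      using less.prems(6,7) nor_space_mono[of "f - {v}" f] by auto
    show ?thesis
    proof (cases "v = c")
      case True
      have "f - {v} \<subseteq> T" "i \<in> T - (f - {v})" using f True by (auto simp: subcell_def)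
      moreover have "f - {v} \<noteq> {}" using y convex_hull_empty by force
      ultimately have "f - {v} \<subseteq> T" "i \<in> T - (f - {v})" "f - {v} \<noteq> {}" by blast+
      then show ?thesis using boundary_nn_zero[OF \<tau> a _ _ _ y mn] by blast
    next
      case False
      have "card (f - {v}) < card f" using v fin by (rule card_Diff1_less[rotated])
      moreover have "c \<in> f - {v}" "f - {v} \<subseteq> sub i" "card (f - {v}) \<le> CARD('n)" using f False calculation by auto
      ultimately show ?thesis using less.hyps[OF _ _ f(2) _ _ y mn] by blast
    qed
  qed
  \<comment> \<open>The hypothesis \<open>b\<close> counts by dimension, one less than the number of
    vertices.\<close>
  have kk: "int k - int (card f) = int k - (int (card f - 1) + 1)" using fin fne by (simp add: of_nat_diff Suc_leI card_gt_0_iff)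
  obtain Q where Q: "Q \<in> hom f (int k - int (card f))"
    "\<And>x. x \<in> convex hull f ==> ?u x = (\<Prod>v\<in>f. lam v (sub i) x) * Q (\<lambda>v. lam v (sub i) x)"
  proof -
    have "\<exists>Q\<in>hom f (int k - int (card f)). \<forall>x\<in>convex hull f. ?u x = (\<Prod>v\<in>f. lam v (sub i) x) * Q (\<lambda>v. lam v (sub i) x)"
      by (rule polys_facet_divide[OF K f(3) fne order.refl _ u]) (use k1 facet in auto)
    then show ?thesis using that by blast
  qed
  let ?q = "\<lambda>x. Q (\<lambda>v. lam v (sub i) x)" and ?b = "\<lambda>x. \<Prod>v\<in>f. lam v (sub i) x"
  have q: "?q \<in> polys (int k - (int (card f - 1) + 1))" unfolding kk[symmetric] by (rule hom_lam_polys[OF K Q(1)])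
  have bp: "?b x \<ge> 0" if "x \<in> convex hull f" for x
    using that mem_convex_hull[OF K f(3)] f(3) by (intro prod_nonneg) auto
  have "surface_integral f (\<lambda>x. ?u x * on_simplex f ?q x) = 0"
  proof (rule b[where l = "card f - 1", OF _ _ f(2,3) less.prems(6,7) polys_on_I[OF q]])
    have c0: "card f > 0" using fin fne by (simp add: card_gt_0_iff)
    then show "card f - 1 < CARD('n)" using f(4) by linarith
    show "f \<in> interior_faces (card f - 1) {T}"
      unfolding interior_faces_T using f(1-3) c0 by (intro conjI bexI[of _ i]) simp_all
  qed
  also have "surface_integral f (\<lambda>x. ?u x * on_simplex f ?q x) = surface_integral f (\<lambda>x. ?b x * (?q x * ?q x))"
    by (rule surface_integral_cong) (simp add: Q(2) on_simplex_apply)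
  finally have 0: "surface_integral f (\<lambda>x. ?b x * (?q x * ?q x)) = 0" .
  have "?b x * (?q x * ?q x) = 0"
  proof (rule surface_integral_definite[OF fin fne _ _ 0 less.prems(5)])
    show "continuous_on (convex hull f) (\<lambda>x. ?b x * (?q x * ?q x))"
      by (intro continuous_intros continuous_lam[OF K] continuous_polys[OF q])
  qed (rule mult_nonneg_nonneg[OF bp zero_le_square])
  then show ?case using Q(2)[OF less.prems(5)] by auto
qed

lemma facet_normal_zero:
  assumes \<tau>: "conforming \<tau>"
    and a: "\<And>i x. i \<in> T ==> x \<in> convex hull (T - {i}) ==> \<tau> (sub i) x *v g i = 0"
    and nn: "\<And>f i x m n. c \<in> f ==> i \<in> T ==> f \<subseteq> sub i ==> card f \<le> CARD('n) ==> x \<in> convex hull f ==>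
      m \<in> nor_space f ==> n \<in> nor_space f ==> m \<bullet> (\<tau> (sub i) x *v n) = 0"
    and ij: "i \<in> T" "j \<in> T" "i \<noteq> j"
    and cdof: "\<And>q. q \<in> ND k (sub i - {j}) ==>
      surface_integral (sub i - {j}) (\<lambda>x. (\<tau> (sub i) x *v (g j - g i)) \<bullet> q x) = 0"
    and x: "x \<in> convex hull (sub i - {j})"
  shows "\<tau> (sub i) x *v (g j - g i) = 0"
proof -
  let ?K = "sub i" and ?F = "sub i - {j}" and ?n = "g j - g i"
  have K: "cell ?K" by (rule cell_sub[OF ij(1)])
  have jK: "j \<in> ?K" using ij by (auto simp: subcell_def)
  have gj: "glam j ?K = ?n" by (rule glam_sub[OF ij(1,2) ij(3)[symmetric]])
  have cF: "card ?F = CARD('n)" using K jK by (simp add: cell_def)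
  have F: "?F \<subseteq> ?K" "?F \<noteq> {}" "finite ?F" "c \<in> ?F"
    using cF cell_finite[OF K] c_notin ij by (auto simp: subcell_def)
  have n: "?n \<in> nor_space ?F" unfolding gj[symmetric] by (rule glam_nor_space[OF K]) (use jK in auto)
  let ?u = "\<lambda>x. \<tau> ?K x *v ?n"
  have sp: "\<tau> ?K \<in> sym_polys (int k)" by (rule conforming_sym_polys[OF \<tau> ij(1)])
  have up: "(\<lambda>x. m \<bullet> ?u x) \<in> polys (int k)" for m by (rule sym_polys_entry[OF sp])
  have tan: "glam j ?K \<bullet> ?u x = 0" if "x \<in> convex hull ?F" for x
    unfolding gj using nn[OF F(4) ij(1) F(1) _ that n n] cF by simp
  \<comment> \<open>On the subfacet opposite to \<open>v\<close> both \<open>glam v ?K\<close> and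
    \<open>?n\<close> are normal, so this is a normal-normal entry, already known to vanish.\<close>
  have facet: "glam v ?K \<bullet> ?u y = 0" if v: "v \<in> ?F" and y: "y \<in> convex hull (?F - {v})" for v y
  proof -
    have m: "glam v ?K \<in> nor_space (?F - {v})" by (rule glam_nor_space[OF K]) (use v in auto)
    have n': "?n \<in> nor_space (?F - {v})" using n nor_space_mono[of "?F - {v}" ?F] by auto
    show ?thesis
    proof (cases "v = c")
      case True
      have "?F - {v} \<subseteq> T" "i \<in> T - (?F - {v})" using ij True by (auto simp: subcell_def)
      moreover have "?F - {v} \<noteq> {}" using y convex_hull_empty by force
      ultimately show ?thesis using boundary_nn_zero[OF \<tau> a _ _ _ y m n'] by blast
    next
      case False
      have "card (?F - {v}) \<le> CARD('n)" using cF card_Diff1_le[of ?F v] by simp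
      then show ?thesis using nn[OF _ ij(1) _ _ y m n'] F False by blast
    qed
  qed
  have "\<exists>Q\<in>hom ?F (int k - 1). \<forall>x\<in>convex hull ?F. glam v ?K \<bullet> ?u x = lam v ?K x * Q (\<lambda>v. lam v ?K x)"
    if v: "v \<in> ?F" for v
    using polys_facet_divide[OF K F(1,2), of "{v}" "int k" "\<lambda>x. glam v ?K \<bullet> ?u x"] v facet up k1 by auto
  then obtain Q where Q: "\<And>v. v \<in> ?F ==> Q v \<in> hom ?F (int k - 1)"
    "\<And>v x. v \<in> ?F ==> x \<in> convex hull ?F ==> glam v ?K \<bullet> ?u x = lam v ?K x * Q v (\<lambda>v. lam v ?K x)"
    by metis
  let ?w = "\<lambda>v x. Q v (\<lambda>v. lam v ?K x)"
  have sum0: "(\<Sum>v\<in>?F. glam v ?K \<bullet> ?u x) = 0" if "x \<in> convex hull ?F" for x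
  proof -
    have "(\<Sum>v\<in>?K. glam v ?K \<bullet> ?u x) = 0" using glam_sum[OF K] by (simp flip: inner_sum_left)
    then show ?thesis using tan[OF that] jK cell_finite[OF K] by (simp add: sum.remove[of ?K j])
  qed
  obtain q where q: "q \<in> ND k ?F" "\<And>x v. x \<in> convex hull ?F ==> v \<in> ?F ==> q x \<bullet> (v - x) = ?w v x"
  proof -
    have "\<exists>q\<in>ND k ?F. \<forall>x\<in>convex hull ?F. \<forall>v\<in>?F. q x \<bullet> (v - x) = ?w v x"
    proof (rule ND_exists[OF K F(1,2)])
      show "?w v \<in> polys (int k - 1)" if "v \<in> ?F" for v by (rule hom_lam_polys[OF K Q(1)[OF that]])
      show "(\<Sum>v\<in>?F. lam v ?K x * ?w v x) = 0" if "x \<in> convex hull ?F" for x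
        using sum0[OF that] Q(2)[OF _ that] by simp
    qed
    then show ?thesis using that by blast
  qed
  \<comment> \<open>The coefficient at \<open>j\<close> vanishes and the remaining ones sum to zero,
    so \<open>?u x\<close> is a combination of the vectors \<open>v - x\<close>, whose products with
    \<open>q\<close> are known.\<close>
  have uexp: "?u x = (\<Sum>v\<in>?F. (glam v ?K \<bullet> ?u x) *\<^sub>R (v - x))" if "x \<in> convex hull ?F" for x
  proof -
    have "?u x = (\<Sum>v\<in>?K. (glam v ?K \<bullet> ?u x) *\<^sub>R v)" by (rule glam_expand[OF K, symmetric])
    also have "\<dots> = (\<Sum>v\<in>?F. (glam v ?K \<bullet> ?u x) *\<^sub>R v)"
      using tan[OF that] jK cell_finite[OF K] by (simp add: sum.remove[of ?K j])
    also have "\<dots> = (\<Sum>v\<in>?F. (glam v ?K \<bullet> ?u x) *\<^sub>R (v - x))"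
      using sum0[OF that] by (simp add: scaleR_diff_right sum_subtractf flip: scaleR_sum_left)
    finally show ?thesis .
  qed
  have uq: "?u x \<bullet> q x = (\<Sum>v\<in>?F. lam v ?K x * (?w v x * ?w v x))" if x: "x \<in> convex hull ?F" for x
  proof -
    have "?u x \<bullet> q x = (\<Sum>v\<in>?F. (glam v ?K \<bullet> ?u x) * (q x \<bullet> (v - x)))"
      by (subst uexp[OF x]) (simp add: inner_sum_left inner_commute[of "q x"])
    then show ?thesis using Q(2)[OF _ x] q(2)[OF x] by (simp add: mult.assoc)
  qed
  have l0: "lam v ?K x \<ge> 0" if "x \<in> convex hull ?F" "v \<in> ?F" for v x
    using that mem_convex_hull[OF K F(1)] by auto
  have int0: "surface_integral ?F (\<lambda>x. \<Sum>v\<in>?F. lam v ?K x * (?w v x * ?w v x)) = 0"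
  proof -
    have "surface_integral ?F (\<lambda>x. ?u x \<bullet> q x) = surface_integral ?F (\<lambda>x. \<Sum>v\<in>?F. lam v ?K x * (?w v x * ?w v x))"
      by (rule surface_integral_cong) (rule uq)
    then show ?thesis using cdof[OF q(1)] by simp
  qed
  have "(\<Sum>v\<in>?F. lam v ?K x * (?w v x * ?w v x)) = 0"
  proof (rule surface_integral_definite[OF F(3,2) _ _ int0 x])
    show "continuous_on (convex hull ?F) (\<lambda>x. \<Sum>v\<in>?F. lam v ?K x * (?w v x * ?w v x))"
      by (intro continuous_intros continuous_lam[OF K] continuous_polys[OF hom_lam_polys[OF K Q(1)]])
  qed (rule sum_nonneg[OF mult_nonneg_nonneg[OF l0 zero_le_square]])
  then have "lam v ?K x * (?w v x * ?w v x) = 0" if "v \<in> ?F" for v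
    using sum_nonneg_eq_0_iff[OF F(3), of "\<lambda>v. lam v ?K x * (?w v x * ?w v x)"] l0[OF x] that by auto
  then have "glam v ?K \<bullet> ?u x = 0" if "v \<in> ?F" for v using Q(2)[OF that x] that by fastforce
  then show ?thesis using uexp[OF x] by simp
qed

lemma conforming_zero:
  assumes \<tau>: "conforming \<tau>"
    and a: "\<And>i x. i \<in> T ==> x \<in> convex hull (T - {i}) ==> \<tau> (sub i) x *v g i = 0"
    and int: "\<And>i j x. i \<in> T ==> j \<in> T ==> i \<noteq> j ==> x \<in> convex hull (sub i - {j}) ==> \<tau> (sub i) x *v (g j - g i) = 0"
    and d: "\<And>K q. K \<in> split T ==> q \<in> Bdiv k K ==> dof_d K \<tau> q = 0"
  shows "\<tau> = 0"
proof -
  have "\<tau> (sub i) x = 0" if i: "i \<in> T" for i x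
  proof -
    let ?K = "sub i"
    have K: "cell ?K" by (rule cell_sub[OF i])
    have KT: "?K \<in> split T" using i split_iff by blast
    have sp: "\<tau> ?K \<in> sym_polys (int k)" using \<tau> KT unfolding conforming_def by blast
    \<comment> \<open>With vanishing normal traces on all its facets, the restriction to the cell is
      itself an admissible test field in (d).\<close>
    have "\<tau> ?K \<in> Bdiv k ?K"
    proof (rule Bdiv_I[OF K sp])
      fix v x assume v: "v \<in> ?K" and x: "x \<in> convex hull (?K - {v})"
      show "\<tau> ?K x *v glam v ?K = 0"
      proof (cases "v = c")
        case True
        have "?K - {v} = T - {i}" using True c_notin by (auto simp: subcell_def)
        then show ?thesis using a[OF i] x True i by (simp add: glam_sub_c matrix_vector_mult_scaleR)
      next
        case False
        then have "v \<in> T" "v \<noteq> i" using v i c_notin by (auto simp: subcell_def)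
        then show ?thesis using int[OF i _ _ x] i by (simp add: glam_sub)
      qed
    qed
    then have "dof_d ?K \<tau> (\<tau> ?K) = 0" by (rule d[OF KT])
    moreover have c: "continuous_on UNIV (\<lambda>x. \<tau> ?K x \<bullet> \<tau> ?K x)"
      by (intro continuous_intros sym_polys_continuous[OF sp])
    ultimately have "cell_int ?K (\<lambda>x. \<tau> ?K x \<bullet> \<tau> ?K x) = 0" by (simp add: dof_d_def cell_int_closed[OF K])
    then have 0: "\<tau> ?K x \<bullet> \<tau> ?K x = 0" if "x \<in> interior (convex hull ?K)" for x
      using cell_int_definite[OF K c _ _ that] by simp
    have "\<tau> ?K x $ p $ q = 0" for p q
    proof (rule polys_zero_on_cell[OF K, where p = "\<lambda>x. \<tau> ?K x $ p $ q"])
      show "(\<lambda>x. \<tau> ?K x $ p $ q) \<in> polys (int k)" using sp by (simp add: sym_polys_def)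
      show "\<tau> ?K y $ p $ q = 0" if "y \<in> interior (convex hull ?K)" for y using 0[OF that] by simp
    qed
    then show ?thesis by (simp add: vec_eq_iff)
  qed
  then have "\<tau> K x = 0" for K x
    using \<tau> by (cases "K \<in> split T") (auto simp: conforming_def split_iff)
  then show ?thesis by (auto simp: fun_eq_iff)
qed

end

section \<open>Linearity of the degrees of freedom and uniqueness\<close>

lemma surface_integral_lin:
  fixes u w :: "real^'n \<Rightarrow> real"
  assumes "finite f" "f \<noteq> {}" "continuous_on (convex hull f) u" "continuous_on (convex hull f) w"
  shows "surface_integral f (\<lambda>x. a * u x + b * w x) = a * surface_integral f u + b * surface_integral f w"
  by (subst surface_integral_add[OF assms(1,2)])
    (auto intro!: continuous_intros assms simp: surface_integral_scale)

lemma pairing_left: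
  fixes h h' q :: "real^'n \<Rightarrow> 'b::real_inner"
  assumes "finite f" "f \<noteq> {}" "continuous_on (convex hull f) h" "continuous_on (convex hull f) h'"
    "continuous_on (convex hull f) q"
  shows "surface_integral f (\<lambda>x. (a *\<^sub>R h x + b *\<^sub>R h' x) \<bullet> q x)
      = a * surface_integral f (\<lambda>x. h x \<bullet> q x) + b * surface_integral f (\<lambda>x. h' x \<bullet> q x)"
  unfolding inner_add_left inner_scaleR_left
  by (rule surface_integral_lin[OF assms(1,2)]) (intro continuous_intros assms)+

lemma pairing_right:
  fixes h q r :: "real^'n \<Rightarrow> 'b::real_inner"
  assumes "finite f" "f \<noteq> {}" "continuous_on (convex hull f) h" "continuous_on (convex hull f) q"
    "continuous_on (convex hull f) r"
  shows "surface_integral f (\<lambda>x. h x \<bullet> (a *\<^sub>R q x + b *\<^sub>R r x))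
      = a * surface_integral f (\<lambda>x. h x \<bullet> q x) + b * surface_integral f (\<lambda>x. h x \<bullet> r x)"
  using pairing_left[OF assms(1,2,4,5,3)] by (simp add: inner_commute)

lemma linear_on_diff: "linear_on Q L ==> linear_on Q M ==> linear_on Q (\<lambda>q. L q - M q)"
  unfolding linear_on_def by (simp add: algebra_simps)

lemma ND_D:
  assumes "q \<in> ND k F"
  shows "q \<in> vec_polys_on F (int k - 1)" "x \<in> convex hull F ==> q x \<in> tan_space F"
    "(\<lambda>x. q x \<bullet> x) \<in> polys_on F (int k - 1)"
  using assms by (auto simp: ND_def)

lemma tangential_part_inner: "n \<bullet> q = 0 ==> tangential_part n w \<bullet> q = w \<bullet> q"
  by (simp add: tangential_part_def inner_diff_left)

lemma tangential_part_add: "tangential_part n (v + w) = tangential_part n v + tangential_part n w"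
  by (simp add: tangential_part_def algebra_simps)

lemma tangential_part_zero: "tangential_part n 0 = 0"
  by (simp add: tangential_part_def)

lemma continuous_tangential: "continuous_on S w ==> continuous_on S (\<lambda>x. tangential_part n (w x))"
  unfolding tangential_part_def by (intro continuous_intros)

locale local_dofs = local_space T nrm v0 k for T :: "(real^'n) set" and nrm v0 k +
  fixes nb :: "(real^'n) set \<Rightarrow> nat \<Rightarrow> real^'n" and elt :: "(real^'n) set \<Rightarrow> (real^'n) set"
  assumes nb_basis: "\<And>l f. l < CARD('n) ==> f \<in> interior_faces l {T} ==>
      inj_on (nb f) {1..CARD('n) - l} \<and> independent (nb f ` {1..CARD('n) - l}) \<and>
      span (nb f ` {1..CARD('n) - l}) = nor_space f"
    and elt_cell: "\<And>l f. l < CARD('n) ==> f \<in> interior_faces l {T} ==> elt f \<in> split T \<and> f \<subseteq> elt f"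
begin

abbreviation "VP i \<equiv> vec_polys_on (T - {i}) (int k)"
abbreviation "PO l f \<equiv> polys_on f (int k - (int l + 1))"

lemma facet_T: "F \<in> faces (CARD('n) - 1) {T} \<longleftrightarrow> (\<exists>i\<in>T. F = T - {i})"
proof
  assume "F \<in> faces (CARD('n) - 1) {T}"
  then have F: "F \<subseteq> T" "card F = CARD('n)" using dim2 by (auto simp: faces_T)
  then have "card (T - F) = 1" using finite_T card_T by (simp add: card_Diff_subset finite_subset)
  then obtain i where "T - F = {i}" by (auto simp: card_1_singleton_iff)
  then show "\<exists>i\<in>T. F = T - {i}" using F(1) by (intro bexI[of _ i]) auto
next
  assume "\<exists>i\<in>T. F = T - {i}"
  then show "F \<in> faces (CARD('n) - 1) {T}" using card_T dim2 by (auto simp: faces_T)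
qed

lemma facet_finite: "finite (T - {i})" "i \<in> T ==> T - {i} \<noteq> {}"
  using finite_T card_T dim2 by (auto dest!: subset_singletonD)

lemma dof_a_eq: "i \<in> T ==> dof_a nrm T (T - {i}) \<tau> q
    = surface_integral (T - {i}) (\<lambda>x. (\<tau> (sub i) x *v nrm (T - {i})) \<bullet> q x)"
  by (simp add: dof_a_def subcell_def)

lemma dof_b_eq: "dof_b K f m n \<tau> q = surface_integral f (\<lambda>x. (m \<bullet> (\<tau> K x *v n)) \<bullet> q x)"
  by (simp add: dof_b_def)

lemma interior_face_cell:
  assumes "l < CARD('n)" "f \<in> interior_faces l {T}"
  obtains i where "i \<in> T" "elt f = sub i" "f \<subseteq> sub i"
  using elt_cell[OF assms] by (auto simp: split_iff)

lemma interior_face_nonempty: "f \<in> interior_faces l {T} ==> f \<noteq> {}"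
  using interior_face_subset(1) by blast

lemma conforming_continuous: "conforming \<tau> ==> continuous_on S (\<tau> K)"
proof (cases "K \<in> split T")
  case True
  assume "conforming \<tau>"
  then show ?thesis using True by (intro sym_polys_continuous[of _ "int k"]) (simp add: conforming_def)
next
  case False
  assume "conforming \<tau>"
  then show ?thesis using False by (simp add: conforming_def)
qed

lemma conforming_mult_continuous: "conforming \<tau> ==> continuous_on S (\<lambda>x. \<tau> K x *v n)"
  by (intro continuous_matrix_mult conforming_continuous continuous_on_const)

lemma dof_a_add:
  assumes "conforming \<tau>" "conforming \<sigma>" "i \<in> T" "q \<in> VP i"
  shows "dof_a nrm T (T - {i}) (\<tau> + \<sigma>) q = dof_a nrm T (T - {i}) \<tau> q + dof_a nrm T (T - {i}) \<sigma> q"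
  using pairing_left[OF facet_finite(1) facet_finite(2)[OF assms(3)] conforming_mult_continuous[OF assms(1)]
      conforming_mult_continuous[OF assms(2)] continuous_vec_polys_on[OF assms(4)], of 1 "sub i" "nrm (T - {i})" 1 "sub i"]
  by (simp add: dof_a_eq[OF assms(3)] matrix_vector_mult_add_rdistrib)

lemma dof_b_add:
  assumes "conforming \<tau>" "conforming \<sigma>" "f \<in> interior_faces l {T}" "q \<in> PO l f"
  shows "dof_b K f m n (\<tau> + \<sigma>) q = dof_b K f m n \<tau> q + dof_b K f m n \<sigma> q"
proof -
  have "continuous_on (convex hull f) (\<lambda>x. m \<bullet> (\<tau> K x *v n))" "continuous_on (convex hull f) (\<lambda>x. m \<bullet> (\<sigma> K x *v n))"
    by (intro continuous_intros conforming_mult_continuous assms)+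
  from pairing_left[OF interior_face_subset(3)[OF assms(3)] interior_face_nonempty[OF assms(3)] this
      continuous_polys_on[OF assms(4)], of 1 1]
  show ?thesis by (simp add: dof_b_eq matrix_vector_mult_add_rdistrib inner_add_right distrib_right)
qed

lemma dof_b_linear:
  assumes "conforming \<tau>" "f \<in> interior_faces l {T}"
  shows "linear_on (PO l f) (dof_b K f m n \<tau>)"
  unfolding linear_on_def dof_b_eq
  by (intro ballI allI pairing_right interior_face_subset(3)[OF assms(2)] interior_face_nonempty[OF assms(2)]
      continuous_on_inner continuous_on_const assms conforming_mult_continuous continuous_polys_on)

lemma dof_c_add:
  assumes "conforming \<tau>" "conforming \<sigma>" "F \<in> interior_faces l {T}" "q \<in> ND k F"
  shows "dof_c nrm K F (\<tau> + \<sigma>) q = dof_c nrm K F \<tau> q + dof_c nrm K F \<sigma> q"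
  using pairing_left[OF interior_face_subset(3)[OF assms(3)] interior_face_nonempty[OF assms(3)]
      continuous_tangential[OF conforming_mult_continuous[OF assms(1)]]
      continuous_tangential[OF conforming_mult_continuous[OF assms(2)]]
      continuous_vec_polys_on[OF ND_D(1)[OF assms(4)]], of 1 "nrm F" K "nrm F" 1 "nrm F" K "nrm F"]
  by (simp add: dof_c_def matrix_vector_mult_add_rdistrib tangential_part_add)

lemma dof_c_linear:
  assumes "conforming \<tau>" "F \<in> interior_faces l {T}"
  shows "linear_on (ND k F) (dof_c nrm K F \<tau>)"
  unfolding linear_on_def dof_c_def
  by (intro ballI allI pairing_right interior_face_subset(3)[OF assms(2)] interior_face_nonempty[OF assms(2)]
      continuous_tangential assms conforming_mult_continuous continuous_vec_polys_on[OF ND_D(1)])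

lemma dof_d_eq:
  assumes "conforming \<tau>" "K \<in> split T" "q \<in> Bdiv k K"
  shows "dof_d K \<tau> q = cell_int K (\<lambda>x. \<tau> K x \<bullet> q x)"
  unfolding dof_d_def
proof (rule cell_int_closed)
  show "cell K" using assms(2) cell_sub by (auto simp: split_iff)
  have "q \<in> sym_polys (int k)" using assms(3) by (simp add: Bdiv_def)
  then show "continuous_on UNIV (\<lambda>x. \<tau> K x \<bullet> q x)"
    by (intro continuous_intros conforming_continuous assms(1) sym_polys_continuous)
qed

lemma cell_int_lin:
  assumes "cell K" "continuous_on UNIV u" "continuous_on UNIV w"
  shows "cell_int K (\<lambda>x. a * u x + b * w x) = a * cell_int K u + b * cell_int K w"
proof -
  have "cell_int K (\<lambda>x. a * u x + b * w x) =
      (LINT x|lborel. a * (indicator (interior (convex hull K)) x * u x) + b * (indicator (interior (convex hull K)) x * w x))"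
    by (simp add: cell_int_def algebra_simps)
  also have "\<dots> = a * cell_int K u + b * cell_int K w"
    unfolding cell_int_def using cell_integrable[OF assms(1,2)] cell_integrable[OF assms(1,3)] by simp
  finally show ?thesis .
qed

lemma Bdiv_continuous: "q \<in> Bdiv k K ==> continuous_on S q"
  by (rule sym_polys_continuous[of q "int k"]) (simp add: Bdiv_def)

lemma Bdiv_comb:
  assumes "K \<in> split T" "q \<in> Bdiv k K" "r \<in> Bdiv k K"
  shows "(\<lambda>x. a *\<^sub>R q x + b *\<^sub>R r x) \<in> Bdiv k K"
proof -
  have K: "cell K" using assms(1) cell_sub by (auto simp: split_iff)
  show ?thesis using assms(2,3) unfolding Bdiv_iff[OF K]
    by (auto intro!: sym_polys_add sym_polys_scale
        simp: matrix_vector_mult_add_rdistrib scaleR_matrix_vector_assoc[symmetric])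
qed

lemma dof_d_add:
  assumes "conforming \<tau>" "conforming \<sigma>" "conforming (\<tau> + \<sigma>)" "K \<in> split T" "q \<in> Bdiv k K"
  shows "dof_d K (\<tau> + \<sigma>) q = dof_d K \<tau> q + dof_d K \<sigma> q"
proof -
  have K: "cell K" using assms(4) cell_sub by (auto simp: split_iff)
  have "continuous_on UNIV (\<lambda>x. \<tau> K x \<bullet> q x)" "continuous_on UNIV (\<lambda>x. \<sigma> K x \<bullet> q x)"
    by (intro continuous_on_inner conforming_continuous[OF assms(1)] conforming_continuous[OF assms(2)]
        Bdiv_continuous[OF assms(5)])+
  from cell_int_lin[OF K this, of 1 1] show ?thesis
    by (simp add: dof_d_eq[OF assms(1,4,5)] dof_d_eq[OF assms(2,4,5)] dof_d_eq[OF assms(3,4,5)] inner_add_left)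
qed

lemma dof_d_linear:
  assumes "conforming \<tau>" "K \<in> split T"
  shows "linear_on (Bdiv k K) (dof_d K \<tau>)"
  unfolding linear_on_def
proof (intro ballI allI)
  fix q r a b assume q: "q \<in> Bdiv k K" and r: "r \<in> Bdiv k K"
  have K: "cell K" using assms(2) cell_sub by (auto simp: split_iff)
  have "continuous_on UNIV (\<lambda>x. \<tau> K x \<bullet> q x)" "continuous_on UNIV (\<lambda>x. \<tau> K x \<bullet> r x)"
    by (intro continuous_intros conforming_continuous assms Bdiv_continuous[OF q] Bdiv_continuous[OF r])+
  from cell_int_lin[OF K this, of a b]
  show "dof_d K \<tau> (\<lambda>x. a *\<^sub>R q x + b *\<^sub>R r x) = a * dof_d K \<tau> q + b * dof_d K \<tau> r"
    by (simp add: dof_d_eq[OF assms q] dof_d_eq[OF assms r] dof_d_eq[OF assms Bdiv_comb[OF assms(2) q r]] inner_add_right)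
qed

definition dofs_a_zero :: "'n field \<Rightarrow> bool" where
  "dofs_a_zero \<tau> \<longleftrightarrow> (\<forall>i\<in>T. \<forall>q\<in>VP i. dof_a nrm T (T - {i}) \<tau> q = 0)"

definition dofs_b_zero :: "nat \<Rightarrow> 'n field \<Rightarrow> bool" where
  "dofs_b_zero l \<tau> \<longleftrightarrow> (\<forall>f\<in>interior_faces l {T}. \<forall>i j. 1 \<le> i \<longrightarrow> i \<le> j \<longrightarrow> j \<le> CARD('n) - l \<longrightarrow>
      (\<forall>q\<in>PO l f. dof_b (elt f) f (nb f i) (nb f j) \<tau> q = 0))"

definition dofs_c_zero :: "'n field \<Rightarrow> bool" where
  "dofs_c_zero \<tau> \<longleftrightarrow> (\<forall>F\<in>interior_facets. \<forall>q\<in>ND k F. dof_c nrm (elt F) F \<tau> q = 0)"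

definition trace_zero :: "'n field \<Rightarrow> bool" where
  "trace_zero \<tau> \<longleftrightarrow> (\<forall>i\<in>T. \<forall>x\<in>convex hull (T - {i}). \<tau> (sub i) x *v g i = 0)"

lemma matrix_mult_vec_polys: "\<tau> \<in> sym_polys r ==> (\<lambda>x. \<tau> x *v n) \<in> vec_polys r"
  using sym_polys_entry[of \<tau> r "axis _ 1" n] by (auto simp: vec_polys_def inner_axis')

text \<open>The normal trace is a polynomial of degree at most \<open>k\<close>, so it may be tested
  with itself.\<close>

lemma trace_zeroI:
  assumes \<tau>: "conforming \<tau>" and a: "dofs_a_zero \<tau>" shows "trace_zero \<tau>"
  unfolding trace_zero_def
proof (intro ballI)
  fix i x assume i: "i \<in> T" and x: "x \<in> convex hull (T - {i})"
  let ?F = "T - {i}"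
  let ?h = "\<lambda>x. \<tau> (sub i) x *v nrm ?F"
  have "on_simplex ?F ?h \<in> VP i"
    using matrix_mult_vec_polys[OF conforming_sym_polys[OF \<tau> i]] by (simp add: vec_polys_on_def)
  then have "surface_integral ?F (\<lambda>x. ?h x \<bullet> on_simplex ?F ?h x) = 0"
    using a i unfolding dofs_a_zero_def dof_a_eq[OF i, symmetric] by blast
  also have "surface_integral ?F (\<lambda>x. ?h x \<bullet> on_simplex ?F ?h x) = surface_integral ?F (\<lambda>x. ?h x \<bullet> ?h x)"
    by (rule surface_integral_cong) (simp add: on_simplex_apply)
  finally have 0: "surface_integral ?F (\<lambda>x. ?h x \<bullet> ?h x) = 0" .
  have "?h x \<bullet> ?h x = 0"
    by (rule surface_integral_definite[OF facet_finite(1) facet_finite(2)[OF i] _ _ 0 x])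
      (auto intro!: continuous_intros conforming_mult_continuous \<tau>)
  moreover obtain s where "s \<noteq> 0" "nrm ?F = s *\<^sub>R g i" using nrm_boundary[OF i] .
  ultimately show "\<tau> (sub i) x *v g i = 0" by (simp add: matrix_vector_mult_scaleR)
qed

text \<open>(b) is prescribed only for ordered pairs of basis vectors and on the cell
  \<open>elt f\<close>. Symmetry of the tensor, bilinearity and continuity of the normal-normal part
  extend the vanishing to all normals and all cells containing \<open>f\<close>.\<close>

lemma dofs_b_zero_span:
  assumes \<tau>: "conforming \<tau>" and l: "l < CARD('n)" and b: "dofs_b_zero l \<tau>"
    and f: "f \<in> interior_faces l {T}" and i: "i \<in> T" "f \<subseteq> sub i"
    and m: "m \<in> nor_space f" and n: "n \<in> nor_space f" and q: "q \<in> PO l f"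
  shows "surface_integral f (\<lambda>x. (m \<bullet> (\<tau> (sub i) x *v n)) * q x) = 0"
proof -
  let ?S = "\<lambda>m n. surface_integral f (\<lambda>x. (m \<bullet> (\<tau> (sub i) x *v n)) * q x)"
  obtain e where e: "e \<in> T" "elt f = sub e" "f \<subseteq> sub e" using interior_face_cell[OF l f] .
  note basis = nb_basis[OF l f]
  have nbn: "nb f a \<in> nor_space f" if "a \<in> {1..CARD('n) - l}" for a
    using basis that span_base[of "nb f a" "nb f ` {1..CARD('n) - l}"] by auto
  have sw: "?S m n = dof_b (elt f) f m n \<tau> q" if "m \<in> nor_space f" "n \<in> nor_space f" for m n
    unfolding dof_b_def e(2)
    by (intro surface_integral_cong arg_cong2[where f = "(*)"] refl nn_continuousD)
      (use \<tau> i e that f in \<open>auto simp: conforming_def interior_face_subset\<close>)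
  have sym: "?S m n = ?S n m" for m n
    using transpose_inner[of "\<tau> (sub i) _"] conforming_sym_polys[OF \<tau> i(1)] by (simp add: sym_polys_def)
  have basis0: "?S (nb f a) (nb f b) = 0" if ab: "a \<in> {1..CARD('n) - l}" "b \<in> {1..CARD('n) - l}" for a b
  proof (cases "a \<le> b")
    case True
    then show ?thesis using sw[OF nbn[OF ab(1)] nbn[OF ab(2)]] b f q ab by (simp add: dofs_b_zero_def)
  next
    case False
    then show ?thesis using sw[OF nbn[OF ab(2)] nbn[OF ab(1)]] sym[of "nb f a"] b f q ab by (simp add: dofs_b_zero_def)
  qed
  have cq: "continuous_on (convex hull f) q" by (rule continuous_polys_on[OF q])
  have cs: "continuous_on (convex hull f) (\<lambda>x. (m \<bullet> (\<tau> (sub i) x *v n)) * q x)" for m n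
    by (intro continuous_intros conforming_mult_continuous[OF \<tau>] cq)
  have comb: "?S (a *\<^sub>R m + m') n = a * ?S m n + ?S m' n" for a m m' n
    using surface_integral_lin[OF interior_face_subset(3)[OF f] interior_face_nonempty[OF f] cs cs, of a m n 1 m' n]
    by (simp add: inner_add_left distrib_right mult.assoc)
  have S0: "?S 0 n = 0" for n by (rule surface_integral_zero) simp
  have ext: "?S m n = 0" if m: "m \<in> nor_space f" and n: "\<And>a. a \<in> {1..CARD('n) - l} ==> ?S (nb f a) n = 0" for m n
  proof -
    have "m \<in> span (nb f ` {1..CARD('n) - l})" using m basis by simp
    then show ?thesis
    proof (induction rule: span_induct_alt)
      case base show ?case by (rule S0)
    next
      case (step a x y)
      then have "?S x n = 0" using n by blast
      then show ?case using comb[of a x y n] step by simp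
    qed
  qed
  have "?S m (nb f a) = 0" if "a \<in> {1..CARD('n) - l}" for a by (rule ext[OF m]) (rule basis0[OF _ that])
  then have "?S (nb f a) m = 0" if "a \<in> {1..CARD('n) - l}" for a using sym[of "nb f a" m] that by simp
  then have "?S n m = 0" by (rule ext[OF n])
  then show ?thesis using sym[of m n] by simp
qed

lemma dofs_zero_unique:
  assumes \<tau>: "conforming \<tau>" and a: "dofs_a_zero \<tau>" and b: "\<And>l. l < CARD('n) ==> dofs_b_zero l \<tau>"
    and c: "dofs_c_zero \<tau>" and d: "\<And>K q. K \<in> split T ==> q \<in> Bdiv k K ==> dof_d K \<tau> q = 0"
  shows "\<tau> = 0"
proof (rule conforming_zero[OF \<tau> _ _ d])
  show tr: "\<tau> (sub i) x *v g i = 0" if "i \<in> T" "x \<in> convex hull (T - {i})" for i x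
    using trace_zeroI[OF \<tau> a] that by (simp add: trace_zero_def)
  fix i j x assume ij: "i \<in> T" "j \<in> T" "i \<noteq> j" and x: "x \<in> convex hull (sub i - {j})"
  let ?F = "sub i - {j}"
  have F: "?F \<in> interior_facets" by (rule interior_facetI[OF ij])
  show "\<tau> (sub i) x *v (g j - g i) = 0"
  proof (rule facet_normal_zero[OF \<tau> tr _ ij _ x])
    fix q assume q: "q \<in> ND k ?F"
    obtain s where s: "s \<noteq> 0" "nrm ?F = s *\<^sub>R (g i - g j)" using nrm_interior[OF ij] .
    have "CARD('n) - 1 < CARD('n)" by simp
    then obtain e where e: "e \<in> T" "elt ?F = sub e" "?F \<subseteq> sub e" using interior_face_cell[OF _ F] by metis
    have "g j - g i \<in> nor_space ?F"
      using glam_nor_space[OF cell_sub[OF ij(1)], of ?F j] glam_sub[OF ij(1,2) ij(3)[symmetric]] ij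
      by (auto simp: subcell_def)
    then have n: "nrm ?F \<in> nor_space ?F"
      using subspace_scale[OF subspace_nor_space, of "g j - g i" ?F "- s"] by (simp add: s(2) algebra_simps)
    \<comment> \<open>\<open>q\<close> is tangential, so the tangential projection may be dropped,
      and normal continuity replaces \<open>elt ?F\<close> by \<open>sub i\<close>. The factor
      relates the unit normal to the difference of gradients.\<close>
    have eq: "tangential_part (nrm ?F) (\<tau> (elt ?F) y *v nrm ?F) \<bullet> q y
        = (- s) * ((\<tau> (sub i) y *v (g j - g i)) \<bullet> q y)" if y: "y \<in> convex hull ?F" for y
    proof -
      have "nrm ?F \<bullet> q y = 0" using nor_tan_orth[OF n ND_D(2)[OF q y]] .
      moreover have "\<tau> (elt ?F) y *v (g i - g j) = \<tau> (sub i) y *v (g i - g j)"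
        using cells_containing_facet[OF ij e(1,3)] e(2) normal_continuousD[OF _ ij y, of \<tau>] \<tau> by (auto simp: conforming_def)
      moreover have "\<tau> (sub i) y *v (g i - g j) = - (\<tau> (sub i) y *v (g j - g i))"
        by (simp add: matrix_vector_mult_diff_distrib)
      moreover have "\<tau> (elt ?F) y *v nrm ?F = s *\<^sub>R (\<tau> (elt ?F) y *v (g i - g j))"
        by (simp only: s(2) matrix_vector_mult_scaleR)
      ultimately show ?thesis by (simp add: tangential_part_inner)
    qed
    have "dof_c nrm (elt ?F) ?F \<tau> q = 0" using c F q by (simp add: dofs_c_zero_def)
    moreover have "dof_c nrm (elt ?F) ?F \<tau> q
        = surface_integral ?F (\<lambda>y. (- s) * ((\<tau> (sub i) y *v (g j - g i)) \<bullet> q y))"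
      unfolding dof_c_def by (rule surface_integral_cong) (rule eq)
    ultimately have "(- s) * surface_integral ?F (\<lambda>y. (\<tau> (sub i) y *v (g j - g i)) \<bullet> q y) = 0"
      unfolding surface_integral_scale by simp
    then show "surface_integral ?F (\<lambda>y. (\<tau> (sub i) y *v (g j - g i)) \<bullet> q y) = 0" using s(1) by simp
  next
    fix f i x m n assume f: "c \<in> f" "i \<in> T" "f \<subseteq> sub i" "card f \<le> CARD('n)" "x \<in> convex hull f"
      "m \<in> nor_space f" "n \<in> nor_space f"
    have "surface_integral f (\<lambda>x. (m \<bullet> (\<tau> (sub i) x *v n)) * q x) = 0"
      if "l < CARD('n)" "f \<in> interior_faces l {T}" "i \<in> T" "f \<subseteq> sub i" "m \<in> nor_space f" "n \<in> nor_space f"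
        "q \<in> PO l f" for l f i m n q
      by (rule dofs_b_zero_span[OF \<tau> that(1) b[OF that(1)] that(2-)])
    from interior_nn_zero[OF \<tau> tr this f] show "m \<bullet> (\<tau> (sub i) x *v n) = 0" .
  qed
qed

end

section \<open>Attaining prescribed degrees of freedom\<close>

text \<open>Solutions for one functional that leave all the others zero can be added up.
  \<open>V\<close> carries the degrees of freedom that must remain zero throughout.\<close>

lemma superpose:
  fixes D :: "'i \<Rightarrow> 'v::ab_group_add \<Rightarrow> 'q \<Rightarrow> real"
  assumes I: "finite I" and V: "0 \<in> V" "\<And>\<tau> \<sigma>. \<tau> \<in> V ==> \<sigma> \<in> V ==> \<tau> + \<sigma> \<in> V"
    and add: "\<And>\<tau> \<sigma> i q. \<tau> \<in> V ==> \<sigma> \<in> V ==> i \<in> I ==> q \<in> Q i ==> D i (\<tau> + \<sigma>) q = D i \<tau> q + D i \<sigma> q"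
    and single: "\<And>i. i \<in> I ==> \<exists>\<tau>\<in>V. (\<forall>q\<in>Q i. D i \<tau> q = L i q) \<and> (\<forall>j\<in>I - {i}. \<forall>q\<in>Q j. D j \<tau> q = 0)"
  shows "\<exists>\<tau>\<in>V. \<forall>i\<in>I. \<forall>q\<in>Q i. D i \<tau> q = L i q"
proof -
  have "\<exists>\<tau>\<in>V. (\<forall>i\<in>J. \<forall>q\<in>Q i. D i \<tau> q = L i q) \<and> (\<forall>i\<in>I - J. \<forall>q\<in>Q i. D i \<tau> q = 0)"
    if "finite J" "J \<subseteq> I" for J
    using that
  proof (induction J rule: finite_induct)
    case empty
    have "D i 0 q = 0" if "i \<in> I" "q \<in> Q i" for i q using add[OF V(1) V(1) that] by simp
    then show ?case using V(1) by (intro bexI[of _ 0]) auto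
  next
    case (insert i J)
    obtain \<tau> where \<tau>: "\<tau> \<in> V" "\<And>j q. j \<in> J ==> q \<in> Q j ==> D j \<tau> q = L j q"
      "\<And>j q. j \<in> I - J ==> q \<in> Q j ==> D j \<tau> q = 0" using insert by auto
    obtain \<sigma> where \<sigma>: "\<sigma> \<in> V" "\<And>q. q \<in> Q i ==> D i \<sigma> q = L i q"
      "\<And>j q. j \<in> I - {i} ==> q \<in> Q j ==> D j \<sigma> q = 0" using single[of i] insert.prems by auto
    have i: "i \<in> I - J" and J: "J \<subseteq> I - {i}" using insert.hyps insert.prems by auto
    have "D j (\<tau> + \<sigma>) q = L j q" if "j \<in> insert i J" "q \<in> Q j" for j q
    proof (cases "j = i")
      case True
      then show ?thesis using add[OF \<tau>(1) \<sigma>(1), of i q] \<tau>(3)[OF i] \<sigma>(2) i that by simp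
    next
      case False
      then have j: "j \<in> J" "j \<in> I - {i}" using that J by auto
      then show ?thesis using add[OF \<tau>(1) \<sigma>(1), of j q] \<tau>(2)[OF j(1)] \<sigma>(3)[OF j(2)] that by simp
    qed
    moreover have "D j (\<tau> + \<sigma>) q = 0" if "j \<in> I - insert i J" "q \<in> Q j" for j q
      using that add[OF \<tau>(1) \<sigma>(1), of j q] \<tau>(3)[of j q] \<sigma>(3)[of j q] by simp
    ultimately show ?case using V(2)[OF \<tau>(1) \<sigma>(1)] by blast
  qed
  from this[OF I order.refl] show ?thesis by blast
qed

text \<open>A monomial is the bubble of its support times a monomial on that support. This splits
  the homogeneous polynomials on a simplex into bubbles of its faces.\<close>

lemma mono_bub:
  assumes F: "finite F" and \<alpha>: "\<alpha> \<in> hexp F (int k)" and f: "f = {v\<in>F. \<alpha> v \<noteq> 0}" and l: "card f = l + 1"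
  shows "mono_at f (\<lambda>v. \<alpha> v - 1) \<in> hom f (int k - int l - 1)"
    and "bub_hom f (mono_at f (\<lambda>v. \<alpha> v - 1)) K x = mono_at F \<alpha> (\<lambda>v. lam v K x)"
proof -
  have ff: "finite f" using F f by simp
  have "sum \<alpha> F = sum \<alpha> f" unfolding f by (rule sum.mono_neutral_right) (use F in auto)
  moreover have "sum \<alpha> f = sum (\<lambda>v. \<alpha> v - 1) f + card f"
    using sum.distrib[of "\<lambda>v. \<alpha> v - 1" "\<lambda>_. 1" f] by (simp add: f)
  ultimately have "int (sum (\<lambda>v. \<alpha> v - 1) f) = int k - int l - 1" using \<alpha> l by (simp add: hexp_def del: of_nat_sum)
  then have "(\<lambda>v. \<alpha> v - 1) \<in> hexp f (int k - int l - 1)"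
    using \<alpha> by (auto simp: hexp_def f simp del: of_nat_sum)
  then show "mono_at f (\<lambda>v. \<alpha> v - 1) \<in> hom f (int k - int l - 1)" by (rule hom_mono_at[OF ff])
  have "mono_at F \<alpha> (\<lambda>v. lam v K x) = (\<Prod>v\<in>f. lam v K x ^ \<alpha> v)"
    unfolding mono_at_def f by (rule prod.mono_neutral_right) (use F in auto)
  also have "\<dots> = (\<Prod>v\<in>f. lam v K x * lam v K x ^ (\<alpha> v - 1))"
    by (rule prod.cong) (auto simp: f power_eq_if)
  finally show "bub_hom f (mono_at f (\<lambda>v. \<alpha> v - 1)) K x = mono_at F \<alpha> (\<lambda>v. lam v K x)"
    by (simp add: bub_hom_def bub_def mono_at_def prod.distrib)
qed

lemma supp_nonempty:
  assumes "\<alpha> \<in> hexp F (int k)" "1 \<le> k" shows "{v\<in>F. \<alpha> v \<noteq> 0} \<noteq> {}"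
proof
  assume "{v\<in>F. \<alpha> v \<noteq> 0} = {}"
  then have "sum \<alpha> F = 0" by (intro sum.neutral) auto
  then show False using assms by (simp add: hexp_def del: of_nat_sum)
qed

lemma tan_space_comb:
  assumes "finite f" "sum y f = 0" shows "(\<Sum>v\<in>f. y v *\<^sub>R v) \<in> tan_space f"
proof (cases "f = {}")
  case True
  then show ?thesis by (simp add: tan_space_def)
next
  case False
  then obtain a where a: "a \<in> f" by blast
  have "(\<Sum>v\<in>f. y v *\<^sub>R v) = (\<Sum>v\<in>f. y v *\<^sub>R (v - a))"
    using assms(2) by (simp add: scaleR_diff_right sum_subtractf flip: scaleR_sum_left)
  then show ?thesis
    using a by (auto intro!: subspace_sum subspace_scale subspace_tan_space tan_space_diff)
qed

lemma vec_polys_Basis: "q \<in> vec_polys r \<longleftrightarrow> (\<forall>b\<in>Basis. (\<lambda>x. q x \<bullet> b) \<in> polys r)"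
  by (auto simp: vec_polys_def Basis_vec_def inner_axis)

lemma vec_polys_comb: "q \<in> vec_polys r ==> p \<in> vec_polys r ==> (\<lambda>x. a *\<^sub>R q x + b *\<^sub>R p x) \<in> vec_polys r"
  by (auto simp: vec_polys_def intro!: polys_add polys_scale)

lemma vec_polys_on_comb:
  assumes "q \<in> vec_polys_on F r" "p \<in> vec_polys_on F r"
  shows "(\<lambda>x. a *\<^sub>R q x + b *\<^sub>R p x) \<in> vec_polys_on F r"
proof -
  obtain q' p' where "q' \<in> vec_polys r" "p' \<in> vec_polys r" "q = on_simplex F q'" "p = on_simplex F p'"
    using assms by (auto simp: vec_polys_on_def)
  then show ?thesis unfolding vec_polys_on_def
    by (intro image_eqI[of _ _ "\<lambda>x. a *\<^sub>R q' x + b *\<^sub>R p' x"] vec_polys_comb) (auto simp: on_simplex_def)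
qed

lemma polys_on_comb:
  assumes "q \<in> polys_on F r" "p \<in> polys_on F r"
  shows "(\<lambda>x. a *\<^sub>R q x + b *\<^sub>R p x) \<in> polys_on F r"
proof -
  obtain q' p' where "q' \<in> polys r" "p' \<in> polys r" "q = on_simplex F q'" "p = on_simplex F p'"
    using assms by (auto simp: polys_on_def)
  then show ?thesis unfolding polys_on_def
    by (intro image_eqI[of _ _ "\<lambda>x. a * q' x + b * p' x"]) (auto simp: on_simplex_def intro: polys_add polys_scale)
qed

lemma vec_polys_on_finite_dim: "\<exists>S. finite S \<and> vec_polys_on F r \<subseteq> fs.span S"
proof -
  have eq: "vec_polys_on F r = {\<lambda>x. (if x \<in> convex hull F then 1 else 0) *\<^sub>R q x |q. \<forall>b\<in>Basis. (\<lambda>x. q x \<bullet> b) \<in> polys r}"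
    unfolding vec_polys_on_def vec_polys_Basis[symmetric] on_simplex_def[abs_def]
    by (auto simp: if_distrib[of "\<lambda>a. a *\<^sub>R _"] cong: if_cong)
  show ?thesis unfolding eq by (rule polys_finite_dim)
qed

lemma polys_on_finite_dim: "\<exists>S. finite S \<and> polys_on F r \<subseteq> fs.span S"
proof -
  have eq: "polys_on F r = {\<lambda>x. (if x \<in> convex hull F then 1 else 0) *\<^sub>R q x |q. \<forall>b\<in>Basis. (\<lambda>x. q x \<bullet> b) \<in> polys r}"
    unfolding polys_on_def on_simplex_def[abs_def]
    by (auto simp: if_distrib[of "\<lambda>a. a * _"] cong: if_cong)
  show ?thesis unfolding eq by (rule polys_finite_dim)
qed

lemma sym_polys_finite_dim: "\<exists>S. finite S \<and> (sym_polys r :: (real^'n \<Rightarrow> real^'n^'n) set) \<subseteq> fs.span S"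
proof -
  have "sym_polys r \<subseteq> {\<lambda>x. (1::real) *\<^sub>R q x |q :: real^'n \<Rightarrow> real^'n^'n. \<forall>b\<in>Basis. (\<lambda>x. q x \<bullet> b) \<in> polys r}"
    by (auto simp: sym_polys_def Basis_vec_def inner_axis)
  moreover obtain S where "finite S" "{\<lambda>x. (1::real) *\<^sub>R q x |q :: real^'n \<Rightarrow> real^'n^'n. \<forall>b\<in>Basis. (\<lambda>x. q x \<bullet> b) \<in> polys r} \<subseteq> fs.span S"
    using polys_finite_dim[of "\<lambda>_. 1" r] by blast
  ultimately show ?thesis by blast
qed

lemma nhat_nonempty:
  assumes K: "cell (K::(real^'n) set)" and dim2: "2 \<le> CARD('n)" and w: "w \<in> K" and f: "f \<subseteq> K - {w}" "f \<noteq> {}"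
    and nrm: "\<And>v. v \<in> K ==> \<exists>s. s \<noteq> 0 \<and> nrm (K - {v}) = s *\<^sub>R glam v K"
  shows "\<exists>n. n \<in> nhat nrm f (K - {w}) K"
proof -
  obtain a where a: "a \<in> f" using f by blast
  obtain s where s: "s \<noteq> 0" "nrm (K - {w}) = s *\<^sub>R glam w K" using nrm[OF w] by blast
  obtain t where t: "t \<in> tan_space f" "(w - a) - t \<in> nor_space f" using tan_nor_decompose by blast
  \<comment> \<open>The normal part of the edge from \<open>a\<close> to \<open>w\<close>: the
    gradients of vertices outside \<open>f\<close> annihilate tangents of \<open>f\<close> and see
    only the endpoint \<open>w\<close>. Division by \<open>s\<close> normalizes.\<close>
  let ?n = "(1 / s) *\<^sub>R ((w - a) - t)"
  have n: "?n \<in> nor_space f" using t(2) subspace_nor_space by (rule subspace_scale[rotated])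
  have gn: "glam v K \<bullet> ((w - a) - t) = (if v = w then 1 else 0)" if v: "v \<in> K - f" for v
  proof -
    have "glam v K \<bullet> t = 0" using tan_space_glam[OF K _ v t(1)] f by blast
    moreover have "a \<in> K" "a \<noteq> v" using a f v by auto
    then have "glam v K \<bullet> (w - a) = (if v = w then 1 else 0)" using glam_vertex[OF K w, of a v] by auto
    ultimately show ?thesis by (simp only: inner_diff_right[of _ "w - a"])
  qed
  have "?n \<bullet> nrm (K - {w}) = 1" using gn[of w] w f s by (auto simp: inner_commute)
  moreover have "?n \<bullet> nrm F' = 0" if F': "F' \<in> faces (CARD('n) - 1) {K}" "f \<subseteq> F'" "F' \<noteq> K - {w}" for F'
  proof -
    have "F' \<subseteq> K" "card F' = CARD('n)" using F' dim2 by (auto simp: faces_def)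
    moreover from this have "card (K - F') = 1" using K cell_finite[OF K] by (simp add: cell_def card_Diff_subset finite_subset)
    ultimately obtain v where v: "K - F' = {v}" "F' = K - {v}" "v \<in> K" by (auto simp: card_1_singleton_iff)
    then have "v \<in> K - f" "v \<noteq> w" using F' by auto
    then show ?thesis using gn[of v] nrm[OF v(3)] v(2) by (auto simp: inner_commute)
  qed
  ultimately have "?n \<in> nhat nrm f (K - {w}) K" using n unfolding nhat_def by blast
  then show ?thesis by blast
qed

section \<open>Extension of boundary data into the local space\<close>

context local_dofs
begin

lemma Sigma_add: "\<tau> \<in> \<Sigma> ==> \<sigma> \<in> \<Sigma> ==> \<tau> + \<sigma> \<in> \<Sigma>"
  and Sigma_scale: "\<tau> \<in> \<Sigma> ==> scale_field a \<tau> \<in> \<Sigma>"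
  and Sigma_zero: "0 \<in> \<Sigma>"
  unfolding Sigma_loc_def by (auto intro: field.span_add field.span_scale field.span_zero)

lemma Sigma_conf: "\<tau> \<in> \<Sigma> ==> conforming \<tau>"
  using Sigma_conforming by blast

lemma bubbles_elem:
  assumes "P \<in> hom f (int k - int l - 1)" "A \<in> V"
  shows "restrict_field (split T) (\<lambda>K x. bub_hom f P K x *\<^sub>R A K) \<in> bubbles k l T f V"
  unfolding bubbles_def bub_hom_def
  by (rule field.span_base, intro CollectI exI[of _ "\<lambda>K x. P (\<lambda>v. lam v K x)"] exI[of _ A])
    (use assms in \<open>auto simp: hom_polys_eq\<close>)

lemma NS_elem:
  assumes "f \<in> faces l {T}" "l < CARD('n)" "P \<in> hom f (int k - int l - 1)" "A \<in> NS f"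
  shows "restrict_field (split T) (\<lambda>K x. bub_hom f P K x *\<^sub>R A) \<in> \<Sigma>"
proof -
  have "restrict_field (split T) (\<lambda>K x. bub_hom f P K x *\<^sub>R A) \<in> bubbles k l T f (constant_fields (NS f))"
    using bubbles_elem[OF assms(3), of "\<lambda>_. A" "constant_fields (NS f)"] assms(4) by (simp add: constant_fields_def)
  then show ?thesis unfolding Sigma_loc_def using assms(1,2) by (intro field.span_base) blast
qed

lemma phi_elem:
  assumes "f \<in> faces l {T}" "l < CARD('n)" "P \<in> hom f (int k - int l - 1)" "i \<in> T - f" "j \<in> T - f" "i \<noteq> j"
  shows "restrict_field (split T) (\<lambda>K x. bub_hom f P K x *\<^sub>R phi v0 T f i j K) \<in> \<Sigma>"
proof -
  have "phi v0 T f i j \<in> phi_generators v0 T f" using assms(4-6) by (auto simp: phi_generators_def)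
  then have "restrict_field (split T) (\<lambda>K x. bub_hom f P K x *\<^sub>R phi v0 T f i j K) \<in> bubbles k l T f (phi_generators v0 T f)"
    by (rule bubbles_elem[OF assms(3)])
  then show ?thesis unfolding Sigma_loc_def using assms(1,2) by (intro field.span_base) blast
qed

lemma SS_elem:
  assumes "f \<in> interior_faces l {T}" "l < CARD('n)" "P \<in> hom f (int k - int l - 1)" "A \<in> SS (nor_space f)"
  shows "restrict_field (split T) (\<lambda>K x. bub_hom f P K x *\<^sub>R A) \<in> \<Sigma>"
proof -
  have "restrict_field (split T) (\<lambda>K x. bub_hom f P K x *\<^sub>R A) \<in> bubbles k l T f (constant_fields (SS (nor_space f)))"
    using bubbles_elem[OF assms(3), of "\<lambda>_. A" "constant_fields (SS (nor_space f))"] assms(4) by (simp add: constant_fields_def)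
  then show ?thesis unfolding Sigma_loc_def using assms(1,2) by (intro field.span_base) blast
qed

lemma tn_elem:
  assumes F: "F \<in> interior_facets" and f: "f \<subseteq> F" "card f = l + 1" "l < CARD('n)"
    and P: "P \<in> hom f (int k - int l - 1)" and t: "t \<in> tan_space f"
    and n: "\<And>K. K \<in> split T ==> F \<subseteq> K ==> n K \<in> nhat nrm f F K"
  shows "restrict_field (split T) (\<lambda>K x. bub_hom f P K x *\<^sub>R tn_tensor F t n K) \<in> \<Sigma>"
proof -
  have eq: "restrict_field (split T) (\<lambda>K x. bub_hom f P K x *\<^sub>R tn_tensor F t n K)
      = restrict_field {K \<in> split T. F \<subseteq> K} (\<lambda>K x. (bub f K x * P (\<lambda>v. lam v K x)) *\<^sub>R sym_part (tensor t (n K)))"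
    by (auto simp: restrict_field_def fun_eq_iff bub_hom_def tn_tensor_def)
  have "restrict_field (split T) (\<lambda>K x. bub_hom f P K x *\<^sub>R tn_tensor F t n K) \<in> tn_bubbles nrm k l T F f"
    unfolding eq tn_bubbles_def
    by (rule field.span_base, intro CollectI exI[of _ "\<lambda>K x. P (\<lambda>v. lam v K x)"] exI[of _ t] exI[of _ n])
      (use P t n in \<open>auto simp: hom_polys_eq\<close>)
  moreover have "f \<in> faces l {F}" using f by (simp add: faces_def)
  ultimately show ?thesis unfolding Sigma_loc_def using F f(3) by (intro field.span_base) blast
qed

lemma cell_elem: "K \<in> split T ==> q \<in> Bdiv k K ==> restrict_field {K} (\<lambda>K'. q) \<in> \<Sigma>"
  unfolding Sigma_loc_def cell_bubbles_def by (intro field.span_base) blast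

lemma restrict_sub: "i \<in> T ==> restrict_field (split T) \<tau> (sub i) x = \<tau> (sub i) x"
  by (simp add: restrict_field_def split_def)

definition boundary_trace :: "'n field \<Rightarrow> real^'n \<Rightarrow> (real^'n \<Rightarrow> real^'n) \<Rightarrow> bool" where
  "boundary_trace \<tau> i h \<longleftrightarrow> (\<forall>j\<in>T. \<forall>x\<in>convex hull (T - {j}). \<tau> (sub j) x *v g j = (if j = i then h x else 0))"

lemma boundary_trace_add: "boundary_trace \<tau> i h ==> boundary_trace \<sigma> i h' ==> boundary_trace (\<tau> + \<sigma>) i (\<lambda>x. h x + h' x)"
  by (simp add: boundary_trace_def matrix_vector_mult_add_rdistrib)

lemma boundary_trace_scale: "boundary_trace \<tau> i h ==> boundary_trace (scale_field a \<tau>) i (\<lambda>x. a *\<^sub>R h x)"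
  by (simp add: boundary_trace_def scale_field_def scaleR_matrix_vector_assoc[symmetric])

lemma boundary_trace_zero: "boundary_trace 0 i (\<lambda>x. 0)"
  by (simp add: boundary_trace_def)

lemma boundary_trace_bub:
  assumes f: "f \<subseteq> T" "finite f" and A: "\<And>j. j \<in> T - f ==> A (sub j) *v g j = (if j = i then y else 0)"
  shows "boundary_trace (restrict_field (split T) (\<lambda>K x. bub_hom f P K x *\<^sub>R A K)) i
    (\<lambda>x. bub_hom f P (sub i) x *\<^sub>R y)"
  unfolding boundary_trace_def
proof (intro ballI)
  fix j x assume j: "j \<in> T" and x: "x \<in> convex hull (T - {j})"
  show "restrict_field (split T) (\<lambda>K x. bub_hom f P K x *\<^sub>R A K) (sub j) x *v g j
      = (if j = i then bub_hom f P (sub i) x *\<^sub>R y else 0)"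
  proof (cases "j \<in> f")
    case True
    then have "bub_hom f P (sub j) x = 0"
      using j by (intro bub_hom_zero[OF cell_sub _ x _ f(2)]) (auto simp: subcell_def)
    then show ?thesis using j by (cases "j = i") (simp_all add: restrict_sub)
  next
    case False
    then show ?thesis using A[of j] j by (auto simp: restrict_sub scaleR_matrix_vector_assoc[symmetric])
  qed
qed

text \<open>The coefficient \<open>CARD('n) + 1\<close> balances the constant tensor against \<open>phi\<close> so that the normal
  trace on the facet opposite to \<open>v\<close> cancels.\<close>

lemma edge_trace:
  assumes f: "f \<in> faces l {T}" "l < CARD('n)" and P: "P \<in> hom f (int k - int l - 1)"
    and i: "i \<in> T - f" and v: "v \<in> T" "v \<noteq> v0 f"
  shows "\<exists>\<tau>\<in>\<Sigma>. boundary_trace \<tau> i (\<lambda>x. bub_hom f P (sub i) x *\<^sub>R (v - v0 f))"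
proof -
  let ?a = "v0 f"
  have a: "?a \<in> f" by (rule v0_mem[OF f(2,1)])
  have fT: "f \<subseteq> T" "finite f" using f finite_T finite_subset by (auto simp: faces_T)
  have aT: "?a \<in> T" using a fT by blast
  obtain A where A: "A \<in> NS f" "\<forall>n\<in>nor_space f. A *v n = sym_part (tensor (v - ?a) (i - ?a)) *v n"
    using NS_part by blast
  have gj: "g j \<in> nor_space f" if "j \<in> T - f" for j using glam_nor_space[OF cell_T fT(1)] that by blast
  have e: "(w - ?a) \<bullet> g j = (if w = j then 1 else 0)" if "w \<in> T" "j \<in> T - f" for w j
  proof -
    have "j \<noteq> ?a" using that a by blast
    then show ?thesis using glam_vertex_T[of j w ?a] that aT by (simp add: inner_commute)
  qed
  have Aj: "A *v g j = (1/2) *\<^sub>R ((if i = j then 1 else 0) *\<^sub>R (v - ?a) + (if v = j then 1 else 0) *\<^sub>R (i - ?a))"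
    if "j \<in> T - f" for j
    using A(2) gj[OF that] e[OF _ that] i v by (simp add: sym_tensor_mult)
  let ?E = "restrict_field (split T) (\<lambda>K x. bub_hom f P K x *\<^sub>R A)"
  have E: "?E \<in> \<Sigma>" by (rule NS_elem[OF f P A(1)])
  \<comment> \<open>If \<open>v\<close> is in \<open>f\<close>, only the facet opposite to
    \<open>i\<close> is reached, with factor 1/2; if \<open>v = i\<close>, the two halves of the
    symmetric tensor add up; otherwise one half falls on the facet opposite to \<open>v\<close> and
    has to be removed.\<close>
  consider "v \<in> f" | "v = i" | "v \<notin> f" "v \<noteq> i" by blast
  then show ?thesis
  proof cases
    case 1
    then have "A *v g j = (if j = i then (1/2) *\<^sub>R (v - ?a) else 0)" if "j \<in> T - f" for j
      using Aj[OF that] that by auto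
    from boundary_trace_scale[OF boundary_trace_bub[OF fT this], of 2]
    have "boundary_trace (scale_field 2 ?E) i (\<lambda>x. bub_hom f P (sub i) x *\<^sub>R (v - ?a))" by simp
    then show ?thesis using Sigma_scale[OF E] by blast
  next
    case 2
    then have "A *v g j = (if j = i then v - ?a else 0)" if "j \<in> T - f" for j
      using Aj[OF that] by (auto simp flip: scaleR_left_distrib)
    from boundary_trace_bub[OF fT this] show ?thesis using E by blast
  next
    case 3
    define d where "d = real CARD('n) + 1"
    have d: "d \<noteq> 0" by (simp add: d_def add_nonneg_eq_0_iff)
    let ?p = "\<lambda>K. A + d *\<^sub>R phi v0 T f i v K"
    have "(c - ?a) \<bullet> g j = 1 / d" if "j \<in> T - f" for j
      using glam_c[of j ?a] that a aT by (auto simp: inner_commute d_def)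
    then have pj: "phi v0 T f i v (sub j) *v g j
        = (if j = i then (1 / (2 * d)) *\<^sub>R (v - ?a) else 0) - (if j = v then (1 / (2 * d)) *\<^sub>R (i - ?a) else 0)"
      if "j \<in> T - f" for j
      using that i v 3 e[of v i] e[of i v] by (auto simp: phi_sub matrix_vector_mult_diff_rdistrib sym_tensor_mult)
    have p: "?p (sub j) *v g j = (if j = i then v - ?a else 0)" if j: "j \<in> T - f" for j
      using Aj[OF j] pj[OF j] 3 d
      by (auto simp: matrix_vector_mult_add_rdistrib scaleR_matrix_vector_assoc[symmetric] simp flip: scaleR_left_distrib)
    let ?F = "restrict_field (split T) (\<lambda>K x. bub_hom f P K x *\<^sub>R phi v0 T f i v K)"
    have F: "?F \<in> \<Sigma>" by (rule phi_elem[OF f P i]) (use 3 v in auto)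
    have "?E + scale_field d ?F = restrict_field (split T) (\<lambda>K x. bub_hom f P K x *\<^sub>R ?p K)"
      by (auto simp: restrict_field_def scale_field_def fun_eq_iff algebra_simps)
    then have "boundary_trace (?E + scale_field d ?F) i (\<lambda>x. bub_hom f P (sub i) x *\<^sub>R (v - ?a))"
      using boundary_trace_bub[OF fT p] by simp
    then show ?thesis using Sigma_add[OF E Sigma_scale[OF F]] by (rule bexI)
  qed
qed

text \<open>The edges from \<open>v0 f\<close> span the whole space, so traces along them give
  traces in every direction.\<close>

lemma bub_trace:
  assumes f: "f \<in> faces l {T}" "l < CARD('n)" and P: "P \<in> hom f (int k - int l - 1)" and i: "i \<in> T - f"
  shows "\<exists>\<tau>\<in>\<Sigma>. boundary_trace \<tau> i (\<lambda>x. bub_hom f P (sub i) x *\<^sub>R y)"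
proof -
  let ?a = "v0 f"
  let ?Y = "{y. \<exists>\<tau>\<in>\<Sigma>. boundary_trace \<tau> i (\<lambda>x. bub_hom f P (sub i) x *\<^sub>R y)}"
  have sub: "subspace ?Y"
    unfolding subspace_def
  proof (intro conjI ballI allI)
    show "0 \<in> ?Y" using boundary_trace_zero Sigma_zero by auto
  next
    fix y z assume "y \<in> ?Y" "z \<in> ?Y"
    then obtain \<tau> \<sigma> where "\<tau> \<in> \<Sigma>" "\<sigma> \<in> \<Sigma>" "boundary_trace \<tau> i (\<lambda>x. bub_hom f P (sub i) x *\<^sub>R y)"
      "boundary_trace \<sigma> i (\<lambda>x. bub_hom f P (sub i) x *\<^sub>R z)" by blast
    then show "y + z \<in> ?Y" using boundary_trace_add[of \<tau> i _ \<sigma>] Sigma_add by (fastforce simp: scaleR_add_right)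
  next
    fix b y assume "y \<in> ?Y"
    then obtain \<tau> where "\<tau> \<in> \<Sigma>" "boundary_trace \<tau> i (\<lambda>x. bub_hom f P (sub i) x *\<^sub>R y)" by blast
    then have "boundary_trace (scale_field b \<tau>) i (\<lambda>x. bub_hom f P (sub i) x *\<^sub>R (b *\<^sub>R y))"
      using boundary_trace_scale[of \<tau> i "\<lambda>x. bub_hom f P (sub i) x *\<^sub>R y" b]
      by (simp only: scaleR_scaleR mult.commute)
    then show "b *\<^sub>R y \<in> ?Y" using Sigma_scale[OF \<open>\<tau> \<in> \<Sigma>\<close>] by blast
  qed
  have "v - ?a \<in> ?Y" if "v \<in> T" for v
    using edge_trace[OF f P i that] subspace_0[OF sub] by (cases "v = ?a") auto
  then have "(\<Sum>v\<in>T. (g v \<bullet> y) *\<^sub>R (v - ?a)) \<in> ?Y"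
    by (intro subspace_sum[OF sub] subspace_scale[OF sub])
  moreover have "(\<Sum>v\<in>T. (g v \<bullet> y) *\<^sub>R (v - ?a)) = y"
  proof -
    have "(\<Sum>v\<in>T. g v \<bullet> y) = 0" using glam_sum[OF cell_T] by (simp flip: inner_sum_left)
    then show ?thesis using glam_expand[OF cell_T, of y]
      by (simp add: scaleR_diff_right sum_subtractf flip: scaleR_sum_left)
  qed
  ultimately show ?thesis by simp
qed

lemma facet_subset: "T - {i} \<subseteq> sub i"
  by (auto simp: subcell_def)

text \<open>Each monomial is a bubble on its support, a proper face of \<open>T\<close> that does
  not contain \<open>i\<close>, where \<open>bub_trace\<close> applies.\<close>

lemma hom_trace:
  assumes i: "i \<in> T" and R: "R \<in> hom (T - {i}) (int k)"
  shows "\<exists>\<tau>\<in>\<Sigma>. boundary_trace \<tau> i (\<lambda>x. R (\<lambda>v. lam v (sub i) x) *\<^sub>R y)"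
  using R
proof (induction rule: hom_induct)
  case (monom \<alpha>)
  define f where "f = {v\<in>T - {i}. \<alpha> v \<noteq> 0}"
  have f: "f \<subseteq> T - {i}" "f \<noteq> {}" "finite f"
    using supp_nonempty[OF monom k1] finite_T by (auto simp: f_def)
  then have "0 < card f" "card f \<le> CARD('n)"
    using card_mono[OF facet_finite(1) f(1)] card_T i by (auto simp: card_gt_0_iff)
  then have c: "card f = (card f - 1) + 1" "card f - 1 < CARD('n)" by linarith+
  have fT: "f \<in> faces (card f - 1) {T}" using f c by (auto simp: faces_T)
  have "i \<in> T - f" using i f by auto
  from bub_trace[OF fT c(2) mono_bub(1)[OF facet_finite(1) monom f_def c(1)] this, of y]
  show ?case unfolding mono_bub(2)[OF facet_finite(1) monom f_def c(1)] .
next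
  case (add p q)
  then obtain \<tau> \<sigma> where *: "\<tau> \<in> \<Sigma>" "\<sigma> \<in> \<Sigma>" "boundary_trace \<tau> i (\<lambda>x. p (\<lambda>v. lam v (sub i) x) *\<^sub>R y)"
    "boundary_trace \<sigma> i (\<lambda>x. q (\<lambda>v. lam v (sub i) x) *\<^sub>R y)" by blast
  show ?case using boundary_trace_add[OF *(3,4)] Sigma_add[OF *(1,2)] by (auto simp: scaleR_add_left)
next
  case (scale a p)
  then obtain \<tau> where *: "\<tau> \<in> \<Sigma>" "boundary_trace \<tau> i (\<lambda>x. p (\<lambda>v. lam v (sub i) x) *\<^sub>R y)" by blast
  show ?case using boundary_trace_scale[OF *(2), of a] Sigma_scale[OF *(1), of a] by auto
next
  case zero
  then show ?case using boundary_trace_zero Sigma_zero by auto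
qed

lemma vec_trace:
  assumes i: "i \<in> T" and q: "q \<in> vec_polys (int k)"
  shows "\<exists>\<tau>\<in>\<Sigma>. boundary_trace \<tau> i q"
proof -
  have sums: "\<exists>\<tau>\<in>\<Sigma>. boundary_trace \<tau> i (\<lambda>x. \<Sum>p\<in>S. q x $ p *\<^sub>R axis p 1)" for S :: "'n set"
  proof (induction S rule: infinite_finite_induct)
    case (insert p S)
    then obtain \<tau> where \<tau>: "\<tau> \<in> \<Sigma>" "boundary_trace \<tau> i (\<lambda>x. \<Sum>p\<in>S. q x $ p *\<^sub>R axis p 1)" by blast
    have "(\<lambda>x. q x $ p) \<in> polys (int k)" using q by (simp add: vec_polys_def)
    then obtain R where R: "R \<in> hom (T - {i}) (int k)" "\<forall>x\<in>affine hull (T - {i}). q x $ p = R (\<lambda>v. lam v (sub i) x)"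
      using polys_hom[OF cell_sub[OF i] facet_subset] by meson
    obtain \<sigma> where \<sigma>: "\<sigma> \<in> \<Sigma>" "boundary_trace \<sigma> i (\<lambda>x. R (\<lambda>v. lam v (sub i) x) *\<^sub>R axis p 1)"
      using hom_trace[OF i R(1)] by blast
    have "boundary_trace \<sigma> i (\<lambda>x. q x $ p *\<^sub>R axis p 1)"
      unfolding boundary_trace_def
    proof (intro ballI)
      fix j x assume j: "j \<in> T" "x \<in> convex hull (T - {j})"
      show "\<sigma> (sub j) x *v g j = (if j = i then q x $ p *\<^sub>R axis p 1 else 0)"
        using \<sigma>(2) R(2) convex_hull_subset_affine_hull[of "T - {i}"] j
        by (cases "j = i") (auto simp: boundary_trace_def)
    qed
    from boundary_trace_add[OF this \<tau>(2)] show ?case using insert.hyps Sigma_add[OF \<sigma>(1) \<tau>(1)] by auto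
  qed (use boundary_trace_zero Sigma_zero in auto)
  have "(\<Sum>p\<in>UNIV. q x $ p *\<^sub>R axis p 1) = q x" for x
    using basis_expansion[of "q x"] by (simp add: scalar_mult_eq_scaleR)
  then show ?thesis using sums[of UNIV] by simp
qed

end

text \<open>The form \<beta> is the Euclidean product for (a), a product weighted by the face bubble
  for (b), and for (c) the form that couples fields through their products with the vectors
  \<open>v - x\<close>, weighted by the coordinates. The weights may vanish on parts of the face, so
  definiteness is demanded of whole functions in \<open>Q\<close>, not pointwise.\<close>

lemma riesz_surface:
  fixes Q :: "(real^'n \<Rightarrow> 'b::real_vector) set" and \<beta> :: "real^'n \<Rightarrow> 'b \<Rightarrow> 'b \<Rightarrow> real"
  assumes f: "finite f" "f \<noteq> {}"
    and fd: "\<exists>S. finite S \<and> Q \<subseteq> fs.span S" and ne: "Q \<noteq> {}"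
    and closed: "\<And>q r a b. q \<in> Q ==> r \<in> Q ==> (\<lambda>x. a *\<^sub>R q x + b *\<^sub>R r x) \<in> Q"
    and cont: "\<And>q r. q \<in> Q ==> r \<in> Q ==> continuous_on (convex hull f) (\<lambda>x. \<beta> x (q x) (r x))"
    and lin: "\<And>x a b u v w. \<beta> x (a *\<^sub>R u + b *\<^sub>R v) w = a * \<beta> x u w + b * \<beta> x v w"
    and sym: "\<And>x u v. \<beta> x u v = \<beta> x v u"
    and nonneg: "\<And>x u. x \<in> convex hull f ==> \<beta> x u u \<ge> 0"
    and definite: "\<And>q. q \<in> Q ==> (\<And>x. x \<in> convex hull f ==> \<beta> x (q x) (q x) = 0) ==> q = (\<lambda>x. 0)"
    and L: "linear_on Q L"
  shows "\<exists>q\<in>Q. \<forall>r\<in>Q. surface_integral f (\<lambda>x. \<beta> x (q x) (r x)) = L r"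
proof -
  obtain S where S: "finite S" "Q \<subseteq> fs.span S" using fd by blast
  show ?thesis
  proof (rule riesz_fun[OF S ne closed _ _ _ L])
    fix q r z a b assume "q \<in> Q" "r \<in> Q" "z \<in> Q"
    then show "surface_integral f (\<lambda>x. \<beta> x (a *\<^sub>R q x + b *\<^sub>R r x) (z x))
        = a * surface_integral f (\<lambda>x. \<beta> x (q x) (z x)) + b * surface_integral f (\<lambda>x. \<beta> x (r x) (z x))"
      unfolding lin by (intro surface_integral_lin[OF f] cont)
  next
    fix q assume q: "q \<in> Q" "q \<noteq> (\<lambda>x. 0)"
    have "surface_integral f (\<lambda>x. \<beta> x (q x) (q x)) \<ge> 0" by (rule surface_integral_nonneg[OF nonneg])
    moreover have "surface_integral f (\<lambda>x. \<beta> x (q x) (q x)) \<noteq> 0"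
    proof
      assume 0: "surface_integral f (\<lambda>x. \<beta> x (q x) (q x)) = 0"
      have "\<beta> x (q x) (q x) = 0" if "x \<in> convex hull f" for x
        by (rule surface_integral_definite[OF f cont[OF q(1) q(1)] nonneg 0 that])
      then show False using definite[OF q(1)] q(2) by blast
    qed
    ultimately show "surface_integral f (\<lambda>x. \<beta> x (q x) (q x)) > 0" by linarith
  next
    show "surface_integral f (\<lambda>x. \<beta> x (q x) (r x)) = surface_integral f (\<lambda>x. \<beta> x (r x) (q x))" for q r
      by (rule surface_integral_cong) (rule sym)
  qed
qed

lemma vec_polys_zero: "(\<lambda>x. 0) \<in> vec_polys r"
  by (simp add: vec_polys_def polys_zero)

lemma vec_polys_on_zero: "(\<lambda>x. 0) \<in> vec_polys_on f r"
  unfolding vec_polys_on_def by (rule image_eqI[OF _ vec_polys_zero]) (auto simp: on_simplex_def)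

lemma polys_on_zero: "(\<lambda>x. 0) \<in> polys_on f r"
  unfolding polys_on_def by (rule image_eqI[OF _ polys_zero]) (auto simp: on_simplex_def)

lemma vec_polys_on_outside: "q \<in> vec_polys_on f r ==> x \<notin> convex hull f ==> q x = 0"
  by (auto simp: vec_polys_on_def on_simplex_def)

lemma vec_polys_scale: "q \<in> vec_polys r ==> (\<lambda>x. a *\<^sub>R q x) \<in> vec_polys r"
  by (auto simp: vec_polys_def intro: polys_scale)

text \<open>The functional dual to one basis vector is represented by a vector; dropping its
  tangential part does not change its values on normals.\<close>

lemma dual_basis:
  fixes nb :: "nat \<Rightarrow> real^'n"
  assumes inj: "inj_on nb I" and ind: "independent (nb ` I)" and nor: "nb ` I \<subseteq> nor_space f" and a: "a \<in> I"
  shows "\<exists>m\<in>nor_space f. \<forall>i\<in>I. m \<bullet> nb i = (if i = a then 1 else 0)"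
proof -
  obtain h :: "real^'n \<Rightarrow> real" where h: "linear h" "\<forall>x\<in>nb ` I. h x = (if x = nb a then 1 else 0)"
    using linear_independent_extend[OF ind, of "\<lambda>x. if x = nb a then 1 else 0"] by blast
  obtain t where t: "t \<in> tan_space f" "adjoint h 1 - t \<in> nor_space f" using tan_nor_decompose by blast
  have "(adjoint h 1 - t) \<bullet> nb i = (if i = a then 1 else 0)" if i: "i \<in> I" for i
  proof -
    have "t \<bullet> nb i = 0" using nor_tan_orth[of "nb i" f t] nor i t(1) by (auto simp: inner_commute)
    moreover have "adjoint h 1 \<bullet> nb i = h (nb i)" using adjoint_works[OF h(1), of "nb i" 1] by (simp add: inner_commute)
    moreover have "h (nb i) = (if i = a then 1 else 0)" using h(2) i a inj by (auto simp: inj_on_eq_iff)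
    ultimately show ?thesis by (simp only: inner_diff_left)
  qed
  then show ?thesis using t(2) by blast
qed

lemma dual_tensor:
  fixes nb :: "nat \<Rightarrow> real^'n"
  assumes "inj_on nb I" "independent (nb ` I)" "nb ` I \<subseteq> nor_space f" and ab: "a \<in> I" "b \<in> I" "a \<le> b"
  shows "\<exists>A\<in>SS (nor_space f). \<forall>i\<in>I. \<forall>j\<in>I. i \<le> j \<longrightarrow> nb i \<bullet> (A *v nb j) = (if i = a \<and> j = b then 1 else 0)"
proof -
  obtain m where m: "m \<in> nor_space f" "\<And>i. i \<in> I ==> m \<bullet> nb i = (if i = a then 1 else 0)"
    using dual_basis[OF assms(1-3) ab(1)] by blast
  obtain n where n: "n \<in> nor_space f" "\<And>i. i \<in> I ==> n \<bullet> nb i = (if i = b then 1 else 0)"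
    using dual_basis[OF assms(1-3) ab(2)] by blast
  \<comment> \<open>Symmetrization halves the entry of an off-diagonal pair; the entry with
    exchanged indices is excluded by the order of the pair.\<close>
  let ?A = "(if a = b then 1 else 2) *\<^sub>R sym_part (tensor m n)"
  have "?A \<in> SS (nor_space f)"
    unfolding SS_def sym_tensors_def by (intro span_scale span_base) (use m(1) n(1) in blast)
  moreover have "nb i \<bullet> (?A *v nb j) = (if i = a \<and> j = b then 1 else 0)" if "i \<in> I" "j \<in> I" "i \<le> j" for i j
    using that ab m(2) n(2)
    by (auto simp: sym_tensor_mult inner_add_right inner_commute[of "nb _"] scaleR_matrix_vector_assoc[symmetric])
  ultimately show ?thesis by blast
qed

section \<open>Attaining the degrees of freedom (a) and (b)\<close>

context local_dofs
begin

lemma attain_a: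
  assumes L: "\<And>i. i \<in> T ==> linear_on (VP i) (L i)"
  shows "\<exists>\<tau>\<in>\<Sigma>. \<forall>i\<in>T. \<forall>q\<in>VP i. dof_a nrm T (T - {i}) \<tau> q = L i q"
proof (rule superpose[OF finite_T Sigma_zero Sigma_add])
  show "dof_a nrm T (T - {i}) (\<tau> + \<sigma>) q = dof_a nrm T (T - {i}) \<tau> q + dof_a nrm T (T - {i}) \<sigma> q"
    if "\<tau> \<in> \<Sigma>" "\<sigma> \<in> \<Sigma>" "i \<in> T" "q \<in> VP i" for \<tau> \<sigma> i q
    by (rule dof_a_add[OF Sigma_conf Sigma_conf]) (use that in auto)
  fix i assume i: "i \<in> T"
  let ?F = "T - {i}"
  have "\<exists>q\<in>VP i. \<forall>r\<in>VP i. surface_integral ?F (\<lambda>x. q x \<bullet> r x) = L i r"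
  proof (rule riesz_surface[OF facet_finite(1) facet_finite(2)[OF i] vec_polys_on_finite_dim _ vec_polys_on_comb _ _ _ _ _ L[OF i]])
    show "VP i \<noteq> {}" using vec_polys_on_zero by blast
    show "continuous_on (convex hull ?F) (\<lambda>x. q x \<bullet> r x)" if "q \<in> VP i" "r \<in> VP i" for q r
      by (intro continuous_intros continuous_vec_polys_on[OF that(1)] continuous_vec_polys_on[OF that(2)])
    show "q = (\<lambda>x. 0)" if "q \<in> VP i" "\<And>x. x \<in> convex hull ?F ==> q x \<bullet> q x = 0" for q
      using that(2) vec_polys_on_outside[OF that(1)] by (intro ext) (metis inner_eq_zero_iff)
  qed (simp_all only: inner_add_left inner_scaleR_left inner_ge_zero, rule inner_commute)
  then obtain p where p: "p \<in> vec_polys (int k)"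
    "\<And>r. r \<in> VP i ==> surface_integral ?F (\<lambda>x. on_simplex ?F p x \<bullet> r x) = L i r"
    by (auto simp: vec_polys_on_def)
  obtain s where s: "s \<noteq> 0" "nrm ?F = s *\<^sub>R g i" using nrm_boundary[OF i] .
  obtain \<tau> where \<tau>: "\<tau> \<in> \<Sigma>" "boundary_trace \<tau> i (\<lambda>x. (1 / s) *\<^sub>R p x)"
    using vec_trace[OF i vec_polys_scale[OF p(1)]] by blast
  have "dof_a nrm T ?F \<tau> r = L i r" if r: "r \<in> VP i" for r
    unfolding dof_a_eq[OF i] p(2)[OF r, symmetric]
    by (rule surface_integral_cong) (use \<tau>(2) i s in \<open>simp add: boundary_trace_def on_simplex_apply matrix_vector_mult_scaleR\<close>)
  moreover have "dof_a nrm T (T - {j}) \<tau> r = 0" if j: "j \<in> T - {i}" for j r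
  proof -
    obtain s where s: "nrm (T - {j}) = s *\<^sub>R g j" using nrm_boundary[of j] j by blast
    have "dof_a nrm T (T - {j}) \<tau> r = surface_integral (T - {j}) (\<lambda>x. (\<tau> (sub j) x *v nrm (T - {j})) \<bullet> r x)"
      by (rule dof_a_eq) (use j in simp)
    also have "\<dots> = 0"
      by (rule surface_integral_zero) (use \<tau>(2) j in \<open>simp add: s boundary_trace_def matrix_vector_mult_scaleR\<close>)
    finally show ?thesis .
  qed
  ultimately show "\<exists>\<tau>\<in>\<Sigma>. (\<forall>q\<in>VP i. dof_a nrm T ?F \<tau> q = L i q) \<and> (\<forall>j\<in>T - {i}. \<forall>q\<in>VP j. dof_a nrm T (T - {j}) \<tau> q = 0)"
    by (intro bexI[OF _ \<tau>(1)]) simp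
qed

lemma dofs_a_zero_zero: "dofs_a_zero 0"
  and dofs_b_zero_zero: "dofs_b_zero l 0"
  and dofs_c_zero_zero: "dofs_c_zero 0"
  by (auto simp: dofs_a_zero_def dof_a_eq dofs_b_zero_def dof_b_def dofs_c_zero_def dof_c_def tangential_part_zero
      intro!: surface_integral_zero)

lemma dofs_a_zero_add: "\<tau> \<in> \<Sigma> ==> \<sigma> \<in> \<Sigma> ==> dofs_a_zero \<tau> ==> dofs_a_zero \<sigma> ==> dofs_a_zero (\<tau> + \<sigma>)"
  using dof_a_add[OF Sigma_conf Sigma_conf] by (simp add: dofs_a_zero_def)

lemma dofs_b_zero_add: "\<tau> \<in> \<Sigma> ==> \<sigma> \<in> \<Sigma> ==> dofs_b_zero l \<tau> ==> dofs_b_zero l \<sigma> ==> dofs_b_zero l (\<tau> + \<sigma>)"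
  using dof_b_add[OF Sigma_conf Sigma_conf] by (simp add: dofs_b_zero_def)

lemma dofs_c_zero_add: "\<tau> \<in> \<Sigma> ==> \<sigma> \<in> \<Sigma> ==> dofs_c_zero \<tau> ==> dofs_c_zero \<sigma> ==> dofs_c_zero (\<tau> + \<sigma>)"
  using dof_c_add[OF Sigma_conf Sigma_conf] by (simp add: dofs_c_zero_def)

lemma finite_interior_faces: "finite (interior_faces l {T})"
  by (rule finite_subset[of _ "Pow (insert c T)"]) (use interior_face_subset(2) finite_T in auto)

lemma nb_nor:
  assumes "l < CARD('n)" "f \<in> interior_faces l {T}" shows "nb f ` {1..CARD('n) - l} \<subseteq> nor_space f"
  using nb_basis[OF assms] span_superset[of "nb f ` {1..CARD('n) - l}"] by simp

text \<open>The functional is represented with the bubble of \<open>f\<close> as weight, which is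
  exactly the factor that the field carries. The first clause, vanishing on all faces that do not
  contain \<open>f\<close>, is what keeps other degrees of freedom zero.\<close>

lemma attain_b_single:
  assumes l: "l < CARD('n)" and f: "f \<in> interior_faces l {T}" and ab: "1 \<le> a" "a \<le> b" "b \<le> CARD('n) - l"
    and L: "linear_on (PO l f) L"
  shows "\<exists>\<tau>\<in>\<Sigma>. (\<forall>i x. i \<in> T \<longrightarrow> (\<forall>f'. f' \<subseteq> sub i \<longrightarrow> \<not> f \<subseteq> f' \<longrightarrow> x \<in> convex hull f' \<longrightarrow> \<tau> (sub i) x = 0)) \<and>
    (\<forall>i j q. 1 \<le> i \<longrightarrow> i \<le> j \<longrightarrow> j \<le> CARD('n) - l \<longrightarrow> q \<in> PO l f \<longrightarrow>
      dof_b (elt f) f (nb f i) (nb f j) \<tau> q = (if i = a \<and> j = b then L q else 0))"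
proof -
  obtain e where e: "e \<in> T" "elt f = sub e" "f \<subseteq> sub e" using interior_face_cell[OF l f] .
  note K = cell_sub[OF e(1)]
  note ff = interior_face_subset(3)[OF f] interior_face_nonempty[OF f]
  have cf: "card f = l + 1" using f interior_faces_T by blast
  have nn: "bub f (sub e) x \<ge> 0" if "x \<in> convex hull f" for x
    unfolding bub_def using that mem_convex_hull[OF K e(3)] e(3) by (intro prod_nonneg) auto
  have "\<exists>q\<in>PO l f. \<forall>r\<in>PO l f. surface_integral f (\<lambda>x. bub f (sub e) x * (q x * r x)) = L r"
  proof (rule riesz_surface[OF ff polys_on_finite_dim _ polys_on_comb _ _ _ _ _ L])
    show "PO l f \<noteq> {}" using polys_on_zero by blast
    show "continuous_on (convex hull f) (\<lambda>x. bub f (sub e) x * (q x * r x))" if "q \<in> PO l f" "r \<in> PO l f" for q r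
      by (intro continuous_intros continuous_polys_on[OF that(1)] continuous_polys_on[OF that(2)]
          continuous_polys[OF bub_polys[OF K]])
    show "q = (\<lambda>x. 0)" if q: "q \<in> PO l f" "\<And>x. x \<in> convex hull f ==> bub f (sub e) x * (q x * q x) = 0" for q
    proof -
      obtain p where p: "p \<in> polys (int k - (int l + 1))" "q = on_simplex f p" using q(1) by (auto simp: polys_on_def)
      have "p x = 0" if "x \<in> convex hull f" for x
      proof (rule polys_zero_on_face[OF K e(3) ff(2) p(1) _ that])
        fix y assume y: "y \<in> convex hull f" "\<And>v. v \<in> f ==> 0 < lam v (sub e) y"
        have "bub f (sub e) y > 0" unfolding bub_def by (rule prod_pos) (use y(2) in blast)
        then show "p y = 0" using q(2)[OF y(1)] y(1) by (simp add: p(2) on_simplex_apply)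
      qed
      then show ?thesis by (auto simp: p(2) on_simplex_def)
    qed
  next
    show "bub f (sub e) x * (u * u) \<ge> 0" if "x \<in> convex hull f" for x u
      by (rule mult_nonneg_nonneg[OF nn[OF that] zero_le_square])
  qed (simp_all add: algebra_simps)
  then obtain p where p: "p \<in> polys (int k - (int l + 1))"
    "\<And>r. r \<in> PO l f ==> surface_integral f (\<lambda>x. bub f (sub e) x * (on_simplex f p x * r x)) = L r"
    by (auto simp: polys_on_def)
  obtain P where P: "P \<in> hom f (int k - (int l + 1))" "\<forall>x\<in>affine hull f. p x = P (\<lambda>v. lam v (sub e) x)"
    using polys_hom[OF K e(3) p(1)] by blast
  have P': "P \<in> hom f (int k - int l - 1)" using P(1) by (simp add: algebra_simps)
  have "a \<in> {1..CARD('n) - l}" "b \<in> {1..CARD('n) - l}" using ab by auto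
  then obtain A where A: "A \<in> SS (nor_space f)"
    "\<And>i j. i \<in> {1..CARD('n) - l} ==> j \<in> {1..CARD('n) - l} ==> i \<le> j ==>
        nb f i \<bullet> (A *v nb f j) = (if i = a \<and> j = b then 1 else 0)"
    using dual_tensor[OF _ _ nb_nor[OF l f], of a b] nb_basis[OF l f] ab(2) by blast
  let ?\<tau> = "restrict_field (split T) (\<lambda>K x. bub_hom f P K x *\<^sub>R A)"
  have \<tau>: "?\<tau> \<in> \<Sigma>" by (rule SS_elem[OF f l P' A(1)])
  have "?\<tau> (sub i) x = 0" if "i \<in> T" "f' \<subseteq> sub i" "\<not> f \<subseteq> f'" "x \<in> convex hull f'" for i x f'
    using bub_hom_zero[OF cell_sub that(2,4,3) ff(1)] that(1) by (simp add: restrict_sub)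
  moreover have "dof_b (elt f) f (nb f i) (nb f j) ?\<tau> q = (if i = a \<and> j = b then L q else 0)"
    if "1 \<le> i" "i \<le> j" "j \<le> CARD('n) - l" and q: "q \<in> PO l f" for i j q
  proof -
    have ij: "nb f i \<bullet> (A *v nb f j) = (if i = a \<and> j = b then 1 else 0)" using that by (intro A(2)) auto
    have "dof_b (elt f) f (nb f i) (nb f j) ?\<tau> q
        = surface_integral f (\<lambda>x. (if i = a \<and> j = b then 1 else 0) * (bub f (sub e) x * (on_simplex f p x * q x)))"
      unfolding dof_b_def e(2)
    proof (rule surface_integral_cong)
      fix x assume x: "x \<in> convex hull f"
      then have "on_simplex f p x = P (\<lambda>v. lam v (sub e) x)"
        using P(2) convex_hull_subset_affine_hull by (auto simp: on_simplex_apply)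
      then show "nb f i \<bullet> (?\<tau> (sub e) x *v nb f j) * q x
          = (if i = a \<and> j = b then 1 else 0) * (bub f (sub e) x * (on_simplex f p x * q x))"
        using ij e(1) by (simp add: restrict_sub bub_hom_def scaleR_matrix_vector_assoc[symmetric])
    qed
    then show ?thesis using p(2)[OF q] by (simp add: surface_integral_scale)
  qed
  ultimately show ?thesis using \<tau> by blast
qed

text \<open>A face of dimension \<open>l\<close> lies in no other interior face of dimension at most
  \<open>l\<close>, and in no facet of \<open>T\<close> because it contains the barycenter. So the
  fields of \<open>attain_b_single\<close> disturb neither (a) nor (b) on these faces.\<close>

lemma attain_b:
  assumes l: "l < CARD('n)"
    and L: "\<And>f i j. f \<in> interior_faces l {T} ==> 1 \<le> i ==> i \<le> j ==> j \<le> CARD('n) - l ==> linear_on (PO l f) (L f i j)"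
  shows "\<exists>\<tau>\<in>{\<tau> \<in> \<Sigma>. dofs_a_zero \<tau> \<and> (\<forall>l'<l. dofs_b_zero l' \<tau>)}.
    \<forall>f\<in>interior_faces l {T}. \<forall>i j. 1 \<le> i \<and> i \<le> j \<and> j \<le> CARD('n) - l \<longrightarrow>
      (\<forall>q\<in>PO l f. dof_b (elt f) f (nb f i) (nb f j) \<tau> q = L f i j q)"
proof -
  let ?N = "{1..CARD('n) - l}"
  define I where "I = {(f, i, j). f \<in> interior_faces l {T} \<and> i \<in> ?N \<and> j \<in> ?N \<and> i \<le> j}"
  define D where "D = (\<lambda>(f, i, j). dof_b (elt f) f (nb f i) (nb f j))"
  define V where "V = {\<tau> \<in> \<Sigma>. dofs_a_zero \<tau> \<and> (\<forall>l'<l. dofs_b_zero l' \<tau>)}"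
  have "finite I"
    by (rule finite_subset[of _ "interior_faces l {T} \<times> ?N \<times> ?N"]) (auto simp: I_def finite_interior_faces)
  moreover have "0 \<in> V" by (simp add: V_def Sigma_zero dofs_a_zero_zero dofs_b_zero_zero)
  moreover have "\<tau> + \<sigma> \<in> V" if "\<tau> \<in> V" "\<sigma> \<in> V" for \<tau> \<sigma>
    using that by (simp add: V_def Sigma_add dofs_a_zero_add dofs_b_zero_add)
  moreover have "D t (\<tau> + \<sigma>) q = D t \<tau> q + D t \<sigma> q"
    if "\<tau> \<in> V" "\<sigma> \<in> V" "t \<in> I" "q \<in> PO l (fst t)" for \<tau> \<sigma> t q
    using that dof_b_add[OF Sigma_conf Sigma_conf] by (auto simp: V_def I_def D_def)
  moreover have "\<exists>\<tau>\<in>V. (\<forall>q\<in>PO l (fst t). D t \<tau> q = (case t of (f, i, j) \<Rightarrow> L f i j) q) \<and>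
      (\<forall>s\<in>I - {t}. \<forall>q\<in>PO l (fst s). D s \<tau> q = 0)" if t: "t \<in> I" for t
  proof -
    obtain f a b where tf: "t = (f, a, b)" "f \<in> interior_faces l {T}" "1 \<le> a" "a \<le> b" "b \<le> CARD('n) - l"
      using t by (auto simp: I_def)
    obtain \<tau> where \<tau>: "\<tau> \<in> \<Sigma>"
      "\<And>i x f'. i \<in> T ==> f' \<subseteq> sub i ==> \<not> f \<subseteq> f' ==> x \<in> convex hull f' ==> \<tau> (sub i) x = 0"
      "\<And>i j q. 1 \<le> i ==> i \<le> j ==> j \<le> CARD('n) - l ==> q \<in> PO l f ==>
        dof_b (elt f) f (nb f i) (nb f j) \<tau> q = (if i = a \<and> j = b then L f a b q else 0)"
      using attain_b_single[OF l tf(2-5) L[OF tf(2-5)]] by auto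
    have cf: "card f = l + 1" "c \<in> f" using tf(2) interior_faces_T by auto
    have a0: "dofs_a_zero \<tau>"
      unfolding dofs_a_zero_def
    proof (intro ballI)
      fix i q assume i: "i \<in> T"
      have "\<not> f \<subseteq> T - {i}" using cf(2) c_notin by blast
      then show "dof_a nrm T (T - {i}) \<tau> q = 0"
        unfolding dof_a_eq[OF i] using \<tau>(2)[OF i facet_subset] by (intro surface_integral_zero) simp
    qed
    have b0: "dof_b (elt f') f' m n \<tau> q = 0"
      if f': "l' < CARD('n)" "f' \<in> interior_faces l' {T}" "\<not> f \<subseteq> f'" for l' f' m n q
    proof -
      obtain e where e: "e \<in> T" "elt f' = sub e" "f' \<subseteq> sub e" using interior_face_cell[OF f'(1,2)] .
      show ?thesis unfolding dof_b_def e(2) using \<tau>(2)[OF e(1,3) f'(3)] by (intro surface_integral_zero) simp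
    qed
    have "\<not> f \<subseteq> f'" if "l' < l" "f' \<in> interior_faces l' {T}" for l' f'
    proof
      assume "f \<subseteq> f'"
      from card_mono[OF interior_face_subset(3)[OF that(2)] this] show False
        using cf(1) that interior_faces_T[of f' l'] by simp
    qed
    then have "dofs_b_zero l' \<tau>" if "l' < l" for l'
      unfolding dofs_b_zero_def using b0[of l'] that l by auto
    then have "\<tau> \<in> V" using \<tau>(1) a0 by (simp add: V_def)
    moreover have "D t \<tau> q = L f a b q" if "q \<in> PO l f" for q
      using \<tau>(3)[OF tf(3-5) that] by (simp add: D_def tf(1))
    moreover have "D s \<tau> q = 0" if s: "s \<in> I - {t}" "q \<in> PO l (fst s)" for s q
    proof -
      obtain f' i j where s': "s = (f', i, j)" "f' \<in> interior_faces l {T}" "1 \<le> i" "i \<le> j" "j \<le> CARD('n) - l"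
        using s by (auto simp: I_def)
      show ?thesis
      proof (cases "f' = f")
        case True
        then show ?thesis using \<tau>(3)[OF s'(3-5), of q] s tf(1) s'(1) by (auto simp: D_def)
      next
        case False
        then have "\<not> f \<subseteq> f'"
          using card_subset_eq[OF interior_face_subset(3)[OF s'(2)], of f] cf(1) s'(2) interior_faces_T by metis
        then show ?thesis using b0[OF l s'(2)] by (simp add: D_def s'(1))
      qed
    qed
    ultimately show ?thesis by (intro bexI[of _ \<tau>]) (auto simp: tf(1))
  qed
  ultimately have "\<exists>\<tau>\<in>V. \<forall>t\<in>I. \<forall>q\<in>PO l (fst t). D t \<tau> q = (case t of (f, i, j) \<Rightarrow> L f i j) q"
    by (rule superpose)
  then obtain \<tau> where \<tau>: "\<tau> \<in> V" "\<And>t q. t \<in> I ==> q \<in> PO l (fst t) ==> D t \<tau> q = (case t of (f, i, j) \<Rightarrow> L f i j) q"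
    by blast
  show ?thesis
  proof (intro bexI[of _ \<tau>] ballI allI impI)
    fix f i j q assume "f \<in> interior_faces l {T}" "1 \<le> i \<and> i \<le> j \<and> j \<le> CARD('n) - l" "q \<in> PO l f"
    then show "dof_b (elt f) f (nb f i) (nb f j) \<tau> q = L f i j q"
      using \<tau>(2)[of "(f, i, j)" q] by (simp add: I_def D_def)
  qed (use \<tau>(1) in \<open>simp add: V_def\<close>)
qed

end

section \<open>The test space of (c) and its components along the vertices\<close>

lemma ND_comb:
  assumes "q \<in> ND k F" "r \<in> ND k F" shows "(\<lambda>x. a *\<^sub>R q x + b *\<^sub>R r x) \<in> ND k F"
proof -
  have "(\<lambda>x. (a *\<^sub>R q x + b *\<^sub>R r x) \<bullet> x) \<in> polys_on F (int k - 1)"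
    using polys_on_comb[OF ND_D(3)[OF assms(1)] ND_D(3)[OF assms(2)], of a b] by (simp add: inner_add_left)
  then show ?thesis
    using vec_polys_on_comb[OF ND_D(1)[OF assms(1)] ND_D(1)[OF assms(2)]] ND_D(2)[OF assms(1)] ND_D(2)[OF assms(2)]
    by (auto simp: ND_def intro!: subspace_add subspace_scale subspace_tan_space)
qed

lemma ND_zero: "(\<lambda>x. 0) \<in> ND k F"
  by (simp add: ND_def vec_polys_on_zero polys_on_zero subspace_0 subspace_tan_space)

lemma ND_finite_dim: "\<exists>S. finite S \<and> ND k F \<subseteq> fs.span S"
  using vec_polys_on_finite_dim[of F "int k - 1"] by (auto simp: ND_def)

text \<open>Both q . v and q . x have degree at most k - 1, the latter by the condition that defines
  \<open>ND\<close>.\<close>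

lemma ND_edge:
  assumes "q \<in> ND k F"
  shows "\<exists>p\<in>polys (int k - 1). \<forall>x\<in>convex hull F. q x \<bullet> (v - x) = p x"
proof -
  obtain q' where q': "q' \<in> vec_polys (int k - 1)" "q = on_simplex F q'" using ND_D(1)[OF assms] by (auto simp: vec_polys_on_def)
  obtain r where r: "r \<in> polys (int k - 1)" "(\<lambda>x. q x \<bullet> x) = on_simplex F r" using ND_D(3)[OF assms] by (auto simp: polys_on_def)
  have "(\<lambda>x. q' x \<bullet> v) \<in> polys (int k - 1)"
    unfolding inner_vec_def inner_real_def using q'(1) by (intro polys_sum polys_const_mult) (simp add: vec_polys_def)
  then have "(\<lambda>x. q' x \<bullet> v - r x) \<in> polys (int k - 1)" using r(1) by (rule polys_minus)
  moreover have "q x \<bullet> (v - x) = q' x \<bullet> v - r x" if "x \<in> convex hull F" for x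
    using fun_cong[OF r(2), of x] that by (simp add: q'(2) on_simplex_apply inner_diff_right)
  ultimately show ?thesis by (intro bexI) simp_all
qed

text \<open>At points with positive coordinates \<open>q\<close> is orthogonal to all vectors
  \<open>v - x\<close>, hence normal to \<open>F\<close>; being tangential as well, it vanishes
  there. A polynomial that vanishes at these points vanishes on the whole face.\<close>

lemma ND_definite:
  assumes K: "cell (K::(real^'n) set)" "F \<subseteq> K" "F \<noteq> {}" and q: "q \<in> ND k F"
    and 0: "\<And>x. x \<in> convex hull F ==> (\<Sum>v\<in>F. lam v K x * ((q x \<bullet> (v - x)) * (q x \<bullet> (v - x)))) = 0"
  shows "q = (\<lambda>x. 0)"
proof -
  have fin: "finite F" using K cell_finite finite_subset by blast
  obtain q' where q': "q' \<in> vec_polys (int k - 1)" "q = on_simplex F q'" using ND_D(1)[OF q] by (auto simp: vec_polys_on_def)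
  have "q' x $ i = 0" if x: "x \<in> convex hull F" for x i
  proof (rule polys_zero_on_face[OF K _ _ x])
    show "(\<lambda>x. q' x $ i) \<in> polys (int k - 1)" using q'(1) by (simp add: vec_polys_def)
    fix y assume y: "y \<in> convex hull F" "\<And>v. v \<in> F ==> lam v K y > 0"
    have "lam v K y * ((q y \<bullet> (v - y)) * (q y \<bullet> (v - y))) = 0" if "v \<in> F" for v
      using 0[OF y(1)] sum_nonneg_eq_0_iff[OF fin, of "\<lambda>v. lam v K y * ((q y \<bullet> (v - y)) * (q y \<bullet> (v - y)))"] that y(2)
      by (simp add: less_imp_le)
    then have v0: "q y \<bullet> (v - y) = 0" if "v \<in> F" for v using y(2)[OF that] that by fastforce
    have "q y \<bullet> (v - u) = 0" if "v \<in> F" "u \<in> F" for u v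
      using v0[OF that(1)] v0[OF that(2)] by (simp add: inner_diff_right)
    then have "q y \<in> nor_space F" by (simp add: nor_space_iff)
    from nor_tan_orth[OF this ND_D(2)[OF q y(1)]] have "q y = 0" by simp
    then show "q' y $ i = 0" using y(1) by (simp add: q'(2) on_simplex_apply)
  qed
  then show ?thesis by (auto simp: q'(2) on_simplex_def fun_eq_iff vec_eq_iff)
qed

text \<open>The coefficient of \<open>\<alpha>\<close> in \<open>\<lambda>\<^sub>v (q \<bullet> (v - x))\<close> vanishes if \<open>\<alpha> v = 0\<close>, and these coefficients
  sum to zero over \<open>v\<close>; hence their combination of the vertices is tangential to the support of \<open>\<alpha>\<close>.\<close>

lemma ND_expand:
  assumes K: "cell (K::(real^'n) set)" "F \<subseteq> K" "F \<noteq> {}" and k: "1 \<le> k" and q: "q \<in> ND k F"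
  shows "\<exists>u. (\<forall>\<alpha>\<in>hexp F (int k). u \<alpha> \<in> tan_space {v\<in>F. \<alpha> v \<noteq> 0}) \<and>
    (\<forall>x\<in>convex hull F. (\<Sum>v\<in>F. (lam v K x * (q x \<bullet> (v - x))) *\<^sub>R v)
      = (\<Sum>\<alpha>\<in>hexp F (int k). mono_at F \<alpha> (\<lambda>v. lam v K x) *\<^sub>R u \<alpha>))"
proof -
  have fin: "finite F" using K cell_finite finite_subset by blast
  have aff: "convex hull F \<subseteq> affine hull F" by (rule convex_hull_subset_affine_hull)
  have "\<forall>v. \<exists>W. W \<in> hom F (int k - 1) \<and> (\<forall>x\<in>convex hull F. q x \<bullet> (v - x) = W (\<lambda>v. lam v K x))"
  proof
    fix v obtain p where p: "p \<in> polys (int k - 1)" "\<forall>x\<in>convex hull F. q x \<bullet> (v - x) = p x" using ND_edge[OF q] by blast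
    obtain W where "W \<in> hom F (int k - 1)" "\<forall>x\<in>affine hull F. p x = W (\<lambda>v. lam v K x)"
      using polys_hom[OF K(1,2) p(1)] by blast
    then show "\<exists>W. W \<in> hom F (int k - 1) \<and> (\<forall>x\<in>convex hull F. q x \<bullet> (v - x) = W (\<lambda>v. lam v K x))"
      using p(2) aff by (intro exI[of _ W]) auto
  qed
  then obtain W where W: "\<And>v. W v \<in> hom F (int k - 1)"
    "\<And>v x. x \<in> convex hull F ==> q x \<bullet> (v - x) = W v (\<lambda>v. lam v K x)"
    by (drule_tac choice) blast
  have "\<forall>v\<in>F. \<exists>a. (\<lambda>y. y v * W v y) = (\<lambda>y. \<Sum>\<alpha>\<in>hexp F (int k). a \<alpha> * mono_at F \<alpha> y)"
    using hom_mult[OF fin hom_var[OF fin] W(1)] by (simp add: hom_def)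
  then obtain a where a: "\<And>v. v \<in> F ==> (\<lambda>y. y v * W v y) = (\<lambda>y. \<Sum>\<alpha>\<in>hexp F (int k). a v \<alpha> * mono_at F \<alpha> y)"
    by (drule_tac bchoice) blast
  have supp: "a v \<alpha> = 0" if "v \<in> F" "\<alpha> \<in> hexp F (int k)" "\<alpha> v = 0" for v \<alpha>
  proof (rule hom_coeff_zero_facet[OF fin that(1) _ _ that(2,3)])
    show "1 \<le> int k" using k by simp
    show "(\<Sum>\<alpha>\<in>hexp F (int k). a v \<alpha> * mono_at F \<alpha> y) = 0" if "y v = 0" for y
      using fun_cong[OF a[OF \<open>v \<in> F\<close>], of y] that by simp
  qed
  \<comment> \<open>The vectors \<open>v - x\<close> weighted by the barycentric coordinates of
    \<open>x\<close> sum to zero.\<close>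
  have edge0: "(\<Sum>v\<in>F. lam v K x * (q x \<bullet> (v - x))) = 0" if x: "x \<in> convex hull F" for x
  proof -
    have "(\<Sum>v\<in>F. lam v K x * (q x \<bullet> (v - x))) = q x \<bullet> (\<Sum>v\<in>F. lam v K x *\<^sub>R (v - x))"
      by (simp add: inner_sum_right)
    also have "(\<Sum>v\<in>F. lam v K x *\<^sub>R (v - x)) = 0"
      using lam_hull_sum[OF K(1,2)] x aff by (auto simp: scaleR_diff_right sum_subtractf simp flip: scaleR_sum_left)
    finally show ?thesis by simp
  qed
  have sum0: "(\<Sum>v\<in>F. a v \<alpha>) = 0" if \<alpha>: "\<alpha> \<in> hexp F (int k)" for \<alpha>
  proof (rule hom_lam_coeff_zero[OF K _ \<alpha>])
    fix x assume x: "\<And>v. v \<in> F ==> lam v K x > 0" "\<And>v. v \<in> K - F ==> lam v K x = 0"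
    have "lam u K x \<ge> 0" if "u \<in> K" for u using x[of u] that by (cases "u \<in> F") (auto intro: less_imp_le)
    then have xF: "x \<in> convex hull F" using x(2) mem_convex_hull[OF K(1,2)] by blast
    have "(\<Sum>\<alpha>\<in>hexp F (int k). (\<Sum>v\<in>F. a v \<alpha>) * mono_at F \<alpha> (\<lambda>v. lam v K x))
        = (\<Sum>v\<in>F. \<Sum>\<alpha>\<in>hexp F (int k). a v \<alpha> * mono_at F \<alpha> (\<lambda>v. lam v K x))"
      by (simp add: sum_distrib_right sum.swap[of _ F])
    also have "\<dots> = (\<Sum>v\<in>F. lam v K x * (q x \<bullet> (v - x)))"
      using fun_cong[OF a, of _ "\<lambda>v. lam v K x"] W(2)[OF xF] by (intro sum.cong refl) simp
    finally show "(\<Sum>\<alpha>\<in>hexp F (int k). (\<Sum>v\<in>F. a v \<alpha>) * mono_at F \<alpha> (\<lambda>v. lam v K x)) = 0" using edge0[OF xF] by simp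
  qed
  let ?u = "\<lambda>\<alpha>. \<Sum>v\<in>F. a v \<alpha> *\<^sub>R v"
  have "?u \<alpha> \<in> tan_space {v\<in>F. \<alpha> v \<noteq> 0}" if \<alpha>: "\<alpha> \<in> hexp F (int k)" for \<alpha>
  proof -
    let ?f = "{v\<in>F. \<alpha> v \<noteq> 0}"
    have "?u \<alpha> = (\<Sum>v\<in>?f. a v \<alpha> *\<^sub>R v)" by (rule sum.mono_neutral_right[OF fin]) (use supp[OF _ \<alpha>] in auto)
    moreover have "(\<Sum>v\<in>F. a v \<alpha>) = (\<Sum>v\<in>?f. a v \<alpha>)" by (rule sum.mono_neutral_right[OF fin]) (use supp[OF _ \<alpha>] in auto)
    ultimately show ?thesis using tan_space_comb[of ?f "\<lambda>v. a v \<alpha>"] fin sum0[OF \<alpha>] by simp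
  qed
  moreover have "(\<Sum>v\<in>F. (lam v K x * (q x \<bullet> (v - x))) *\<^sub>R v)
      = (\<Sum>\<alpha>\<in>hexp F (int k). mono_at F \<alpha> (\<lambda>v. lam v K x) *\<^sub>R ?u \<alpha>)" if x: "x \<in> convex hull F" for x
  proof -
    have "(\<Sum>v\<in>F. (lam v K x * (q x \<bullet> (v - x))) *\<^sub>R v)
        = (\<Sum>v\<in>F. (\<Sum>\<alpha>\<in>hexp F (int k). a v \<alpha> * mono_at F \<alpha> (\<lambda>v. lam v K x)) *\<^sub>R v)"
      using fun_cong[OF a, of _ "\<lambda>v. lam v K x"] W(2)[OF x] by (intro sum.cong refl) simp
    also have "\<dots> = (\<Sum>\<alpha>\<in>hexp F (int k). \<Sum>v\<in>F. (a v \<alpha> * mono_at F \<alpha> (\<lambda>v. lam v K x)) *\<^sub>R v)"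
      by (simp add: scaleR_sum_left sum.swap[of _ F])
    finally show ?thesis by (simp add: scaleR_sum_right mult.commute)
  qed
  ultimately show ?thesis by (intro exI[of _ ?u] conjI ballI)
qed

section \<open>Attaining the degrees of freedom (c) and (d)\<close>

context local_dofs
begin

abbreviation "Sigma_ab \<equiv> {\<tau> \<in> \<Sigma>. dofs_a_zero \<tau> \<and> (\<forall>l<CARD('n). dofs_b_zero l \<tau>)}"
abbreviation "Sigma_abc \<equiv> {\<tau> \<in> \<Sigma>. dofs_a_zero \<tau> \<and> (\<forall>l<CARD('n). dofs_b_zero l \<tau>) \<and> dofs_c_zero \<tau>}"

text \<open>With \<open>F = {}\<close>, the trace vanishes on all facets.\<close>

definition facet_trace :: "(real^'n) set \<Rightarrow> (real^'n \<Rightarrow> real^'n) \<Rightarrow> 'n field \<Rightarrow> bool" where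
  "facet_trace F h \<tau> \<longleftrightarrow>
    (\<forall>i\<in>T. \<forall>j\<in>sub i. \<forall>x\<in>convex hull (sub i - {j}).
      \<tau> (sub i) x *v nrm (sub i - {j}) = (if sub i - {j} = F then h x else 0)) \<and>
    (\<forall>i\<in>T. \<forall>f. f \<noteq> {} \<longrightarrow> f \<subseteq> sub i \<longrightarrow> (\<forall>x\<in>convex hull f. \<forall>m\<in>nor_space f. \<forall>n\<in>nor_space f.
      m \<bullet> (\<tau> (sub i) x *v n) = 0))"

lemma facet_traceD:
  assumes "facet_trace F h \<tau>"
  shows "i \<in> T ==> j \<in> sub i ==> x \<in> convex hull (sub i - {j}) ==>
      \<tau> (sub i) x *v nrm (sub i - {j}) = (if sub i - {j} = F then h x else 0)"
    and "i \<in> T ==> f \<noteq> {} ==> f \<subseteq> sub i ==> x \<in> convex hull f ==> m \<in> nor_space f ==> n \<in> nor_space f ==>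
      m \<bullet> (\<tau> (sub i) x *v n) = 0"
  using assms unfolding facet_trace_def by blast+

lemma facet_trace_add:
  assumes "facet_trace F h \<tau>" "facet_trace F h' \<sigma>" shows "facet_trace F (\<lambda>x. h x + h' x) (\<tau> + \<sigma>)"
  unfolding facet_trace_def field_add_apply matrix_vector_mult_add_rdistrib inner_add_right
  by (intro conjI ballI allI impI)
    (simp_all add: facet_traceD(1)[OF assms(1)] facet_traceD(1)[OF assms(2)]
      facet_traceD(2)[OF assms(1)] facet_traceD(2)[OF assms(2)])

lemma facet_trace_scale:
  assumes "facet_trace F h \<tau>" shows "facet_trace F (\<lambda>x. a *\<^sub>R h x) (scale_field a \<tau>)"
  unfolding facet_trace_def scale_field_def scaleR_matrix_vector_assoc[symmetric] inner_scaleR_right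
  by (intro conjI ballI allI impI) (simp_all add: facet_traceD(1)[OF assms] facet_traceD(2)[OF assms])

lemma facet_trace_zero: "facet_trace F (\<lambda>x. 0) 0"
  by (simp add: facet_trace_def)

text \<open>The monomial is the bubble of its support \<open>f\<close>, so an interior
  tangential-normal function at \<open>f\<close> realizes it. That function vanishes on facets not
  containing \<open>f\<close>, and on the others its normal vectors single out
  \<open>F\<close>.\<close>

lemma facet_trace_mono:
  assumes F: "F \<in> interior_facets" and K: "K \<in> split T" "F \<subseteq> K"
    and \<alpha>: "\<alpha> \<in> hexp F (int k)" and t: "t \<in> tan_space {v\<in>F. \<alpha> v \<noteq> 0}"
  shows "\<exists>\<tau>\<in>\<Sigma>. facet_trace F (\<lambda>x. mono_at F \<alpha> (\<lambda>v. lam v K x) *\<^sub>R t) \<tau>"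
proof -
  define f where "f = {v\<in>F. \<alpha> v \<noteq> 0}"
  have t: "t \<in> tan_space f" using t by (simp add: f_def)
  have finF: "finite F" by (rule interior_face_subset(3)[OF F])
  have f: "f \<subseteq> F" "f \<noteq> {}" "finite f" using supp_nonempty[OF \<alpha> k1] finF by (auto simp: f_def)
  have cF: "card F = CARD('n)" using F dim2 interior_faces_T by auto
  have "0 < card f" "card f \<le> CARD('n)" using card_mono[OF finF f(1)] cF f by (auto simp: card_gt_0_iff)
  then have l: "card f = (card f - 1) + 1" "card f - 1 < CARD('n)" by linarith+
  let ?P = "mono_at f (\<lambda>v. \<alpha> v - 1)"
  note P = mono_bub[OF finF \<alpha> f_def l(1)]
  have cK: "cell K'" if "K' \<in> split T" for K' using that cell_sub by (auto simp: split_iff)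
  have "\<exists>n. n \<in> nhat nrm f F K'" if K': "K' \<in> split T" "F \<subseteq> K'" for K'
  proof -
    obtain i where i: "i \<in> T" "K' = sub i" using K'(1) split_iff by blast
    have "card (K' - F) = 1"
      using K'(2) cF cK[OF K'(1)] cell_finite[OF cK[OF K'(1)]] by (simp add: cell_def card_Diff_subset finite_subset)
    then obtain w where w: "w \<in> K'" "F = K' - {w}" using K'(2) by (auto simp: card_1_singleton_iff)
    have "\<exists>s. s \<noteq> 0 \<and> nrm (K' - {v}) = s *\<^sub>R glam v K'" if "v \<in> K'" for v
      using nrm_facet[OF i(1), of v] that i(2) by metis
    from nhat_nonempty[OF cK[OF K'(1)] dim2 w(1) _ f(2) this] show ?thesis using f(1) w(2) by simp
  qed
  then obtain n where n: "\<And>K'. K' \<in> split T ==> F \<subseteq> K' ==> n K' \<in> nhat nrm f F K'" by metis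
  let ?\<tau> = "restrict_field (split T) (\<lambda>K x. bub_hom f ?P K x *\<^sub>R tn_tensor F t n K)"
  have \<tau>: "?\<tau> \<in> \<Sigma>" by (rule tn_elem[OF F f(1) l P(1) t n])
  have e: "?\<tau> (sub i) x *v m = bub_hom f ?P (sub i) x *\<^sub>R (tn_tensor F t n (sub i) *v m)" if "i \<in> T" for i x m
    using that by (simp add: restrict_sub scaleR_matrix_vector_assoc)
  have "facet_trace F (\<lambda>x. mono_at F \<alpha> (\<lambda>v. lam v K x) *\<^sub>R (1/2) *\<^sub>R t) ?\<tau>"
    unfolding facet_trace_def
  proof (intro conjI ballI allI impI)
    fix i j x assume i: "i \<in> T" and j: "j \<in> sub i" and x: "x \<in> convex hull (sub i - {j})"
    show "?\<tau> (sub i) x *v nrm (sub i - {j}) = (if sub i - {j} = F then mono_at F \<alpha> (\<lambda>v. lam v K x) *\<^sub>R (1/2) *\<^sub>R t else 0)"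
    proof (cases "f \<subseteq> sub i - {j}")
      case True
      have "bub_hom f ?P (sub i) x = bub_hom f ?P K x" if "sub i - {j} = F"
        by (rule bub_hom_single_valued[OF cell_sub[OF i] cK[OF K(1)] _ K(2)]) (use that x in auto)
      moreover have "tn_tensor F t n (sub i) *v nrm (sub i - {j}) = (if sub i - {j} = F then (1/2) *\<^sub>R t else 0)"
        by (rule tn_tensor_normal[OF F f(1) t n i j True])
      ultimately show ?thesis
        unfolding e[OF i] unfolding P(2) by (cases "sub i - {j} = F") simp_all
    next
      case False
      then have "sub i - {j} \<noteq> F" using f(1) by blast
      then show ?thesis unfolding e[OF i] using bub_hom_zero[OF cell_sub[OF i] _ x False f(3)] by auto
    qed
  next
    fix i f' x m n' assume i: "i \<in> T" and f': "f' \<subseteq> sub i" and x: "x \<in> convex hull f'"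
      and mn: "m \<in> nor_space f'" "n' \<in> nor_space f'"
    show "m \<bullet> (?\<tau> (sub i) x *v n') = 0"
    proof (cases "f \<subseteq> f'")
      case True
      then show ?thesis unfolding e[OF i] using tn_tensor_nn[OF t True mn] by simp
    next
      case False
      then show ?thesis unfolding e[OF i] using bub_hom_zero[OF cell_sub[OF i] f' x False f(3)] by simp
    qed
  qed
  \<comment> \<open>Compensates the factor 1/2 left by symmetrization in
    \<open>tn_tensor_normal\<close>.\<close>
  from facet_trace_scale[OF this, of 2] show ?thesis using Sigma_scale[OF \<tau>, of 2] by (auto simp: mult.commute)
qed

lemma facet_trace_sum:
  assumes "\<And>\<alpha>. \<alpha> \<in> I ==> \<exists>\<tau>\<in>\<Sigma>. facet_trace F (h \<alpha>) \<tau>"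
  shows "\<exists>\<tau>\<in>\<Sigma>. facet_trace F (\<lambda>x. \<Sum>\<alpha>\<in>I. h \<alpha> x) \<tau>"
  using assms
proof (induction I rule: infinite_finite_induct)
  case (insert \<alpha> I)
  then obtain \<tau> \<sigma> where *: "\<tau> \<in> \<Sigma>" "facet_trace F (h \<alpha>) \<tau>" "\<sigma> \<in> \<Sigma>" "facet_trace F (\<lambda>x. \<Sum>\<alpha>\<in>I. h \<alpha> x) \<sigma>"
    by (metis insertI1 insertI2)
  from facet_trace_add[OF *(2,4)] show ?case using Sigma_add[OF *(1,3)] insert.hyps by auto
qed (use facet_trace_zero Sigma_zero in auto)

lemma facet_trace_cong:
  "facet_trace F h \<tau> ==> (\<And>x. x \<in> convex hull F ==> h x = h' x) ==> facet_trace F h' \<tau>"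
  unfolding facet_trace_def by (simp cong: if_cong)

lemma facet_trace_dofs_a:
  assumes \<tau>: "facet_trace F h \<tau>" and F: "c \<in> F \<or> F = {}" shows "dofs_a_zero \<tau>"
  unfolding dofs_a_zero_def
proof (intro ballI)
  fix i q assume i: "i \<in> T"
  have eq: "sub i - {c} = T - {i}" and ci: "c \<in> sub i" using c_notin by (auto simp: subcell_def)
  \<comment> \<open>A facet of \<open>T\<close> is nonempty and does not contain the barycenter, so
    it differs from \<open>F\<close> in both cases.\<close>
  have "T - {i} \<noteq> F" using F c_notin facet_finite(2)[OF i] by auto
  then show "dof_a nrm T (T - {i}) \<tau> q = 0"
    unfolding dof_a_eq[OF i] using facet_traceD(1)[OF \<tau> i ci, unfolded eq]
    by (intro surface_integral_zero) simp
qed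

lemma facet_trace_dofs_b:
  assumes \<tau>: "facet_trace F h \<tau>" and l: "l < CARD('n)" shows "dofs_b_zero l \<tau>"
  unfolding dofs_b_zero_def
proof (intro ballI allI impI)
  fix f i j q assume f: "f \<in> interior_faces l {T}" and ij: "1 \<le> i" "i \<le> j" "j \<le> CARD('n) - l"
  obtain e where e: "e \<in> T" "elt f = sub e" "f \<subseteq> sub e" using interior_face_cell[OF l f] .
  have "i \<in> {1..CARD('n) - l}" "j \<in> {1..CARD('n) - l}" using ij by auto
  then have "nb f i \<in> nor_space f" "nb f j \<in> nor_space f" using nb_nor[OF l f] by blast+
  then show "dof_b (elt f) f (nb f i) (nb f j) \<tau> q = 0"
    unfolding dof_b_def e(2) using facet_traceD(2)[OF \<tau> e(1) interior_face_nonempty[OF f] e(3)]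
    by (intro surface_integral_zero) simp
qed

lemma facet_trace_dof_c:
  assumes \<tau>: "facet_trace F h \<tau>" and F': "F' \<in> interior_facets" and q: "q \<in> ND k F'"
  shows "dof_c nrm (elt F') F' \<tau> q = (if F' = F then surface_integral F (\<lambda>x. h x \<bullet> q x) else 0)"
proof -
  have "CARD('n) - 1 < CARD('n)" by simp
  then obtain e where e: "e \<in> T" "elt F' = sub e" "F' \<subseteq> sub e" using interior_face_cell[OF _ F'] by metis
  obtain i j where ij: "i \<in> T" "j \<in> T" "i \<noteq> j" "F' = sub i - {j}" "F' = sub j - {i}" using interior_facetE[OF F'] .
  have "e = i \<or> e = j" using cells_containing_facet[OF ij(1-3) e(1)] e(3) ij(4) by simp
  then obtain w where w: "w \<in> sub e" "F' = sub e - {w}" using ij by (auto simp: subcell_def)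
  obtain s where "nrm F' = s *\<^sub>R glam w (sub e)" using nrm_facet[OF e(1) w(1)] w(2) by metis
  then have "nrm F' \<in> nor_space F'"
    using glam_nor_space[OF cell_sub[OF e(1)] e(3), of w] w subspace_scale[OF subspace_nor_space] by auto
  then have nq: "nrm F' \<bullet> q x = 0" if "x \<in> convex hull F'" for x using nor_tan_orth ND_D(2)[OF q that] by blast
  have "tangential_part (nrm F') (\<tau> (sub e) x *v nrm F') \<bullet> q x = (if F' = F then h x \<bullet> q x else 0)"
    if x: "x \<in> convex hull F'" for x
    unfolding tangential_part_inner[OF nq[OF x]]
    using facet_traceD(1)[OF \<tau> e(1) w(1), folded w(2), OF x] by simp
  then have "dof_c nrm (elt F') F' \<tau> q = surface_integral F' (\<lambda>x. if F' = F then h x \<bullet> q x else 0)"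
    unfolding dof_c_def e(2) by (rule surface_integral_cong)
  then show ?thesis by (auto intro: surface_integral_zero)
qed

text \<open>The trace \<open>?h\<close> is chosen so that its product with a test field
  \<open>r\<close> is the weighted product of \<open>q\<close> and \<open>r\<close>, through which
  \<open>q\<close> represents \<open>L\<close>. By \<open>ND_expand\<close> it is a sum of monomials
  times tangents of their supports, and these traces are attained.\<close>

lemma attain_c_single:
  assumes F: "F \<in> interior_facets" and L: "linear_on (ND k F) L"
  shows "\<exists>\<tau>\<in>\<Sigma>. \<exists>h. facet_trace F h \<tau> \<and> (\<forall>r\<in>ND k F. surface_integral F (\<lambda>x. h x \<bullet> r x) = L r)"
proof -
  have "CARD('n) - 1 < CARD('n)" by simp
  then obtain e where e: "e \<in> T" "F \<subseteq> sub e" using interior_face_cell[OF _ F] by metis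
  note K = cell_sub[OF e(1)]
  note FF = interior_face_subset(3)[OF F] interior_face_nonempty[OF F]
  let ?\<beta> = "\<lambda>x q r. \<Sum>v\<in>F. lam v (sub e) x * ((q \<bullet> (v - x)) * (r \<bullet> (v - x)))"
  have "\<exists>q\<in>ND k F. \<forall>r\<in>ND k F. surface_integral F (\<lambda>x. ?\<beta> x (q x) (r x)) = L r"
  proof (rule riesz_surface[OF FF ND_finite_dim _ ND_comb _ _ _ _ _ L])
    show "ND k F \<noteq> {}" using ND_zero by blast
    show "continuous_on (convex hull F) (\<lambda>x. ?\<beta> x (q x) (r x))" if "q \<in> ND k F" "r \<in> ND k F" for q r
      by (intro continuous_intros continuous_lam[OF K] continuous_vec_polys_on[OF ND_D(1)[OF that(1)]]
          continuous_vec_polys_on[OF ND_D(1)[OF that(2)]])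
    show "?\<beta> x u u \<ge> 0" if "x \<in> convex hull F" for x u
      using that mem_convex_hull[OF K e(2)] e(2) by (intro sum_nonneg mult_nonneg_nonneg zero_le_square) auto
    show "q = (\<lambda>x. 0)" if "q \<in> ND k F" "\<And>x. x \<in> convex hull F ==> ?\<beta> x (q x) (q x) = 0" for q
      by (rule ND_definite[OF K e(2) FF(2) that])
    show "?\<beta> x u v = ?\<beta> x v u" for x u v by (simp add: mult.commute)
    show "?\<beta> x (a *\<^sub>R u + b *\<^sub>R v) w = a * ?\<beta> x u w + b * ?\<beta> x v w" for x a b u v w
      by (simp add: inner_add_left sum_distrib_left sum.distrib[symmetric] algebra_simps)
  qed
  then obtain q where q: "q \<in> ND k F" "\<And>r. r \<in> ND k F ==> surface_integral F (\<lambda>x. ?\<beta> x (q x) (r x)) = L r" by blast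
  let ?h = "\<lambda>x. \<Sum>v\<in>F. (lam v (sub e) x * (q x \<bullet> (v - x))) *\<^sub>R v"
  obtain u where u: "\<And>\<alpha>. \<alpha> \<in> hexp F (int k) ==> u \<alpha> \<in> tan_space {v\<in>F. \<alpha> v \<noteq> 0}"
    "\<And>x. x \<in> convex hull F ==> ?h x = (\<Sum>\<alpha>\<in>hexp F (int k). mono_at F \<alpha> (\<lambda>v. lam v (sub e) x) *\<^sub>R u \<alpha>)"
    using ND_expand[OF K e(2) FF(2) k1 q(1)] by blast
  have "sub e \<in> split T" using e(1) split_iff by blast
  then have "\<exists>\<tau>\<in>\<Sigma>. facet_trace F (\<lambda>x. \<Sum>\<alpha>\<in>hexp F (int k). mono_at F \<alpha> (\<lambda>v. lam v (sub e) x) *\<^sub>R u \<alpha>) \<tau>"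
    by (intro facet_trace_sum facet_trace_mono[OF F _ e(2)] u(1))
  then obtain \<tau> where \<tau>: "\<tau> \<in> \<Sigma>"
    "facet_trace F (\<lambda>x. \<Sum>\<alpha>\<in>hexp F (int k). mono_at F \<alpha> (\<lambda>v. lam v (sub e) x) *\<^sub>R u \<alpha>) \<tau>"
    by blast
  have h: "facet_trace F ?h \<tau>" by (rule facet_trace_cong[OF \<tau>(2)]) (rule u(2)[symmetric])
  have "surface_integral F (\<lambda>x. ?h x \<bullet> r x) = L r" if r: "r \<in> ND k F" for r
    unfolding q(2)[OF r, symmetric]
  proof (rule surface_integral_cong)
    fix x assume x: "x \<in> convex hull F"
    have xa: "x \<in> affine hull F" using x convex_hull_subset_affine_hull by blast
    have "(\<Sum>v\<in>F. lam v (sub e) x * (q x \<bullet> (v - x))) = q x \<bullet> (\<Sum>v\<in>F. lam v (sub e) x *\<^sub>R (v - x))"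
      by (simp add: inner_sum_right)
    also have "(\<Sum>v\<in>F. lam v (sub e) x *\<^sub>R (v - x)) = 0"
      using lam_hull_sum[OF K e(2) xa] by (simp add: scaleR_diff_right sum_subtractf flip: scaleR_sum_left)
    finally have "?h x = (\<Sum>v\<in>F. (lam v (sub e) x * (q x \<bullet> (v - x))) *\<^sub>R (v - x))"
      by (simp add: scaleR_diff_right sum_subtractf flip: scaleR_sum_left)
    then have "?h x \<bullet> r x = (\<Sum>v\<in>F. (lam v (sub e) x * (q x \<bullet> (v - x))) *\<^sub>R (v - x)) \<bullet> r x" by simp
    then show "?h x \<bullet> r x = ?\<beta> x (q x) (r x)"
      by (simp add: inner_sum_left inner_commute[of "r x"] mult.assoc)
  qed
  then show ?thesis using \<tau>(1) h by blast
qed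

lemma attain_c:
  assumes L: "\<And>F. F \<in> interior_facets ==> linear_on (ND k F) (L F)"
  shows "\<exists>\<tau>\<in>Sigma_ab.
    \<forall>F\<in>interior_facets. \<forall>q\<in>ND k F. dof_c nrm (elt F) F \<tau> q = L F q"
proof (rule superpose[OF finite_interior_faces])
  show "dof_c nrm (elt F) F (\<tau> + \<sigma>) q = dof_c nrm (elt F) F \<tau> q + dof_c nrm (elt F) F \<sigma> q"
    if "\<tau> \<in> Sigma_ab"
      "\<sigma> \<in> Sigma_ab"
      "F \<in> interior_facets" "q \<in> ND k F" for \<tau> \<sigma> F q
    using that by (intro dof_c_add[OF Sigma_conf Sigma_conf]) auto
  fix F assume F: "F \<in> interior_facets"
  obtain \<tau> h where \<tau>: "\<tau> \<in> \<Sigma>" "facet_trace F h \<tau>" "\<And>r. r \<in> ND k F ==> surface_integral F (\<lambda>x. h x \<bullet> r x) = L F r"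
    using attain_c_single[OF F L[OF F]] by blast
  have "c \<in> F" by (rule interior_face_subset(1)[OF F])
  then have "dofs_a_zero \<tau>" "\<forall>l<CARD('n). dofs_b_zero l \<tau>"
    using facet_trace_dofs_a[OF \<tau>(2)] facet_trace_dofs_b[OF \<tau>(2)] by auto
  moreover have "dof_c nrm (elt F) F \<tau> q = L F q" if "q \<in> ND k F" for q
    using facet_trace_dof_c[OF \<tau>(2) F that] \<tau>(3)[OF that] by simp
  moreover have "dof_c nrm (elt F') F' \<tau> q = 0"
    if "F' \<in> interior_facets - {F}" "q \<in> ND k F'" for F' q
    using facet_trace_dof_c[OF \<tau>(2) _ that(2)] that(1) by simp
  ultimately show "\<exists>\<tau>\<in>Sigma_ab.
      (\<forall>q\<in>ND k F. dof_c nrm (elt F) F \<tau> q = L F q) \<and>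
      (\<forall>F'\<in>interior_facets - {F}. \<forall>q\<in>ND k F'. dof_c nrm (elt F') F' \<tau> q = 0)"
    by (intro bexI[of _ \<tau>]) (simp_all add: \<tau>(1))
qed (simp_all add: Sigma_zero dofs_a_zero_zero dofs_b_zero_zero Sigma_add dofs_a_zero_add dofs_b_zero_add)

lemma attain_d_single:
  assumes K: "K \<in> split T" and L: "linear_on (Bdiv k K) L"
  shows "\<exists>q\<in>Bdiv k K. \<forall>r\<in>Bdiv k K. cell_int K (\<lambda>x. q x \<bullet> r x) = L r"
proof -
  have cK: "cell K" using K cell_sub by (auto simp: split_iff)
  obtain S where S: "finite S" "(sym_polys (int k) :: (real^'n \<Rightarrow> real^'n^'n) set) \<subseteq> fs.span S"
    using sym_polys_finite_dim by blast
  have cont: "continuous_on UNIV (\<lambda>x. q x \<bullet> r x)" if "q \<in> Bdiv k K" "r \<in> Bdiv k K" for q r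
    by (intro continuous_intros Bdiv_continuous[OF that(1)] Bdiv_continuous[OF that(2)])
  show ?thesis
  proof (rule riesz_fun[OF S(1) _ _ Bdiv_comb[OF K] _ _ _ L])
    show "Bdiv k K \<subseteq> fs.span S" using S(2) by (auto simp: Bdiv_def)
    have "(\<lambda>x. 0) \<in> Bdiv k K" by (simp add: Bdiv_iff[OF cK] sym_polys_zero)
    then show "Bdiv k K \<noteq> {}" by blast
  next
    fix q r z a b assume qrz: "q \<in> Bdiv k K" "r \<in> Bdiv k K" "z \<in> Bdiv k K"
    show "cell_int K (\<lambda>x. (a *\<^sub>R q x + b *\<^sub>R r x) \<bullet> z x) = a * cell_int K (\<lambda>x. q x \<bullet> z x) + b * cell_int K (\<lambda>x. r x \<bullet> z x)"
      unfolding inner_add_left inner_scaleR_left by (rule cell_int_lin[OF cK cont[OF qrz(1,3)] cont[OF qrz(2,3)]])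
  next
    show "cell_int K (\<lambda>x. q x \<bullet> r x) = cell_int K (\<lambda>x. r x \<bullet> q x)" for q r by (simp add: inner_commute)
  next
    fix q assume q: "q \<in> Bdiv k K" "q \<noteq> (\<lambda>x. 0)"
    have "cell_int K (\<lambda>x. q x \<bullet> q x) \<ge> 0"
      unfolding cell_int_def by (rule Bochner_Integration.integral_nonneg) (simp add: indicator_def)
    moreover have "cell_int K (\<lambda>x. q x \<bullet> q x) \<noteq> 0"
    proof
      assume 0: "cell_int K (\<lambda>x. q x \<bullet> q x) = 0"
      have q0: "q x = 0" if "x \<in> interior (convex hull K)" for x
        using cell_int_definite[OF cK cont[OF q(1) q(1)] _ 0 that] by simp
      have "q x $ i $ j = 0" for x i j
        by (rule polys_zero_on_cell[OF cK, of "\<lambda>x. q x $ i $ j" "int k"]) (use q(1) q0 in \<open>auto simp: Bdiv_def sym_polys_def\<close>)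
      then show False using q(2) by (simp add: fun_eq_iff vec_eq_iff)
    qed
    ultimately show "cell_int K (\<lambda>x. q x \<bullet> q x) > 0" by linarith
  qed
qed

text \<open>A normal of a face of \<open>K\<close> is a combination of gradients belonging to the
  facets that contain it, and an element bubble annihilates each of these on the face. Hence it
  leaves (a), (b) and (c) zero.\<close>

lemma Bdiv_facet_trace:
  assumes K: "K \<in> split T" and q: "q \<in> Bdiv k K"
  shows "facet_trace {} h (restrict_field {K} (\<lambda>K'. q))"
proof -
  have cK: "cell K" using K cell_sub by (auto simp: split_iff)
  have q0: "q x *v glam v K = 0" if "v \<in> K" "x \<in> convex hull (K - {v})" for v x by (rule Bdiv_D[OF cK q that])
  have qn: "q x *v n = 0" if f: "f \<noteq> {}" "f \<subseteq> K" and x: "x \<in> convex hull f" and n: "n \<in> nor_space f" for f x n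
  proof -
    have "q x *v n = 0 *v n"
    proof (rule matrix_vector_mult_span)
      show "n \<in> span ((\<lambda>v. glam v K) ` (K - f))" using nor_space_span[OF cK f(2,1)] n by simp
      fix m assume "m \<in> (\<lambda>v. glam v K) ` (K - f)"
      then obtain v where v: "v \<in> K" "v \<notin> f" "m = glam v K" by blast
      have "convex hull f \<subseteq> convex hull (K - {v})" using f(2) v(2) by (intro hull_mono) blast
      then show "q x *v m = 0 *v m" using q0[OF v(1)] x v(3) by auto
    qed
    then show ?thesis by simp
  qed
  show ?thesis
    unfolding facet_trace_def
  proof (intro conjI ballI allI impI)
    fix i j x assume ij: "i \<in> T" "j \<in> sub i" and x: "x \<in> convex hull (sub i - {j})"
    obtain s where s: "nrm (sub i - {j}) = s *\<^sub>R glam j (sub i)" using nrm_facet[OF ij] by metis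
    have "convex hull (sub i - {j}) \<noteq> {}" using x by blast
    then have "sub i - {j} \<noteq> {}" by auto
    moreover have "restrict_field {K} (\<lambda>K'. q) (sub i) x *v nrm (sub i - {j}) = 0"
      using q0[of j x] ij x by (auto simp: restrict_field_def s matrix_vector_mult_scaleR)
    ultimately show "restrict_field {K} (\<lambda>K'. q) (sub i) x *v nrm (sub i - {j}) = (if sub i - {j} = {} then h x else 0)"
      by simp
  next
    fix i f x m n assume "i \<in> T" "f \<noteq> {}" "f \<subseteq> sub i" "x \<in> convex hull f" "n \<in> nor_space f"
    then show "m \<bullet> (restrict_field {K} (\<lambda>K'. q) (sub i) x *v n) = 0"
      using qn[of f x n] by (auto simp: restrict_field_def)
  qed
qed

lemma attain_d:
  assumes L: "\<And>K. K \<in> split T ==> linear_on (Bdiv k K) (L K)"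
  shows "\<exists>\<tau>\<in>Sigma_abc.
    \<forall>K\<in>split T. \<forall>q\<in>Bdiv k K. dof_d K \<tau> q = L K q"
proof (rule superpose)
  show "finite (split T)" by (simp add: split_def finite_T)
  show "dof_d K (\<tau> + \<sigma>) q = dof_d K \<tau> q + dof_d K \<sigma> q"
    if "\<tau> \<in> Sigma_abc"
      "\<sigma> \<in> Sigma_abc"
      "K \<in> split T" "q \<in> Bdiv k K" for \<tau> \<sigma> K q
    using that by (intro dof_d_add Sigma_conf Sigma_add) auto
  fix K assume K: "K \<in> split T"
  obtain q where q: "q \<in> Bdiv k K" "\<And>r. r \<in> Bdiv k K ==> cell_int K (\<lambda>x. q x \<bullet> r x) = L K r"
    using attain_d_single[OF K L[OF K]] by blast
  let ?\<tau> = "restrict_field {K} (\<lambda>K'. q)"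
  note \<tau> = cell_elem[OF K q(1)]
  note tr = Bdiv_facet_trace[OF K q(1), of "\<lambda>x. 0"]
  have "dofs_c_zero ?\<tau>" unfolding dofs_c_zero_def
    using facet_trace_dof_c[OF tr] interior_face_nonempty by auto
  then have "?\<tau> \<in> Sigma_abc"
    using \<tau> facet_trace_dofs_a[OF tr] facet_trace_dofs_b[OF tr] by simp
  moreover have "dof_d K ?\<tau> r = L K r" if "r \<in> Bdiv k K" for r
    unfolding dof_d_eq[OF Sigma_conf[OF \<tau>] K that] using q(2)[OF that] by (simp add: restrict_field_def)
  moreover have "dof_d K' ?\<tau> r = 0" if "K' \<in> split T - {K}" "r \<in> Bdiv k K'" for K' r
    using that by (simp add: dof_d_def restrict_field_def)
  ultimately show "\<exists>\<tau>\<in>Sigma_abc.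
      (\<forall>q\<in>Bdiv k K. dof_d K \<tau> q = L K q) \<and> (\<forall>K'\<in>split T - {K}. \<forall>q\<in>Bdiv k K'. dof_d K' \<tau> q = 0)"
    by (intro bexI[of _ ?\<tau>]) simp_all
qed (simp_all add: Sigma_zero dofs_a_zero_zero dofs_b_zero_zero dofs_c_zero_zero Sigma_add dofs_a_zero_add
    dofs_b_zero_add dofs_c_zero_add)

lemma attain:
  assumes La: "\<And>i. i \<in> T ==> linear_on (VP i) (La (T - {i}))"
    and Lb: "\<And>l f i j. l < CARD('n) ==> f \<in> interior_faces l {T} ==> 1 \<le> i ==> i \<le> j ==> j \<le> CARD('n) - l ==>
      linear_on (PO l f) (Lb f i j)"
    and Lc: "\<And>F. F \<in> interior_facets ==> linear_on (ND k F) (Lc F)"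
    and Ld: "\<And>K. K \<in> split T ==> linear_on (Bdiv k K) (Ld K)"
  shows "\<exists>\<tau>\<in>\<Sigma>. (\<forall>i\<in>T. \<forall>q\<in>VP i. dof_a nrm T (T - {i}) \<tau> q = La (T - {i}) q) \<and>
    (\<forall>l<CARD('n). \<forall>f\<in>interior_faces l {T}. \<forall>i j. 1 \<le> i \<and> i \<le> j \<and> j \<le> CARD('n) - l \<longrightarrow>
      (\<forall>q\<in>PO l f. dof_b (elt f) f (nb f i) (nb f j) \<tau> q = Lb f i j q)) \<and>
    (\<forall>F\<in>interior_facets. \<forall>q\<in>ND k F. dof_c nrm (elt F) F \<tau> q = Lc F q) \<and>
    (\<forall>K\<in>split T. \<forall>q\<in>Bdiv k K. dof_d K \<tau> q = Ld K q)"
proof -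
  define A where "A = (\<lambda>\<tau>. \<forall>i\<in>T. \<forall>q\<in>VP i. dof_a nrm T (T - {i}) \<tau> q = La (T - {i}) q)"
  define B where "B = (\<lambda>l \<tau>. \<forall>f\<in>interior_faces l {T}. \<forall>i j. 1 \<le> i \<and> i \<le> j \<and> j \<le> CARD('n) - l \<longrightarrow>
      (\<forall>q\<in>PO l f. dof_b (elt f) f (nb f i) (nb f j) \<tau> q = Lb f i j q))"
  define C where "C = (\<lambda>\<tau>. \<forall>F\<in>interior_facets. \<forall>q\<in>ND k F. dof_c nrm (elt F) F \<tau> q = Lc F q)"
  have A_add: "A (\<tau> + \<sigma>)" if "A \<tau>" "dofs_a_zero \<sigma>" "\<tau> \<in> \<Sigma>" "\<sigma> \<in> \<Sigma>" for \<tau> \<sigma>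
    using that dof_a_add[OF Sigma_conf Sigma_conf] by (simp add: A_def dofs_a_zero_def)
  have B_add: "B l (\<tau> + \<sigma>)" if "B l \<tau>" "dofs_b_zero l \<sigma>" "\<tau> \<in> \<Sigma>" "\<sigma> \<in> \<Sigma>" for l \<tau> \<sigma>
    using that dof_b_add[OF Sigma_conf Sigma_conf] by (simp add: B_def dofs_b_zero_def)
  have C_add: "C (\<tau> + \<sigma>)" if "C \<tau>" "dofs_c_zero \<sigma>" "\<tau> \<in> \<Sigma>" "\<sigma> \<in> \<Sigma>" for \<tau> \<sigma>
    using that dof_c_add[OF Sigma_conf Sigma_conf] by (simp add: C_def dofs_c_zero_def)
  have "\<exists>\<tau>\<in>\<Sigma>. A \<tau> \<and> (\<forall>l<m. B l \<tau>)" if "m \<le> CARD('n)" for m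
    using that
  proof (induction m)
    case 0
    then show ?case using attain_a[of "\<lambda>i. La (T - {i})"] La by (simp add: A_def)
  next
    case (Suc m)
    then obtain \<tau> where \<tau>: "\<tau> \<in> \<Sigma>" "A \<tau>" "\<And>l. l < m ==> B l \<tau>" by auto
    have m: "m < CARD('n)" using Suc.prems by simp
    \<comment> \<open>The correction attains the residual in dimension \<open>m\<close> and is zero
      in (a) and in smaller dimensions; higher dimensions are repaired in later steps.\<close>
    have "\<exists>\<sigma>\<in>{\<tau> \<in> \<Sigma>. dofs_a_zero \<tau> \<and> (\<forall>l'<m. dofs_b_zero l' \<tau>)}.
      \<forall>f\<in>interior_faces m {T}. \<forall>i j. 1 \<le> i \<and> i \<le> j \<and> j \<le> CARD('n) - m \<longrightarrow>
        (\<forall>q\<in>PO m f. dof_b (elt f) f (nb f i) (nb f j) \<sigma> q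
          = Lb f i j q - dof_b (elt f) f (nb f i) (nb f j) \<tau> q)"
      by (rule attain_b[OF m]) (intro linear_on_diff Lb[OF m] dof_b_linear[OF Sigma_conf[OF \<tau>(1)]])
    then obtain \<sigma> where \<sigma>: "\<sigma> \<in> \<Sigma>" "dofs_a_zero \<sigma>" "\<And>l. l < m ==> dofs_b_zero l \<sigma>"
      "\<And>f i j q. f \<in> interior_faces m {T} ==> 1 \<le> i \<and> i \<le> j \<and> j \<le> CARD('n) - m ==> q \<in> PO m f ==>
        dof_b (elt f) f (nb f i) (nb f j) \<sigma> q = Lb f i j q - dof_b (elt f) f (nb f i) (nb f j) \<tau> q"
      by auto
    have "B m (\<tau> + \<sigma>)"
      unfolding B_def using dof_b_add[OF Sigma_conf[OF \<tau>(1)] Sigma_conf[OF \<sigma>(1)]] \<sigma>(4) by simp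
    then have "\<forall>l<Suc m. B l (\<tau> + \<sigma>)"
      using B_add[OF \<tau>(3) \<sigma>(3) \<tau>(1) \<sigma>(1)] by (auto simp: less_Suc_eq)
    then show ?case using A_add[OF \<tau>(2) \<sigma>(2) \<tau>(1) \<sigma>(1)] Sigma_add[OF \<tau>(1) \<sigma>(1)] by blast
  qed
  from this[OF order.refl] obtain \<tau> where \<tau>: "\<tau> \<in> \<Sigma>" "A \<tau>" "\<And>l. l < CARD('n) ==> B l \<tau>" by blast
  have "\<exists>\<sigma>\<in>Sigma_ab.
    \<forall>F\<in>interior_facets. \<forall>q\<in>ND k F. dof_c nrm (elt F) F \<sigma> q = Lc F q - dof_c nrm (elt F) F \<tau> q"
    by (rule attain_c) (intro linear_on_diff Lc dof_c_linear[OF Sigma_conf[OF \<tau>(1)]])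
  then obtain \<sigma> where \<sigma>: "\<sigma> \<in> \<Sigma>" "dofs_a_zero \<sigma>" "\<And>l. l < CARD('n) ==> dofs_b_zero l \<sigma>"
    "\<And>F q. F \<in> interior_facets ==> q \<in> ND k F ==>
      dof_c nrm (elt F) F \<sigma> q = Lc F q - dof_c nrm (elt F) F \<tau> q"
    by auto
  let ?\<tau> = "\<tau> + \<sigma>"
  have \<tau>': "?\<tau> \<in> \<Sigma>" "A ?\<tau>" "\<And>l. l < CARD('n) ==> B l ?\<tau>"
    using Sigma_add[OF \<tau>(1) \<sigma>(1)] A_add[OF \<tau>(2) \<sigma>(2) \<tau>(1) \<sigma>(1)] B_add[OF \<tau>(3) \<sigma>(3) \<tau>(1) \<sigma>(1)] by auto
  have C: "C ?\<tau>"
    unfolding C_def using dof_c_add[OF Sigma_conf[OF \<tau>(1)] Sigma_conf[OF \<sigma>(1)]] \<sigma>(4) by simp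
  have "\<exists>\<rho>\<in>Sigma_abc.
    \<forall>K\<in>split T. \<forall>q\<in>Bdiv k K. dof_d K \<rho> q = Ld K q - dof_d K ?\<tau> q"
    by (rule attain_d) (intro linear_on_diff Ld dof_d_linear[OF Sigma_conf[OF \<tau>'(1)]])
  then obtain \<rho> where \<rho>: "\<rho> \<in> \<Sigma>" "dofs_a_zero \<rho>" "\<And>l. l < CARD('n) ==> dofs_b_zero l \<rho>" "dofs_c_zero \<rho>"
    "\<And>K q. K \<in> split T ==> q \<in> Bdiv k K ==> dof_d K \<rho> q = Ld K q - dof_d K ?\<tau> q"
    by auto
  have sum: "?\<tau> + \<rho> \<in> \<Sigma>" by (rule Sigma_add[OF \<tau>'(1) \<rho>(1)])
  moreover have "A (?\<tau> + \<rho>)" by (rule A_add[OF \<tau>'(2) \<rho>(2) \<tau>'(1) \<rho>(1)])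
  moreover have "\<forall>l<CARD('n). B l (?\<tau> + \<rho>)" using B_add[OF \<tau>'(3) \<rho>(3) \<tau>'(1) \<rho>(1)] by blast
  moreover have "C (?\<tau> + \<rho>)" by (rule C_add[OF C \<rho>(4) \<tau>'(1) \<rho>(1)])
  moreover have "dof_d K (?\<tau> + \<rho>) q = Ld K q" if "K \<in> split T" "q \<in> Bdiv k K" for K q
    using dof_d_add[OF Sigma_conf[OF \<tau>'(1)] Sigma_conf[OF \<rho>(1)] Sigma_conf[OF sum] that] \<rho>(5)[OF that] by simp
  ultimately show ?thesis unfolding A_def B_def C_def by (intro bexI[of _ "?\<tau> + \<rho>"] conjI) simp_all
qed

lemma dofs_injective:
  assumes \<tau>: "\<tau> \<in> \<Sigma>" and \<sigma>: "\<sigma> \<in> \<Sigma>"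
    and a: "\<And>i q. i \<in> T ==> q \<in> VP i ==> dof_a nrm T (T - {i}) \<tau> q = dof_a nrm T (T - {i}) \<sigma> q"
    and b: "\<And>l f i j q. l < CARD('n) ==> f \<in> interior_faces l {T} ==> 1 \<le> i ==> i \<le> j ==> j \<le> CARD('n) - l ==>
      q \<in> PO l f ==> dof_b (elt f) f (nb f i) (nb f j) \<tau> q = dof_b (elt f) f (nb f i) (nb f j) \<sigma> q"
    and c: "\<And>F q. F \<in> interior_facets ==> q \<in> ND k F ==>
      dof_c nrm (elt F) F \<tau> q = dof_c nrm (elt F) F \<sigma> q"
    and d: "\<And>K q. K \<in> split T ==> q \<in> Bdiv k K ==> dof_d K \<tau> q = dof_d K \<sigma> q"
  shows "\<tau> = \<sigma>"
proof -
  let ?\<rho> = "\<tau> - \<sigma>"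
  have \<rho>: "?\<rho> \<in> \<Sigma>" using \<tau> \<sigma> unfolding Sigma_loc_def by (rule field.span_diff)
  have eq: "?\<rho> + \<sigma> = \<tau>" by simp
  note cf = Sigma_conf[OF \<rho>] Sigma_conf[OF \<sigma>]
  have "?\<rho> = 0"
  proof (rule dofs_zero_unique[OF cf(1)])
    show "dofs_a_zero ?\<rho>"
      using dof_a_add[OF cf] a unfolding eq dofs_a_zero_def by simp
    show "dofs_b_zero l ?\<rho>" if "l < CARD('n)" for l
      using dof_b_add[OF cf] b[OF that] unfolding eq dofs_b_zero_def by simp
    show "dofs_c_zero ?\<rho>"
      using dof_c_add[OF cf] c unfolding eq dofs_c_zero_def by simp
    show "dof_d K ?\<rho> q = 0" if "K \<in> split T" "q \<in> Bdiv k K" for K q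
      using dof_d_add[OF cf] Sigma_conf[OF \<tau>] d[OF that] that unfolding eq by simp
  qed
  then show ?thesis by simp
qed

end

section \<open>Triangulations\<close>

text \<open>This and \<open>matches\<close> are the premise and the requirement in
  \<open>unisolvent\<close>, separated so that data on the mesh can be restricted to one simplex and
  local solutions compared with global ones.\<close>

definition linear_data ::
  "((real^'n) set \<Rightarrow> nat \<Rightarrow> real^'n) \<Rightarrow> nat \<Rightarrow> (real^'n) set set
     \<Rightarrow> ((real^'n) set \<Rightarrow> (real^'n \<Rightarrow> real^'n) \<Rightarrow> real) \<Rightarrow> ((real^'n) set \<Rightarrow> nat \<Rightarrow> nat \<Rightarrow> (real^'n \<Rightarrow> real) \<Rightarrow> real)
     \<Rightarrow> ((real^'n) set \<Rightarrow> (real^'n \<Rightarrow> real^'n) \<Rightarrow> real) \<Rightarrow> ((real^'n) set \<Rightarrow> (real^'n \<Rightarrow> real^'n^'n) \<Rightarrow> real) \<Rightarrow> bool" where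
  "linear_data nb k M La Lb Lc Ld \<longleftrightarrow>
        (\<forall>F\<in>faces (CARD('n) - 1) M. linear_on (vec_polys_on F (int k)) (La F)) \<and>
        (\<forall>l<CARD('n). \<forall>f\<in>interior_faces l M. \<forall>i j. 1 \<le> i \<and> i \<le> j \<and> j \<le> CARD('n) - l \<longrightarrow>
           linear_on (polys_on f (int k - (int l + 1))) (Lb f i j)) \<and>
        (\<forall>F\<in>interior_faces (CARD('n) - 1) M. linear_on (ND k F) (Lc F)) \<and>
        (\<forall>K\<in>refine M. linear_on (Bdiv k K) (Ld K))"

definition matches ::
  "((real^'n) set \<Rightarrow> real^'n) \<Rightarrow> ((real^'n) set \<Rightarrow> nat \<Rightarrow> real^'n) \<Rightarrow> ((real^'n) set \<Rightarrow> (real^'n) set)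
     \<Rightarrow> nat \<Rightarrow> (real^'n) set set
     \<Rightarrow> ((real^'n) set \<Rightarrow> (real^'n \<Rightarrow> real^'n) \<Rightarrow> real) \<Rightarrow> ((real^'n) set \<Rightarrow> nat \<Rightarrow> nat \<Rightarrow> (real^'n \<Rightarrow> real) \<Rightarrow> real)
     \<Rightarrow> ((real^'n) set \<Rightarrow> (real^'n \<Rightarrow> real^'n) \<Rightarrow> real) \<Rightarrow> ((real^'n) set \<Rightarrow> (real^'n \<Rightarrow> real^'n^'n) \<Rightarrow> real)
     \<Rightarrow> 'n::finite field \<Rightarrow> bool" where
  "matches nrm nb elt k M La Lb Lc Ld \<tau> \<longleftrightarrow>
           (\<forall>T\<in>M. \<forall>F\<in>faces (CARD('n) - 1) {T}. \<forall>q\<in>vec_polys_on F (int k).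
              dof_a nrm T F \<tau> q = La F q) \<and>
           (\<forall>l<CARD('n). \<forall>f\<in>interior_faces l M. \<forall>i j. 1 \<le> i \<and> i \<le> j \<and> j \<le> CARD('n) - l \<longrightarrow>
              (\<forall>q\<in>polys_on f (int k - (int l + 1)). dof_b (elt f) f (nb f i) (nb f j) \<tau> q = Lb f i j q)) \<and>
           (\<forall>F\<in>interior_faces (CARD('n) - 1) M. \<forall>q\<in>ND k F. dof_c nrm (elt F) F \<tau> q = Lc F q) \<and>
           (\<forall>K\<in>refine M. \<forall>q\<in>Bdiv k K. dof_d K \<tau> q = Ld K q)"

lemma unisolvent_iff:
  "unisolvent nrm nb elt k M V \<longleftrightarrow> (\<forall>La Lb Lc Ld. linear_data nb k M La Lb Lc Ld \<longrightarrow>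
    (\<exists>!\<tau>. \<tau> \<in> V \<and> matches nrm nb elt k M La Lb Lc Ld \<tau>))"
  unfolding unisolvent_def linear_data_def matches_def by (rule refl)

lemma matches_a:
  assumes "matches nrm nb elt k {T :: (real^'n) set} La Lb Lc Ld \<tau>" "F \<in> faces (CARD('n) - 1) {T}" "q \<in> vec_polys_on F (int k)"
  shows "dof_a nrm T F \<tau> q = La F q"
  using assms by (simp add: matches_def del: One_nat_def)

section \<open>Unisolvence on one simplex\<close>

context local_dofs
begin

lemma dof_a_restrict: "F \<in> faces (CARD('n) - 1) {T} ==> dof_a nrm T F (restrict_field (split T) \<tau>) q = dof_a nrm T F \<tau> q"
  unfolding facet_T by (auto simp: dof_a_eq restrict_sub)

lemma elt_restrict: "l < CARD('n) ==> f \<in> interior_faces l {T} ==> restrict_field (split T) \<tau> (elt f) = \<tau> (elt f)"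
  using elt_cell[of l f] by (auto simp: restrict_field_def)

lemma matches_restrict:
  "matches nrm nb elt k {T} La Lb Lc Ld (restrict_field (split T) \<tau>) \<longleftrightarrow> matches nrm nb elt k {T} La Lb Lc Ld \<tau>"
proof -
  have c: "dof_c nrm (elt F) F (restrict_field (split T) \<tau>) q = dof_c nrm (elt F) F \<tau> q"
    if "F \<in> interior_faces (CARD('n) - 1) {T}" for F q
    using elt_restrict[OF _ that, of \<tau>] by (simp add: dof_c_def)
  have b: "dof_b (elt f) f m n (restrict_field (split T) \<tau>) q = dof_b (elt f) f m n \<tau> q"
    if "l < CARD('n)" "f \<in> interior_faces l {T}" for l f m n q
    using elt_restrict[OF that, of \<tau>] by (simp add: dof_b_def)
  have d: "dof_d K (restrict_field (split T) \<tau>) q = dof_d K \<tau> q" if "K \<in> split T" for K q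
    using that by (simp add: dof_d_def restrict_field_def)
  show ?thesis unfolding matches_def refine_T
    by (simp add: dof_a_restrict b c d del: One_nat_def)
qed

lemma unisolvent_local: "unisolvent nrm nb elt k {T} \<Sigma>"
  unfolding unisolvent_iff
proof (intro allI impI)
  fix La Lb Lc Ld assume L: "linear_data nb k {T} La Lb Lc Ld"
  have "T - {i} \<in> faces (CARD('n) - 1) {T}" if "i \<in> T" for i using that facet_T by blast
  then have La: "linear_on (VP i) (La (T - {i}))" if "i \<in> T" for i
    using L that by (simp add: linear_data_def del: One_nat_def)
  have Lb: "linear_on (PO l f) (Lb f i j)"
    if "l < CARD('n)" "f \<in> interior_faces l {T}" "1 \<le> i" "i \<le> j" "j \<le> CARD('n) - l" for l f i j
    using L that by (simp add: linear_data_def del: One_nat_def)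
  have Lc: "linear_on (ND k F) (Lc F)" if "F \<in> interior_faces (CARD('n) - 1) {T}" for F
    using L that by (simp add: linear_data_def del: One_nat_def)
  have Ld: "linear_on (Bdiv k K) (Ld K)" if "K \<in> split T" for K
    using L that by (simp add: linear_data_def refine_T del: One_nat_def)
  have iff: "matches nrm nb elt k {T} La Lb Lc Ld \<tau> \<longleftrightarrow>
    (\<forall>i\<in>T. \<forall>q\<in>VP i. dof_a nrm T (T - {i}) \<tau> q = La (T - {i}) q) \<and>
    (\<forall>l<CARD('n). \<forall>f\<in>interior_faces l {T}. \<forall>i j. 1 \<le> i \<and> i \<le> j \<and> j \<le> CARD('n) - l \<longrightarrow>
      (\<forall>q\<in>PO l f. dof_b (elt f) f (nb f i) (nb f j) \<tau> q = Lb f i j q)) \<and>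
    (\<forall>F\<in>interior_faces (CARD('n) - 1) {T}. \<forall>q\<in>ND k F. dof_c nrm (elt F) F \<tau> q = Lc F q) \<and>
    (\<forall>K\<in>split T. \<forall>q\<in>Bdiv k K. dof_d K \<tau> q = Ld K q)" for \<tau>
  proof -
    have "faces (CARD('n) - 1) {T} = (\<lambda>i. T - {i}) ` T" using facet_T by blast
    then show ?thesis unfolding matches_def refine_T by (simp del: One_nat_def)
  qed
  have "\<exists>\<tau>\<in>\<Sigma>. matches nrm nb elt k {T} La Lb Lc Ld \<tau>"
    unfolding iff by (rule attain) (intro La Lb Lc Ld; assumption)+
  then obtain \<tau> where \<tau>: "\<tau> \<in> \<Sigma>" "matches nrm nb elt k {T} La Lb Lc Ld \<tau>" by blast
  show "\<exists>!\<tau>. \<tau> \<in> \<Sigma> \<and> matches nrm nb elt k {T} La Lb Lc Ld \<tau>"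
  proof (rule ex1I[of _ \<tau>])
    show "\<tau> \<in> \<Sigma> \<and> matches nrm nb elt k {T} La Lb Lc Ld \<tau>" using \<tau> by blast
    fix \<sigma> assume \<sigma>: "\<sigma> \<in> \<Sigma> \<and> matches nrm nb elt k {T} La Lb Lc Ld \<sigma>"
    note m = \<tau>(2)[unfolded iff] \<sigma>[THEN conjunct2, unfolded iff]
    show "\<sigma> = \<tau>"
      by (rule dofs_injective) (use \<tau>(1) \<sigma> m in \<open>simp_all del: One_nat_def add: One_nat_def[symmetric]\<close>)
  qed
qed

end

text \<open>The vertices are the extreme points of the hull.\<close>

lemma affine_independent_hull_inj:
  fixes S S' :: "'a::euclidean_space set"
  assumes "\<not> affine_dependent S" "\<not> affine_dependent S'" "convex hull S = convex hull S'"
  shows "S = S'"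
  using extreme_point_of_convex_hull_affine_independent[OF assms(1)]
    extreme_point_of_convex_hull_affine_independent[OF assms(2)] assms(3) by auto

section \<open>Gluing over a conforming triangulation\<close>

locale mesh =
  fixes Th :: "(real^'n) set set"
  assumes dim2: "CARD('n) \<ge> 2"
    and cells: "\<And>T. T \<in> Th ==> cell T"
    and triang: "triangulation ((\<lambda>T. convex hull T) ` Th)"
begin

lemma split_simplex: "T \<in> Th ==> split_simplex T"
  by unfold_locales (simp_all add: cells dim2)

lemma finite_Th: "finite Th"
proof -
  have "inj_on (\<lambda>T. convex hull T) Th"
  proof (rule inj_onI)
    fix S S' assume S: "S \<in> Th" "S' \<in> Th" "convex hull S = convex hull S'"
    show "S = S'" by (rule affine_independent_hull_inj[OF _ _ S(3)]) (use cells[OF S(1)] cells[OF S(2)] in \<open>simp_all add: cell_def\<close>)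
  qed
  moreover have "finite ((\<lambda>T. convex hull T) ` Th)" using triang by (simp add: triangulation_def)
  ultimately show ?thesis by (rule finite_imageD[rotated])
qed

text \<open>The intersection is a face of both simplices, hence the hull of a subset of the vertices
  of each, and the two subsets agree as its extreme points.\<close>

lemma hull_Int:
  assumes T: "T \<in> Th" and T': "T' \<in> Th"
  shows "convex hull T \<inter> convex hull T' = convex hull (T \<inter> T')"
proof
  have ind: "\<not> affine_dependent T" "\<not> affine_dependent T'" using cells T T' by (auto simp: cell_def)
  have face: "A \<inter> B face_of A" if "A \<in> (\<lambda>T. convex hull T) ` Th" "B \<in> (\<lambda>T. convex hull T) ` Th" for A B
    using triang that unfolding triangulation_def by simp
  have f: "(convex hull T \<inter> convex hull T') face_of convex hull T" "(convex hull T \<inter> convex hull T') face_of convex hull T'"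
    using face[OF imageI[OF T] imageI[OF T']] face[OF imageI[OF T'] imageI[OF T]] by (simp_all only: Int_commute)
  obtain S where S: "S \<subseteq> T" "convex hull T \<inter> convex hull T' = convex hull S"
    using f(1) unfolding face_of_convex_hull_affine_independent[OF ind(1)] by (elim exE conjE)
  obtain S' where S': "S' \<subseteq> T'" "convex hull T \<inter> convex hull T' = convex hull S'"
    using f(2) unfolding face_of_convex_hull_affine_independent[OF ind(2)] by (elim exE conjE)
  have "S = S'"
    using affine_independent_hull_inj[OF affine_independent_subset[OF ind(1) S(1)] affine_independent_subset[OF ind(2) S'(1)]]
      S(2) S'(2) by simp
  then show "convex hull T \<inter> convex hull T' \<subseteq> convex hull (T \<inter> T')"
    using S S' by (simp add: hull_mono)
  show "convex hull (T \<inter> T') \<subseteq> convex hull T \<inter> convex hull T'" by (simp add: hull_mono)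
qed

text \<open>All coordinates of the barycenter are positive, whereas on the common face with another
  simplex the coordinate of some vertex of \<open>T\<close> is zero.\<close>

lemma barycenter_notin:
  assumes T: "T \<in> Th" and T': "T' \<in> Th" and ne: "T \<noteq> T'"
  shows "barycenter T \<notin> convex hull T'"
proof
  interpret split_simplex T by (rule split_simplex[OF T])
  assume "c \<in> convex hull T'"
  moreover have "c \<in> convex hull T" using c_interior interior_subset by blast
  ultimately have c: "c \<in> convex hull (T \<inter> T')" using hull_Int[OF T T'] by blast
  have "finite T'" "card T' = card T" using cells[OF T'] cell_finite card_T by (auto simp: cell_def)
  then have "\<not> T \<subseteq> T'" using ne card_subset_eq by metis
  then obtain v where v: "v \<in> T - (T \<inter> T')" by blast
  then have "lam v T c = 0" using c mem_convex_hull[OF cell_T, of "T \<inter> T'"] by blast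
  then show False using lam_c[of v] v by (simp add: add_nonneg_eq_0_iff)
qed

lemma split_hull: "T \<in> Th ==> K \<in> split T ==> K \<subseteq> convex hull T"
proof -
  assume T: "T \<in> Th" and K: "K \<in> split T"
  interpret split_simplex T by (rule split_simplex[OF T])
  have "c \<in> convex hull T" using c_interior interior_subset by blast
  then show ?thesis using K hull_subset[of T convex] by (auto simp: split_iff subcell_def)
qed

text \<open>The barycenter serves as a mark of the simplex from which a refined cell stems.\<close>

lemma owner_unique:
  assumes "T \<in> Th" "T' \<in> Th" "K \<in> split T'" "barycenter T \<in> K" shows "T' = T"
  using barycenter_notin[OF assms(1,2)] split_hull[OF assms(2,3)] assms(4) by blast

lemma split_barycenter: "K \<in> split T ==> barycenter T \<in> K"
  by (auto simp: split_def subcell_def)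

lemma split_disjoint: "T \<in> Th ==> T' \<in> Th ==> K \<in> split T ==> K \<in> split T' ==> T = T'"
  using owner_unique split_barycenter by metis

text \<open>A face that is interior to one simplex contains its barycenter, which lies in no other
  simplex; so it cannot be a face of the unrefined mesh elsewhere.\<close>

lemma interior_faces_Th: "interior_faces l Th = (\<Union>T\<in>Th. interior_faces l {T})"
proof (intro set_eqI iffI)
  fix f assume f: "f \<in> interior_faces l Th"
  then obtain T K where TK: "T \<in> Th" "K \<in> split T" "f \<subseteq> K" "card f = l + 1"
    by (auto simp: interior_faces_def faces_def refine_def)
  moreover have "f \<notin> faces l {T}" using f TK(1) by (auto simp: interior_faces_def faces_def)
  ultimately have "f \<in> interior_faces l {T}" by (auto simp: interior_faces_def faces_def refine_def)
  then show "f \<in> (\<Union>T\<in>Th. interior_faces l {T})" using TK(1) by blast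
next
  fix f assume "f \<in> (\<Union>T\<in>Th. interior_faces l {T})"
  then obtain T where T: "T \<in> Th" "f \<in> interior_faces l {T}" by blast
  interpret split_simplex T by (rule split_simplex[OF T(1)])
  have cf: "c \<in> f" by (rule interior_face_subset(1)[OF T(2)])
  have "f \<in> faces l (refine Th)" using T by (auto simp: interior_faces_def faces_def refine_def)
  moreover have "f \<notin> faces l Th"
  proof
    assume "f \<in> faces l Th"
    then obtain T' where T': "T' \<in> Th" "f \<subseteq> T'" by (auto simp: faces_def)
    then have "c \<in> convex hull T'" using cf hull_subset[of T' convex] by blast
    then have "T = T'" using barycenter_notin[OF T(1) T'(1)] by blast
    then show False using T'(2) cf c_notin by blast
  qed
  ultimately show "f \<in> interior_faces l Th" by (simp add: interior_faces_def)
qed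

lemma matches_Th:
  "matches nrm nb elt k Th La Lb Lc Ld \<tau> \<longleftrightarrow> (\<forall>T\<in>Th. matches nrm nb elt k {T} La Lb Lc Ld \<tau>)"
  unfolding matches_def interior_faces_Th refine_def by (simp del: One_nat_def) blast

lemma linear_data_local:
  assumes "linear_data nb k Th La Lb Lc Ld" "T \<in> Th" shows "linear_data nb k {T} La Lb Lc Ld"
proof -
  have "faces l {T} \<subseteq> faces l Th" for l using assms(2) by (auto simp: faces_def)
  moreover have "interior_faces l {T} \<subseteq> interior_faces l Th" for l using assms(2) interior_faces_Th by blast
  moreover have "refine {T} \<subseteq> refine Th" using assms(2) by (auto simp: refine_def)
  ultimately show ?thesis using assms(1) unfolding linear_data_def by (simp del: One_nat_def add: subset_eq)
qed

text \<open>Every degree of freedom belongs to some local problem, and the prescribed functional (a)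
  on a shared facet is the same for both sides. So the glued local solutions satisfy the
  single-valuedness in \<open>Sigma_glob\<close>.\<close>

lemma unisolvent_glob:
  assumes dofs: "\<And>T. T \<in> Th ==> local_dofs T nrm v0 k nb elt"
  shows "unisolvent nrm nb elt k Th (Sigma_glob nrm v0 k Th)"
  unfolding unisolvent_iff
proof (intro allI impI)
  fix La Lb Lc Ld assume L: "linear_data nb k Th La Lb Lc Ld"
  let ?m = "\<lambda>T. matches nrm nb elt k {T} La Lb Lc Ld"
  have ex1: "\<exists>!\<tau>. \<tau> \<in> Sigma_loc nrm v0 k T \<and> ?m T \<tau>" if "T \<in> Th" for T
    using local_dofs.unisolvent_local[OF dofs[OF that]] linear_data_local[OF L that] unfolding unisolvent_iff by blast
  then have "\<forall>T\<in>Th. \<exists>\<tau>. \<tau> \<in> Sigma_loc nrm v0 k T \<and> ?m T \<tau>" by blast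
  then obtain t where t: "\<And>T. T \<in> Th ==> t T \<in> Sigma_loc nrm v0 k T" "\<And>T. T \<in> Th ==> ?m T (t T)"
    by (drule_tac bchoice) blast
  have t0: "t T K = (\<lambda>x. 0)" if "T \<in> Th" "K \<notin> split T" for T K
  proof -
    interpret local_dofs T nrm v0 k nb elt by (rule dofs[OF that(1)])
    show ?thesis using Sigma_conf[OF t(1)[OF that(1)]] that(2) by (simp add: conforming_def)
  qed
  \<comment> \<open>A cell of the refinement belongs to one simplex and the other local solutions
    are zero on it, so at most one summand survives.\<close>
  define \<tau> where "\<tau> K x = (\<Sum>T\<in>Th. t T K x)" for K x
  have \<tau>T: "restrict_field (split T) \<tau> = t T" if T: "T \<in> Th" for T
  proof (intro ext)
    fix K x show "restrict_field (split T) \<tau> K x = t T K x"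
    proof (cases "K \<in> split T")
      case True
      have "t T' K x = (if T' = T then t T K x else 0)" if "T' \<in> Th" for T'
      proof (cases "T' = T")
        case False
        then have "K \<notin> split T'" using split_disjoint[OF T that True] by blast
        then show ?thesis using t0[OF that] False by simp
      qed simp
      then have "(\<Sum>T'\<in>Th. t T' K x) = (\<Sum>T'\<in>Th. if T' = T then t T K x else 0)" by (intro sum.cong refl)
      then show ?thesis using True T finite_Th by (simp add: restrict_field_def \<tau>_def)
    next
      case False
      then show ?thesis using t0[OF T] by (simp add: restrict_field_def)
    qed
  qed
  have m: "?m T \<tau> \<longleftrightarrow> ?m T (restrict_field (split T) \<tau>)" if "T \<in> Th" for T \<tau>
    using local_dofs.matches_restrict[OF dofs[OF that]] by blast
  have \<tau>m: "?m T \<tau>" if "T \<in> Th" for T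
    by (rule iffD2[OF m[OF that]]) (simp only: \<tau>T[OF that] t(2)[OF that])
  have "\<tau> \<in> Sigma_glob nrm v0 k Th"
    unfolding Sigma_glob_def
  proof (intro CollectI conjI ballI)
    show "restrict_field (refine Th) \<tau> = \<tau>"
      by (auto simp: restrict_field_def fun_eq_iff \<tau>_def refine_def t0)
    show "restrict_field (split T) \<tau> \<in> Sigma_loc nrm v0 k T" if "T \<in> Th" for T using \<tau>T t(1) that by simp
    fix T T' F q assume *: "T \<in> Th" "T' \<in> Th" "F \<in> faces (CARD('n) - 1) {T} \<inter> faces (CARD('n) - 1) {T'}"
      "q \<in> vec_polys_on F (int k)"
    have "dof_a nrm T F \<tau> q = La F q" "dof_a nrm T' F \<tau> q = La F q"
      using matches_a[OF \<tau>m[OF *(1)] _ *(4)] matches_a[OF \<tau>m[OF *(2)] _ *(4)] *(3) by auto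
    then show "dof_a nrm T F \<tau> q = dof_a nrm T' F \<tau> q" by simp
  qed
  moreover have "matches nrm nb elt k Th La Lb Lc Ld \<tau>" using matches_Th \<tau>m by blast
  moreover have "\<sigma> = \<tau>" if \<sigma>: "\<sigma> \<in> Sigma_glob nrm v0 k Th" "matches nrm nb elt k Th La Lb Lc Ld \<sigma>" for \<sigma>
  proof -
    have eq: "restrict_field (split T) \<sigma> = t T" if T: "T \<in> Th" for T
    proof -
      have "restrict_field (split T) \<sigma> \<in> Sigma_loc nrm v0 k T" using \<sigma>(1) T by (simp add: Sigma_glob_def)
      moreover have "?m T (restrict_field (split T) \<sigma>)" using m[OF T] \<sigma>(2) matches_Th T by blast
      ultimately show ?thesis using ex1[OF T] t[OF T] by blast
    qed
    have "\<sigma> K = \<tau> K" for K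
    proof (cases "K \<in> refine Th")
      case True
      then obtain T where T: "T \<in> Th" "K \<in> split T" by (auto simp: refine_def)
      have "restrict_field (split T) \<sigma> K = restrict_field (split T) \<tau> K" using eq[OF T(1)] \<tau>T[OF T(1)] by simp
      then show ?thesis using T(2) by (simp add: restrict_field_def)
    next
      case False
      have "restrict_field (refine Th) \<sigma> K = \<sigma> K" using \<sigma>(1) by (simp add: Sigma_glob_def)
      moreover have "\<tau> K = (\<lambda>x. 0)" using False t0 by (auto simp: \<tau>_def refine_def fun_eq_iff)
      ultimately show ?thesis using False by (auto simp: restrict_field_def)
    qed
    then show ?thesis by (rule ext)
  qed
  ultimately show "\<exists>!\<tau>. \<tau> \<in> Sigma_glob nrm v0 k Th \<and> matches nrm nb elt k Th La Lb Lc Ld \<tau>" by blast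
qed

end

section \<open>Conformity in H(div)\<close>

lemma integrable_lborel_lebesgue_on:
  fixes f :: "real^'n \<Rightarrow> 'b::euclidean_space"
  assumes D: "open D" and f: "integrable lborel f"
  shows "integrable (lebesgue_on D) f"
proof -
  have "integrable lborel (\<lambda>x. indicator D x *\<^sub>R f x)"
    using f D by (intro integrable_mult_indicator) auto
  then have "integrable lebesgue (\<lambda>x. indicator D x *\<^sub>R f x)"
    using integrable_completion[of "\<lambda>x. indicator D x *\<^sub>R f x" lborel] by auto
  then show ?thesis using D by (simp add: integrable_restrict_space)
qed

lemma L2_pieces:
  fixes f :: "'i \<Rightarrow> real^'n \<Rightarrow> 'b::euclidean_space"
  assumes M: "finite M" and D: "\<And>K. K \<in> M ==> open (D K)" "\<And>K. K \<in> M ==> bounded (D K)"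
    and f: "\<And>K. K \<in> M ==> continuous_on UNIV (f K)" and \<Omega>: "open \<Omega>"
  shows "L2 \<Omega> (\<lambda>x. \<Sum>K\<in>M. indicator (D K) x *\<^sub>R f K x)"
proof -
  let ?f = "\<lambda>x. \<Sum>K\<in>M. indicator (D K) x *\<^sub>R f K x"
  \<comment> \<open>The Cauchy-Schwarz bound for the squared sum; the factor is the number of
    pieces, which allows for overlaps.\<close>
  let ?g = "\<lambda>x. (\<Sum>K\<in>M. indicator (D K) x *\<^sub>R (norm (f K x))\<^sup>2) * real (card M)"
  have piece: "integrable lborel (\<lambda>x. indicator (D K) x *\<^sub>R f K x)" if "K \<in> M" for K
    by (rule integrable_indicator_open[OF f[OF that] D(1)[OF that] D(2)[OF that]])
  have "integrable lborel ?f" by (intro Bochner_Integration.integrable_sum piece)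
  then have m: "integrable (lebesgue_on \<Omega>) ?f" by (rule integrable_lborel_lebesgue_on[OF \<Omega>])
  have "integrable lborel (\<lambda>x. indicator (D K) x *\<^sub>R (norm (f K x))\<^sup>2)" if "K \<in> M" for K
    by (rule integrable_indicator_open[OF _ D(1)[OF that] D(2)[OF that]]) (intro continuous_intros f that)
  then have "integrable lborel ?g" by (intro integrable_mult_left Bochner_Integration.integrable_sum)
  then have g: "integrable (lebesgue_on \<Omega>) ?g" by (rule integrable_lborel_lebesgue_on[OF \<Omega>])
  have le: "(norm (?f x))\<^sup>2 \<le> ?g x" for x
  proof -
    have "(norm (?f x))\<^sup>2 \<le> (\<Sum>K\<in>M. norm (indicator (D K) x *\<^sub>R f K x))\<^sup>2"
      by (intro power_mono norm_sum norm_ge_zero)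
    also have "\<dots> \<le> (\<Sum>K\<in>M. (norm (indicator (D K) x *\<^sub>R f K x))\<^sup>2) * real (card M)"
      by (rule sum_squared_le_sum_of_squares)
    also have "\<dots> = ?g x"
      by (intro arg_cong2[where f = "(*)"] sum.cong refl) (simp add: indicator_def)
    finally show ?thesis .
  qed
  have "integrable (lebesgue_on \<Omega>) (\<lambda>x. (norm (?f x))\<^sup>2)"
    by (rule Bochner_Integration.integrable_bound[OF g])
      (use borel_measurable_integrable[OF m] le in \<open>auto intro!: AE_I2 order_trans[OF le]\<close>)
  then show ?thesis using borel_measurable_integrable[OF m] by (simp add: L2_def)
qed

lemma integral_pieces:
  fixes f :: "'i \<Rightarrow> real^'n \<Rightarrow> 'b::euclidean_space"
  assumes M: "finite M" and D: "\<And>K. K \<in> M ==> open (D K)" "\<And>K. K \<in> M ==> bounded (D K)" "\<And>K. K \<in> M ==> D K \<subseteq> \<Omega>"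
    and f: "\<And>K. K \<in> M ==> continuous_on UNIV (f K)" and \<Omega>: "open \<Omega>"
  shows "(LINT x|lebesgue_on \<Omega>. (\<Sum>K\<in>M. indicator (D K) x *\<^sub>R f K x)) = (\<Sum>K\<in>M. (LINT x|lebesgue_on (D K). f K x))"
proof -
  have piece: "integrable lborel (\<lambda>x. indicator (D K) x *\<^sub>R f K x)" if "K \<in> M" for K
    by (rule integrable_indicator_open[OF f[OF that] D(1)[OF that] D(2)[OF that]])
  have meas: "f K \<in> borel_measurable borel" if "K \<in> M" for K
    by (rule borel_measurable_continuous_onI[OF f[OF that]])
  have "(\<lambda>x. \<Sum>K\<in>M. indicator (D K) x *\<^sub>R f K x) \<in> borel_measurable borel"
    using borel_measurable_integrable[OF piece] by (intro borel_measurable_sum) simp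
  then have "(LINT x|lebesgue_on \<Omega>. (\<Sum>K\<in>M. indicator (D K) x *\<^sub>R f K x))
      = (LINT x|lborel. indicator \<Omega> x *\<^sub>R (\<Sum>K\<in>M. indicator (D K) x *\<^sub>R f K x))"
    by (rule integral_lebesgue_on[OF \<Omega>])
  also have "\<dots> = (LINT x|lborel. (\<Sum>K\<in>M. indicator (D K) x *\<^sub>R f K x))"
  proof (rule Bochner_Integration.integral_cong[OF refl])
    fix x
    have "indicator \<Omega> x *\<^sub>R (indicator (D K) x *\<^sub>R f K x) = indicator (D K) x *\<^sub>R f K x" if "K \<in> M" for K
      using D(3)[OF that] by (auto simp: indicator_def)
    then show "indicator \<Omega> x *\<^sub>R (\<Sum>K\<in>M. indicator (D K) x *\<^sub>R f K x) = (\<Sum>K\<in>M. indicator (D K) x *\<^sub>R f K x)"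
      unfolding scaleR_sum_right by (rule sum.cong[OF refl])
  qed
  also have "\<dots> = (\<Sum>K\<in>M. (LINT x|lborel. indicator (D K) x *\<^sub>R f K x))"
    by (rule Bochner_Integration.integral_sum) (rule piece)
  also have "\<dots> = (\<Sum>K\<in>M. (LINT x|lebesgue_on (D K). f K x))"
    by (intro sum.cong refl integral_lebesgue_on[symmetric] D(1) meas)
  finally show ?thesis .
qed

text \<open>The involution pairs the two sides of each facet. Fixed points are allowed; for them the
  hypothesis demands a zero limit on their own.\<close>

lemma tendsto_sum_involution:
  fixes b :: "nat \<Rightarrow> 'i \<Rightarrow> real"
  assumes B: "finite B" and inv: "\<And>p. p \<in> B ==> s p \<in> B" "\<And>p. p \<in> B ==> s (s p) = p"
    and lim: "\<And>p. p \<in> B ==> (\<lambda>m. b m p + b m (s p)) \<longlonglongrightarrow> 0"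
  shows "(\<lambda>m. \<Sum>p\<in>B. b m p) \<longlonglongrightarrow> 0"
proof -
  have "(\<Sum>p\<in>B. b m (s p)) = (\<Sum>p\<in>B. b m p)" for m
    by (rule sum.reindex_bij_witness[of _ s s]) (simp_all add: inv)
  then have eq: "(\<lambda>m. \<Sum>p\<in>B. b m p) = (\<lambda>m. (\<Sum>p\<in>B. b m p + b m (s p)) / 2)" by (simp add: sum.distrib)
  have "(\<lambda>m. (\<Sum>p\<in>B. b m p + b m (s p)) / 2) \<longlonglongrightarrow> (\<Sum>p\<in>B. 0) / 2"
    by (rule tendsto_divide[OF tendsto_sum[OF lim] tendsto_const]) simp_all
  then show ?thesis unfolding eq by simp
qed

lemma open_small_step:
  fixes x w :: "'a::real_normed_vector"
  assumes "open G" "x \<in> G"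
  shows "\<exists>e. 0 < e \<and> e < 1 \<and> x + e *\<^sub>R w \<in> G"
proof -
  have "((\<lambda>e. x + e *\<^sub>R w) \<longlongrightarrow> x + 0 *\<^sub>R w) (at_right 0)" by (intro tendsto_intros)
  then have "\<forall>\<^sub>F e in at_right 0. x + e *\<^sub>R w \<in> G" using assms by (auto dest: topological_tendstoD)
  moreover have "\<forall>\<^sub>F e in at_right (0::real). e \<in> {0<..<1}" by (rule eventually_at_right_real) simp
  ultimately have "\<forall>\<^sub>F e in at_right 0. x + e *\<^sub>R w \<in> G \<and> e \<in> {0<..<1}" by eventually_elim simp
  then have "\<exists>e. x + e *\<^sub>R w \<in> G \<and> e \<in> {0<..<1}" by (rule eventually_happens'[OF trivial_limit_at_right_real])
  then show ?thesis by auto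
qed

text \<open>Green's formula on each cell turns the defect of the weak divergence into minus the
  limit of the sum of all facet integrals, and the assumption \<open>facets\<close> makes this limit
  zero.\<close>

lemma weak_div_pieces:
  assumes M: "finite M" "\<And>K. K \<in> M ==> cell K" "\<And>K. K \<in> M ==> interior (convex hull K) \<subseteq> \<Omega>" and \<Omega>: "open \<Omega>"
    and \<tau>: "\<And>K. K \<in> M ==> \<tau> K \<in> sym_polys r"
    and facets: "\<And>u i. test_function \<Omega> u ==>
      (\<lambda>m. \<Sum>K\<in>M. \<Sum>v\<in>K. facet_int m v K (\<lambda>x. glam v K \<bullet> (u x *\<^sub>R \<tau> K x $ i))) \<longlonglongrightarrow> 0"
  shows "weak_div \<Omega> (field_fun M \<tau>) (\<lambda>x. \<Sum>K\<in>M. indicator (interior (convex hull K)) x *\<^sub>R row_div (\<tau> K) x)"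
  unfolding weak_div_def
proof (intro allI impI)
  fix u assume u: "test_function \<Omega> u"
  let ?D = "\<lambda>K. interior (convex hull K)"
  have u1: "cont_diff 1 u" by (rule test_function_cont_diff[OF u])
  have D: "open (?D K)" "bounded (?D K)" if "K \<in> M" for K using bounded_cell_interior[OF M(2)[OF that]] by auto
  have c\<tau>: "continuous_on UNIV (\<tau> K)" "continuous_on UNIV (row_div (\<tau> K))" if "K \<in> M" for K
    using sym_polys_continuous[OF \<tau>[OF that]] continuous_row_div[OF \<tau>[OF that]] by auto
  have cu: "continuous_on UNIV (grad u)" "continuous_on UNIV u"
    using continuous_grad[OF u1] cont_diff_continuous[OF u1] by auto
  have "(LINT x|lebesgue_on \<Omega>. field_fun M \<tau> x *v grad u x)
      = (LINT x|lebesgue_on \<Omega>. (\<Sum>K\<in>M. indicator (?D K) x *\<^sub>R (\<tau> K x *v grad u x)))"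
  proof (rule Bochner_Integration.integral_cong[OF refl])
    fix x
    have "(\<Sum>K\<in>N. A K) *v w = (\<Sum>K\<in>N. A K *v w)" for N and A :: "(real^'a) set \<Rightarrow> real^'a^'a" and w
      by (induction N rule: infinite_finite_induct) (simp_all add: matrix_vector_mult_add_rdistrib)
    then show "field_fun M \<tau> x *v grad u x = (\<Sum>K\<in>M. indicator (?D K) x *\<^sub>R (\<tau> K x *v grad u x))"
      by (simp add: field_fun_def scaleR_matrix_vector_assoc)
  qed
  also have "\<dots> = (\<Sum>K\<in>M. (LINT x|lebesgue_on (?D K). \<tau> K x *v grad u x))"
    by (rule integral_pieces[OF M(1) D M(3) continuous_matrix_mult[OF c\<tau>(1) cu(1)] \<Omega>])
  finally have A: "(LINT x|lebesgue_on \<Omega>. field_fun M \<tau> x *v grad u x)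
      = (\<Sum>K\<in>M. (LINT x|lebesgue_on (?D K). \<tau> K x *v grad u x))" .
  have "(LINT x|lebesgue_on \<Omega>. u x *\<^sub>R (\<Sum>K\<in>M. indicator (?D K) x *\<^sub>R row_div (\<tau> K) x))
      = (LINT x|lebesgue_on \<Omega>. (\<Sum>K\<in>M. indicator (?D K) x *\<^sub>R (u x *\<^sub>R row_div (\<tau> K) x)))"
    by (simp add: scaleR_sum_right mult.commute)
  also have "\<dots> = (\<Sum>K\<in>M. (LINT x|lebesgue_on (?D K). u x *\<^sub>R row_div (\<tau> K) x))"
    by (rule integral_pieces[OF M(1) D M(3) continuous_on_scaleR[OF cu(2) c\<tau>(2)] \<Omega>])
  finally have B: "(LINT x|lebesgue_on \<Omega>. u x *\<^sub>R (\<Sum>K\<in>M. indicator (?D K) x *\<^sub>R row_div (\<tau> K) x))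
      = (\<Sum>K\<in>M. (LINT x|lebesgue_on (?D K). u x *\<^sub>R row_div (\<tau> K) x))" .
  have tr: "(LINT x|lebesgue_on (?D K). \<tau> K x *v grad u x) + (LINT x|lebesgue_on (?D K). u x *\<^sub>R row_div (\<tau> K) x)
      = normal_trace (?D K) (\<tau> K) (row_div (\<tau> K)) u" if "K \<in> M" for K
    by (rule normal_trace_split(1)[OF D[OF that] c\<tau>(1)[OF that] u1 L2_continuous[OF D[OF that] c\<tau>(2)[OF that]], symmetric])
  have "(\<Sum>K\<in>M. normal_trace (?D K) (\<tau> K) (row_div (\<tau> K)) u) = 0"
  proof (rule iffD2[OF vec_eq_iff], rule allI)
    fix i
    let ?w = "\<lambda>K x. u x *\<^sub>R \<tau> K x $ i"
    have "(\<lambda>m. \<Sum>K\<in>M. \<Sum>v\<in>K. facet_int m v K (\<lambda>x. glam v K \<bullet> ?w K x)) \<longlonglongrightarrow> (\<Sum>K\<in>M. - cell_int K (pdiv (?w K)))"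
      by (intro tendsto_sum Green_limit M(2) sym_polys_row_mult[OF \<tau> u1])
    then have "(\<Sum>K\<in>M. - cell_int K (pdiv (?w K))) = 0" using facets[OF u] by (rule LIMSEQ_unique)
    moreover have "(\<Sum>K\<in>M. normal_trace (?D K) (\<tau> K) (row_div (\<tau> K)) u) $ i = (\<Sum>K\<in>M. cell_int K (pdiv (?w K)))"
      using normal_trace_cell[OF M(2) \<tau> u1] by simp
    ultimately show "(\<Sum>K\<in>M. normal_trace (?D K) (\<tau> K) (row_div (\<tau> K)) u) $ i = 0 $ i" by (simp add: sum_negf)
  qed
  then show "(LINT x|lebesgue_on \<Omega>. field_fun M \<tau> x *v grad u x)
      = - (LINT x|lebesgue_on \<Omega>. u x *\<^sub>R (\<Sum>K\<in>M. indicator (?D K) x *\<^sub>R row_div (\<tau> K) x))"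
    unfolding A B using tr by (simp add: eq_neg_iff_add_eq_0 flip: sum.distrib)
qed

lemma simplex_center:
  assumes K: "cell (K::(real^'n) set)" "f \<subseteq> K" "f \<noteq> {}"
  obtains z where "z \<in> convex hull f" "\<And>u. u \<in> f ==> lam u K z > 0"
proof -
  have fin: "finite f" using K cell_finite finite_subset by blast
  then have c: "card f > 0" using K(3) by (simp add: card_gt_0_iff)
  let ?z = "\<Sum>v\<in>f. (1 / real (card f)) *\<^sub>R v"
  have l: "lam u K ?z = (if u \<in> f then 1 / real (card f) else 0)" for u
    by (rule lam_comb'[OF K(1) _ K(2)]) (use c in simp)
  have "?z \<in> convex hull f" using mem_convex_hull[OF K(1,2)] by (simp add: l)
  then show ?thesis using that[of ?z] l c by simp
qed

section \<open>Neighbouring simplices across a facet\<close>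

context mesh
begin

lemma facet_Int:
  assumes T: "T \<in> Th" and T': "T' \<in> Th" and ne: "T \<noteq> T'" and i: "i \<in> T" "i' \<in> T'" and eq: "T - {i} = T' - {i'}"
  shows "T \<inter> T' = T - {i}" "i' \<notin> T"
proof -
  have card: "finite T" "finite T'" "card T = card T'" using cells[OF T] cells[OF T'] cell_finite by (auto simp: cell_def)
  have "\<not> T \<subseteq> T'" "\<not> T' \<subseteq> T" using card ne card_subset_eq by metis+
  then have "i \<notin> T'" "i' \<notin> T" using i eq by blast+
  then show "T \<inter> T' = T - {i}" "i' \<notin> T" using eq by blast+
qed

text \<open>Were \<open>i'\<close> on the same side as \<open>i\<close>, a small step from the
  center of the facet towards \<open>i'\<close> would lie in both simplices but off their common
  facet, against \<open>hull_Int\<close>. And \<open>i'\<close> is not in the plane of the facet,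
  since \<open>T'\<close> is nondegenerate.\<close>

lemma opposite_sides:
  assumes T: "T \<in> Th" and T': "T' \<in> Th" and ne: "T \<noteq> T'" and i: "i \<in> T" "i' \<in> T'" and eq: "T - {i} = T' - {i'}"
  shows "lam i T i' < 0"
proof -
  let ?F = "T - {i}"
  note K = cells[OF T] note K' = cells[OF T']
  have F: "?F \<subseteq> T" "?F \<subseteq> T'" using eq by auto
  have "card ?F = CARD('n)" using K i by (simp add: cell_def)
  then have ne': "?F \<noteq> {}" by force
  have "lam i T i' \<noteq> 0"
  proof
    assume "lam i T i' = 0"
    moreover have "T - ?F = {i}" using i by blast
    ultimately have "i' \<in> affine hull ?F" using mem_affine_hull[OF K F(1)] by simp
    moreover have "i' \<in> T' - ?F" using i eq by blast
    ultimately have "lam i' T' i' = 0" using mem_affine_hull[OF K' F(2)] by blast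
    then show False using lam_vertex[OF K' i(2)] by simp
  qed
  moreover have "\<not> lam i T i' > 0"
  proof
    assume pos: "lam i T i' > 0"
    obtain z where z: "z \<in> convex hull ?F" "\<And>u. u \<in> ?F ==> lam u T z > 0" using simplex_center[OF K F(1) ne'] by blast
    have "open (\<Inter>u\<in>?F. {x. 0 < lam u T x})"
      by (intro open_INT ballI open_Collect_less continuous_intros continuous_lam[OF K]) (use cell_finite[OF K] in auto)
    moreover have "z \<in> (\<Inter>u\<in>?F. {x. 0 < lam u T x})" using z(2) by simp
    ultimately obtain e where e: "0 < e" "e < 1" "z + e *\<^sub>R (i' - z) \<in> (\<Inter>u\<in>?F. {x. 0 < lam u T x})"
      using open_small_step by blast
    let ?y = "z + e *\<^sub>R (i' - z)"
    have zi: "lam i T z = 0" using mem_convex_hull[OF K F(1)] z(1) i by blast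
    have "lam i T ?y - lam i T z = e * (lam i T i' - lam i T z)"
      using lam_diff[OF K, of i ?y z] lam_diff[OF K, of i i' z] by simp
    then have yi: "lam i T ?y > 0" using zi pos e by simp
    have "lam u T ?y \<ge> 0" if "u \<in> T" for u using e(3) yi that by (cases "u = i") (auto intro: less_imp_le)
    then have "?y \<in> convex hull T" using mem_cell_hull[OF K] by blast
    moreover have "?y \<in> convex hull T'"
    proof -
      have "z \<in> convex hull T'" using z(1) hull_mono[OF F(2)] by blast
      moreover have "i' \<in> convex hull T'" by (rule hull_inc[OF i(2)])
      ultimately have "(1 - e) *\<^sub>R z + e *\<^sub>R i' \<in> convex hull T'"
        using e by (intro convexD_alt[OF convex_convex_hull]) auto
      then show ?thesis by (simp add: algebra_simps)
    qed
    ultimately have "?y \<in> convex hull ?F" using hull_Int[OF T T'] facet_Int(1)[OF T T' ne i eq] by auto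
    then have "lam i T ?y = 0" using mem_convex_hull[OF K F(1)] i by blast
    then show False using yi by simp
  qed
  ultimately show ?thesis by linarith
qed

text \<open>The coordinates of \<open>i\<close> and \<open>i'\<close> both vanish on the shared
  facet, so one is a negative multiple of the other. A third simplex opposite to both would
  contradict the signs.\<close>

lemma neighbour_unique:
  assumes "T \<in> Th" "T' \<in> Th" "T'' \<in> Th" "T \<noteq> T'" "T \<noteq> T''" "i \<in> T" "i' \<in> T'" "i'' \<in> T''"
    "T - {i} = T' - {i'}" "T - {i} = T'' - {i''}"
  shows "T' = T''"
proof (rule ccontr)
  assume ne: "T' \<noteq> T''"
  note K = cells[OF assms(1)] note K' = cells[OF assms(2)]
  have neg: "lam i T i' < 0" "lam i T i'' < 0" "lam i' T' i'' < 0"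
    using opposite_sides[OF assms(1,2,4,6,7,9)] opposite_sides[OF assms(1,3,5,6,8,10)]
      opposite_sides[OF assms(2,3) ne assms(7,8) trans[OF assms(9)[symmetric] assms(10)]] by auto
  have "lam i' T' = (\<lambda>x. (1 / lam i T i') * lam i T x)"
  proof (rule lam_eqI[OF K' polys_scale[OF lam_polys[OF K]]])
    fix w assume w: "w \<in> T'"
    then have "w \<noteq> i' ==> w \<in> T \<and> w \<noteq> i" using assms(9) by blast
    then show "(1 / lam i T i') * lam i T w = (if w = i' then 1 else 0)" using lam_vertex[OF K, of w i] neg(1) by auto
  qed
  then have "lam i' T' i'' = (1 / lam i T i') * lam i T i''" by simp
  then show False using neg by (simp add: divide_less_0_iff)
qed

end

section \<open>Boundary facets of the domain and cancellation across the others\<close>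

locale mesh_space = mesh Th for Th :: "(real^'n) set set" +
  fixes \<Omega> :: "(real^'n) set" and nrm v0 k nb elt
  assumes regular: "interior (closure \<Omega>) = \<Omega>" and cover: "closure \<Omega> = (\<Union>T\<in>Th. convex hull T)"
    and dofs: "\<And>T. T \<in> Th ==> local_dofs T nrm v0 k nb elt"
begin

lemma open_\<Omega>: "open \<Omega>"
  using open_interior regular by metis

text \<open>From such a point a small step away from \<open>i\<close> leaves \<open>T\<close> but
  stays in the domain. So another simplex contains the point, and positivity of the coordinates
  forces it to contain every vertex of the facet.\<close>

lemma boundary_facet:
  assumes T: "T \<in> Th" and i: "i \<in> T" and x: "x \<in> convex hull (T - {i})" "x \<in> \<Omega>" and pos: "\<And>u. u \<in> T - {i} ==> lam u T x > 0"
  shows "\<exists>T'\<in>Th. \<exists>i'\<in>T'. T \<noteq> T' \<and> T - {i} = T' - {i'}"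
proof -
  note K = cells[OF T]
  let ?C = "\<Union>T'\<in>Th - {T}. convex hull T'"
  have C: "closed ?C"
    using finite_Th compact_cell[OF cells] by (intro closed_UN compact_imp_closed) auto
  have xi: "lam i T x = 0" using mem_convex_hull[OF K, of "T - {i}"] x(1) i by blast
  have "x \<in> ?C"
  proof (rule ccontr)
    assume "x \<notin> ?C"
    then have xG: "x \<in> \<Omega> - ?C" using x(2) by simp
    obtain e where e: "0 < e" "e < 1" "x + e *\<^sub>R (x - i) \<in> \<Omega> - ?C"
      using open_small_step[OF open_Diff[OF open_\<Omega> C] xG, of "x - i"] by (elim exE conjE)
    let ?y = "x + e *\<^sub>R (x - i)"
    have "lam i T ?y - lam i T x = e * (lam i T x - lam i T i)"
      using lam_diff[OF K, of i ?y x] lam_diff[OF K, of i x i] by simp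
    then have "lam i T ?y < 0" using xi lam_vertex[OF K i] e by simp
    then have "?y \<notin> convex hull T" using mem_cell_hull[OF K] i by force
    moreover have "?y \<in> closure \<Omega>" using e(3) closure_subset by blast
    ultimately show False using e(3) cover by blast
  qed
  then obtain T' where T': "T' \<in> Th" "T' \<noteq> T" "x \<in> convex hull T'" by blast
  have "x \<in> convex hull T" using x(1) hull_mono[of "T - {i}" T] by blast
  then have "x \<in> convex hull (T \<inter> T')" using T' hull_Int[OF T T'(1)] by blast
  then have "\<forall>u\<in>T - (T \<inter> T'). lam u T x = 0" unfolding mem_convex_hull[OF K Int_lower1] by (rule conjunct1)
  then have z: "lam u T x = 0" if "u \<in> T - (T \<inter> T')" for u using that by (rule bspec)
  have sub: "T - {i} \<subseteq> T'"
  proof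
    fix u assume u: "u \<in> T - {i}"
    then show "u \<in> T'" using z[of u] pos[OF u] by force
  qed
  have "card (T' - (T - {i})) = 1"
    using sub K cells[OF T'(1)] i cell_finite[OF K] by (simp add: cell_def card_Diff_subset finite_subset)
  then obtain i' where i': "T' - (T - {i}) = {i'}" by (auto simp: card_1_singleton_iff)
  then have "i' \<in> T'" "T - {i} = T' - {i'}" using sub by blast+
  then show ?thesis using T'(1,2) by blast
qed

text \<open>If \<open>u\<close> did not vanish at \<open>x\<close>, it would not vanish at a nearby
  relatively interior point of the facet. That point would lie in the domain, and
  \<open>boundary_facet\<close> would give the facet a second simplex.\<close>

lemma test_function_boundary:
  assumes T: "T \<in> Th" and i: "i \<in> T" and x: "x \<in> convex hull (T - {i})" and u: "test_function \<Omega> u"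
    and no: "\<And>T' i'. T' \<in> Th ==> i' \<in> T' ==> T \<noteq> T' ==> T - {i} = T' - {i'} ==> False"
  shows "u x = 0"
proof (rule ccontr)
  assume ux: "u x \<noteq> 0"
  note K = cells[OF T]
  let ?F = "T - {i}"
  have "?F \<noteq> {}" using x by force
  then obtain z where z: "z \<in> convex hull ?F" "\<And>v. v \<in> ?F ==> lam v T z > 0"
    using simplex_center[OF K, of ?F] by blast
  have "open {y. u y \<noteq> 0}"
    by (intro open_Collect_neq continuous_intros cont_diff_continuous[OF test_function_cont_diff[OF u, of 1]])
  then obtain e where e: "0 < e" "e < 1" "u (x + e *\<^sub>R (z - x)) \<noteq> 0"
    using open_small_step[of "{y. u y \<noteq> 0}" x "z - x"] ux by auto
  let ?y = "x + e *\<^sub>R (z - x)"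
  have ly: "lam v T ?y = (1 - e) * lam v T x + e * lam v T z" for v
  proof -
    have "lam v T ?y - lam v T x = e * (lam v T z - lam v T x)"
      using lam_diff[OF K, of v ?y x] lam_diff[OF K, of v z x] by simp
    then show ?thesis unfolding left_diff_distrib right_diff_distrib by linarith
  qed
  have lx: "lam v T x \<ge> 0" if "v \<in> ?F" for v using x mem_convex_hull[OF K, of ?F] that by blast
  have "(1 - e) *\<^sub>R x + e *\<^sub>R z \<in> convex hull ?F"
    using e x z(1) by (intro convexD_alt[OF convex_convex_hull]) auto
  then have y: "?y \<in> convex hull ?F" by (simp add: algebra_simps)
  have y\<Omega>: "?y \<in> \<Omega>" using test_function_zero[OF u, of ?y] e(3) by argo
  have ypos: "lam v T ?y > 0" if "v \<in> ?F" for v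
    unfolding ly using lx[OF that] z(2)[OF that] e by (intro add_nonneg_pos mult_nonneg_nonneg mult_pos_pos) auto
  have "\<exists>T'\<in>Th. \<exists>i'\<in>T'. T \<noteq> T' \<and> ?F = T' - {i'}" by (rule boundary_facet[OF T i y y\<Omega> ypos])
  then show False by (elim bexE conjE) (rule no)
qed

context
  fixes \<tau> assumes \<tau>: "\<tau> \<in> Sigma_glob nrm v0 k Th"
begin

lemma restrict_conforming: "T \<in> Th ==> local_space.conforming T k (restrict_field (split T) \<tau>)"
proof -
  assume T: "T \<in> Th"
  interpret local_dofs T nrm v0 k nb elt by (rule dofs[OF T])
  show ?thesis using Sigma_conf[of "restrict_field (split T) \<tau>"] \<tau> T by (simp add: Sigma_glob_def)
qed

lemma cell_sym_polys:
  assumes "T \<in> Th" "i \<in> T" shows "\<tau> (subcell T i) \<in> sym_polys (int k)"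
proof -
  interpret local_dofs T nrm v0 k nb elt by (rule dofs[OF assms(1)])
  show ?thesis
    using conforming_sym_polys[OF restrict_conforming[OF assms(1)] assms(2)] assms(2)
    by (simp add: restrict_field_def split_def)
qed

lemma interior_pair:
  assumes T: "T \<in> Th" and ij: "i \<in> T" "j \<in> T" "i \<noteq> j" and u: "cont_diff 1 u"
  shows "(\<lambda>m. facet_int m j (subcell T i) (\<lambda>x. glam j (subcell T i) \<bullet> (u x *\<^sub>R \<tau> (subcell T i) x $ p))
    + facet_int m i (subcell T j) (\<lambda>x. glam i (subcell T j) \<bullet> (u x *\<^sub>R \<tau> (subcell T j) x $ p))) \<longlonglongrightarrow> 0"
proof -
  interpret local_dofs T nrm v0 k nb elt by (rule dofs[OF T])
  let ?F = "sub i - {j}"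
  have e: "insert j ?F = sub i" "insert i ?F = sub j" "j \<notin> ?F" "i \<notin> ?F"
    using ij c_notin facet_sub_commute[OF ij(1,2)] by (auto simp: subcell_def)
  have cw: "continuous_on UNIV (\<lambda>x. u x *\<^sub>R \<tau> (sub i) x $ p)" if "i \<in> T" for i
    by (intro continuous_intros cont_diff_continuous[OF u] sym_polys_continuous[OF cell_sym_polys[OF T that]])
  have neg: "lam j (sub i) i < 0"
    using lam_sub[OF ij(1,2) ij(3)[symmetric]] lam_vertex[OF cell_T ij(1)] ij by simp
  have eq: "glam j (sub i) \<bullet> (u x *\<^sub>R \<tau> (sub i) x $ p) = glam j (sub i) \<bullet> (u x *\<^sub>R \<tau> (sub j) x $ p)"
    if x: "x \<in> convex hull ?F" for x
  proof -
    have "restrict_field (split T) \<tau> (sub i) x *v (g i - g j) = restrict_field (split T) \<tau> (sub j) x *v (g i - g j)"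
      by (rule normal_continuousD[OF _ ij x]) (use restrict_conforming[OF T] in \<open>simp add: conforming_def\<close>)
    then have "\<tau> (sub i) x *v (g j - g i) = \<tau> (sub j) x *v (g j - g i)"
      using ij by (simp add: restrict_sub matrix_vector_mult_diff_distrib algebra_simps)
    then show ?thesis using glam_sub[OF ij(1,2) ij(3)[symmetric]] by (simp add: row_inner)
  qed
  show ?thesis
    using facet_int_opposite[of j ?F i "\<lambda>x. u x *\<^sub>R \<tau> (sub i) x $ p" "\<lambda>x. u x *\<^sub>R \<tau> (sub j) x $ p"]
      cell_sub[OF ij(1)] cell_sub[OF ij(2)] e(3,4) neg cw[OF ij(1)] cw[OF ij(2)] eq
    unfolding e(1,2) by blast
qed

text \<open>The difference of the two traces is a polynomial of degree at most \<open>k\<close> on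
  the facet, so it is itself a test function for (a).\<close>

lemma trace_single_valued:
  assumes T: "T \<in> Th" and T': "T' \<in> Th" and i: "i \<in> T" "i' \<in> T'" and eq: "T - {i} = T' - {i'}" and x: "x \<in> convex hull (T - {i})"
  shows "\<tau> (subcell T i) x *v nrm (T - {i}) = \<tau> (subcell T' i') x *v nrm (T - {i})"
proof -
  interpret local_dofs T nrm v0 k nb elt by (rule dofs[OF T])
  interpret T': local_dofs T' nrm v0 k nb elt by (rule dofs[OF T'])
  let ?F = "T - {i}"
  let ?h = "\<lambda>x. \<tau> (subcell T i) x *v nrm ?F" and ?h' = "\<lambda>x. \<tau> (subcell T' i') x *v nrm ?F"
  let ?d = "\<lambda>x. 1 *\<^sub>R ?h x + (- 1) *\<^sub>R ?h' x"
  have F: "finite ?F" "?F \<noteq> {}" using facet_finite i by auto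
  have vp: "?h \<in> vec_polys (int k)" "?h' \<in> vec_polys (int k)"
    using matrix_mult_vec_polys cell_sym_polys[OF T i(1)] cell_sym_polys[OF T' i(2)] by auto
  have d: "?d \<in> vec_polys (int k)" by (rule vec_polys_comb[OF vp])
  then have q: "on_simplex ?F ?d \<in> vec_polys_on ?F (int k)" by (simp add: vec_polys_on_def)
  have "?F \<in> faces (CARD('n) - 1) {T} \<inter> faces (CARD('n) - 1) {T'}"
    using facet_T T'.facet_T i eq by blast
  then have Fmem: "?F \<in> faces (CARD('n) - 1) {T} \<inter> faces (CARD('n) - 1) {T'}" .
  have "\<forall>T\<in>Th. \<forall>T'\<in>Th. \<forall>F\<in>faces (CARD('n) - 1) {T} \<inter> faces (CARD('n) - 1) {T'}.
      \<forall>q\<in>vec_polys_on F (int k). dof_a nrm T F \<tau> q = dof_a nrm T' F \<tau> q"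
    using \<tau> unfolding Sigma_glob_def mem_Collect_eq by (elim conjE)
  then have "dof_a nrm T ?F \<tau> (on_simplex ?F ?d) = dof_a nrm T' ?F \<tau> (on_simplex ?F ?d)"
    by (drule_tac bspec[OF _ T], drule_tac bspec[OF _ T'], drule_tac bspec[OF _ Fmem], drule_tac bspec[OF _ q])
  moreover have "insert (barycenter T') ?F = subcell T' i'" by (simp add: subcell_def eq)
  moreover have "insert (barycenter T) ?F = subcell T i" by (simp add: subcell_def)
  ultimately have "surface_integral ?F (\<lambda>x. ?h x \<bullet> on_simplex ?F ?d x) = surface_integral ?F (\<lambda>x. ?h' x \<bullet> on_simplex ?F ?d x)"
    by (simp add: dof_a_def)
  moreover have "surface_integral ?F (\<lambda>x. ?d x \<bullet> on_simplex ?F ?d x)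
      = 1 * surface_integral ?F (\<lambda>x. ?h x \<bullet> on_simplex ?F ?d x) + (- 1) * surface_integral ?F (\<lambda>x. ?h' x \<bullet> on_simplex ?F ?d x)"
    by (rule pairing_left[OF F vec_polys_continuous[OF vp(1)] vec_polys_continuous[OF vp(2)] continuous_vec_polys_on[OF q]])
  moreover have "surface_integral ?F (\<lambda>x. ?d x \<bullet> on_simplex ?F ?d x) = surface_integral ?F (\<lambda>x. ?d x \<bullet> ?d x)"
    by (rule surface_integral_cong) (simp add: on_simplex_apply)
  ultimately have 0: "surface_integral ?F (\<lambda>x. ?d x \<bullet> ?d x) = 0" by linarith
  have "?d x \<bullet> ?d x = 0"
    by (rule surface_integral_definite[OF F _ _ 0 x]) (intro continuous_intros vec_polys_continuous[OF vp(1)] vec_polys_continuous[OF vp(2)], simp)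
  then show ?thesis by simp
qed

lemma boundary_pair:
  assumes T: "T \<in> Th" and T': "T' \<in> Th" and ne: "T \<noteq> T'" and i: "i \<in> T" "i' \<in> T'" and eq: "T - {i} = T' - {i'}"
    and u: "cont_diff 1 u"
  shows "(\<lambda>m. facet_int m (barycenter T) (subcell T i) (\<lambda>x. glam (barycenter T) (subcell T i) \<bullet> (u x *\<^sub>R \<tau> (subcell T i) x $ p))
    + facet_int m (barycenter T') (subcell T' i') (\<lambda>x. glam (barycenter T') (subcell T' i') \<bullet> (u x *\<^sub>R \<tau> (subcell T' i') x $ p))) \<longlonglongrightarrow> 0"
proof -
  interpret local_dofs T nrm v0 k nb elt by (rule dofs[OF T])
  interpret T': local_dofs T' nrm v0 k nb elt by (rule dofs[OF T'])
  let ?F = "T - {i}"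
  have e: "insert c ?F = sub i" "insert T'.c ?F = T'.sub i'" "c \<notin> ?F" "T'.c \<notin> ?F"
    using c_notin T'.c_notin eq by (auto simp: subcell_def)
  have cw: "continuous_on UNIV (\<lambda>x. u x *\<^sub>R \<tau> (subcell S j) x $ p)" if "S \<in> Th" "j \<in> S" for S j
    by (intro continuous_intros cont_diff_continuous[OF u] sym_polys_continuous[OF cell_sym_polys[OF that]])
  \<comment> \<open>Of the vertices of \<open>T'\<close> only \<open>i'\<close> lies off the plane
    of the facet, so the coordinate at the barycenter has the sign of that at
    \<open>i'\<close>.\<close>
  have neg: "lam c (sub i) T'.c < 0"
  proof -
    have cT: "card T' \<noteq> 0" using T'.card_T by simp
    have "lam i T v = 0" if "v \<in> T' - {i'}" for v
    proof -
      have "v \<in> T - {i}" using that unfolding eq .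
      then show ?thesis using lam_vertex[OF cell_T, of v i] by simp
    qed
    then have s: "(\<Sum>v\<in>T'. lam i T v) = lam i T i'" using T'.finite_T i(2) by (simp add: sum.remove)
    have "T'.c = (\<Sum>v\<in>T'. (1 / real (card T')) *\<^sub>R v)" by (simp add: barycenter_def scaleR_sum_right)
    then have "lam i T T'.c = (\<Sum>v\<in>T'. (1 / real (card T')) * lam i T v)"
      using lam_comb[OF cell_T, of "\<lambda>_. 1 / real (card T')" T' i] cT by simp
    also have "\<dots> = (1 / real (card T')) * lam i T i'" unfolding s[symmetric] by (rule sum_distrib_left[symmetric])
    finally have "lam i T T'.c < 0" using opposite_sides[OF T T' ne i eq] cT by (simp add: divide_less_0_iff)
    then show ?thesis by (simp add: lam_sub_c[OF i(1)] mult_less_0_iff)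
  qed
  have tr: "glam c (sub i) \<bullet> (u x *\<^sub>R \<tau> (sub i) x $ p) = glam c (sub i) \<bullet> (u x *\<^sub>R \<tau> (T'.sub i') x $ p)"
    if x: "x \<in> convex hull ?F" for x
  proof -
    obtain s where s: "s \<noteq> 0" "nrm ?F = s *\<^sub>R g i" using nrm_boundary[OF i(1)] .
    have "\<tau> (sub i) x *v g i = \<tau> (T'.sub i') x *v g i"
      using trace_single_valued[OF T T' i eq x] s by (simp add: matrix_vector_mult_scaleR)
    then show ?thesis by (simp add: glam_sub_c[OF i(1)] row_inner matrix_vector_mult_scaleR)
  qed
  show ?thesis
    using facet_int_opposite[of c ?F T'.c "\<lambda>x. u x *\<^sub>R \<tau> (sub i) x $ p" "\<lambda>x. u x *\<^sub>R \<tau> (T'.sub i') x $ p"]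
      cell_sub[OF i(1)] T'.cell_sub[OF i(2)] e(3,4) neg cw[OF T i(1)] cw[OF T' i(2)] tr
    unfolding e(1,2) by blast
qed

end

end

context mesh_space
begin

lemma sum_refine: "(\<Sum>K\<in>refine Th. h K) = (\<Sum>T\<in>Th. \<Sum>i\<in>T. h (subcell T i))" for h :: "(real^'n) set \<Rightarrow> real"
proof -
  have "(\<Sum>K\<in>refine Th. h K) = (\<Sum>T\<in>Th. \<Sum>K\<in>split T. h K)"
    unfolding refine_def
  proof (rule sum.UNION_disjoint[OF finite_Th])
    show "\<forall>T\<in>Th. finite (split T)" using cells cell_finite by (auto simp: split_def)
    show "\<forall>T\<in>Th. \<forall>T'\<in>Th. T \<noteq> T' \<longrightarrow> split T \<inter> split T' = {}" using split_disjoint by blast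
  qed
  also have "\<dots> = (\<Sum>T\<in>Th. \<Sum>i\<in>T. h (subcell T i))"
  proof (rule sum.cong[OF refl])
    fix T assume "T \<in> Th"
    then interpret split_simplex T by (rule split_simplex)
    have "inj_on (subcell T) T" by (rule inj_onI) (simp add: sub_inj)
    then show "(\<Sum>K\<in>split T. h K) = (\<Sum>i\<in>T. h (subcell T i))" unfolding split_def by (simp add: sum.reindex)
  qed
  finally show ?thesis .
qed

text \<open>A side of a facet is addressed by a simplex together with its vertex opposite to the
  facet.\<close>

definition neighbour :: "(real^'n) set \<times> (real^'n) \<Rightarrow> (real^'n) set \<times> (real^'n) \<Rightarrow> bool" where
  "neighbour p q \<longleftrightarrow> fst p \<in> Th \<and> snd p \<in> fst p \<and> fst q \<in> Th \<and> snd q \<in> fst q \<and> fst p \<noteq> fst q \<and>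
    fst p - {snd p} = fst q - {snd q}"

lemma neighbour_sym: "neighbour p q ==> neighbour q p"
  unfolding neighbour_def by auto

lemma neighbour_eq:
  assumes "neighbour p q" "neighbour p r" shows "q = r"
proof -
  have "fst q = fst r"
    using neighbour_unique[of "fst p" "fst q" "fst r" "snd p" "snd q" "snd r"] assms by (simp add: neighbour_def)
  moreover from this have "fst q - {snd q} = fst q - {snd r}" "snd q \<in> fst q" "snd r \<in> fst q"
    using assms by (auto simp: neighbour_def)
  then have "snd q = snd r" by blast
  ultimately show ?thesis by (rule prod_eqI)
qed

text \<open>Facets inside a simplex are paired by exchanging the two vertices, facets of the mesh by
  the neighbour relation. A side without neighbour is its own partner, and there \<open>u\<close>
  vanishes.\<close>

lemma facet_sum_tendsto:
  assumes \<tau>: "\<tau> \<in> Sigma_glob nrm v0 k Th" and u: "test_function \<Omega> u"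
  shows "(\<lambda>m. \<Sum>K\<in>refine Th. \<Sum>v\<in>K. facet_int m v K (\<lambda>x. glam v K \<bullet> (u x *\<^sub>R \<tau> K x $ p))) \<longlonglongrightarrow> 0"
proof -
  define X where "X m K v = facet_int m v K (\<lambda>x. glam v K \<bullet> (u x *\<^sub>R \<tau> K x $ p))" for m K v
  have u1: "cont_diff 1 u" by (rule test_function_cont_diff[OF u])
  have split_sum: "(\<Sum>v\<in>subcell T i. X m (subcell T i) v)
      = X m (subcell T i) (barycenter T) + (\<Sum>j\<in>T - {i}. X m (subcell T i) j)" if "T \<in> Th" "i \<in> T" for m T i
  proof -
    interpret split_simplex T by (rule split_simplex[OF that(1)])
    have "c \<notin> T - {i}" "finite (T - {i})" using c_notin finite_T by auto
    then show ?thesis unfolding subcell_def by simp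
  qed
  have int: "(\<lambda>m. \<Sum>i\<in>T. \<Sum>j\<in>T - {i}. X m (subcell T i) j) \<longlonglongrightarrow> 0" if T: "T \<in> Th" for T
  proof -
    let ?B = "SIGMA i:T. T - {i}"
    have fin: "finite T" using cells[OF T] cell_finite by blast
    have "(\<lambda>m. \<Sum>q\<in>?B. X m (subcell T (fst q)) (snd q)) \<longlonglongrightarrow> 0"
    proof (rule tendsto_sum_involution[of _ prod.swap])
      show "finite ?B" using fin by auto
      fix q assume "q \<in> ?B"
      then obtain i j where q: "q = (i, j)" "i \<in> T" "j \<in> T" "i \<noteq> j" by auto
      then show "prod.swap q \<in> ?B" "prod.swap (prod.swap q) = q" by auto
      show "(\<lambda>m. X m (subcell T (fst q)) (snd q) + X m (subcell T (fst (prod.swap q))) (snd (prod.swap q))) \<longlonglongrightarrow> 0"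
        unfolding q(1) swap_simp fst_conv snd_conv X_def by (rule interior_pair[OF \<tau> T q(2-4) u1])
    qed
    moreover have "(\<Sum>i\<in>T. \<Sum>j\<in>T - {i}. X m (subcell T i) j) = (\<Sum>q\<in>?B. X m (subcell T (fst q)) (snd q))" for m
      using fin by (simp add: sum.Sigma split_beta)
    ultimately show ?thesis by simp
  qed
  have bd: "(\<lambda>m. \<Sum>T\<in>Th. \<Sum>i\<in>T. X m (subcell T i) (barycenter T)) \<longlonglongrightarrow> 0"
  proof -
    let ?B = "SIGMA T:Th. T"
    \<comment> \<open>There is at most one neighbour by \<open>neighbour_eq\<close>, so the
      description is well defined, and the map is an involution because the relation is
      symmetric.\<close>
    let ?s = "\<lambda>q. if \<exists>r. neighbour q r then THE r. neighbour q r else q"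
    let ?Y = "\<lambda>m q. X m (subcell (fst q) (snd q)) (barycenter (fst q))"
    have fin: "finite T" if "T \<in> Th" for T using cells[OF that] cell_finite by blast
    have s: "?s q = r" if "neighbour q r" for q r
    proof -
      have "(THE r. neighbour q r) = r" by (rule the_equality) (use that neighbour_eq in auto)
      moreover have "\<exists>r. neighbour q r" using that by (rule exI)
      ultimately show ?thesis by (simp only: if_True)
    qed
    have "(\<lambda>m. \<Sum>q\<in>?B. ?Y m q) \<longlonglongrightarrow> 0"
    proof (rule tendsto_sum_involution[of _ ?s])
      show "finite ?B" using finite_Th fin by auto
      fix q assume q: "q \<in> ?B"
      have "?s q \<in> ?B \<and> ?s (?s q) = q \<and> (\<lambda>m. ?Y m q + ?Y m (?s q)) \<longlonglongrightarrow> 0"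
      proof (cases "\<exists>r. neighbour q r")
        case True
        then obtain r where r: "neighbour q r" by blast
        have "r \<in> ?B" using r by (cases r) (auto simp: neighbour_def)
        moreover have "(\<lambda>m. ?Y m q + ?Y m r) \<longlonglongrightarrow> 0"
          unfolding X_def using r unfolding neighbour_def by (intro boundary_pair[OF \<tau> _ _ _ _ _ _ u1]) simp_all
        ultimately show ?thesis unfolding s[OF r] s[OF neighbour_sym[OF r]] by simp
      next
        case False
        obtain T i where Ti: "q = (T, i)" "T \<in> Th" "i \<in> T" using q by auto
        interpret split_simplex T by (rule split_simplex[OF Ti(2)])
        have u0: "u x = 0" if "x \<in> convex hull (T - {i})" for x
        proof (rule test_function_boundary[OF Ti(2,3) that u])
          fix T' i' assume "T' \<in> Th" "i' \<in> T'" "T \<noteq> T'" "T - {i} = T' - {i'}"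
          then have "neighbour q (T', i')" using Ti by (simp add: neighbour_def)
          then show False using False by blast
        qed
        have eq: "sub i - {c} = T - {i}" and ci: "c \<in> sub i" using c_notin by (auto simp: subcell_def)
        have "continuous_on UNIV (\<lambda>x. glam c (sub i) \<bullet> (u x *\<^sub>R \<tau> (sub i) x $ p))"
          by (intro continuous_intros cont_diff_continuous[OF u1] sym_polys_continuous[OF cell_sym_polys[OF \<tau> Ti(2,3)]])
        then have "(\<lambda>m. X m (sub i) c) \<longlonglongrightarrow> 0"
          unfolding X_def by (rule facet_int_vanish[OF cell_sub[OF Ti(3)] ci]) (simp add: eq u0)
        then have "(\<lambda>m. X m (sub i) c + X m (sub i) c) \<longlonglongrightarrow> 0 + 0" by (intro tendsto_add)
        then have "(\<lambda>m. ?Y m q + ?Y m q) \<longlonglongrightarrow> 0" by (simp add: Ti(1))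
        moreover have sq: "?s q = q" using False by simp
        ultimately show ?thesis unfolding sq using q by (intro conjI) simp_all
      qed
      then show "?s q \<in> ?B" "?s (?s q) = q" "(\<lambda>m. ?Y m q + ?Y m (?s q)) \<longlonglongrightarrow> 0" by blast+
    qed
    moreover have "(\<Sum>T\<in>Th. \<Sum>i\<in>T. X m (subcell T i) (barycenter T)) = (\<Sum>q\<in>?B. ?Y m q)" for m
      using finite_Th fin by (simp add: sum.Sigma split_beta)
    ultimately show ?thesis by simp
  qed
  have "(\<Sum>K\<in>refine Th. \<Sum>v\<in>K. X m K v)
      = (\<Sum>T\<in>Th. \<Sum>i\<in>T. X m (subcell T i) (barycenter T)) + (\<Sum>T\<in>Th. \<Sum>i\<in>T. \<Sum>j\<in>T - {i}. X m (subcell T i) j)" for m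
  proof -
    have "(\<Sum>K\<in>refine Th. \<Sum>v\<in>K. X m K v)
        = (\<Sum>T\<in>Th. \<Sum>i\<in>T. X m (subcell T i) (barycenter T) + (\<Sum>j\<in>T - {i}. X m (subcell T i) j))"
      unfolding sum_refine by (intro sum.cong refl split_sum)
    then show ?thesis by (simp add: sum.distrib)
  qed
  moreover have "(\<lambda>m. (\<Sum>T\<in>Th. \<Sum>i\<in>T. X m (subcell T i) (barycenter T))
      + (\<Sum>T\<in>Th. \<Sum>i\<in>T. \<Sum>j\<in>T - {i}. X m (subcell T i) j)) \<longlonglongrightarrow> 0 + (\<Sum>T\<in>Th. 0)"
    by (intro tendsto_add bd tendsto_sum int)
  ultimately show ?thesis unfolding X_def[symmetric] by simp
qed

lemma Sigma_glob_Hdiv: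
  assumes \<tau>: "\<tau> \<in> Sigma_glob nrm v0 k Th"
  shows "field_fun (refine Th) \<tau> \<in> Hdiv \<Omega>"
proof -
  let ?M = "refine Th"
  let ?g = "\<lambda>x. \<Sum>K\<in>?M. indicator (interior (convex hull K)) x *\<^sub>R row_div (\<tau> K) x"
  have M: "\<exists>T\<in>Th. \<exists>i\<in>T. K = subcell T i" if "K \<in> ?M" for K using that by (auto simp: refine_def split_def)
  have fin: "finite ?M" using finite_Th cells cell_finite by (auto simp: refine_def split_def)
  have cell: "cell K" if K: "K \<in> ?M" for K
  proof -
    obtain T i where T: "T \<in> Th" "i \<in> T" "K = subcell T i" using M[OF K] by blast
    interpret split_simplex T by (rule split_simplex[OF T(1)])
    show ?thesis unfolding T(3) by (rule cell_sub[OF T(2)])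
  qed
  have sp: "\<tau> K \<in> sym_polys (int k)" if "K \<in> ?M" for K using M[OF that] cell_sym_polys[OF \<tau>] by auto
  have sub: "interior (convex hull K) \<subseteq> \<Omega>" if K: "K \<in> ?M" for K
  proof -
    obtain T where T: "T \<in> Th" "K \<in> split T" using K by (auto simp: refine_def)
    have "convex hull K \<subseteq> convex hull T"
      using hull_mono[OF split_hull[OF T], of convex] by (simp add: hull_hull)
    then have "convex hull K \<subseteq> closure \<Omega>" using cover T(1) by blast
    \<comment> \<open>Regularity of the domain excludes that an open cell meets its boundary, as
      could happen at a slit.\<close>
    then show ?thesis using interior_mono[of "convex hull K" "closure \<Omega>"] regular by simp
  qed
  have D: "open (interior (convex hull K))" "bounded (interior (convex hull K))" if "K \<in> ?M" for K
    using bounded_cell_interior[OF cell[OF that]] by auto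
  have "L2 \<Omega> (field_fun ?M \<tau>)"
    unfolding field_fun_def[abs_def] by (rule L2_pieces[OF fin D sym_polys_continuous[OF sp] open_\<Omega>])
  moreover have "transpose (field_fun ?M \<tau> x) = field_fun ?M \<tau> x" for x
  proof -
    have "\<tau> K x $ i $ j = \<tau> K x $ j $ i" if "K \<in> ?M" for K i j
    proof -
      have "transpose (\<tau> K x) = \<tau> K x" using sp[OF that] by (simp add: sym_polys_def)
      from arg_cong[OF this, of "\<lambda>A. A $ j $ i"] show ?thesis by (simp add: transpose_def)
    qed
    then show ?thesis by (simp add: field_fun_def vec_eq_iff transpose_def)
  qed
  moreover have "L2 \<Omega> ?g" by (rule L2_pieces[OF fin D continuous_row_div[OF sp] open_\<Omega>])
  moreover have "weak_div \<Omega> (field_fun ?M \<tau>) ?g"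
    by (rule weak_div_pieces[OF fin cell sub open_\<Omega> sp facet_sum_tendsto[OF \<tau>]])
  ultimately show ?thesis unfolding Hdiv_def by (intro CollectI conjI exI[of _ ?g]) auto
qed

end

theorem theorem4p8:
  fixes \<Omega> :: "(real^'n) set" and Th :: "(real^'n) set set" and k :: nat
    and nrm :: "(real^'n) set \<Rightarrow> real^'n"
    and v0 :: "(real^'n) set \<Rightarrow> real^'n"
    and nb :: "(real^'n) set \<Rightarrow> nat \<Rightarrow> real^'n"
    and elt :: "(real^'n) set \<Rightarrow> (real^'n) set"
  assumes "CARD('n) \<ge> 2" and "k \<ge> 1"
    and "polyhedral_domain \<Omega>" and "conforming_triangulation \<Omega> Th"
    and "\<And>F. F \<in> faces (CARD('n) - 1) (refine Th) \<Longrightarrow> unit_normal F (nrm F)"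
    and "\<And>l f. l < CARD('n) \<Longrightarrow> f \<in> faces l Th \<Longrightarrow> v0 f \<in> f"
    and "\<And>l f. l < CARD('n) \<Longrightarrow> f \<in> interior_faces l Th \<Longrightarrow>
           inj_on (nb f) {1..CARD('n) - l} \<and> independent (nb f ` {1..CARD('n) - l}) \<and>
           span (nb f ` {1..CARD('n) - l}) = nor_space f"
    and "\<And>l f. l < CARD('n) \<Longrightarrow> f \<in> interior_faces l Th \<Longrightarrow> elt f \<in> refine Th \<and> f \<subseteq> elt f"
  shows "(\<forall>T\<in>Th. unisolvent nrm nb elt k {T} (Sigma_loc nrm v0 k T)) \<and>
         (\<forall>\<tau>\<in>Sigma_glob nrm v0 k Th. field_fun (refine Th) \<tau> \<in> Hdiv \<Omega>) \<and>
         unisolvent nrm nb elt k Th (Sigma_glob nrm v0 k Th)"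
proof -
  note tri = assms(4)[unfolded conforming_triangulation_def]
  interpret mesh Th
    by unfold_locales (use assms(1) tri in \<open>simp_all add: cell_def\<close>)
  have dofs: "local_dofs T nrm v0 k nb elt" if T: "T \<in> Th" for T
  proof -
    interpret split_simplex T by (rule split_simplex[OF T])
    have sub: "faces l (refine {T}) \<subseteq> faces l (refine Th)" "faces l {T} \<subseteq> faces l Th" for l
      using T by (auto simp: faces_def refine_def)
    have int: "interior_faces l {T} \<subseteq> interior_faces l Th" for l using T interior_faces_Th by blast
    show ?thesis
    proof unfold_locales
      show "1 \<le> k" by (rule assms(2))
      show "unit_normal F (nrm F)" if "F \<in> faces (CARD('n) - 1) (refine {T})" for F
        using assms(5) sub(1) that by blast
      show "v0 f \<in> f" if "l < CARD('n)" "f \<in> faces l {T}" for l f using assms(6)[OF that(1)] sub(2) that(2) by blast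
      fix l f assume l: "l < CARD('n)" and f: "f \<in> interior_faces l {T}"
      have f': "f \<in> interior_faces l Th" using f int by blast
      show "inj_on (nb f) {1..CARD('n) - l} \<and> independent (nb f ` {1..CARD('n) - l}) \<and>
          span (nb f ` {1..CARD('n) - l}) = nor_space f" by (rule assms(7)[OF l f'])
      \<comment> \<open>\<open>elt f\<close> is only known to be a cell of the refined mesh; the
        barycenter in \<open>f\<close> shows that it belongs to \<open>T\<close>.\<close>
      obtain T' where T': "T' \<in> Th" "elt f \<in> split T'" "f \<subseteq> elt f"
        using assms(8)[OF l f'] by (auto simp: refine_def)
      then have "T' = T" using owner_unique[OF T T'(1,2)] interior_face_subset(1)[OF f] by blast
      then show "elt f \<in> split T \<and> f \<subseteq> elt f" using T' by simp
    qed
  qed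
  interpret mesh_space Th \<Omega> nrm v0 k nb elt
  proof (intro mesh_space.intro mesh_space_axioms.intro mesh_axioms dofs)
    show "interior (closure \<Omega>) = \<Omega>" using assms(3) by (simp only: polyhedral_domain_def)
    show "closure \<Omega> = (\<Union>T\<in>Th. convex hull T)" using tri by (elim conjE)
  qed
  show ?thesis
    using local_dofs.unisolvent_local[OF dofs] Sigma_glob_Hdiv unisolvent_glob[OF dofs] by blast
qed

end
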